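(* Let $n\geq 1$ and let $\mathcal{H}\subset\{h=1\}\subset\mathbb{R}^{n+1}$ be an $n$-dimensional CCPSR manifold in standard form. Then for every $p\in\mathcal{H}$ and every $v\in T_p\mathcal{H}\setminus\{0\}$ the limit polynomial $\overline{h}=\lim_{t\to R}h|_t$ of $\mathcal{H}$ along $\gamma_{p,v}$ is well defined, and the corresponding limit geometry $\overline{\mathcal{H}}$ is a CCPSR manifold. Every such limit polynomial $\overline{h}$ is equivalent to one of the following. (i) If $\dim(\mathcal{H})=1$: $$\overline{h}=x^3-xy^2-\frac{2}{3\sqrt{3}}y^3,$$ and $\overline{\mathcal{H}}$ is a homogeneous space and equivalent to the curve $\{(x,y)\in\mathbb{R}^2\mid x^2y=1,\ x>0\}$. (ii) If $\dim(\mathcal{H})=2$, with linear coordinates $(x,y,z)$ on $\mathbb{R}^3$, either (a) $$\overline{h}=x^3-x(y^2+z^2)-\frac{1}{\sqrt{3}}yz^2-\frac{2}{3\sqrt{3}}y^3,$$ and $\overline{\mathcal{H}}$ is a homogeneous space isomorphic to the hyperbolic plane; or (b) $$\overline{h}=x^3-x(y^2+z^2)+\frac{2}{\sqrt{3}}yz^2-\frac{2}{3\sqrt{3}}y^3,$$ and $\overline{\mathcal{H}}$ is a homogeneous space isomorphic to the flat $\mathbb{R}^2$. (iii) If $n=\dim(\mathcal{H})\geq 3$: $$\overline{h}=x^3-x(\langle s,s\rangle+\langle u,u\rangle+w^2)+\sum_{i=1}^{m}s_i\langle u,F_iu\rangle+\left(\frac{2}{\sqrt{3}}\langle s,s\rangle-\frac{1}{\sqrt{3}}\langle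 u,u\rangle\right)w-\frac{2}{3\sqrt{3}}w^3,$$ where $(x,s,u,w)$ are linear coordinates on $\mathbb{R}^{n+1}$ with $s=(s_1,\ldots,s_m)^{\mathrm{T}}$, $u=(u_1,\ldots,u_{n-1-m})^{\mathrm{T}}$ for some $0\leq m\leq n-1$, and each $F_i$, $1\leq i\leq m$, is a real symmetric $(n-1-m)\times(n-1-m)$-matrix, such that for all $c=(c_1,\ldots,c_m)^{\mathrm{T}}\in\mathbb{R}^m$ with $\|c\|=1$ all eigenvalues of $\sum_{i=1}^{m}c_iF_i$ are contained in $[-1,1]$. The symmetry group of the corresponding CCPSR manifold $\overline{\mathcal{H}}$ is of dimension at least $1$. Moreover, all of the CCPSR manifolds in standard form corresponding to the polynomials listed in (i)--(iii) (for all $m$ and all $F_i$ as described) are singular at infinity, and each of them can be realised as a limit geometry of a CCPSR manifold, in particular as a limit geometry of itself.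
   Context: Let $h:\mathbb{R}^{n+1}\to\mathbb{R}$ be a cubic homogeneous polynomial. A point $p\in\{h>0\}$ is a hyperbolic point of $h$ if the negative Hessian $-\partial^2h_p$ has Lorentz signature ($n$ positive, one negative eigenvalue); $h$ is hyperbolic if it has a hyperbolic point. A projective special real (PSR) manifold of dimension $n$ is a smooth hypersurface $\mathcal{H}\subset\mathbb{R}^{n+1}$ contained in $\{h=1\}$ for a hyperbolic cubic homogeneous polynomial $h$ and consisting only of hyperbolic points of $h$. It carries the Riemannian metric $g_{\mathcal{H}}=-\frac13\partial^2h|_{T\mathcal{H}\times T\mathcal{H}}$ (centro-affine fundamental form). A CCPSR manifold is a PSR manifold that is connected and closed as a subset of $\mathbb{R}^{n+1}$. Standard form: with linear coordinates $(x,y)=(x,y_1,\dots,y_n)$ on $\mathbb{R}^{n+1}$, a CCPSR manifold $\mathcal{H}\subset\{h=1\}$ and $h$ are in standard form if $h=x^3-x\langle y,y\rangle+P_3(y)$ with $P_3:\mathbb{R}^n\to\mathbb{R}$ a cubic homogeneous polynomial and $\mathcal{H}$ is the connected component of $\{h=1\}$ containing $(x,y)=(1,0)$. Here $\langle\cdot,\cdot\rangle$ and $\|\cdot\|$ are the standard Euclidean scalar product and norm. Equivalence: two PSR manifolds of the same dimension are equivalent if they are related by a linear isomorphism of the ambient space (in particular the defining polynomials are related by it). Correspondingly, polynomials in standard form are called equivalent if a linear isomorphism of $\mathbb{R}^{n+1}$ relates them and the corresponding CCPSR manifolds. Limit polynomial and limit geometry: for $p\in\mathcal{H}$, $v\in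 T_p\mathcal{H}\setminus\{0\}$, let $R>0$ be the smallest positive zero of $t\mapsto h(p+tv)$ and let $\gamma=\gamma_{p,v}:[0,R)\to\mathcal{H}$, $\gamma(t)=h(p+tv)^{-1/3}(p+tv)$, a curve leaving every compact subset of $\mathcal{H}$. For $t\in[0,R)$ choose $A(t)\in\mathrm{GL}(n+1)$, depending smoothly on $t$, with $A(t)\left(\begin{smallmatrix}1\\0\end{smallmatrix}\right)=\gamma(t)$ and such that $h|_t:=A(t)^*h=h\circ A(t)$ has the form $x^3-x\langle y,y\rangle+P_3(y)|_t$ for some cubic homogeneous polynomial $P_3(y)|_t$ on $\mathbb{R}^n$ (such $A$ exists; $A(t)$ is unique up to right multiplication by elements of $\mathrm{Id}_x\times\mathrm{O}(n)$). If $\overline{h}=\lim_{t\to R}h|_t$ exists in $\mathrm{Sym}^3(\mathbb{R}^{n+1})^*$, it is called a limit polynomial, and the connected component $\overline{\mathcal{H}}$ of $\{\overline{h}=1\}$ containing $(1,0)$ is called a limit geometry of $\mathcal{H}$. That the limit polynomial along $\gamma_{p,v}$ is well defined means that the limit exists for a suitable choice of $A(t)$, the result being determined up to equivalence. A CCPSR manifold $\mathcal{H}\subset\{h=1\}$ is singular at infinity if there is a non-zero point $p\in\partial(\mathbb{R}_{>0}\cdot\mathcal{H})\subset\mathbb{R}^{n+1}$ with $\mathrm{d}h_p=0$. The symmetry group of $\mathcal{H}$ is the Lie group of linear automorphisms of $\mathbb{R}^{n+1}$ preserving $\mathcal{H}$; $\mathcal{H}$ is a homogeneous space if this group acts transitively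 on it. "Isomorphic to the hyperbolic plane (flat $\mathbb{R}^2$)" refers to $(\overline{\mathcal{H}},g_{\overline{\mathcal{H}}})$ as a Riemannian manifold (isometric, up to constant rescaling of the metric). *)

theory Defs
  imports "HOL-Analysis.Analysis" "Jordan_Normal_Form.Char_Poly"
begin

(* Jordan_Normal_Form is used only for the matrices F i, whose size varies with m;
   the infix $ below is the component access of real^'n. *)
no_notation vec_index (infixl "$" 100)

primrec Ck_on :: "nat \<Rightarrow> 'a::real_normed_vector set \<Rightarrow> ('a \<Rightarrow> 'b::real_normed_vector) \<Rightarrow> bool" where
  "Ck_on 0 U f \<longleftrightarrow> continuous_on U f"
| "Ck_on (Suc k) U f \<longleftrightarrow>
     (\<forall>x\<in>U. f differentiable (at x)) \<and> (\<forall>v. Ck_on k U (\<lambda>x. frechet_derivative f (at x) v))"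

(* For an arbitrary set S: f extends to a C^infinity map on an open neighbourhood of S.
   Ck_on is only meaningful on open sets; all domains used are finite-dimensional. *)
definition smooth_on :: "'a::real_normed_vector set \<Rightarrow> ('a \<Rightarrow> 'b::real_normed_vector) \<Rightarrow> bool" where
  "smooth_on S f \<longleftrightarrow> (\<exists>U g. open U \<and> S \<subseteq> U \<and> (\<forall>k. Ck_on k U g) \<and> (\<forall>x\<in>S. g x = f x))"

definition smooth_hypersurface :: "'a::euclidean_space set \<Rightarrow> bool" where
  "smooth_hypersurface S \<longleftrightarrow>
     (\<forall>p\<in>S. \<exists>U (f :: 'a \<Rightarrow> real). open U \<and> p \<in> U \<and> smooth_on U f \<and>
        (\<forall>q\<in>U. frechet_derivative f (at q) \<noteq> (\<lambda>_. 0)) \<and>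
        S \<inter> U = {q \<in> U. f q = 0})"

(* Velocities at p of curves in S; used for hypersurfaces S and for the (closed) linear
   groups below, where this is the usual tangent space. *)
definition tangent_space :: "'a::real_normed_vector set \<Rightarrow> 'a \<Rightarrow> 'a set" where
  "tangent_space S p =
     {v. \<exists>(c :: real \<Rightarrow> 'a) \<epsilon>. 0 < \<epsilon> \<and> c 0 = p \<and> (\<forall>t. \<bar>t\<bar> < \<epsilon> \<longrightarrow> c t \<in> S) \<and>
         (c has_vector_derivative v) (at 0)}"

definition cubic_form :: "('a::real_normed_vector \<Rightarrow> real) \<Rightarrow> bool" where
  "cubic_form h \<longleftrightarrow> real_polynomial_function h \<and> (\<forall>c x. h (c *\<^sub>R x) = c ^ 3 * h x)"

definition hessian :: "('a::real_normed_vector \<Rightarrow> real) \<Rightarrow> 'a \<Rightarrow> 'a \<Rightarrow> 'a \<Rightarrow> real" where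
  "hessian h p v w = frechet_derivative (\<lambda>q. frechet_derivative h (at q) v) (at p) w"

(* Eigenspace of the symmetric matrix (B b b') with b, b' in the standard orthonormal basis. *)
definition form_eigenspace :: "('a::euclidean_space \<Rightarrow> 'a \<Rightarrow> real) \<Rightarrow> real \<Rightarrow> 'a set" where
  "form_eigenspace B \<mu> = {v. \<forall>w. B v w = \<mu> * (v \<bullet> w)}"

(* Eigenvalues are counted with multiplicity; for a symmetric form this is the dimension
   of the eigenspace. *)
definition lorentz_signature :: "('a::euclidean_space \<Rightarrow> 'a \<Rightarrow> real) \<Rightarrow> bool" where
  "lorentz_signature B \<longleftrightarrow>
     (\<Sum>\<mu> | 0 < \<mu> \<and> form_eigenspace B \<mu> \<noteq> {0}. dim (form_eigenspace B \<mu>)) = DIM('a) - 1 \<and>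
     (\<Sum>\<mu> | \<mu> < 0 \<and> form_eigenspace B \<mu> \<noteq> {0}. dim (form_eigenspace B \<mu>)) = 1"

definition hyperbolic_point :: "('a::euclidean_space \<Rightarrow> real) \<Rightarrow> 'a \<Rightarrow> bool" where
  "hyperbolic_point h p \<longleftrightarrow> 0 < h p \<and> lorentz_signature (\<lambda>v w. - hessian h p v w)"

definition psr_manifold :: "('a::euclidean_space \<Rightarrow> real) \<Rightarrow> 'a set \<Rightarrow> bool" where
  "psr_manifold h H \<longleftrightarrow>
     cubic_form h \<and> (\<exists>p. hyperbolic_point h p) \<and>
     H \<noteq> {} \<and> smooth_hypersurface H \<and> H \<subseteq> {p. h p = 1} \<and> (\<forall>p\<in>H. hyperbolic_point h p)"

definition ccpsr_manifold :: "('a::euclidean_space \<Rightarrow> real) \<Rightarrow> 'a set \<Rightarrow> bool" where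
  "ccpsr_manifold h H \<longleftrightarrow> psr_manifold h H \<and> connected H \<and> closed H"

definition psr_metric :: "('a::euclidean_space \<Rightarrow> real) \<Rightarrow> 'a \<Rightarrow> 'a \<Rightarrow> 'a \<Rightarrow> real" where
  "psr_metric h p v w = - (1 / 3) * hessian h p v w"

definition GL :: "('a::euclidean_space \<Rightarrow>\<^sub>L 'a) set" where
  "GL = {L. bij (blinfun_apply L)}"

definition psr_equivalent ::
    "('a::euclidean_space \<Rightarrow> real) \<Rightarrow> 'a set \<Rightarrow> ('a \<Rightarrow> real) \<Rightarrow> 'a set \<Rightarrow> bool" where
  "psr_equivalent h1 H1 h2 H2 \<longleftrightarrow>
     (\<exists>L\<in>GL. (\<forall>x. h2 (blinfun_apply L x) = h1 x) \<and> blinfun_apply L ` H1 = H2)"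

definition symmetry_group :: "'a::euclidean_space set \<Rightarrow> ('a \<Rightarrow>\<^sub>L 'a) set" where
  "symmetry_group H = {L \<in> GL. blinfun_apply L ` H = H}"

definition homogeneous_space :: "'a::euclidean_space set \<Rightarrow> bool" where
  "homogeneous_space H \<longleftrightarrow> (\<forall>p\<in>H. \<forall>q\<in>H. \<exists>L\<in>symmetry_group H. blinfun_apply L p = q)"

(* The dimension of a linear Lie group is that of its tangent space at the identity. *)
definition lie_group_dim :: "('a::euclidean_space \<Rightarrow>\<^sub>L 'a) set \<Rightarrow> nat" where
  "lie_group_dim G = dim (tangent_space G id_blinfun)"

definition singular_at_infinity :: "('a::euclidean_space \<Rightarrow> real) \<Rightarrow> 'a set \<Rightarrow> bool" where
  "singular_at_infinity h H \<longleftrightarrow>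
     (\<exists>p \<in> frontier {r *\<^sub>R q | r q. 0 < r \<and> q \<in> H}.
        p \<noteq> 0 \<and> frechet_derivative h (at p) = (\<lambda>_. 0))"

(* (U, gU) is an open subset of a Euclidean space with a Riemannian metric, (H, gH) a
   submanifold of another one, gH being evaluated on tangent vectors of H only.
   phi is a diffeomorphism with inverse psi and pulls gH back to a constant multiple of gU. *)
definition isometric_up_to_scale ::
    "'b::euclidean_space set \<Rightarrow> ('b \<Rightarrow> 'b \<Rightarrow> 'b \<Rightarrow> real) \<Rightarrow>
     'a::euclidean_space set \<Rightarrow> ('a \<Rightarrow> 'a \<Rightarrow> 'a \<Rightarrow> real) \<Rightarrow> bool" where
  "isometric_up_to_scale U gU H gH \<longleftrightarrow>
     (\<exists>\<phi> \<psi> c. smooth_on U \<phi> \<and> smooth_on H \<psi> \<and> \<phi> ` U = H \<and> (\<forall>u\<in>U. \<psi> (\<phi> u) = u) \<and> 0 < c \<and>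
        (\<forall>u\<in>U. \<forall>a b. gH (\<phi> u) (frechet_derivative \<phi> (at u) a) (frechet_derivative \<phi> (at u) b)
                       = c * gU u a b))"

(* The upper half-plane model of the hyperbolic plane. *)
definition isomorphic_hyperbolic_plane :: "('a::euclidean_space \<Rightarrow> real) \<Rightarrow> 'a set \<Rightarrow> bool" where
  "isomorphic_hyperbolic_plane h H \<longleftrightarrow>
     isometric_up_to_scale {u :: real \<times> real. 0 < snd u} (\<lambda>u a b. (a \<bullet> b) / (snd u)\<^sup>2) H (psr_metric h)"

definition isomorphic_flat_plane :: "('a::euclidean_space \<Rightarrow> real) \<Rightarrow> 'a set \<Rightarrow> bool" where
  "isomorphic_flat_plane h H \<longleftrightarrow>
     isometric_up_to_scale (UNIV :: (real \<times> real) set) (\<lambda>u a b. a \<bullet> b) H (psr_metric h)"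

definition standard_cubic ::
    "('b::euclidean_space \<Rightarrow> real) \<Rightarrow> real \<times> 'b \<Rightarrow> real" where
  "standard_cubic P = (\<lambda>(x, y). x ^ 3 - x * (y \<bullet> y) + P y)"

definition std_component :: "(real \<times> 'b::euclidean_space \<Rightarrow> real) \<Rightarrow> (real \<times> 'b) set" where
  "std_component h = connected_component_set {q. h q = 1} (1, 0)"

definition standard_form ::
    "(real \<times> 'b::euclidean_space \<Rightarrow> real) \<Rightarrow> (real \<times> 'b) set \<Rightarrow> bool" where
  "standard_form h H \<longleftrightarrow>
     (\<exists>P. cubic_form P \<and> h = standard_cubic P) \<and> H = std_component h"

definition std_equivalent ::
    "(real \<times> 'b::euclidean_space \<Rightarrow> real) \<Rightarrow> (real \<times> 'b \<Rightarrow> real) \<Rightarrow> bool" where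
  "std_equivalent h1 h2 \<longleftrightarrow> psr_equivalent h1 (std_component h1) h2 (std_component h2)"

definition smallest_positive_zero :: "('a::real_vector \<Rightarrow> real) \<Rightarrow> 'a \<Rightarrow> 'a \<Rightarrow> real \<Rightarrow> bool" where
  "smallest_positive_zero h p v R \<longleftrightarrow>
     0 < R \<and> h (p + R *\<^sub>R v) = 0 \<and> (\<forall>t. 0 < t \<and> t < R \<longrightarrow> h (p + t *\<^sub>R v) \<noteq> 0)"

definition limit_curve :: "('a::real_vector \<Rightarrow> real) \<Rightarrow> 'a \<Rightarrow> 'a \<Rightarrow> real \<Rightarrow> 'a" where
  "limit_curve h p v t = (h (p + t *\<^sub>R v) powr (- 1 / 3)) *\<^sub>R (p + t *\<^sub>R v)"

definition standard_frame ::
    "(real \<times> 'b::euclidean_space \<Rightarrow> real) \<Rightarrow> real \<times> 'b \<Rightarrow> real \<times> 'b \<Rightarrow> real \<Rightarrow>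
     (real \<Rightarrow> (real \<times> 'b) \<Rightarrow>\<^sub>L (real \<times> 'b)) \<Rightarrow> bool" where
  "standard_frame h p v R A \<longleftrightarrow>
     smooth_on {0..<R} A \<and>
     (\<forall>t\<in>{0..<R}. A t \<in> GL \<and> blinfun_apply (A t) (1, 0) = limit_curve h p v t \<and>
        (\<exists>P. cubic_form P \<and> h \<circ> blinfun_apply (A t) = standard_cubic P))"

(* hb is a limit, for some admissible choice of A, of h o A(t) as t increases to R. Convergence
   is in the sup-norm over the closed unit ball, a norm on the finite-dimensional space of
   cubic forms. *)
definition limit_polynomial ::
    "(real \<times> 'b::euclidean_space \<Rightarrow> real) \<Rightarrow> real \<times> 'b \<Rightarrow> real \<times> 'b \<Rightarrow>
     (real \<times> 'b \<Rightarrow> real) \<Rightarrow> bool" where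
  "limit_polynomial h p v hb \<longleftrightarrow>
     (\<exists>R A. smallest_positive_zero h p v R \<and> standard_frame h p v R A \<and> cubic_form hb \<and>
        uniform_limit (cball 0 1) (\<lambda>t. h \<circ> blinfun_apply (A t)) hb (at_left R))"

(* The argument e enumerates the index type 'n: y $ e 0, ..., y $ e (n - 1) are the
   coordinates y_1, ..., y_n on R^n, where n = CARD('n). *)

definition poly_curve :: "(nat \<Rightarrow> 'n::finite) \<Rightarrow> real \<times> (real ^ 'n) \<Rightarrow> real" where
  "poly_curve e = (\<lambda>(x, v). let y = v $ e 0 in
     x ^ 3 - x * y\<^sup>2 - 2 / (3 * sqrt 3) * y ^ 3)"

definition poly_surface_a :: "(nat \<Rightarrow> 'n::finite) \<Rightarrow> real \<times> (real ^ 'n) \<Rightarrow> real" where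
  "poly_surface_a e = (\<lambda>(x, v). let y = v $ e 0; z = v $ e 1 in
     x ^ 3 - x * (y\<^sup>2 + z\<^sup>2) - 1 / sqrt 3 * y * z\<^sup>2 - 2 / (3 * sqrt 3) * y ^ 3)"

definition poly_surface_b :: "(nat \<Rightarrow> 'n::finite) \<Rightarrow> real \<times> (real ^ 'n) \<Rightarrow> real" where
  "poly_surface_b e = (\<lambda>(x, v). let y = v $ e 0; z = v $ e 1 in
     x ^ 3 - x * (y\<^sup>2 + z\<^sup>2) + 2 / sqrt 3 * y * z\<^sup>2 - 2 / (3 * sqrt 3) * y ^ 3)"

(* F 0, ..., F (m - 1) are symmetric of size k = n - 1 - m. For m = 0 there is no unit
   vector c, and for k = 0 there are no eigenvalues. *)
definition admissible_matrices :: "nat \<Rightarrow> nat \<Rightarrow> (nat \<Rightarrow> real mat) \<Rightarrow> bool" where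
  "admissible_matrices m k F \<longleftrightarrow>
     (\<forall>i<m. F i \<in> carrier_mat k k \<and> transpose_mat (F i) = F i) \<and>
     (\<forall>c :: nat \<Rightarrow> real. (\<Sum>i<m. (c i)\<^sup>2) = 1 \<longrightarrow>
        (\<forall>\<mu>. eigenvalue (mat k k (\<lambda>(a, b). \<Sum>i<m. c i * F i $$ (a, b))) \<mu> \<longrightarrow> \<mu> \<in> {-1..1}))"

definition poly_general ::
    "(nat \<Rightarrow> 'n::finite) \<Rightarrow> nat \<Rightarrow> (nat \<Rightarrow> real mat) \<Rightarrow> real \<times> (real ^ 'n) \<Rightarrow> real" where
  "poly_general e m F = (\<lambda>(x, y).
     let k = CARD('n) - 1 - m;
         s = (\<lambda>i. y $ e i);
         u = (\<lambda>j. y $ e (m + j));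
         w = y $ e (CARD('n) - 1);
         ss = (\<Sum>i<m. (s i)\<^sup>2);
         uu = (\<Sum>j<k. (u j)\<^sup>2)
     in x ^ 3 - x * (ss + uu + w\<^sup>2)
        + (\<Sum>i<m. s i * (\<Sum>j<k. u j * (\<Sum>l<k. F i $$ (j, l) * u l)))
        + (2 / sqrt 3 * ss - 1 / sqrt 3 * uu) * w
        - 2 / (3 * sqrt 3) * w ^ 3)"

definition limit_list :: "(nat \<Rightarrow> 'n::finite) \<Rightarrow> (real \<times> (real ^ 'n) \<Rightarrow> real) set" where
  "limit_list e =
     (if CARD('n) = 1 then {poly_curve e}
      else if CARD('n) = 2 then {poly_surface_a e, poly_surface_b e}
      else {poly_general e m F | m F.
              m \<le> CARD('n) - 1 \<and> admissible_matrices m (CARD('n) - 1 - m) F})"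

definition curve_geometry ::
    "(nat \<Rightarrow> 'n::finite) \<Rightarrow> (real \<times> (real ^ 'n) \<Rightarrow> real) \<Rightarrow> (real \<times> (real ^ 'n)) set \<Rightarrow> bool" where
  "curve_geometry e g H \<longleftrightarrow>
     homogeneous_space H \<and>
     psr_equivalent g H (\<lambda>(x, v). x\<^sup>2 * v $ e 0) {(x, v). x\<^sup>2 * v $ e 0 = 1 \<and> 0 < x}"

end

theory Submission
  imports Defs
begin

text \<open>
  A cubic form h is studied through its symmetric trilinear form T. For a cubic in standard form,
  h = x ^ 3 - x * (y \<bullet> y) + P y, the component of (1, 0) in the level set h = 1 consists of hyperbolic points if and only if
  P y \<le> 2 / (3 * sqrt 3) * norm y ^ 3 for all y (ccpsr_iff_cubic_bound). In that case the component is the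
  part of the level set inside the light cone norm y = sqrt 3 * x, since h is not positive on this cone. The bound is closed
  under limits, so every limit polynomial belongs to a CCPSR manifold again.

  The inverse of a standard frame at p moves p to (1, 0) and the direction to (0, w). The line (1, t w) meets the boundary of the
  cone over the component in a first zero q = (1, R w) of h. If q lies inside the light cone, it is a regular point of the
  boundary; if it lies on the light cone, it is a critical point of h. In both cases the plane spanned
  by (1, 0) and q contains vectors a and b with T a a a = 0, T a a b = 1 / 3 and T a b b = 0, and
  on the common kernel of T a a and T a b hyperbolicity near q makes one of the forms T a and T b negative semidefinite and the
  other one negative definite on its radical. The radical and a complement of it become the coordinates s and u in the regular
  case, u and s in the singular case (adapted_regular, adapted_singular). Consider the one-parameter group that scales a
  and s with weight 2, b with weight - 4 and u with weight - 1. The limit curve is, up to factors tending to 1, an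
  orbit of this group, and hyperbolicity forces all products of T to vanish whose weights would make the scaled
  form diverge. What survives in the limit is the part of weight zero, and this is exactly the normal form with
  matrices F_i given by the products of s_i with u and u (degeneration_limit, adapted_limit, limit_exists_at_base). The
  scaling maps differ from standard frames by corrections that tend to the identity (frame_family). The
  bound on P, applied to the normal form, says that the matrices are admissible (admissible_iff_cubic_bound).
  Different choices of frames differ by orthogonal maps, so by compactness limits are unique up to equivalence
  (limit_polynomial_unique).

  In the null coordinates X = x + w / sqrt 3 and Y = x - 2 * w / sqrt 3 the normal form is
  Y * (X ^ 2 - s \<bullet> s) - X * (u \<bullet> u) plus the terms s_i * (u \<bullet> F_i u). The same scalings are symmetries of it. They
  show that the symmetry group has positive dimension, that the normal form is a limit of
  itself, and that the ray X = s = u = 0 consists of critical points in the boundary of the cone. For n = 1 the normal form is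
  X ^ 2 * Y. For n = 2 it is X ^ 2 * Y - X * u ^ 2 or (X ^ 2 - s ^ 2) * Y, and explicit parametrizations by the upper
  half-plane and by the plane exhibit the homogeneous geometries (surface_a_geometry, surface_b_geometry).
\<close>

(* Keeps \<bullet> unambiguous as the inner product of a Euclidean space. *)
no_notation scalar_prod (infix "\<bullet>" 70)

section \<open>Smooth maps\<close>

definition Cinf_on :: "'a::real_normed_vector set \<Rightarrow> ('a \<Rightarrow> 'b::real_normed_vector) \<Rightarrow> bool" where
  "Cinf_on U f \<longleftrightarrow> (\<forall>k. Ck_on k U f)"

lemma Ck_on_cong:
  assumes "open U" "\<And>x. x \<in> U \<Longrightarrow> f x = g x" "Ck_on k U f"
  shows "Ck_on k U g"
  using assms(2,3)
proof (induction k arbitrary: f g)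
  case 0
  then have "continuous_on U f" by simp
  then have "continuous_on U g" by (rule continuous_on_eq) (rule 0(1))
  then show ?case by simp
next
  case (Suc k)
  have d: "(g has_derivative frechet_derivative f (at x)) (at x)" if "x \<in> U" for x
  proof (rule has_derivative_transform_within_open[of f _ x UNIV U])
    show "(f has_derivative frechet_derivative f (at x)) (at x)"
      using Suc.prems(2) that by (metis Ck_on.simps(2) frechet_derivative_works)
  qed (use that assms(1) Suc.prems(1) in auto)
  then have "frechet_derivative f (at x) = frechet_derivative g (at x)" if "x \<in> U" for x
    using that frechet_derivative_at by blast
  then have "Ck_on k U (\<lambda>x. frechet_derivative g (at x) v)" for v
    using Suc.IH[of "\<lambda>x. frechet_derivative f (at x) v" "\<lambda>x. frechet_derivative g (at x) v"] Suc.prems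
    by auto
  then show ?case using d by (auto simp: differentiable_def)
qed

lemma Ck_on_Suc_imp: "Ck_on (Suc k) U f \<Longrightarrow> Ck_on k U f"
proof (induction k arbitrary: f)
  case 0
  then show ?case
    by (auto intro!: continuous_at_imp_continuous_on differentiable_imp_continuous_within)
next
  case (Suc k)
  have "Ck_on (Suc k) U (\<lambda>x. frechet_derivative f (at x) v)" for v
    using Suc.prems by simp
  then show ?case using Suc.prems Suc.IH by (subst Ck_on.simps(2)) auto
qed

lemma Ck_on_SucI:
  assumes "open U" "\<And>x. x \<in> U \<Longrightarrow> (f has_derivative f' x) (at x)"
    and "\<And>v. Ck_on k U (\<lambda>x. f' x v)"
  shows "Ck_on (Suc k) U f"
proof -
  have "frechet_derivative f (at x) = f' x" if "x \<in> U" for x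
    using assms(2)[OF that] frechet_derivative_at by metis
  then have "Ck_on k U (\<lambda>x. frechet_derivative f (at x) v)" for v
    using Ck_on_cong[OF assms(1) _ assms(3)[of v]] by auto
  then show ?thesis using assms(2) by (auto simp: differentiable_def)
qed

lemma Ck_on_SucD:
  assumes "Ck_on (Suc k) U f"
  shows "x \<in> U \<Longrightarrow> (f has_derivative frechet_derivative f (at x)) (at x)"
    and "Ck_on k U (\<lambda>x. frechet_derivative f (at x) v)"
  using assms by (auto simp: frechet_derivative_works[symmetric])

lemma Ck_on_const: "open U \<Longrightarrow> Ck_on k U (\<lambda>x. c)"
proof (induction k arbitrary: c)
  case (Suc k)
  show ?case by (rule Ck_on_SucI[OF Suc.prems(1), where f' = "\<lambda>x v. 0"]) (auto intro: Suc)
qed auto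

lemma Ck_on_linear:
  assumes "open U" "bounded_linear L" shows "Ck_on k U L"
proof (cases k)
  case 0
  then show ?thesis using assms(2) linear_continuous_on by auto
next
  case (Suc j)
  show ?thesis unfolding Suc
    by (rule Ck_on_SucI[OF assms(1), where f' = "\<lambda>x. L"])
       (auto intro: bounded_linear_imp_has_derivative assms Ck_on_const)
qed

lemma Ck_on_linear_comp:
  assumes "open U" "bounded_linear L" shows "Ck_on k U f \<Longrightarrow> Ck_on k U (\<lambda>x. L (f x))"
proof (induction k arbitrary: f)
  case 0
  then show ?case using bounded_linear.continuous_on[OF assms(2)] by auto
next
  case (Suc k)
  show ?case
    by (rule Ck_on_SucI[OF assms(1), where f' = "\<lambda>x v. L (frechet_derivative f (at x) v)"])
       (auto intro: bounded_linear.has_derivative[OF assms(2)] Ck_on_SucD[OF Suc.prems] Suc.IH)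
qed

lemma Ck_on_add:
  assumes "open U" shows "Ck_on k U f \<Longrightarrow> Ck_on k U g \<Longrightarrow> Ck_on k U (\<lambda>x. f x + g x)"
proof (induction k arbitrary: f g)
  case 0
  then show ?case by (auto intro: continuous_on_add)
next
  case (Suc k)
  show ?case
    by (rule Ck_on_SucI[OF assms(1), where
          f' = "\<lambda>x v. frechet_derivative f (at x) v + frechet_derivative g (at x) v"])
       (auto intro!: has_derivative_add Ck_on_SucD[OF Suc.prems(1)] Ck_on_SucD[OF Suc.prems(2)] Suc.IH)
qed

lemma Ck_on_bilinear:
  assumes "open U" "bounded_bilinear bl"
  shows "Ck_on k U f \<Longrightarrow> Ck_on k U g \<Longrightarrow> Ck_on k U (\<lambda>x. bl (f x) (g x))"
proof (induction k arbitrary: f g)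
  case 0
  then show ?case by (auto intro: bounded_bilinear.continuous_on[OF assms(2)])
next
  case (Suc k)
  show ?case
    by (rule Ck_on_SucI[OF assms(1), where
          f' = "\<lambda>x v. bl (f x) (frechet_derivative g (at x) v) + bl (frechet_derivative f (at x) v) (g x)"])
       (auto intro!: bounded_bilinear.FDERIV[OF assms(2)] Ck_on_add[OF assms(1)]
          Ck_on_SucD[OF Suc.prems(1)] Ck_on_SucD[OF Suc.prems(2)] Suc.IH
          Ck_on_Suc_imp[OF Suc.prems(1)] Ck_on_Suc_imp[OF Suc.prems(2)])
qed

text \<open>By induction on the order of differentiability: the chain rule turns a derivative of the
  composition into a product of a composition and a derivative, so products have to be available first. Only
  real inner functions occur below, which keeps the chain rule one-dimensional.\<close>
lemma Ck_on_real_comp: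
  fixes g :: "real \<Rightarrow> real" and f :: "'a::real_normed_vector \<Rightarrow> real"
  assumes "open U" and "f ` U \<subseteq> V"
  shows "Ck_on k V g \<Longrightarrow> Ck_on k U f \<Longrightarrow> Ck_on k U (\<lambda>x. g (f x))"
proof (induction k arbitrary: g)
  case 0
  then show ?case using assms(2) by (auto intro: continuous_on_compose2)
next
  case (Suc k)
  have lin: "frechet_derivative g (at y) c = c * frechet_derivative g (at y) 1" if "y \<in> V" for y c
    using linear_cmul[OF has_derivative_linear[OF Ck_on_SucD(1)[OF Suc.prems(1) that]], of c 1]
    by simp
  have der: "((\<lambda>x. g (f x)) has_derivative
         (\<lambda>v. frechet_derivative g (at (f x)) 1 * frechet_derivative f (at x) v)) (at x)" if "x \<in> U" for x
  proof -
    have V: "f x \<in> V" using that assms(2) by auto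
    show ?thesis
      using has_derivative_compose[OF Ck_on_SucD(1)[OF Suc.prems(2) that]
          Ck_on_SucD(1)[OF Suc.prems(1) V]] lin[OF V, of "frechet_derivative f (at x) v" for v]
      by (subst (asm) lin[OF V]) (simp add: mult.commute)
  qed
  show ?case
    by (rule Ck_on_SucI[OF assms(1) der])
       (auto intro!: Ck_on_bilinear[OF assms(1) bounded_bilinear_mult] Suc.IH
         Ck_on_SucD(2)[OF Suc.prems(1)] Ck_on_SucD(2)[OF Suc.prems(2)] Ck_on_Suc_imp[OF Suc.prems(2)])
qed

lemma Ck_on_precomp_linear:
  assumes "open U" "bounded_linear L" "\<And>x. x \<in> W \<Longrightarrow> L x \<in> U" "open W"
  shows "Ck_on k U f \<Longrightarrow> Ck_on k W (\<lambda>x. f (L x))"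
proof (induction k arbitrary: f)
  case 0
  then show ?case using linear_continuous_on[OF assms(2)] assms(3)
    by (auto intro!: continuous_on_compose2[of U f W L])
next
  case (Suc k)
  show ?case
    by (rule Ck_on_SucI[OF assms(4), where f' = "\<lambda>x v. frechet_derivative f (at (L x)) (L v)"])
       (auto intro!: has_derivative_compose[OF bounded_linear_imp_has_derivative[OF assms(2)]]
         Ck_on_SucD[OF Suc.prems] assms(3) Suc.IH)
qed

text \<open>The derivative of a power is a multiple of another power, so the induction over the order has to
  run over all exponents at once.\<close>
lemma Cinf_powr: "Cinf_on {0<..} (\<lambda>x::real. x powr a)"
proof -
  have "Ck_on k {0<..} (\<lambda>x::real. x powr a)" for k
  proof (induction k arbitrary: a)
    case 0
    then show ?case by (auto intro!: continuous_intros)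
  next
    case (Suc k)
    show ?case
      by (rule Ck_on_SucI[where f' = "\<lambda>x v. (a * x powr (a - 1)) * v"])
         (auto intro!: Ck_on_bilinear[OF _ bounded_bilinear_mult] Ck_on_const Suc.IH
            derivative_eq_intros simp: has_field_derivative_def[symmetric])
  qed
  then show ?thesis by (simp add: Cinf_on_def)
qed

lemma Cinf_exp: "Cinf_on UNIV (exp :: real \<Rightarrow> real)"
proof -
  have "Ck_on k UNIV (exp :: real \<Rightarrow> real)" for k
  proof (induction k)
    case (Suc k)
    show ?case
      by (rule Ck_on_SucI[where f' = "\<lambda>x v. exp x * v"])
         (auto intro!: Ck_on_bilinear[OF _ bounded_bilinear_mult] Ck_on_const Suc.IH
            derivative_eq_intros simp: has_field_derivative_def[symmetric])
  qed (auto intro!: continuous_intros)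
  then show ?thesis by (simp add: Cinf_on_def)
qed

lemma Cinf_ln: "Cinf_on {0<..} (ln :: real \<Rightarrow> real)"
proof -
  have "Ck_on k {0<..} (ln :: real \<Rightarrow> real)" for k
  proof (cases k)
    case (Suc k)
    have pw: "Ck_on k {0<..} (\<lambda>x::real. x powr (-1))"
      using Cinf_powr[of "-1"] unfolding Cinf_on_def by blast
    have der: "(ln has_derivative (\<lambda>v. x powr (-1) * v)) (at x)" if "x \<in> {0<..}" for x :: real
    proof -
      have "(ln has_real_derivative x powr (-1)) (at x)"
        using that DERIV_ln[of x] by (simp add: powr_minus)
      then show ?thesis by (simp only: has_field_derivative_def)
    qed
    show ?thesis unfolding Suc
      by (rule Ck_on_SucI[OF _ der])
         (intro Ck_on_bilinear[OF _ bounded_bilinear_mult] Ck_on_const pw open_greaterThan | assumption)+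
  qed (auto intro!: continuous_intros)
  then show ?thesis by (simp add: Cinf_on_def)
qed

lemma Cinf_const: "open U \<Longrightarrow> Cinf_on U (\<lambda>x. c)"
  by (simp add: Cinf_on_def Ck_on_const)

lemma Cinf_linear: "open U \<Longrightarrow> bounded_linear L \<Longrightarrow> Cinf_on U L"
  by (simp add: Cinf_on_def Ck_on_linear)

lemma Cinf_linear_comp:
  "open U \<Longrightarrow> bounded_linear L \<Longrightarrow> Cinf_on U f \<Longrightarrow> Cinf_on U (\<lambda>x. L (f x))"
  by (simp add: Cinf_on_def Ck_on_linear_comp)

lemma Cinf_add: "open U \<Longrightarrow> Cinf_on U f \<Longrightarrow> Cinf_on U g \<Longrightarrow> Cinf_on U (\<lambda>x. f x + g x)"
  by (simp add: Cinf_on_def Ck_on_add)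

lemma Cinf_bilinear:
  "open U \<Longrightarrow> bounded_bilinear bl \<Longrightarrow> Cinf_on U f \<Longrightarrow> Cinf_on U g \<Longrightarrow> Cinf_on U (\<lambda>x. bl (f x) (g x))"
  by (simp add: Cinf_on_def Ck_on_bilinear)

lemma Cinf_precomp_linear:
  assumes "open V" "bounded_linear L" "\<And>x. x \<in> U \<Longrightarrow> L x \<in> V" "open U" "Cinf_on V f"
  shows "Cinf_on U (\<lambda>x. f (L x))"
  using assms(5) Ck_on_precomp_linear[OF assms(1,2,3,4), of _ f] by (simp add: Cinf_on_def)

lemma Cinf_cong:
  assumes "open U" "\<And>x. x \<in> U \<Longrightarrow> f x = g x" "Cinf_on U f" shows "Cinf_on U g"
  using assms(3) Ck_on_cong[OF assms(1,2)] by (simp add: Cinf_on_def)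

lemma Cinf_mult: "open U \<Longrightarrow> Cinf_on U f \<Longrightarrow> Cinf_on U g \<Longrightarrow> Cinf_on U (\<lambda>x. f x * g x :: real)"
  by (rule Cinf_bilinear[OF _ bounded_bilinear_mult])

lemma Cinf_scaleR: "open U \<Longrightarrow> Cinf_on U f \<Longrightarrow> Cinf_on U g \<Longrightarrow> Cinf_on U (\<lambda>x. f x *\<^sub>R g x)"
  by (rule Cinf_bilinear[OF _ bounded_bilinear_scaleR])

lemma Cinf_inner: "open U \<Longrightarrow> Cinf_on U f \<Longrightarrow> Cinf_on U g \<Longrightarrow> Cinf_on U (\<lambda>x. f x \<bullet> g x)"
  by (rule Cinf_bilinear[OF _ bounded_bilinear_inner])

lemma Cinf_minus: "open U \<Longrightarrow> Cinf_on U f \<Longrightarrow> Cinf_on U (\<lambda>x. - f x)"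
  by (rule Cinf_linear_comp) (auto intro: bounded_linear_minus[OF bounded_linear_ident])

lemma Cinf_diff: "open U \<Longrightarrow> Cinf_on U f \<Longrightarrow> Cinf_on U g \<Longrightarrow> Cinf_on U (\<lambda>x. f x - g x)"
  using Cinf_add[of U f "\<lambda>x. - g x"] Cinf_minus[of U g] by simp

lemma Cinf_sum: "open U \<Longrightarrow> (\<And>i. i \<in> A \<Longrightarrow> Cinf_on U (f i)) \<Longrightarrow> Cinf_on U (\<lambda>x. \<Sum>i\<in>A. f i x)"
  by (induction A rule: infinite_finite_induct) (auto intro: Cinf_const Cinf_add)

lemma Cinf_power: "open U \<Longrightarrow> Cinf_on U f \<Longrightarrow> Cinf_on U (\<lambda>x. f x ^ n :: real)"
  by (induction n) (auto intro: Cinf_const Cinf_mult)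

lemma Cinf_ident: "open U \<Longrightarrow> Cinf_on U (\<lambda>x. x)"
  by (rule Cinf_linear) auto

lemma Cinf_real_comp:
  fixes g :: "real \<Rightarrow> real"
  assumes "open U" "Cinf_on V g" "Cinf_on U f" "\<And>x. x \<in> U \<Longrightarrow> f x \<in> V"
  shows "Cinf_on U (\<lambda>x. g (f x))"
proof -
  have "f ` U \<subseteq> V" using assms(4) by auto
  then show ?thesis using Ck_on_real_comp[OF assms(1)] assms(2,3) unfolding Cinf_on_def by blast
qed

lemma Cinf_powr_comp:
  "open U \<Longrightarrow> Cinf_on U f \<Longrightarrow> (\<And>x. x \<in> U \<Longrightarrow> 0 < f x) \<Longrightarrow> Cinf_on U (\<lambda>x. f x powr a :: real)"
  by (rule Cinf_real_comp[OF _ Cinf_powr[of a], of U f]) auto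

lemma Cinf_divide:
  assumes "open U" "Cinf_on U f" "Cinf_on U g" "\<And>x. x \<in> U \<Longrightarrow> 0 < g x"
  shows "Cinf_on U (\<lambda>x. f x / g x :: real)"
proof -
  have c: "Cinf_on U (\<lambda>x. f x * g x powr (-1))"
    by (intro Cinf_mult Cinf_powr_comp assms)
  have "f x * g x powr (-1) = f x / g x" if "x \<in> U" for x
    using assms(4)[OF that] by (simp add: powr_minus_divide)
  from Cinf_cong[OF assms(1) this c] show ?thesis .
qed

lemma smooth_onI: "open U \<Longrightarrow> S \<subseteq> U \<Longrightarrow> Cinf_on U f \<Longrightarrow> smooth_on S f"
  unfolding smooth_on_def Cinf_on_def by (intro exI[of _ U] exI[of _ f]) simp

lemma smooth_on_linear_comp:
  assumes "bounded_linear L" "smooth_on S f" shows "smooth_on S (\<lambda>x. L (f x))"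
proof -
  obtain U g where "open U" "S \<subseteq> U" "Cinf_on U g" "\<forall>x\<in>S. g x = f x"
    using assms(2) unfolding smooth_on_def Cinf_on_def by auto
  then show ?thesis unfolding smooth_on_def Cinf_on_def[symmetric]
    by (intro exI[of _ U] exI[of _ "\<lambda>x. L (g x)"]) (auto intro: Cinf_linear_comp assms)
qed

section \<open>Cubic forms and symmetric trilinear forms\<close>

text \<open>A cubic form is handled throughout through its polarization T, with h x = T x x x: then dh at p is
  3 T p p, the Hessian at p is 6 T p, and pulling h back along a linear map is composition in each slot.\<close>
definition sym3 :: "('a::real_vector \<Rightarrow> 'a \<Rightarrow> 'a \<Rightarrow> real) \<Rightarrow> bool" where
  "sym3 T \<longleftrightarrow> (\<forall>b c. linear (\<lambda>a. T a b c)) \<and>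
     (\<forall>a b c. T a b c = T b a c) \<and> (\<forall>a b c. T a b c = T a c b)"

lemma sym3_commute:
  assumes "sym3 T" shows "T a b c = T b a c" "T a b c = T a c b"
  using assms unfolding sym3_def by blast+

lemma sym3_rotate:
  assumes "sym3 T" shows "T a b c = T b c a" "T a b c = T c a b"
  using sym3_commute(1)[OF assms, of a b c] sym3_commute(2)[OF assms, of b a c]
    sym3_commute(2)[OF assms, of a b c] sym3_commute(1)[OF assms, of a c b] by simp_all

lemma sym3_linear:
  assumes "sym3 T"
  shows "linear (\<lambda>a. T a b c)" "linear (\<lambda>b. T a b c)" "linear (\<lambda>c. T a b c)"
proof -
  have *: "linear (\<lambda>a. T a b c)" for b c using assms unfolding sym3_def by blast
  show "linear (\<lambda>a. T a b c)" by (rule *)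
  have "(\<lambda>b. T a b c) = (\<lambda>b. T b a c)" by (intro ext sym3_commute(1)[OF assms])
  then show "linear (\<lambda>b. T a b c)" using * by simp
  have "(\<lambda>c. T a b c) = (\<lambda>c. T c a b)"
    by (intro ext) (metis sym3_commute[OF assms])
  then show "linear (\<lambda>c. T a b c)" using * by simp
qed

lemma sym3_simps:
  assumes "sym3 T"
  shows "T (a + a') b c = T a b c + T a' b c" "T a (b + b') c = T a b c + T a b' c"
    "T a b (c + c') = T a b c + T a b c'"
    "T (r *\<^sub>R a) b c = r * T a b c" "T a (r *\<^sub>R b) c = r * T a b c" "T a b (r *\<^sub>R c) = r * T a b c"
    "T (a - a') b c = T a b c - T a' b c" "T a (b - b') c = T a b c - T a b' c"
    "T a b (c - c') = T a b c - T a b c'"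
    "T (- a) b c = - T a b c" "T a (- b) c = - T a b c" "T a b (- c) = - T a b c"
    "T 0 b c = 0" "T a 0 c = 0" "T a b 0 = 0"
proof -
  note L = sym3_linear[OF assms]
  show "T (a + a') b c = T a b c + T a' b c" "T a (b + b') c = T a b c + T a b' c"
    "T a b (c + c') = T a b c + T a b c'"
    "T (r *\<^sub>R a) b c = r * T a b c" "T a (r *\<^sub>R b) c = r * T a b c" "T a b (r *\<^sub>R c) = r * T a b c"
    "T (a - a') b c = T a b c - T a' b c" "T a (b - b') c = T a b c - T a b' c"
    "T a b (c - c') = T a b c - T a b c'"
    "T (- a) b c = - T a b c" "T a (- b) c = - T a b c" "T a b (- c) = - T a b c"
    "T 0 b c = 0" "T a 0 c = 0" "T a b 0 = 0"
    by (simp_all add: linear_add[OF L(1)] linear_add[OF L(2)] linear_add[OF L(3)]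
       linear_scale[OF L(1)] linear_scale[OF L(2)] linear_scale[OF L(3)]
       linear_diff[OF L(1)] linear_diff[OF L(2)] linear_diff[OF L(3)]
       linear_neg[OF L(1)] linear_neg[OF L(2)] linear_neg[OF L(3)]
       linear_0[OF L(1)] linear_0[OF L(2)] linear_0[OF L(3)])
qed

lemma sym3_sum:
  assumes "sym3 T"
  shows "T (\<Sum>i\<in>A. f i) b c = (\<Sum>i\<in>A. T (f i) b c)" "T a (\<Sum>i\<in>A. f i) c = (\<Sum>i\<in>A. T a (f i) c)"
    "T a b (\<Sum>i\<in>A. f i) = (\<Sum>i\<in>A. T a b (f i))"
  using linear_sum[OF sym3_linear(1)[OF assms, of b c]] linear_sum[OF sym3_linear(2)[OF assms, of a c]]
    linear_sum[OF sym3_linear(3)[OF assms, of a b]] by simp_all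

lemma sym3_expand1:
  fixes T :: "'a::euclidean_space \<Rightarrow> 'a \<Rightarrow> 'a \<Rightarrow> real"
  assumes "sym3 T"
  shows "T x b c = (\<Sum>i\<in>Basis. (x \<bullet> i) * T i b c)" "T a x c = (\<Sum>i\<in>Basis. (x \<bullet> i) * T a i c)"
    "T a b x = (\<Sum>i\<in>Basis. (x \<bullet> i) * T a b i)"
  using sym3_sum(1)[OF assms, of "\<lambda>k. (x \<bullet> k) *\<^sub>R k" Basis b c]
    sym3_sum(2)[OF assms, of a "\<lambda>k. (x \<bullet> k) *\<^sub>R k" Basis c]
    sym3_sum(3)[OF assms, of a b "\<lambda>k. (x \<bullet> k) *\<^sub>R k" Basis]
  by (simp_all add: euclidean_representation sym3_simps[OF assms])

lemma sym3_expand: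
  fixes T :: "'a::euclidean_space \<Rightarrow> 'a \<Rightarrow> 'a \<Rightarrow> real"
  assumes "sym3 T"
  shows "T x y z = (\<Sum>i\<in>Basis. \<Sum>j\<in>Basis. \<Sum>k\<in>Basis. (x \<bullet> i) * (y \<bullet> j) * (z \<bullet> k) * T i j k)"
proof -
  have "T x y z = (\<Sum>i\<in>Basis. (x \<bullet> i) * (\<Sum>j\<in>Basis. (y \<bullet> j) * (\<Sum>k\<in>Basis. (z \<bullet> k) * T i j k)))"
    by (subst sym3_expand1(1)[OF assms], rule sum.cong[OF refl], subst sym3_expand1(2)[OF assms],
        rule arg_cong[of _ _ "(*) _"], rule sum.cong[OF refl], subst sym3_expand1(3)[OF assms]) simp
  then show ?thesis by (simp add: sum_distrib_left mult.assoc)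
qed

text \<open>Polarization. It makes the diagonal determine the whole trilinear form, so that identities and
  limits between cubic forms pass to their trilinear forms.\<close>
lemma sym3_polar:
  assumes "sym3 T"
  shows "T a b c = (T (a+b+c) (a+b+c) (a+b+c) - T (a+b) (a+b) (a+b) - T (b+c) (b+c) (b+c)
     - T (a+c) (a+c) (a+c) + T a a a + T b b b + T c c c) / 6"
  by (simp add: sym3_simps[OF assms] sym3_commute[OF assms])

lemma sym3_eqI:
  assumes "sym3 T" "sym3 T'" "\<And>x. T x x x = T' x x x" shows "T = T'"
proof (intro ext)
  show "T a b c = T' a b c" for a b c
    using sym3_polar[OF assms(1), of a b c] sym3_polar[OF assms(2), of a b c] assms(3) by simp
qed

lemma sym3_compose:
  assumes "sym3 T" "linear L" shows "sym3 (\<lambda>a b c. T (L a) (L b) (L c))"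
  unfolding sym3_def using sym3_commute[OF assms(1)] linear_compose[OF assms(2) sym3_linear(1)[OF assms(1)]]
  by (auto simp: o_def)

lemma sym3_cubic_form:
  fixes T :: "'a::euclidean_space \<Rightarrow> 'a \<Rightarrow> 'a \<Rightarrow> real"
  assumes "sym3 T" shows "cubic_form (\<lambda>x. T x x x)"
proof -
  have "real_polynomial_function (\<lambda>x. T x x x)"
    by (subst sym3_expand[OF assms])
       (intro real_polynomial_function_sum real_polynomial_function.intros
          bounded_linear_inner_left finite_Basis)
  then show ?thesis by (simp add: cubic_form_def sym3_simps[OF assms] power3_eq_cube)
qed

definition bounded01 :: "(real \<Rightarrow> real) \<Rightarrow> bool" where
  "bounded01 f \<longleftrightarrow> (\<exists>K. \<forall>s\<in>{0..1}. \<bar>f s\<bar> \<le> K)"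

lemma bounded01_const: "bounded01 (\<lambda>s. c)" and bounded01_ident: "bounded01 (\<lambda>s. s)"
  unfolding bounded01_def by (auto intro: exI[of _ "\<bar>c\<bar>"] exI[of _ 1])

lemma bounded01_add: "bounded01 f \<Longrightarrow> bounded01 g \<Longrightarrow> bounded01 (\<lambda>s. f s + g s)"
  unfolding bounded01_def by (meson abs_triangle_ineq add_mono order_trans)

lemma bounded01_mult: "bounded01 f \<Longrightarrow> bounded01 g \<Longrightarrow> bounded01 (\<lambda>s. f s * g s)"
proof -
  assume "bounded01 f" "bounded01 g"
  then obtain K L where "\<forall>s\<in>{0..1}. \<bar>f s\<bar> \<le> K" "\<forall>s\<in>{0..1}. \<bar>g s\<bar> \<le> L"
    unfolding bounded01_def by blast
  then have "\<forall>s\<in>{0..1}. \<bar>f s * g s\<bar> \<le> K * L"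
    by (auto simp: abs_mult intro!: mult_mono order_trans[OF abs_ge_zero])
  then show ?thesis unfolding bounded01_def by blast
qed

lemma bounded01_power: "bounded01 f \<Longrightarrow> bounded01 (\<lambda>s. f s ^ n)"
  by (induction n) (auto intro: bounded01_const bounded01_mult)

text \<open>Let s tend to 0.\<close>
lemma bounded01_vanish:
  assumes "bounded01 g" "\<And>s. 0 < s \<Longrightarrow> s \<le> 1 \<Longrightarrow> a + s * g s = 0" shows "a = 0"
proof (rule ccontr)
  assume a: "a \<noteq> 0"
  obtain K where K: "\<forall>s\<in>{0..1}. \<bar>g s\<bar> \<le> K" using assms(1) unfolding bounded01_def by blast
  define s where "s = min 1 (\<bar>a\<bar> / (2 * (\<bar>K\<bar> + 1)))"
  have s: "0 < s" "s \<le> 1" using a by (auto simp: s_def)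
  have "a = - (s * g s)" using assms(2)[OF s] by simp
  then have "\<bar>a\<bar> = s * \<bar>g s\<bar>" using s by (simp add: abs_mult)
  also have "\<dots> \<le> \<bar>a\<bar> / (2 * (\<bar>K\<bar> + 1)) * (\<bar>K\<bar> + 1)"
    using K s by (intro mult_mono) (auto simp: s_def intro: order_trans[of _ K])
  also have "\<dots> = \<bar>a\<bar> / 2" by (simp add: field_simps)
  finally show False using a by simp
qed

definition trilin :: "('a::real_vector \<Rightarrow> 'a \<Rightarrow> 'a \<Rightarrow> real) \<Rightarrow> bool" where
  "trilin t \<longleftrightarrow> (\<forall>b c. linear (\<lambda>a. t a b c)) \<and> (\<forall>a c. linear (\<lambda>b. t a b c)) \<and> (\<forall>a b. linear (\<lambda>c. t a b c))"

text \<open>A Taylor expansion of order three at 0 along each ray. The remainder is only asked to be bounded on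
  the unit interval: this is stable under sums and products, so it can be carried through the inductive
  generation of polynomial functions, which gives no direct access to coefficients.\<close>
definition taylor3 where
  "taylor3 f c l b t \<longleftrightarrow> linear l \<and> (\<forall>y. linear (\<lambda>x. b x y)) \<and> (\<forall>x. linear (b x)) \<and> trilin t \<and>
     (\<forall>x. \<exists>\<rho>. bounded01 \<rho> \<and> (\<forall>s\<in>{0..1}. f (s *\<^sub>R x) =
        c + s * l x + s^2 * b x x + s^3 * t x x x + s^4 * \<rho> s))"

lemma linear_zero_fun: "linear (\<lambda>x. 0)"
  by (simp add: linear_iff)

lemma linear_mult_const: "linear l \<Longrightarrow> linear (\<lambda>x. l x * (c::real))" "linear l \<Longrightarrow> linear (\<lambda>x. (c::real) * l x)"
  by (simp_all add: linear_iff algebra_simps)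

lemma polynomial_taylor3:
  fixes f :: "'a::real_normed_vector \<Rightarrow> real"
  assumes "real_polynomial_function f" shows "\<exists>c l b t. taylor3 f c l b t"
  using assms
proof (induction rule: real_polynomial_function.induct)
  case (linear f)
  then have "taylor3 f 0 f (\<lambda>x y. 0) (\<lambda>x y z. 0)"
    unfolding taylor3_def trilin_def using bounded01_const[of 0] linear_zero_fun
    by (auto simp: bounded_linear.linear linear_scale intro!: exI[of _ "\<lambda>s. 0"])
  then show ?case by blast
next
  case (const c)
  have "taylor3 (\<lambda>x. c) c (\<lambda>x. 0) (\<lambda>x y. 0) (\<lambda>x y z. 0)"
    unfolding taylor3_def trilin_def using bounded01_const[of 0] linear_zero_fun
    by (auto intro!: exI[of _ "\<lambda>s. 0"])
  then show ?case by blast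
next
  case (add f g)
  then obtain c l b t c' l' b' t' where 1: "taylor3 f c l b t" and 2: "taylor3 g c' l' b' t'" by blast
  have "taylor3 (\<lambda>x. f x + g x) (c + c') (\<lambda>x. l x + l' x) (\<lambda>x y. b x y + b' x y) (\<lambda>x y z. t x y z + t' x y z)"
    unfolding taylor3_def trilin_def
  proof (intro conjI allI)
    fix x
    obtain \<rho> where r: "bounded01 \<rho>" "\<forall>s\<in>{0..1}. f (s *\<^sub>R x) = c + s * l x + s^2 * b x x + s^3 * t x x x + s^4 * \<rho> s"
      using 1 unfolding taylor3_def by meson
    obtain \<rho>' where r': "bounded01 \<rho>'" "\<forall>s\<in>{0..1}. g (s *\<^sub>R x) = c' + s * l' x + s^2 * b' x x + s^3 * t' x x x + s^4 * \<rho>' s"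
      using 2 unfolding taylor3_def by meson
    show "\<exists>\<rho>. bounded01 \<rho> \<and> (\<forall>s\<in>{0..1}. f (s *\<^sub>R x) + g (s *\<^sub>R x) =
             c + c' + s * (l x + l' x) + s\<^sup>2 * (b x x + b' x x) + s ^ 3 * (t x x x + t' x x x) + s ^ 4 * \<rho> s)"
      using r r' by (intro exI[of _ "\<lambda>s. \<rho> s + \<rho>' s"]) (auto intro: bounded01_add simp: algebra_simps)
  qed (use 1 2 in \<open>auto simp: taylor3_def trilin_def intro!: linear_compose_add\<close>)
  then show ?case by blast
next
  case (mult f g)
  then obtain c l b t c' l' b' t' where 1: "taylor3 f c l b t" and 2: "taylor3 g c' l' b' t'" by blast
  have "taylor3 (\<lambda>x. f x * g x) (c * c') (\<lambda>x. l x * c' + c * l' x)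
     (\<lambda>x y. b x y * c' + (l x * l' y + c * b' x y))
     (\<lambda>x y z. t x y z * c' + (b x y * l' z + (l x * b' y z + c * t' x y z)))"
    unfolding taylor3_def trilin_def
  proof (intro conjI allI)
    fix x
    obtain \<rho> where r: "bounded01 \<rho>" "\<forall>s\<in>{0..1}. f (s *\<^sub>R x) = c + s * l x + s^2 * b x x + s^3 * t x x x + s^4 * \<rho> s"
      using 1 unfolding taylor3_def by meson
    obtain \<rho>' where r': "bounded01 \<rho>'" "\<forall>s\<in>{0..1}. g (s *\<^sub>R x) = c' + s * l' x + s^2 * b' x x + s^3 * t' x x x + s^4 * \<rho>' s"
      using 2 unfolding taylor3_def by meson
    define R where "R = (\<lambda>s. l x * t' x x x + b x x * b' x x + t x x x * l' x
        + s * (b x x * t' x x x + t x x x * b' x x) + s^2 * (t x x x * t' x x x)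
        + (c + s * l x + s^2 * b x x + s^3 * t x x x) * \<rho>' s
        + (c' + s * l' x + s^2 * b' x x + s^3 * t' x x x) * \<rho> s + s^4 * (\<rho> s * \<rho>' s))"
    have "bounded01 R" unfolding R_def
      by (intro bounded01_add bounded01_mult bounded01_const bounded01_ident bounded01_power r(1) r'(1))
    moreover have "f (s *\<^sub>R x) * g (s *\<^sub>R x) =
             c * c' + s * (l x * c' + c * l' x) + s\<^sup>2 * (b x x * c' + (l x * l' x + c * b' x x)) +
             s ^ 3 * (t x x x * c' + (b x x * l' x + (l x * b' x x + c * t' x x x))) + s ^ 4 * R s"
      if "s \<in> {0..1}" for s
      unfolding R_def using r(2) r'(2) that
      by (simp add: algebra_simps power2_eq_square power3_eq_cube power4_eq_xxxx)
    ultimately show "\<exists>\<rho>. bounded01 \<rho> \<and> (\<forall>s\<in>{0..1}. f (s *\<^sub>R x) * g (s *\<^sub>R x) =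
             c * c' + s * (l x * c' + c * l' x) + s\<^sup>2 * (b x x * c' + (l x * l' x + c * b' x x)) +
             s ^ 3 * (t x x x * c' + (b x x * l' x + (l x * b' x x + c * t' x x x))) + s ^ 4 * \<rho> s)"
      by blast
  qed (use 1 2 in \<open>auto simp: taylor3_def trilin_def intro!: linear_compose_add linear_mult_const\<close>)
  then show ?case by blast
qed

lemma trilin_symmetrize:
  assumes "trilin t"
  shows "sym3 (\<lambda>a b c. (t a b c + t a c b + t b a c + t b c a + t c a b + t c b a) / 6)"
proof -
  have l: "linear (\<lambda>a. t a b c)" "linear (\<lambda>b. t a b c)" "linear (\<lambda>c. t a b c)" for a b c
    using assms by (auto simp: trilin_def)
  have *: "t (a + a') b c = t a b c + t a' b c" "t (r *\<^sub>R a) b c = r * t a b c"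
    "t a (b + b') c = t a b c + t a b' c" "t a (r *\<^sub>R b) c = r * t a b c"
    "t a b (c + c') = t a b c + t a b c'" "t a b (r *\<^sub>R c) = r * t a b c" for a a' b b' c c' r
    by (simp_all add: linear_add[OF l(1)] linear_add[OF l(2)] linear_add[OF l(3)]
       linear_scale[OF l(1)] linear_scale[OF l(2)] linear_scale[OF l(3)])
  show ?thesis unfolding sym3_def
    by (auto simp: linear_iff * algebra_simps add_divide_distrib)
qed

text \<open>Along a ray the Taylor expansion must agree with s ^ 3 * h x. Dividing successively by powers of s,
  the constant, linear and quadratic terms vanish and h is the diagonal of the cubic term, which may then be
  symmetrized without changing its diagonal.\<close>
theorem cubic_form_sym3:
  fixes h :: "'a::real_normed_vector \<Rightarrow> real"
  assumes "cubic_form h" obtains T where "sym3 T" "h = (\<lambda>x. T x x x)"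
proof -
  obtain c l b t where f: "taylor3 h c l b t"
    using polynomial_taylor3 assms unfolding cubic_form_def by blast
  have "h x = t x x x" for x
  proof -
    obtain \<rho> where r: "bounded01 \<rho>" "\<forall>s\<in>{0..1}. h (s *\<^sub>R x) = c + s * l x + s^2 * b x x + s^3 * t x x x + s^4 * \<rho> s"
      using f unfolding taylor3_def by meson
    have e: "c + s * l x + s^2 * b x x + s^3 * (t x x x - h x) + s^4 * \<rho> s = 0" if "0 < s" "s \<le> 1" for s
      using r(2) that assms by (auto simp: cubic_form_def algebra_simps)
    note bd = bounded01_add bounded01_mult bounded01_const bounded01_ident bounded01_power r(1)
    have c: "c = 0"
    proof (rule bounded01_vanish[of "\<lambda>s. l x + s * b x x + s^2 * (t x x x - h x) + s^3 * \<rho> s"])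
      show "c + s * (l x + s * b x x + s^2 * (t x x x - h x) + s^3 * \<rho> s) = 0" if "0 < s" "s \<le> 1" for s
        using e[OF that] by (simp add: algebra_simps power2_eq_square power3_eq_cube power4_eq_xxxx)
    qed (intro bd)
    have l: "l x = 0"
    proof (rule bounded01_vanish[of "\<lambda>s. b x x + s * (t x x x - h x) + s^2 * \<rho> s"])
      show "l x + s * (b x x + s * (t x x x - h x) + s^2 * \<rho> s) = 0" if "0 < s" "s \<le> 1" for s
      proof -
        have "s * (l x + s * (b x x + s * (t x x x - h x) + s^2 * \<rho> s)) = 0"
          using e[OF that] c by (simp add: algebra_simps power2_eq_square power3_eq_cube power4_eq_xxxx)
        then show ?thesis using that by simp
      qed
    qed (intro bd)
    have b: "b x x = 0"
    proof (rule bounded01_vanish[of "\<lambda>s. (t x x x - h x) + s * \<rho> s"])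
      show "b x x + s * ((t x x x - h x) + s * \<rho> s) = 0" if "0 < s" "s \<le> 1" for s
      proof -
        have "s^2 * (b x x + s * ((t x x x - h x) + s * \<rho> s)) = 0"
          using e[OF that] c l by (simp add: algebra_simps power2_eq_square power3_eq_cube power4_eq_xxxx)
        then show ?thesis using that by simp
      qed
    qed (intro bd)
    have "t x x x - h x = 0"
    proof (rule bounded01_vanish[of \<rho>])
      show "t x x x - h x + s * \<rho> s = 0" if "0 < s" "s \<le> 1" for s
      proof -
        have "s^3 * (t x x x - h x + s * \<rho> s) = 0"
          using e[OF that] c l b by (simp add: algebra_simps power2_eq_square power3_eq_cube power4_eq_xxxx)
        then show ?thesis using that by simp
      qed
    qed (intro bd)
    then show ?thesis by simp
  qed
  moreover have "trilin t" using f by (simp add: taylor3_def)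
  ultimately show thesis using that[OF trilin_symmetrize[of t]] by (simp add: fun_eq_iff)
qed

lemma sym3_bilinear:
  fixes T :: "'a::euclidean_space \<Rightarrow> 'a \<Rightarrow> 'a \<Rightarrow> real"
  assumes "sym3 T" shows "bounded_bilinear (\<lambda>a b. T a b c)"
  using sym3_linear[OF assms] by (simp add: bilinear_conv_bounded_bilinear[symmetric] bilinear_def)

lemma sym3_quadratic_derivative:
  fixes T :: "'a::euclidean_space \<Rightarrow> 'a \<Rightarrow> 'a \<Rightarrow> real"
  assumes "sym3 T"
  shows "((\<lambda>x. T x x c) has_derivative (\<lambda>v. 2 * T p v c)) (at p)"
proof -
  have "((\<lambda>x. T x x c) has_derivative (\<lambda>v. T p v c + T v p c)) (at p)"
    by (rule bounded_bilinear.FDERIV[OF sym3_bilinear[OF assms]]) (auto intro: has_derivative_ident)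
  then show ?thesis using sym3_commute(1)[OF assms, of _ p c] by simp
qed

lemma sym3_cubic_derivative:
  fixes T :: "'a::euclidean_space \<Rightarrow> 'a \<Rightarrow> 'a \<Rightarrow> real"
  assumes "sym3 T"
  shows "((\<lambda>x. T x x x) has_derivative (\<lambda>v. 3 * T p p v)) (at p)"
proof -
  note e = sym3_expand1(3)[OF assms]
  have "((\<lambda>x. \<Sum>k\<in>Basis. (x \<bullet> k) * T x x k) has_derivative
        (\<lambda>v. \<Sum>k\<in>Basis. (p \<bullet> k) * (2 * T p v k) + (v \<bullet> k) * T p p k)) (at p)"
    by (intro has_derivative_sum has_derivative_mult has_derivative_inner_left has_derivative_ident
        sym3_quadratic_derivative[OF assms])
  moreover have "(\<Sum>k\<in>Basis. (p \<bullet> k) * (2 * T p v k) + (v \<bullet> k) * T p p k) = 3 * T p p v" for v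
  proof -
    have "(\<Sum>k\<in>Basis. (p \<bullet> k) * (2 * T p v k) + (v \<bullet> k) * T p p k) = 2 * T p v p + T p p v"
      by (simp add: sum.distrib e[of p v p] e[of p p v] sum_distrib_left algebra_simps)
    then show ?thesis using sym3_commute(2)[OF assms, of p v p] by simp
  qed
  ultimately show ?thesis using e[of x x x for x] by simp
qed

lemma sym3_frechet:
  fixes T :: "'a::euclidean_space \<Rightarrow> 'a \<Rightarrow> 'a \<Rightarrow> real"
  assumes "sym3 T"
  shows "frechet_derivative (\<lambda>x. T x x x) (at p) = (\<lambda>v. 3 * T p p v)"
  using frechet_derivative_at[OF sym3_cubic_derivative[OF assms]] by simp

lemma sym3_hessian:
  fixes T :: "'a::euclidean_space \<Rightarrow> 'a \<Rightarrow> 'a \<Rightarrow> real"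
  assumes "sym3 T"
  shows "hessian (\<lambda>x. T x x x) p v w = 6 * T p v w"
proof -
  have "((\<lambda>q. 3 * T q q v) has_derivative (\<lambda>w. 3 * (2 * T p w v))) (at p)"
    by (intro has_derivative_mult_right sym3_quadratic_derivative[OF assms])
  then have "frechet_derivative (\<lambda>q. 3 * T q q v) (at p) = (\<lambda>w. 3 * (2 * T p w v))"
    using frechet_derivative_at by metis
  then show ?thesis
    unfolding hessian_def sym3_frechet[OF assms] by (simp add: sym3_commute[OF assms])
qed

lemma sym3_Cinf:
  fixes T :: "'a::euclidean_space \<Rightarrow> 'a \<Rightarrow> 'a \<Rightarrow> real"
  assumes "sym3 T" "open U" shows "Cinf_on U (\<lambda>x. T x x x)"
  by (subst sym3_expand[OF assms(1)])
     (intro Cinf_sum Cinf_mult Cinf_const Cinf_linear bounded_linear_inner_left assms(2) bounded_linear_ident)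

section \<open>Symmetric bilinear forms and Lorentz signature\<close>

definition sym_form :: "('a::real_vector \<Rightarrow> 'a \<Rightarrow> real) \<Rightarrow> bool" where
  "sym_form B \<longleftrightarrow> (\<forall>y. linear (\<lambda>x. B x y)) \<and> (\<forall>x y. B x y = B y x)"

lemma sym_form_commute: "sym_form B \<Longrightarrow> B x y = B y x"
  unfolding sym_form_def by blast

lemma sym_form_linear:
  assumes "sym_form B" shows "linear (\<lambda>x. B x y)" "linear (\<lambda>y. B x y)"
proof -
  show "linear (\<lambda>x. B x y)" for y using assms unfolding sym_form_def by blast
  from this[of x] show "linear (\<lambda>y. B x y)"
    using sym_form_commute[OF assms] by simp
qed

lemma sym_form_simps:
  assumes "sym_form B"
  shows "B (x + x') y = B x y + B x' y" "B x (y + y') = B x y + B x y'"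
    "B (r *\<^sub>R x) y = r * B x y" "B x (r *\<^sub>R y) = r * B x y"
    "B (x - x') y = B x y - B x' y" "B x (y - y') = B x y - B x y'"
    "B (- x) y = - B x y" "B x (- y) = - B x y" "B 0 y = 0" "B x 0 = 0"
proof -
  note L = sym_form_linear[OF assms]
  show "B (x + x') y = B x y + B x' y" "B x (y + y') = B x y + B x y'"
    "B (r *\<^sub>R x) y = r * B x y" "B x (r *\<^sub>R y) = r * B x y"
    "B (x - x') y = B x y - B x' y" "B x (y - y') = B x y - B x y'"
    "B (- x) y = - B x y" "B x (- y) = - B x y" "B 0 y = 0" "B x 0 = 0"
    by (simp_all add: linear_add[OF L(1)] linear_add[OF L(2)] linear_scale[OF L(1)] linear_scale[OF L(2)]
       linear_diff[OF L(1)] linear_diff[OF L(2)] linear_neg[OF L(1)] linear_neg[OF L(2)]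
       linear_0[OF L(1)] linear_0[OF L(2)])
qed

lemma sym_form_sum:
  assumes "sym_form B"
  shows "B (\<Sum>i\<in>A. f i) y = (\<Sum>i\<in>A. B (f i) y)" "B x (\<Sum>i\<in>A. f i) = (\<Sum>i\<in>A. B x (f i))"
  using linear_sum[OF sym_form_linear(1)[OF assms, of y]] linear_sum[OF sym_form_linear(2)[OF assms, of x]]
  by simp_all

lemma sym_form_sym3:
  assumes "sym3 T" shows "sym_form (\<lambda>x y. c * T p x y)"
  unfolding sym_form_def using sym3_commute(2)[OF assms, of p]
  by (auto simp: linear_iff algebra_simps sym3_simps[OF assms])

text \<open>For real r the number 2 * r * B a w + r ^ 2 * B w w is nonnegative, which forces its linear
  coefficient to vanish.\<close>
lemma psd_kernel:
  assumes B: "sym_form B" and S: "subspace S" "\<And>x. x \<in> S \<Longrightarrow> 0 \<le> B x x"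
    and a: "a \<in> S" "B a a = 0" and w: "w \<in> S"
  shows "B a w = 0"
proof (rule ccontr)
  assume ne: "B a w \<noteq> 0"
  have *: "0 \<le> 2 * t * B a w + B w w" for t
  proof -
    have "t *\<^sub>R a + w \<in> S" using S(1) a(1) w by (simp add: subspace_add subspace_scale)
    from S(2)[OF this] show ?thesis
      using a(2) sym_form_commute[OF B, of w a] by (simp add: sym_form_simps[OF B])
  qed
  have "2 * (- (B w w + 1) / (2 * B a w)) * B a w + B w w = - 1" using ne by (simp add: field_simps)
  then show False using *[of "- (B w w + 1) / (2 * B a w)"] by simp
qed

lemma sym_form_continuous:
  fixes B :: "'a::euclidean_space \<Rightarrow> 'a \<Rightarrow> real"
  assumes "sym_form B" shows "continuous_on S (\<lambda>x. B x x)"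
proof -
  have "bounded_bilinear B"
    unfolding bilinear_conv_bounded_bilinear[symmetric] bilinear_def
    using sym_form_linear[OF assms] by blast
  then show ?thesis by (rule bounded_bilinear.continuous_on) (rule continuous_on_id)+
qed

text \<open>The maximizer a of the Rayleigh quotient on the unit sphere of S, with maximum \<mu>: the form
  \<mu> * (x \<bullet> y) - B x y is positive semidefinite on S and a is a null vector of it, hence lies in its
  radical.\<close>
lemma sym_form_max_eigenvector:
  fixes B :: "'a::euclidean_space \<Rightarrow> 'a \<Rightarrow> real"
  assumes B: "sym_form B" and S: "subspace S" "S \<noteq> {0}"
  obtains a \<mu> where "a \<in> S" "norm a = 1" "\<And>w. w \<in> S \<Longrightarrow> B a w = \<mu> * (a \<bullet> w)"
    "\<And>w. w \<in> S \<Longrightarrow> B w w \<le> \<mu> * (w \<bullet> w)"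
proof -
  define K where "K = S \<inter> sphere 0 1"
  obtain x where x: "x \<in> S" "x \<noteq> 0" using S subspace_0 by blast
  have "(1 / norm x) *\<^sub>R x \<in> K" using x S(1) by (simp add: K_def subspace_scale)
  then have "K \<noteq> {}" by blast
  moreover have "compact K"
    unfolding K_def using closed_subspace[OF S(1)] by (simp add: closed_Int_compact)
  ultimately obtain a where a: "a \<in> K" "\<And>y. y \<in> K \<Longrightarrow> B y y \<le> B a a"
    using continuous_attains_sup[of K "\<lambda>x. B x x"] sym_form_continuous[OF B] by blast
  define C where "C x y = B a a * (x \<bullet> y) - B x y" for x y
  have C: "sym_form C"
    unfolding sym_form_def C_def
    by (auto simp: linear_iff algebra_simps inner_simps sym_form_simps[OF B] sym_form_commute[OF B] inner_commute)
  have nn: "0 \<le> C y y" if "y \<in> S" for y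
  proof (cases "y = 0")
    case False
    have "(1 / norm y) *\<^sub>R y \<in> K" using that False S(1) by (simp add: K_def subspace_scale)
    from a(2)[OF this] have "B y y / (norm y)\<^sup>2 \<le> B a a"
      by (simp add: sym_form_simps[OF B] power2_eq_square)
    then show ?thesis using False by (simp add: C_def divide_le_eq dot_square_norm)
  qed (simp add: C_def sym_form_simps[OF B])
  have Caa: "C a a = 0" using a(1) by (simp add: C_def K_def dot_square_norm)
  have aS: "a \<in> S" using a(1) by (simp add: K_def)
  have Caw: "C a w = 0" if "w \<in> S" for w
    by (rule psd_kernel[OF C S(1) nn aS Caa that])
  show thesis
  proof (rule that[OF aS, of "B a a"])
    show "norm a = 1" using a(1) by (simp add: K_def)
    show "B a w = B a a * (a \<bullet> w)" if "w \<in> S" for w using Caw[OF that] by (simp add: C_def)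
    show "B w w \<le> B a a * (w \<bullet> w)" if "w \<in> S" for w using nn[OF that] by (simp add: C_def)
  qed
qed

text \<open>Split off a maximal eigenvector and continue on its orthogonal complement in S.\<close>
lemma sym_form_orthonormal_eigenbasis:
  fixes B :: "'a::euclidean_space \<Rightarrow> 'a \<Rightarrow> real"
  assumes B: "sym_form B"
  shows "subspace S \<Longrightarrow> \<exists>Bs l. Bs \<subseteq> S \<and> finite Bs \<and> pairwise Linear_Algebra.orthogonal Bs \<and> (\<forall>b\<in>Bs. norm b = 1) \<and>
     span Bs = S \<and> (\<forall>b\<in>Bs. \<forall>w\<in>S. B b w = l b * (b \<bullet> w))"
proof (induction "dim S" arbitrary: S rule: less_induct)
  case less
  show ?case
  proof (cases "S = {0}")
    case True
    then show ?thesis by (intro exI[of _ "{}"]) auto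
  next
    case False
    obtain a \<mu> where a: "a \<in> S" "norm a = 1" "\<And>w. w \<in> S \<Longrightarrow> B a w = \<mu> * (a \<bullet> w)"
      by (rule sym_form_max_eigenvector[OF B less.prems False]) (rule that)
    define S' where "S' = {x \<in> S. a \<bullet> x = 0}"
    have S': "subspace S'"
      using less.prems by (auto simp: S'_def subspace_def inner_simps)
    have aS': "a \<notin> S'" using a(2) by (auto simp: S'_def)
    have "S' \<subseteq> S" by (auto simp: S'_def)
    moreover have "S' \<noteq> S" using aS' a(1) by blast
    ultimately have "span S' \<subset> span S"
      unfolding span_eq_iff[THEN iffD2, OF S'] span_eq_iff[THEN iffD2, OF less.prems] by blast
    then have "dim S' < dim S" by (rule dim_psubset)
    from less.hyps[OF this S'] obtain Bs l where Bs: "Bs \<subseteq> S'" "finite Bs" "pairwise Linear_Algebra.orthogonal Bs"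
      "\<forall>b\<in>Bs. norm b = 1" "span Bs = S'" "\<forall>b\<in>Bs. \<forall>w\<in>S'. B b w = l b * (b \<bullet> w)" by blast
    have aB: "a \<notin> Bs" using Bs(1) aS' by blast
    have dec: "w - (a \<bullet> w) *\<^sub>R a \<in> S'" if "w \<in> S" for w
      using that a(1,2) less.prems
      by (auto simp: S'_def subspace_diff subspace_scale inner_simps dot_square_norm)
    have "span (insert a Bs) = S"
    proof
      show "span (insert a Bs) \<subseteq> S"
        using a(1) Bs(1) less.prems by (intro span_minimal) (auto simp: S'_def)
      show "S \<subseteq> span (insert a Bs)"
      proof
        fix w assume "w \<in> S"
        then have "w - (a \<bullet> w) *\<^sub>R a \<in> span Bs" using dec Bs(5) by simp
        then show "w \<in> span (insert a Bs)" by (auto simp: span_insert)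
      qed
    qed
    moreover have "B b w = (l(a := \<mu>)) b * (b \<bullet> w)" if "b \<in> insert a Bs" "w \<in> S" for b w
    proof (cases "b = a")
      case False
      then have b: "b \<in> Bs" using that by simp
      then have bS: "b \<in> S" "a \<bullet> b = 0" using Bs(1) by (auto simp: S'_def)
      have "B b a = 0" using a(3)[OF bS(1)] bS(2) sym_form_commute[OF B, of b a] by simp
      moreover have "B b (w - (a \<bullet> w) *\<^sub>R a) = l b * (b \<bullet> (w - (a \<bullet> w) *\<^sub>R a))"
        using Bs(6) b dec[OF that(2)] by blast
      ultimately show ?thesis using False bS(2)
        by (simp add: sym_form_simps[OF B] inner_simps inner_commute)
    qed (use a(3) that in simp)
    moreover have "pairwise Linear_Algebra.orthogonal (insert a Bs)"
      using Bs(1,3) by (auto simp: pairwise_insert Linear_Algebra.orthogonal_def S'_def inner_commute)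
    ultimately show ?thesis
      using Bs a(1,2) by (intro exI[of _ "insert a Bs"] exI[of _ "l(a := \<mu>)"]) (auto simp: S'_def)
  qed
qed

lemma sym_form_diagonal:
  fixes B :: "'a::euclidean_space \<Rightarrow> 'a \<Rightarrow> real"
  assumes B: "sym_form B"
  obtains Bs :: "'a set" and l where "finite Bs" "pairwise Linear_Algebra.orthogonal Bs" "\<And>b. b \<in> Bs \<Longrightarrow> norm b = 1" "card Bs = DIM('a)"
    "\<And>x. x = (\<Sum>b\<in>Bs. (x \<bullet> b) *\<^sub>R b)" "\<And>x y. B x y = (\<Sum>b\<in>Bs. l b * (x \<bullet> b) * (y \<bullet> b))"
proof -
  obtain Bs :: "'a set" and l where Bs: "finite Bs" "pairwise Linear_Algebra.orthogonal Bs" "\<forall>b\<in>Bs. norm b = 1" "span Bs = UNIV"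
    "\<forall>b\<in>Bs. \<forall>w. B b w = l b * (b \<bullet> w)"
    using sym_form_orthonormal_eigenbasis[OF B, of UNIV] by auto
  have "0 \<notin> Bs" using Bs(3) by auto
  then have "independent Bs" using Bs(2) by (simp add: pairwise_orthogonal_independent)
  then have "card Bs = dim (UNIV :: 'a set)"
    using basis_card_eq_dim[of Bs UNIV] Bs(4) by simp
  moreover have x: "x = (\<Sum>b\<in>Bs. (x \<bullet> b) *\<^sub>R b)" for x
  proof -
    have "x - (\<Sum>b\<in>Bs. (b \<bullet> x / (b \<bullet> b)) *\<^sub>R b) = 0"
    proof -
      let ?y = "x - (\<Sum>b\<in>Bs. (b \<bullet> x / (b \<bullet> b)) *\<^sub>R b)"
      have "Linear_Algebra.orthogonal ?y ?y" by (rule Gram_Schmidt_step[OF Bs(2)]) (simp add: Bs(4))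
      then show ?thesis by (simp add: orthogonal_self)
    qed
    moreover have "(\<Sum>b\<in>Bs. (b \<bullet> x / (b \<bullet> b)) *\<^sub>R b) = (\<Sum>b\<in>Bs. (x \<bullet> b) *\<^sub>R b)"
      using Bs(3) by (intro sum.cong) (auto simp: dot_square_norm inner_commute)
    ultimately show ?thesis by simp
  qed
  moreover have "B x y = (\<Sum>b\<in>Bs. l b * (x \<bullet> b) * (y \<bullet> b))" for x y
  proof -
    have "B x y = B (\<Sum>b\<in>Bs. (x \<bullet> b) *\<^sub>R b) y" using x by simp
    also have "\<dots> = (\<Sum>b\<in>Bs. (x \<bullet> b) * B b y)"
      by (simp only: sym_form_sum(1)[OF B] sym_form_simps[OF B])
    also have "\<dots> = (\<Sum>b\<in>Bs. l b * (x \<bullet> b) * (y \<bullet> b))"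
      using Bs(5) by (intro sum.cong) (auto simp: inner_commute)
    finally show ?thesis .
  qed
  ultimately show thesis using that[of Bs l] Bs by simp
qed

text \<open>The eigenspace of \<mu> is spanned by the basis vectors whose eigenvalue is \<mu>. Summing
  dimensions over all \<mu> with a given sign therefore counts eigenvalues of that sign with multiplicity.\<close>
lemma sum_dim_eigenspaces:
  fixes B :: "'a::euclidean_space \<Rightarrow> 'a \<Rightarrow> real"
  assumes "finite Bs" "pairwise Linear_Algebra.orthogonal Bs" "\<And>b. b \<in> Bs \<Longrightarrow> norm b = 1"
    and dec: "\<And>x. x = (\<Sum>b\<in>Bs. (x \<bullet> b) *\<^sub>R b)"
    and B: "\<And>x y. B x y = (\<Sum>b\<in>Bs. l b * (x \<bullet> b) * (y \<bullet> b))"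
  shows "(\<Sum>\<mu> | Q \<mu> \<and> form_eigenspace B \<mu> \<noteq> {0}. dim (form_eigenspace B \<mu>)) = card {b\<in>Bs. Q (l b)}"
proof -
  have on: "c \<bullet> b = (if c = b then 1 else 0)" if "b \<in> Bs" "c \<in> Bs" for b c
    using assms(2,3) that by (auto simp: pairwise_def Linear_Algebra.orthogonal_def dot_square_norm)
  have Bb: "B b y = l b * (b \<bullet> y)" if "b \<in> Bs" for b y
  proof -
    have "B b y = (\<Sum>c\<in>Bs. if c = b then l b * (y \<bullet> b) else 0)"
      unfolding B using on that by (intro sum.cong) auto
    then show ?thesis using that assms(1) by (simp add: inner_commute)
  qed
  have sf: "B x y = B y x" for x y unfolding B by (simp add: mult_ac)
  have eig: "form_eigenspace B \<mu> = span {b\<in>Bs. l b = \<mu>}" for \<mu>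
  proof
    show "span {b\<in>Bs. l b = \<mu>} \<subseteq> form_eigenspace B \<mu>"
    proof (rule span_minimal)
      show "subspace (form_eigenspace B \<mu>)"
        unfolding subspace_def form_eigenspace_def
        by (auto simp: B inner_simps sum.distrib algebra_simps simp flip: sum_distrib_left)
    qed (auto simp: form_eigenspace_def Bb)
    show "form_eigenspace B \<mu> \<subseteq> span {b\<in>Bs. l b = \<mu>}"
    proof
      fix v assume v: "v \<in> form_eigenspace B \<mu>"
      have z: "v \<bullet> b = 0" if "b \<in> Bs" "l b \<noteq> \<mu>" for b
      proof -
        have "l b * (b \<bullet> v) = \<mu> * (v \<bullet> b)"
          using v Bb[OF that(1), of v] sf[of v b] by (auto simp: form_eigenspace_def)
        then show ?thesis using that(2) by (simp add: inner_commute)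
      qed
      have "v = (\<Sum>b\<in>{b\<in>Bs. l b = \<mu>}. (v \<bullet> b) *\<^sub>R b)"
        by (subst dec, rule sum.mono_neutral_right) (use assms(1) z in auto)
      also have "\<dots> \<in> span {b\<in>Bs. l b = \<mu>}"
        by (intro span_sum span_scale span_base)
      finally show "v \<in> span {b\<in>Bs. l b = \<mu>}" .
    qed
  qed
  have nz: "0 \<notin> Bs" using assms(3)[of 0] by auto
  have dim: "dim (form_eigenspace B \<mu>) = card {b\<in>Bs. l b = \<mu>}" for \<mu>
  proof -
    have "pairwise Linear_Algebra.orthogonal {b\<in>Bs. l b = \<mu>}" using assms(2) by (auto simp: pairwise_def)
    then have "independent {b\<in>Bs. l b = \<mu>}" using nz by (intro pairwise_orthogonal_independent) auto
    then show ?thesis unfolding eig by (simp add: dim_span dim_eq_card_independent)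
  qed
  have triv: "form_eigenspace B \<mu> \<noteq> {0} \<longleftrightarrow> \<mu> \<in> l ` Bs" for \<mu>
  proof
    assume "form_eigenspace B \<mu> \<noteq> {0}"
    then have "{b\<in>Bs. l b = \<mu>} \<noteq> {}" unfolding eig by (metis span_empty)
    then show "\<mu> \<in> l ` Bs" by blast
  next
    assume "\<mu> \<in> l ` Bs"
    then obtain b where "b \<in> Bs" "l b = \<mu>" by blast
    then have "b \<in> form_eigenspace B \<mu>" "b \<noteq> 0" unfolding eig using nz by (auto intro: span_base)
    then show "form_eigenspace B \<mu> \<noteq> {0}" by blast
  qed
  have "{\<mu>. Q \<mu> \<and> form_eigenspace B \<mu> \<noteq> {0}} = l ` {b\<in>Bs. Q (l b)}" unfolding triv by auto
  moreover have "card {b\<in>Bs. Q (l b)} = (\<Sum>\<mu>\<in>l ` {b\<in>Bs. Q (l b)}. card {b\<in>{b\<in>Bs. Q (l b)}. l b = \<mu>})"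
    using sum.image_gen[of "{b\<in>Bs. Q (l b)}" "\<lambda>_. 1::nat" l] assms(1) by simp
  moreover have "{b\<in>{b\<in>Bs. Q (l b)}. l b = \<mu>} = {b\<in>Bs. l b = \<mu>}" if "\<mu> \<in> l ` {b\<in>Bs. Q (l b)}" for \<mu>
    using that by auto
  ultimately show ?thesis by (simp add: dim)
qed

text \<open>Some eigenvalue is negative because B p p is. If a second one were not positive, a combination of
  the two eigenvectors would be B-orthogonal to p without being spacelike. Conversely, let b0 be the only
  negative eigenvector and suppose that a is B-orthogonal to p with B a a not positive: the combination of p
  and a without b0-component is both B-nonnegative and B-nonpositive, which is impossible for a \<noteq> 0.\<close>
theorem lorentz_signature_iff:
  fixes B :: "'a::euclidean_space \<Rightarrow> 'a \<Rightarrow> real"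
  assumes B: "sym_form B" and p: "B p p < 0"
  shows "lorentz_signature B \<longleftrightarrow> (\<forall>a. a \<noteq> 0 \<longrightarrow> B p a = 0 \<longrightarrow> 0 < B a a)"
proof -
  obtain Bs :: "'a set" and l where Bs: "finite Bs" "pairwise Linear_Algebra.orthogonal Bs" "\<And>b. b \<in> Bs \<Longrightarrow> norm b = 1" "card Bs = DIM('a)"
    and dec: "\<And>x. x = (\<Sum>b\<in>Bs. (x \<bullet> b) *\<^sub>R b)" and Beq: "\<And>x y. B x y = (\<Sum>b\<in>Bs. l b * (x \<bullet> b) * (y \<bullet> b))"
    by (rule sym_form_diagonal[OF B]) (rule that, assumption+)
  have on: "c \<bullet> b = (if c = b then 1 else 0)" if "b \<in> Bs" "c \<in> Bs" for b c
    using Bs(2,3) that by (auto simp: pairwise_def Linear_Algebra.orthogonal_def dot_square_norm)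
  have Bbc: "B b c = (if b = c then l b else 0)" if "b \<in> Bs" "c \<in> Bs" for b c
  proof -
    have "B b c = (\<Sum>d\<in>Bs. if d = b then l b * (c \<bullet> b) else 0)"
      unfolding Beq using on that by (intro sum.cong) auto
    then show ?thesis using that Bs(1) on[of b c] by auto
  qed
  have lor: "lorentz_signature B \<longleftrightarrow> card {b\<in>Bs. 0 < l b} = DIM('a) - 1 \<and> card {b\<in>Bs. l b < 0} = 1"
    unfolding lorentz_signature_def
    using sum_dim_eigenspaces[OF Bs(1,2,3) dec Beq, of "\<lambda>\<mu>. 0 < \<mu>"]
      sum_dim_eigenspaces[OF Bs(1,2,3) dec Beq, of "\<lambda>\<mu>. \<mu> < 0"] by simp
  obtain b0 where b0: "b0 \<in> Bs" "l b0 < 0"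
  proof (rule ccontr)
    assume "\<not> thesis"
    then have "0 \<le> l b" if "b \<in> Bs" for b using that \<open>\<And>b0. b0 \<in> Bs \<Longrightarrow> l b0 < 0 \<Longrightarrow> thesis\<close> by force
    then have "0 \<le> B p p" unfolding Beq by (intro sum_nonneg) (auto simp: mult.assoc)
    then show False using p by simp
  qed
  show ?thesis
  proof
    assume pos: "\<forall>a. a \<noteq> 0 \<longrightarrow> B p a = 0 \<longrightarrow> 0 < B a a"
    have "0 < l c" if c: "c \<in> Bs" "c \<noteq> b0" for c
    proof (rule ccontr)
      assume lc: "\<not> 0 < l c"
      \<comment> \<open>B-orthogonal to p, and not spacelike since neither b0 nor c is.\<close>
      define x where "x = (if B p b0 = 0 then b0 else B p c *\<^sub>R b0 - B p b0 *\<^sub>R c)"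
      have "B p x = 0" by (simp add: x_def sym_form_simps[OF B])
      moreover have "x \<noteq> 0"
      proof
        assume x0: "x = 0"
        have "x \<bullet> b0 = (if B p b0 = 0 then 1 else B p c)" "x \<bullet> c = (if B p b0 = 0 then 0 else - B p b0)"
          using on[of b0 c] on[of c b0] on[of c c] on[of b0 b0] c b0 by (auto simp: x_def inner_simps)
        then show False using x0 by (auto split: if_splits)
      qed
      moreover have "B x x \<le> 0"
        using Bbc[of b0 c] Bbc[of c b0] Bbc[of c c] Bbc[of b0 b0] c b0 lc
        by (auto simp: x_def sym_form_simps[OF B] mult.assoc[symmetric] mult_nonneg_nonpos add_nonpos_nonpos)
      ultimately show False using pos by force
    qed
    then have "{b\<in>Bs. 0 < l b} = Bs - {b0}" "{b\<in>Bs. l b < 0} = {b0}" using b0 by force+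
    then show "lorentz_signature B" using lor Bs(1,4) b0 by simp
  next
    assume "lorentz_signature B"
    then have c: "card {b\<in>Bs. 0 < l b} = DIM('a) - 1" "card {b\<in>Bs. l b < 0} = 1" using lor by auto
    have "{b\<in>Bs. 0 < l b} \<subseteq> Bs - {b0}" using b0 by auto
    moreover have "card (Bs - {b0}) = DIM('a) - 1" using Bs(1,4) b0 by simp
    ultimately have "{b\<in>Bs. 0 < l b} = Bs - {b0}" using c(1) Bs(1) by (intro card_subset_eq) auto
    then have pos: "0 < l b" if "b \<in> Bs" "b \<noteq> b0" for b using that by blast
    show "\<forall>a. a \<noteq> 0 \<longrightarrow> B p a = 0 \<longrightarrow> 0 < B a a"
    proof (intro allI impI, rule ccontr)
      fix a assume a: "a \<noteq> 0" "B p a = 0" "\<not> 0 < B a a"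
      define x where "x = (a \<bullet> b0) *\<^sub>R p - (p \<bullet> b0) *\<^sub>R a"
      have xb0: "x \<bullet> b0 = 0" by (simp add: x_def inner_simps)
      have Bx: "B x x = (a \<bullet> b0)\<^sup>2 * B p p + (p \<bullet> b0)\<^sup>2 * B a a"
        using a(2) sym_form_commute[OF B, of a p]
        by (simp add: x_def sym_form_simps[OF B] power2_eq_square algebra_simps)
      have t: "0 \<le> l b * (x \<bullet> b) * (x \<bullet> b)" if "b \<in> Bs" for b
        using pos[OF that] xb0 by (cases "b = b0") (auto simp: mult.assoc)
      have "0 \<le> B x x" unfolding Beq by (intro sum_nonneg t)
      moreover have "(a \<bullet> b0)\<^sup>2 * B p p \<le> 0" "(p \<bullet> b0)\<^sup>2 * B a a \<le> 0"
        using p a(3) by (auto simp: mult_nonneg_nonpos)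
      ultimately have z: "B x x = 0" "(a \<bullet> b0)\<^sup>2 * B p p = 0" using Bx by linarith+
      then have a0: "a \<bullet> b0 = 0" using p by simp
      have "l b * (x \<bullet> b) * (x \<bullet> b) = 0" if "b \<in> Bs" for b
        using z(1) sum_nonneg_eq_0_iff[OF Bs(1), of "\<lambda>b. l b * (x \<bullet> b) * (x \<bullet> b)"] t that
        unfolding Beq by blast
      then have "x \<bullet> b = 0" if "b \<in> Bs" for b
        using pos[OF that] xb0 that by (cases "b = b0") force+
      then have "x = 0" by (subst dec) simp
      then have p0: "p \<bullet> b0 = 0" using a0 a(1) by (simp add: x_def)
      have "0 \<le> l b * (p \<bullet> b) * (p \<bullet> b)" if "b \<in> Bs" for b
        using pos[OF that] p0 by (cases "b = b0") (auto simp: mult.assoc)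
      then have "0 \<le> B p p" unfolding Beq by (intro sum_nonneg)
      then show False using p by simp
    qed
  qed
qed

text \<open>Hyperbolicity in terms of T. The Hessian at p is 6 T p, and T p p p is positive by the first
  conjunct, so that Lorentz signature of its negative means definiteness on the hyperplane T p p a = 0.\<close>
definition hyp :: "('a::real_vector \<Rightarrow> 'a \<Rightarrow> 'a \<Rightarrow> real) \<Rightarrow> 'a \<Rightarrow> bool" where
  "hyp T p \<longleftrightarrow> 0 < T p p p \<and> (\<forall>a. a \<noteq> 0 \<longrightarrow> T p p a = 0 \<longrightarrow> T p a a < 0)"

lemma hyperbolic_point_iff:
  fixes T :: "'a::euclidean_space \<Rightarrow> 'a \<Rightarrow> 'a \<Rightarrow> real"
  assumes "sym3 T"
  shows "hyperbolic_point (\<lambda>x. T x x x) p \<longleftrightarrow> hyp T p"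
proof (cases "0 < T p p p")
  case True
  have "sym_form (\<lambda>v w. - 6 * T p v w)" by (rule sym_form_sym3[OF assms])
  from lorentz_signature_iff[OF this, of p] True show ?thesis
    unfolding hyperbolic_point_def hyp_def by (simp add: sym3_hessian[OF assms])
qed (simp add: hyperbolic_point_def hyp_def)

section \<open>Standard cubics and their hyperbolic cone\<close>

text \<open>The polarization of a cubic in standard form; the three conditions fix the coefficients of x ^ 3,
  of x ^ 2 and of x.\<close>
definition std3 :: "(real \<times> 'b::euclidean_space \<Rightarrow> real \<times> 'b \<Rightarrow> real \<times> 'b \<Rightarrow> real) \<Rightarrow> bool" where
  "std3 T \<longleftrightarrow> sym3 T \<and> T (1, 0) (1, 0) (1, 0) = 1 \<and> (\<forall>y. T (1, 0) (1, 0) (0, y) = 0) \<and>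
     (\<forall>y z. T (1, 0) (0, y) (0, z) = - (y \<bullet> z) / 3)"

text \<open>With c = 2 / (3 * sqrt 3) one has 1 - t ^ 2 + c * t ^ 3 = (1 - t / sqrt 3) ^ 2 * (1 + 2 * t / sqrt
  3), so for a unit vector v the inequality P v \<le> c holds if and only if h has a zero on the ray (1, t v)
  with t > 0. In the extreme case this zero lies on the light cone norm y = sqrt 3 * x.\<close>
definition cubic_bound :: "(real \<times> 'b::euclidean_space \<Rightarrow> real \<times> 'b \<Rightarrow> real \<times> 'b \<Rightarrow> real) \<Rightarrow> bool" where
  "cubic_bound T \<longleftrightarrow> (\<forall>y. T (0, y) (0, y) (0, y) \<le> 2 / (3 * sqrt 3) * norm y ^ 3)"

text \<open>The light cone is that of the quadratic form T p p (1, 0) = x ^ 2 - (y \<bullet> y) / 3. Under the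
  bound on P this set is the open cone over the component of (1, 0).\<close>
definition hyp_cone :: "(real \<times> 'b::euclidean_space \<Rightarrow> real \<times> 'b \<Rightarrow> real \<times> 'b \<Rightarrow> real) \<Rightarrow> (real \<times> 'b) set" where
  "hyp_cone T = {p. norm (snd p) < sqrt 3 * fst p \<and> 0 < T p p p}"

lemma std3_sym3: "std3 T \<Longrightarrow> sym3 T"
  by (simp add: std3_def)

lemma std3_bilinear:
  assumes "std3 T"
  shows "T (x, y) (x', y') (1, 0) = x * x' - (y \<bullet> y') / 3"
proof -
  note s = std3_sym3[OF assms]
  have "(x, y) = x *\<^sub>R (1, 0) + (0, y)" "(x', y') = x' *\<^sub>R (1, 0) + (0, y')" by auto
  then have "T (x, y) (x', y') (1, 0) = T (x *\<^sub>R (1, 0) + (0, y)) (x' *\<^sub>R (1, 0) + (0, y')) (1, 0)"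
    by simp
  moreover have "T (1, 0) (1, 0) (1, 0) = 1" "T (1, 0) (0, y') (1, 0) = 0" "T (0, y) (1, 0) (1, 0) = 0"
     "T (0, y) (0, y') (1, 0) = - (y \<bullet> y') / 3"
    using assms sym3_commute(2)[OF s, of "(1, 0)" "(0, y')" "(1, 0)"] sym3_rotate(1)[OF s, of "(0, y)" "(1, 0)" "(1, 0)"]
      sym3_rotate(2)[OF s, of "(0, y)" "(0, y')" "(1, 0)"] unfolding std3_def by auto
  ultimately show ?thesis by (simp only: sym3_simps[OF s]) simp
qed

lemma std3_eval:
  assumes "std3 T"
  shows "T (x, y) (x, y) (x, y) = x ^ 3 - x * (y \<bullet> y) + T (0, y) (0, y) (0, y)"
proof -
  note s = std3_sym3[OF assms]
  have split: "T (x, y) b c = x * T b c (1, 0) + T (0, y) b c" for b c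
  proof -
    have "T (x, y) b c = T (x *\<^sub>R (1, 0) + (0, y)) b c" by simp
    also have "\<dots> = x * T b c (1, 0) + T (0, y) b c"
      by (simp only: sym3_simps[OF s] sym3_rotate(1)[OF s, of "(1, 0)" b c])
    finally show ?thesis .
  qed
  have "T (x, y) (x, y) (x, y) = x * T (x, y) (x, y) (1, 0) + T (0, y) (x, y) (x, y)" by (rule split)
  moreover have "T (0, y) (x, y) (x, y) = x * T (x, y) (0, y) (1, 0) + T (0, y) (x, y) (0, y)"
    using split[of "(x, y)" "(0, y)"] by (simp only: sym3_rotate(1)[OF s, of "(0, y)" "(x, y)" "(x, y)"])
  moreover have "T (0, y) (x, y) (0, y) = x * T (0, y) (0, y) (1, 0) + T (0, y) (0, y) (0, y)"
    using split[of "(0, y)" "(0, y)"] by (simp only: sym3_commute(1)[OF s, of "(0, y)" "(x, y)" "(0, y)"])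
  ultimately show ?thesis by (simp add: std3_bilinear[OF assms] power3_eq_cube algebra_simps)
qed

lemma std3_standard_cubic:
  assumes "std3 T"
  shows "(\<lambda>p. T p p p) = standard_cubic (\<lambda>y. T (0, y) (0, y) (0, y))" "cubic_form (\<lambda>y. T (0, y) (0, y) (0, y))"
proof -
  show "(\<lambda>p. T p p p) = standard_cubic (\<lambda>y. T (0, y) (0, y) (0, y))"
  proof
    fix p show "T p p p = standard_cubic (\<lambda>y. T (0, y) (0, y) (0, y)) p"
      using std3_eval[OF assms, of "fst p" "snd p"] by (simp add: standard_cubic_def case_prod_beta)
  qed
  have "linear (\<lambda>y::'a. (0::real, y))" by (simp add: linear_iff)
  from sym3_cubic_form[OF sym3_compose[OF std3_sym3[OF assms] this]]
  show "cubic_form (\<lambda>y. T (0, y) (0, y) (0, y))" .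
qed

lemma standard_cubic_std3:
  fixes P :: "'b::euclidean_space \<Rightarrow> real"
  assumes "cubic_form P" obtains T where "std3 T" "standard_cubic P = (\<lambda>p. T p p p)"
    "P = (\<lambda>y. T (0, y) (0, y) (0, y))"
proof -
  obtain p where p: "sym3 p" "P = (\<lambda>y. p y y y)" using cubic_form_sym3[OF assms] by blast
  define T :: "real \<times> 'b \<Rightarrow> real \<times> 'b \<Rightarrow> real \<times> 'b \<Rightarrow> real" where
    "T a b c = fst a * fst b * fst c - (fst a * (snd b \<bullet> snd c) + fst b * (snd a \<bullet> snd c) + fst c * (snd a \<bullet> snd b)) / 3
        + p (snd a) (snd b) (snd c)" for a b c
  have "sym3 T"
    unfolding sym3_def T_def
    by (auto simp: linear_iff sym3_simps[OF p(1)] inner_simps algebra_simps add_divide_distrib inner_commute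
        sym3_commute[OF p(1)])
  then have "std3 T" by (simp add: std3_def T_def sym3_simps[OF p(1)])
  moreover have "standard_cubic P = (\<lambda>p. T p p p)"
    by (auto simp: standard_cubic_def T_def p(2) power3_eq_cube)
  ultimately show thesis using that by (simp add: T_def p(2))
qed

lemma sqrt3_simps: "sqrt 3 * sqrt 3 = 3" "sqrt 3 * (sqrt 3 * x) = 3 * x" "(sqrt 3)\<^sup>2 = 3"
  "sqrt 3 ^ 3 = 3 * sqrt 3"
  by (simp_all add: power3_eq_cube mult.assoc[symmetric])

text \<open>There h = x ^ 3 - 3 * x ^ 3 + P y, and the bound on P reads P y \<le> 2 * x ^ 3.\<close>
lemma nonpos_on_light_cone:
  assumes T: "std3 T" "cubic_bound T" and p: "norm (snd p) = sqrt 3 * fst p"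
  shows "T p p p \<le> 0"
proof -
  obtain x y where xy: "p = (x, y)" by (cases p)
  have y: "norm y = sqrt 3 * x" using p xy by simp
  have "y \<bullet> y = 3 * x\<^sup>2" by (simp add: dot_square_norm y power_mult_distrib)
  then have "T p p p = - 2 * x ^ 3 + T (0, y) (0, y) (0, y)"
    using std3_eval[OF T(1), of x y] xy by (simp add: power2_eq_square power3_eq_cube)
  moreover have "T (0, y) (0, y) (0, y) \<le> 2 / (3 * sqrt 3) * (sqrt 3 * x) ^ 3"
    using T(2) y by (metis cubic_bound_def)
  moreover have "2 / (3 * sqrt 3) * (sqrt 3 * x) ^ 3 = 2 * x ^ 3"
    by (simp add: power_mult_distrib sqrt3_simps)
  ultimately show ?thesis by simp
qed

lemma line_meets_light_cone:
  fixes a q :: "real \<times> 'b::euclidean_space"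
  assumes q: "norm (snd q) < sqrt 3 * fst q"
  shows "\<exists>s. norm (snd (a + s *\<^sub>R q)) = sqrt 3 * fst (a + s *\<^sub>R q)"
proof -
  define g where "g s = sqrt 3 * fst (a + s *\<^sub>R q) - norm (snd (a + s *\<^sub>R q))" for s
  define M where "M = (\<bar>sqrt 3 * fst a\<bar> + norm (snd a)) / (sqrt 3 * fst q - norm (snd q))"
  have M0: "0 \<le> M" using q by (simp add: M_def)
  have M: "M * (sqrt 3 * fst q - norm (snd q)) = \<bar>sqrt 3 * fst a\<bar> + norm (snd a)"
    using q by (simp add: M_def)
  have "norm (snd a + M *\<^sub>R snd q) \<le> norm (snd a) + M * norm (snd q)"
    using norm_triangle_ineq[of "snd a" "M *\<^sub>R snd q"] M0 by simp
  then have 1: "0 \<le> g M" using M by (simp add: g_def algebra_simps)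
  have "0 \<le> norm (snd a + (- M) *\<^sub>R snd q)" "0 \<le> M * norm (snd q)" using M0 by auto
  moreover have "g (- M) = sqrt 3 * fst a - M * (sqrt 3 * fst q) - norm (snd a + (- M) *\<^sub>R snd q)"
    by (simp add: g_def algebra_simps)
  moreover have "M * (sqrt 3 * fst q) - M * norm (snd q) = \<bar>sqrt 3 * fst a\<bar> + norm (snd a)"
    using M by (simp only: right_diff_distrib)
  ultimately have 2: "g (- M) \<le> 0"
    using abs_ge_self[of "sqrt 3 * fst a"] norm_ge_zero[of "snd a"] by linarith
  have "continuous_on {-M..M} g" unfolding g_def by (intro continuous_intros)
  then obtain s where "g s = 0" using IVT'[of g "- M" 0 M] 1 2 M0 by auto
  then show ?thesis by (intro exI[of _ s]) (simp add: g_def)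
qed

text \<open>Suppose that T q q a = 0 but T q a a \<ge> 0. Then r \<mapsto> h (a + r q) has no quadratic term
  and strictly increases. The line a + r q meets the forward light cone, where h \<le> 0, at some s1 and the
  backward one, where h \<ge> 0, at some s2; monotonicity gives s1 \<le> s2. But q points forward, so the point
  on the forward cone cannot come first unless both are the apex, and then a is a multiple of q, which T q q a
  = 0 excludes.\<close>
theorem hyp_cone_hyp:
  assumes T: "std3 T" "cubic_bound T" and q: "q \<in> hyp_cone T"
  shows "hyp T q"
  unfolding hyp_def
proof (intro conjI allI impI)
  note s = std3_sym3[OF T(1)]
  have qt: "norm (snd q) < sqrt 3 * fst q" and h: "0 < T q q q" using q by (auto simp: hyp_cone_def)
  show "0 < T q q q" by (rule h)
  have q0: "0 < fst q"
    using order_le_less_trans[OF norm_ge_zero qt] by (simp add: zero_less_mult_iff)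
  fix a assume a: "a \<noteq> 0" "T q q a = 0"
  show "T q a a < 0"
  proof (rule ccontr)
    assume neg: "\<not> T q a a < 0"
    define f where "f r = T (a + r *\<^sub>R q) (a + r *\<^sub>R q) (a + r *\<^sub>R q)" for r
    have f: "f r = T a a a + 3 * r * T q a a + r ^ 3 * T q q q" for r
      using a(2) by (simp add: f_def sym3_simps[OF s] sym3_commute[OF s] power3_eq_cube algebra_simps)
    have mono: "f r < f r'" if "r < r'" for r r'
    proof -
      have "0 < (r' - r) * ((r' + r / 2)\<^sup>2 + 3 * (r / 2)\<^sup>2)"
        using that by (intro mult_pos_pos) (auto simp: add_nonneg_eq_0_iff less_le)
      then have "r ^ 3 < r' ^ 3" by (simp add: power2_eq_square power3_eq_cube field_simps)
      then have "r ^ 3 * T q q q < r' ^ 3 * T q q q" using h by simp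
      moreover have "r * T q a a \<le> r' * T q a a" using that neg by (intro mult_right_mono) auto
      ultimately show ?thesis unfolding f by linarith
    qed
    obtain s1 where s1: "norm (snd (a + s1 *\<^sub>R q)) = sqrt 3 * fst (a + s1 *\<^sub>R q)"
      using line_meets_light_cone[OF qt] by blast
    obtain s2' where s2': "norm (snd (- a + s2' *\<^sub>R q)) = sqrt 3 * fst (- a + s2' *\<^sub>R q)"
      using line_meets_light_cone[OF qt] by blast
    define s2 where "s2 = - s2'"
    have eq: "- a + s2' *\<^sub>R q = - (a + s2 *\<^sub>R q)" by (simp add: s2_def)
    have "f s1 \<le> 0" unfolding f_def by (rule nonpos_on_light_cone[OF T s1])
    moreover have "- f s2 \<le> 0"
    proof -
      have "T (- z) (- z) (- z) = - T z z z" for z by (simp add: sym3_simps[OF s])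
      from this[of "a + s2 *\<^sub>R q"] show ?thesis
        using nonpos_on_light_cone[OF T s2'] unfolding eq f_def by linarith
    qed
    ultimately have le: "s1 \<le> s2" using mono[of s2 s1] by linarith
    have x1: "0 \<le> fst (a + s1 *\<^sub>R q)" using s1 norm_ge_zero[of "snd (a + s1 *\<^sub>R q)"]
      by (simp add: zero_le_mult_iff)
    have "0 \<le> sqrt 3 * fst (- (a + s2 *\<^sub>R q))" using s2' unfolding eq by (metis norm_ge_zero)
    then have x2: "fst (a + s2 *\<^sub>R q) \<le> 0" by (simp only: fst_uminus zero_le_mult_iff) simp
    have "s2 * fst q \<le> s1 * fst q" using x1 x2 by simp
    then have "s2 \<le> s1" using q0 by simp
    then have "s1 = s2" using le by simp
    then have "fst (a + s1 *\<^sub>R q) = 0" using x1 x2 by simp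
    then have "a + s1 *\<^sub>R q = 0" using s1 by (simp add: prod_eq_iff)
    then have aq: "a = (- s1) *\<^sub>R q" by (simp add: eq_neg_iff_add_eq_0)
    then have "s1 * T q q q = 0" using a(2) by (simp add: sym3_simps[OF s])
    then show False using a(1) aq h by simp
  qed
qed

lemma hyp_scale:
  assumes "sym3 T" "0 < r" "hyp T (r *\<^sub>R q)" shows "hyp T q"
  using assms(2,3) unfolding hyp_def by (simp add: sym3_simps[OF assms(1)] zero_less_mult_iff mult_less_0_iff)

text \<open>In the variable t the value of h is x ^ 3 - x * r ^ 2 * t ^ 2 + P * t ^ 3 with r = norm y, and the
  bound P \<le> (2 / 3) * x * r ^ 2 inside the light cone makes it smallest at t = 1.\<close>
lemma hyp_cone_radial:
  assumes T: "std3 T" "cubic_bound T" and q: "(x, y) \<in> hyp_cone T" and t: "0 \<le> t" "t \<le> 1"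
  shows "(x, t *\<^sub>R y) \<in> hyp_cone T"
proof -
  note s = std3_sym3[OF T(1)]
  define P where "P = T (0, y) (0, y) (0, y)"
  define r where "r = norm y"
  have r: "0 \<le> r" "r < sqrt 3 * x" and h: "0 < x ^ 3 - x * r\<^sup>2 + P"
    using q std3_eval[OF T(1), of x y] by (auto simp: hyp_cone_def r_def P_def dot_square_norm)
  have "0 < sqrt 3 * x" using r by linarith
  then have x: "0 < x" by (simp add: zero_less_mult_iff)
  have e: "(0, t *\<^sub>R y) = t *\<^sub>R (0::real, y)" by simp
  have val: "T (x, t *\<^sub>R y) (x, t *\<^sub>R y) (x, t *\<^sub>R y) = x ^ 3 - x * (t\<^sup>2 * r\<^sup>2) + t ^ 3 * P"
    using std3_eval[OF T(1), of x "t *\<^sub>R y"] unfolding e sym3_simps[OF s]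
    by (simp add: P_def r_def dot_square_norm power_mult_distrib power2_eq_square power3_eq_cube)
  have "P \<le> 2 / (3 * sqrt 3) * (r\<^sup>2 * r)"
    using T(2) by (simp add: cubic_bound_def P_def r_def power3_eq_cube power2_eq_square)
  also have "\<dots> \<le> 2 / (3 * sqrt 3) * (r\<^sup>2 * (sqrt 3 * x))"
    using r by (intro mult_left_mono) auto
  also have "\<dots> = 2 / 3 * x * r\<^sup>2" by (simp add: field_simps)
  finally have P: "P \<le> 2 / 3 * x * r\<^sup>2" .
  have "t ^ 3 \<le> 1" using t by (simp add: power_le_one)
  then have "P * (1 - t ^ 3) \<le> 2 / 3 * x * r\<^sup>2 * (1 - t ^ 3)" using P by (intro mult_right_mono) auto
  moreover have "x * r\<^sup>2 * (1 - t\<^sup>2) - 2 / 3 * x * r\<^sup>2 * (1 - t ^ 3) = x * r\<^sup>2 * ((1 - t)\<^sup>2 * (1 + 2 * t)) / 3"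
    by (simp add: power2_eq_square power3_eq_cube field_simps)
  moreover have "0 \<le> x * r\<^sup>2 * ((1 - t)\<^sup>2 * (1 + 2 * t)) / 3" using x t by auto
  moreover have "x ^ 3 - x * (t\<^sup>2 * r\<^sup>2) + t ^ 3 * P = (x ^ 3 - x * r\<^sup>2 + P) + x * r\<^sup>2 * (1 - t\<^sup>2) - P * (1 - t ^ 3)"
    by (simp add: algebra_simps)
  ultimately have "0 < x ^ 3 - x * (t\<^sup>2 * r\<^sup>2) + t ^ 3 * P" using h by linarith
  moreover have "t * r \<le> r" using t r(1) by (simp add: mult_left_le_one_le)
  ultimately show ?thesis using t r(2) val by (simp add: hyp_cone_def r_def)
qed

lemma powr_cube_root: "0 < (h::real) \<Longrightarrow> (h powr (- 1 / 3)) ^ 3 * h = 1"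
proof -
  assume h: "0 < h"
  have "(h powr (- 1 / 3)) ^ 3 = (h powr (- 1 / 3)) powr 3" using h by (simp add: powr_numeral)
  also have "\<dots> = h powr (- 1)" by (subst powr_powr) simp
  finally have "(h powr (- 1 / 3)) ^ 3 = h powr (- 1)" .
  then show ?thesis using h by (simp add: powr_minus_divide)
qed

text \<open>Rescaling a path on which h is positive to the level set h = 1 keeps it connected, and it starts at
  (1, 0).\<close>
lemma segment_in_component:
  fixes c :: "real \<Rightarrow> real \<times> 'b::euclidean_space"
  assumes s: "sym3 T" and c: "continuous_on {0..b} c" "0 \<le> b" and pos: "\<And>t. t \<in> {0..b} \<Longrightarrow> 0 < T (c t) (c t) (c t)"
    and c0: "c 0 = (x0, 0)" "0 < x0" "T (1, 0) (1, 0) (1, 0) = 1" and t: "t \<in> {0..b}"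
  shows "(T (c t) (c t) (c t) powr (- 1 / 3)) *\<^sub>R c t \<in> std_component (\<lambda>p. T p p p)"
proof -
  define g where "g t = (T (c t) (c t) (c t) powr (- 1 / 3)) *\<^sub>R c t" for t
  have hc: "continuous_on {0..b} (\<lambda>t. T (c t) (c t) (c t))"
    by (subst sym3_expand[OF s]) (intro continuous_intros c(1))
  have "continuous_on {0..b} g"
    unfolding g_def using pos by (intro continuous_intros hc c(1)) force
  then have "connected (g ` {0..b})" by (intro connected_continuous_image) auto
  moreover have "g ` {0..b} \<subseteq> {q. T q q q = 1}"
    using powr_cube_root[OF pos] by (auto simp: g_def sym3_simps[OF s] power3_eq_cube mult.assoc)
  moreover have "(1, 0) \<in> g ` {0..b}"
  proof (rule image_eqI[of _ _ 0])
    have "c 0 = x0 *\<^sub>R (1, 0)" using c0 by simp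
    then have "T (c 0) (c 0) (c 0) = x0 ^ 3" using c0(3) by (simp only: sym3_simps[OF s]) (simp add: power3_eq_cube)
    moreover have "(x0 ^ 3) powr (- 1 / 3) = 1 / x0"
    proof -
      have "(x0 ^ 3) powr (- 1 / 3) = (x0 powr 3) powr (- 1 / 3)" using c0(2) by (simp add: powr_numeral)
      also have "\<dots> = x0 powr (- 1)" by (subst powr_powr) simp
      finally show ?thesis using c0(2) by (simp add: powr_minus_divide)
    qed
    ultimately show "(1, 0) = g 0" using c0 by (simp add: g_def)
  qed (use c(2) in auto)
  ultimately have "g ` {0..b} \<subseteq> std_component (\<lambda>p. T p p p)"
    unfolding std_component_def by (intro connected_component_maximal)
  then show ?thesis using t by (auto simp: g_def)
qed

text \<open>The component cannot cross the light cone, because h is not positive there. In the other direction,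
  every point of the level set inside the light cone is joined to (1, 0) by shrinking its y-part.\<close>
theorem std_component_eq:
  assumes T: "std3 T" "cubic_bound T"
  shows "std_component (\<lambda>p. T p p p) = {p. T p p p = 1 \<and> norm (snd p) < sqrt 3 * fst p}"
proof
  note s = std3_sym3[OF T(1)]
  let ?C = "std_component (\<lambda>p. T p p p)"
  have one: "T (1, 0) (1, 0) (1, 0) = 1" using T(1) by (simp add: std3_def)
  let ?A = "{p. norm (snd p) < sqrt 3 * fst p} :: (real \<times> 'a) set"
  let ?B = "{p. sqrt 3 * fst p < norm (snd p)} :: (real \<times> 'a) set"
  have sub: "?C \<subseteq> {q. T q q q = 1}" unfolding std_component_def by (rule connected_component_subset)
  have con: "connected ?C" unfolding std_component_def by (rule connected_connected_component)
  have "(1, 0) \<in> ?C" using one unfolding std_component_def by (simp add: connected_component_refl)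
  then have "(1, 0) \<in> ?A \<inter> ?C" by simp
  then have A: "?A \<inter> ?C \<noteq> {}" by blast
  have AB: "?C \<subseteq> ?A \<union> ?B"
  proof
    fix p assume "p \<in> ?C"
    then have "T p p p = 1" using sub by auto
    then have "norm (snd p) \<noteq> sqrt 3 * fst p" using nonpos_on_light_cone[OF T, of p] by auto
    then show "p \<in> ?A \<union> ?B" by auto
  qed
  have op: "open ?A" "open ?B" by (intro open_Collect_less continuous_intros)+
  have "?A \<inter> ?B \<inter> ?C = {}" by auto
  from connectedD[OF con op this AB] have "?B \<inter> ?C = {}" using A by blast
  then show "?C \<subseteq> {p. T p p p = 1 \<and> norm (snd p) < sqrt 3 * fst p}"
    using AB sub by blast
  show "{p. T p p p = 1 \<and> norm (snd p) < sqrt 3 * fst p} \<subseteq> ?C"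
  proof
    fix p assume p: "p \<in> {p. T p p p = 1 \<and> norm (snd p) < sqrt 3 * fst p}"
    obtain x y where xy: "p = (x, y)" by (cases p)
    have q: "(x, y) \<in> hyp_cone T" using p xy by (simp add: hyp_cone_def)
    have "0 < sqrt 3 * x" using p xy norm_ge_zero[of y] by (simp del: norm_ge_zero) 
    then have x: "0 < x" by (simp add: zero_less_mult_iff)
    have "(T (x, 1 *\<^sub>R y) (x, 1 *\<^sub>R y) (x, 1 *\<^sub>R y) powr (- 1 / 3)) *\<^sub>R (x, 1 *\<^sub>R y) \<in> ?C"
      using hyp_cone_radial[OF T q] x one
      by (intro segment_in_component[OF s, of 1 "\<lambda>t. (x, t *\<^sub>R y)" x 1])
         (auto simp: hyp_cone_def intro!: continuous_intros)
    then show "p \<in> ?C" using p xy by simp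
  qed
qed

lemma std_component_hyp_cone:
  assumes T: "std3 T" "cubic_bound T"
  shows "p \<in> std_component (\<lambda>p. T p p p) \<longleftrightarrow> p \<in> hyp_cone T \<and> T p p p = 1"
  unfolding std_component_eq[OF T] hyp_cone_def by auto

text \<open>If the bound failed at a unit vector v, then h would be positive along the whole ray (1, t v), so
  every point of the ray would project to the component. But in the plane spanned by (1, 0) and (0, v) the
  Hessian degenerates on the tangent line when t ^ 2 - 9 * c * t + 3 = 0, where c = P v, and this equation has
  a positive solution.\<close>
lemma cubic_bound_if_hyp:
  assumes T: "std3 T" and H: "\<And>p. p \<in> std_component (\<lambda>p. T p p p) \<Longrightarrow> hyp T p"
  shows "cubic_bound T"
  unfolding cubic_bound_def
proof (intro allI, rule ccontr)
  note s = std3_sym3[OF T]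
  fix y assume y: "\<not> T (0, y) (0, y) (0, y) \<le> 2 / (3 * sqrt 3) * norm y ^ 3"
  have y0: "y \<noteq> 0" using y by (auto simp: sym3_simps[OF s] zero_prod_def[symmetric])
  define v where "v = (1 / norm y) *\<^sub>R y"
  define c where "c = T (0, v) (0, v) (0, v)"
  have v1: "v \<bullet> v = 1" using y0 by (simp add: v_def dot_square_norm power2_eq_square)
  have "(0::real, y) = norm y *\<^sub>R (0, v)" using y0 by (simp add: v_def)
  then have "T (0, y) (0, y) (0, y) = norm y ^ 3 * c"
    unfolding c_def by (simp only: sym3_simps[OF s]) (simp add: power3_eq_cube)
  then have "2 / (3 * sqrt 3) * norm y ^ 3 < c * norm y ^ 3" using y by (simp add: mult.commute)
  moreover have "0 < norm y ^ 3" using y0 by simp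
  ultimately have c: "2 / (3 * sqrt 3) < c" using mult_less_cancel_right_pos by blast
  have f: "T (x, t *\<^sub>R v) (x, t *\<^sub>R v) (x, t *\<^sub>R v) = x ^ 3 - x * t\<^sup>2 + c * t ^ 3" for x t
  proof -
    have "(0, t *\<^sub>R v) = t *\<^sub>R (0::real, v)" by simp
    then show ?thesis using std3_eval[OF T, of x "t *\<^sub>R v"]
      by (simp only: sym3_simps[OF s]) (simp add: v1 c_def power2_eq_square power3_eq_cube)
  qed
  have pos: "0 < 1 - t\<^sup>2 + c * t ^ 3" if "0 \<le> t" for t
  proof (cases "t = 0")
    case False
    have "1 - t\<^sup>2 + 2 / (3 * sqrt 3) * t ^ 3 = (1 - t / sqrt 3)\<^sup>2 * (1 + 2 * t / sqrt 3)"
      by (simp add: power2_eq_square power3_eq_cube field_simps sqrt3_simps)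
    moreover have "0 \<le> (1 - t / sqrt 3)\<^sup>2 * (1 + 2 * t / sqrt 3)" using that by auto
    moreover have "2 / (3 * sqrt 3) * t ^ 3 < c * t ^ 3" using c that False by (intro mult_strict_right_mono) auto
    ultimately show ?thesis by linarith
  qed simp
  have c0: "0 < c" using c by (smt (verit) divide_pos_pos real_sqrt_gt_zero)
  have "(2 / (3 * sqrt 3))\<^sup>2 < c\<^sup>2" using c by (intro power_strict_mono) auto
  then have c2: "0 \<le> 81 * c\<^sup>2 - 12" by (simp add: power_divide power_mult_distrib)
  \<comment> \<open>The larger root of t ^ 2 - 9 * c * t + 3.\<close>
  define t where "t = (9 * c + sqrt (81 * c\<^sup>2 - 12)) / 2"
  have t0: "0 < t" using c0 c2 by (simp add: t_def add_pos_nonneg)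
  have "2 * t - 9 * c = sqrt (81 * c\<^sup>2 - 12)" by (simp add: t_def field_simps)
  then have "(2 * t - 9 * c)\<^sup>2 = 81 * c\<^sup>2 - 12" using c2 by (simp only: real_sqrt_pow2)
  then have t: "9 * (c * t) = t\<^sup>2 + 3" by (simp add: power2_eq_square algebra_simps)
  define q where "q = (1::real, t *\<^sub>R v)"
  have "(T q q q powr (- 1 / 3)) *\<^sub>R q \<in> std_component (\<lambda>p. T p p p)"
    unfolding q_def using pos t0 T
    by (intro segment_in_component[OF s, of t "\<lambda>t. (1, t *\<^sub>R v)" 1 t])
       (auto simp: f std3_def intro!: continuous_intros)
  from H[OF this] have hq: "hyp T q"
    by (rule hyp_scale[OF s, rotated]) (use pos[of t] t0 in \<open>simp add: q_def f\<close>)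
  \<comment> \<open>Tangent at q, and a null vector of the Hessian at q.\<close>
  define a where "a = (t / 3, v)"
  have qe: "q = (1, 0) + t *\<^sub>R (0, v)" and ae: "a = (t / 3) *\<^sub>R (1, 0) + (0, v)"
    by (auto simp: q_def a_def)
  have vals: "T (1, 0) (1, 0) (1, 0) = 1" "T (1, 0) (1, 0) (0, v) = 0" "T (1, 0) (0, v) (0, v) = - 1 / 3"
     "T (0, v) (0, v) (0, v) = c" using T v1 by (auto simp: std3_def c_def)
  have vals': "T (1, 0) (0, v) (1, 0) = 0" "T (0, v) (1, 0) (1, 0) = 0" "T (0, v) (1, 0) (0, v) = - 1 / 3"
     "T (0, v) (0, v) (1, 0) = - 1 / 3" using vals by (simp_all add: sym3_commute[OF s])
  have c': "c = (t\<^sup>2 + 3) / (9 * t)" using t t0 by (simp add: field_simps)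
  have "T q q a = 0"
    unfolding qe ae sym3_simps[OF s] vals vals' c' using t0
    by (simp add: field_simps power2_eq_square)
  moreover have "T q a a = 0"
    unfolding qe ae sym3_simps[OF s] vals vals' c' using t0
    by (simp add: field_simps power2_eq_square)
  moreover have "a \<noteq> 0" using v1 by (auto simp: a_def zero_prod_def)
  ultimately show False using hq unfolding hyp_def by (metis order_less_irrefl)
qed

text \<open>By Euler's identity dh at q does not vanish on q when h q > 0.\<close>
lemma smooth_hypersurface_cone:
  assumes T: "std3 T" "cubic_bound T"
  shows "smooth_hypersurface (std_component (\<lambda>p. T p p p))"
  unfolding smooth_hypersurface_def
proof
  note s = std3_sym3[OF T(1)]
  fix p assume p: "p \<in> std_component (\<lambda>p. T p p p)"
  define f where "f q = T q q q - 1" for q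
  have cont: "continuous_on UNIV (\<lambda>q. T q q q)"
    by (subst sym3_expand[OF s]) (intro continuous_intros)
  have op: "open (hyp_cone T)"
    unfolding hyp_cone_def Collect_conj_eq
    by (intro open_Int open_Collect_less continuous_intros cont)
  have der: "(f has_derivative (\<lambda>v. 3 * T q q v - 0)) (at q)" for q
    unfolding f_def by (intro has_derivative_diff sym3_cubic_derivative[OF s] has_derivative_const)
  have fr: "frechet_derivative f (at q) = (\<lambda>v. 3 * T q q v)" for q
    using frechet_derivative_at[OF der[of q]] by simp
  have "Cinf_on (hyp_cone T) f"
    unfolding f_def by (intro Cinf_diff Cinf_const sym3_Cinf s op)
  then have "smooth_on (hyp_cone T) f" using smooth_onI[OF op] by blast
  moreover have "frechet_derivative f (at q) \<noteq> (\<lambda>_. 0)" if "q \<in> hyp_cone T" for q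
    using fun_cong[of "\<lambda>v. 3 * T q q v" "\<lambda>_. 0" q] that by (auto simp: fr hyp_cone_def)
  moreover have "std_component (\<lambda>p. T p p p) \<inter> hyp_cone T = {q \<in> hyp_cone T. f q = 0}"
    using std_component_hyp_cone[OF T] by (auto simp: f_def)
  ultimately show "\<exists>U (f :: real \<times> 'a \<Rightarrow> real). open U \<and> p \<in> U \<and> smooth_on U f \<and>
        (\<forall>q\<in>U. frechet_derivative f (at q) \<noteq> (\<lambda>_. 0)) \<and> std_component (\<lambda>p. T p p p) \<inter> U = {q \<in> U. f q = 0}"
    using op p std_component_hyp_cone[OF T] by (intro exI[of _ "hyp_cone T"] exI[of _ f]) blast
qed

text \<open>This replaces the global condition of being a CCPSR manifold by an inequality for P on the unit
  sphere; in particular the condition is closed under limits.\<close>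
theorem ccpsr_iff_cubic_bound:
  assumes T: "std3 T"
  shows "ccpsr_manifold (\<lambda>p. T p p p) (std_component (\<lambda>p. T p p p)) \<longleftrightarrow> cubic_bound T"
proof
  note s = std3_sym3[OF T]
  let ?C = "std_component (\<lambda>p. T p p p)"
  show "cubic_bound T" if "ccpsr_manifold (\<lambda>p. T p p p) ?C"
    using that by (intro cubic_bound_if_hyp[OF T])
      (auto simp: ccpsr_manifold_def psr_manifold_def hyperbolic_point_iff[OF s])
  assume B: "cubic_bound T"
  have one: "(1, 0) \<in> ?C" using T by (simp add: std_component_eq[OF T B] std3_def)
  have hyp: "hyp T p" if "p \<in> ?C" for p
    using that hyp_cone_hyp[OF T B] by (simp add: std_component_hyp_cone[OF T B])
  have cont: "continuous_on UNIV (\<lambda>q. T q q q)"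
    by (subst sym3_expand[OF s]) (intro continuous_intros)
  have "?C = {p. T p p p = 1} \<inter> {p. norm (snd p) \<le> sqrt 3 * fst p}"
  proof -
    have "norm (snd p) < sqrt 3 * fst p" if "T p p p = 1" "norm (snd p) \<le> sqrt 3 * fst p" for p
      using nonpos_on_light_cone[OF T B, of p] that by force
    then show ?thesis unfolding std_component_eq[OF T B] by auto
  qed
  moreover have "closed ({p. T p p p = 1} \<inter> {p. norm (snd p) \<le> sqrt 3 * fst p})"
    by (intro closed_Int closed_Collect_eq closed_Collect_le continuous_intros cont)
  ultimately have cl: "closed ?C" by simp
  have con: "connected ?C" unfolding std_component_def by (rule connected_connected_component)
  have sub: "?C \<subseteq> {p. T p p p = 1}" by (auto simp: std_component_eq[OF T B])
  have hp: "hyperbolic_point (\<lambda>p. T p p p) p" if "p \<in> ?C" for p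
    using hyp[OF that] hyperbolic_point_iff[OF s] by simp
  have "psr_manifold (\<lambda>p. T p p p) ?C"
    unfolding psr_manifold_def
    using sym3_cubic_form[OF s] hp[OF one] one smooth_hypersurface_cone[OF T B] sub hp by blast
  then show "ccpsr_manifold (\<lambda>p. T p p p) ?C"
    unfolding ccpsr_manifold_def using cl con by blast
qed

section \<open>Linear maps and components\<close>

lemma blinfun_GL_inverse:
  fixes L :: "'a::euclidean_space \<Rightarrow>\<^sub>L 'a"
  assumes "L \<in> GL"
  obtains K where "K \<in> GL" "\<And>x. blinfun_apply K (blinfun_apply L x) = x" "\<And>x. blinfun_apply L (blinfun_apply K x) = x"
proof -
  have b: "bij (blinfun_apply L)" using assms by (simp add: GL_def)
  have "bounded_linear (inv_into UNIV (blinfun_apply L))"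
    by (rule inj_linear_imp_inv_bounded_linear) (auto intro: blinfun.bounded_linear_right bij_is_inj[OF b])
  then have K: "blinfun_apply (Blinfun (inv_into UNIV (blinfun_apply L))) = inv_into UNIV (blinfun_apply L)"
    by (rule bounded_linear_Blinfun_apply)
  show thesis
    by (rule that[of "Blinfun (inv_into UNIV (blinfun_apply L))"])
       (simp_all add: GL_def K bij_imp_bij_inv[OF b] inv_f_f[OF bij_is_inj[OF b]] surj_f_inv_f[OF bij_is_surj[OF b]])
qed

lemma GL_linear_injI:
  fixes f :: "'a::euclidean_space \<Rightarrow> 'a"
  assumes "linear f" "inj f"
  shows "Blinfun f \<in> GL" "blinfun_apply (Blinfun f) = f"
proof -
  show "blinfun_apply (Blinfun f) = f"
    using assms(1) by (simp add: bounded_linear_Blinfun_apply linear_linear)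
  then show "Blinfun f \<in> GL"
    using assms linear_inj_imp_surj[OF assms] by (simp add: GL_def bij_def)
qed

text \<open>L and its inverse map connected sets of the level sets to connected sets, and the images contain
  the respective base points.\<close>
lemma component_image:
  fixes h :: "real \<times> 'b::euclidean_space \<Rightarrow> real"
  assumes L: "L \<in> GL" and h: "\<And>x. h (blinfun_apply L x) = h1 x"
    and p: "blinfun_apply L (1, 0) \<in> std_component h"
  shows "blinfun_apply L ` std_component h1 = std_component h"
proof -
  obtain K where K: "K \<in> GL" "\<And>x. blinfun_apply K (blinfun_apply L x) = x" "\<And>x. blinfun_apply L (blinfun_apply K x) = x"
    using blinfun_GL_inverse[OF L] by blast
  have eq: "connected_component_set {q. h q = 1} (blinfun_apply L (1, 0)) = std_component h"
    using p unfolding std_component_def by (rule connected_component_eq)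
  have ph: "h (blinfun_apply L (1, 0)) = 1"
    using p connected_component_subset[of "{q. h q = 1}"] unfolding std_component_def by blast
  have "(1, 0) \<in> std_component h1"
    using ph h unfolding std_component_def by (simp add: connected_component_refl)
  moreover have "connected (blinfun_apply L ` std_component h1)"
    unfolding std_component_def
    by (intro connected_continuous_image connected_connected_component blinfun.continuous_on continuous_intros)
  moreover have "blinfun_apply L ` std_component h1 \<subseteq> {q. h q = 1}"
    using connected_component_subset[of "{q. h1 q = 1}" "(1, 0)"] h unfolding std_component_def by auto
  ultimately have 1: "blinfun_apply L ` std_component h1 \<subseteq> std_component h"
    unfolding eq[symmetric] by (intro connected_component_maximal) auto
  have "h1 (blinfun_apply K q) = h q" for q using h[of "blinfun_apply K q"] K(3) by simp
  then have "blinfun_apply K ` std_component h \<subseteq> {q. h1 q = 1}"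
    using connected_component_subset[of "{q. h q = 1}" "(1, 0)"] unfolding std_component_def by auto
  moreover have "(1, 0) \<in> blinfun_apply K ` std_component h" using p K(2)[of "(1, 0)"] by (intro image_eqI[of _ _ "blinfun_apply L (1, 0)"]) simp_all
  moreover have "connected (blinfun_apply K ` std_component h)"
    unfolding std_component_def
    by (intro connected_continuous_image connected_connected_component blinfun.continuous_on continuous_intros)
  ultimately have "blinfun_apply K ` std_component h \<subseteq> std_component h1"
    unfolding std_component_def[of h1] by (intro connected_component_maximal)
  then have "std_component h \<subseteq> blinfun_apply L ` std_component h1"
    using K(3) by (metis (no_types, lifting) image_iff subset_iff)
  with 1 show ?thesis by blast
qed

lemma std_equivalentI:
  fixes h1 h2 :: "real \<times> 'b::euclidean_space \<Rightarrow> real"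
  assumes "L \<in> GL" "\<And>x. h2 (blinfun_apply L x) = h1 x" "blinfun_apply L (1, 0) \<in> std_component h2"
  shows "std_equivalent h1 h2"
  unfolding std_equivalent_def psr_equivalent_def
  using component_image[OF assms] assms(1,2) by blast

lemma GL_compose: "L \<in> GL \<Longrightarrow> K \<in> GL \<Longrightarrow> L o\<^sub>L K \<in> GL"
  unfolding GL_def using bij_comp[of "blinfun_apply K" "blinfun_apply L"]
  by (simp add: o_def blinfun_compose.rep_eq)

lemma psr_equivalent_sym:
  assumes "psr_equivalent h1 H1 h2 H2" shows "psr_equivalent h2 H2 h1 H1"
proof -
  obtain L where L: "L \<in> GL" "\<forall>x. h2 (blinfun_apply L x) = h1 x" "blinfun_apply L ` H1 = H2"
    using assms unfolding psr_equivalent_def by blast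
  obtain K where K: "K \<in> GL" "\<And>x. blinfun_apply K (blinfun_apply L x) = x" "\<And>x. blinfun_apply L (blinfun_apply K x) = x"
    using blinfun_GL_inverse[OF L(1)] by blast
  show ?thesis unfolding psr_equivalent_def
  proof (intro bexI[of _ K] conjI allI)
    show "h1 (blinfun_apply K x) = h2 x" for x using L(2) K(3) by metis
    show "blinfun_apply K ` H2 = H1" using K(2) by (simp add: L(3)[symmetric] image_image)
  qed (rule K(1))
qed

lemma psr_equivalent_trans:
  assumes "psr_equivalent h1 H1 h2 H2" "psr_equivalent h2 H2 h3 H3" shows "psr_equivalent h1 H1 h3 H3"
proof -
  obtain L where L: "L \<in> GL" "\<forall>x. h2 (blinfun_apply L x) = h1 x" "blinfun_apply L ` H1 = H2"
    using assms(1) unfolding psr_equivalent_def by blast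
  obtain K where K: "K \<in> GL" "\<forall>x. h3 (blinfun_apply K x) = h2 x" "blinfun_apply K ` H2 = H3"
    using assms(2) unfolding psr_equivalent_def by blast
  show ?thesis unfolding psr_equivalent_def
  proof (intro bexI[of _ "K o\<^sub>L L"] conjI allI)
    show "h3 (blinfun_apply (K o\<^sub>L L) x) = h1 x" for x using L(2) K(2) by simp
    have "blinfun_apply (K o\<^sub>L L) ` H1 = blinfun_apply K ` (blinfun_apply L ` H1)"
      by (simp add: image_image)
    then show "blinfun_apply (K o\<^sub>L L) ` H1 = H3" unfolding L(3) K(3) .
  qed (rule GL_compose[OF K(1) L(1)])
qed

section \<open>Families of trilinear forms\<close>

lemma sym3_tendsto:
  fixes T :: "'t \<Rightarrow> 'a::euclidean_space \<Rightarrow> 'a \<Rightarrow> 'a \<Rightarrow> real"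
  assumes "\<And>t. sym3 (T t)" "sym3 T'"
    and "\<And>i j k. i \<in> Basis \<Longrightarrow> j \<in> Basis \<Longrightarrow> k \<in> Basis \<Longrightarrow> ((\<lambda>t. T t i j k) \<longlongrightarrow> T' i j k) F"
    and "(x \<longlongrightarrow> x') F" "(y \<longlongrightarrow> y') F" "(z \<longlongrightarrow> z') F"
  shows "((\<lambda>t. T t (x t) (y t) (z t)) \<longlongrightarrow> T' x' y' z') F"
proof -
  have "T t (x t) (y t) (z t) = (\<Sum>i\<in>Basis. \<Sum>j\<in>Basis. \<Sum>k\<in>Basis. (x t \<bullet> i) * (y t \<bullet> j) * (z t \<bullet> k) * T t i j k)" for t
    by (rule sym3_expand[OF assms(1)])
  moreover have "T' x' y' z' = (\<Sum>i\<in>Basis. \<Sum>j\<in>Basis. \<Sum>k\<in>Basis. (x' \<bullet> i) * (y' \<bullet> j) * (z' \<bullet> k) * T' i j k)"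
    by (rule sym3_expand[OF assms(2)])
  moreover have "((\<lambda>t. \<Sum>i\<in>Basis. \<Sum>j\<in>Basis. \<Sum>k\<in>Basis. (x t \<bullet> i) * (y t \<bullet> j) * (z t \<bullet> k) * T t i j k)
     \<longlongrightarrow> (\<Sum>i\<in>Basis. \<Sum>j\<in>Basis. \<Sum>k\<in>Basis. (x' \<bullet> i) * (y' \<bullet> j) * (z' \<bullet> k) * T' i j k)) F"
    by (intro tendsto_sum tendsto_mult tendsto_inner tendsto_const assms(3-6))
  ultimately show ?thesis by simp
qed

lemma sym3_Cinf_family:
  fixes T :: "real \<Rightarrow> 'a::euclidean_space \<Rightarrow> 'a \<Rightarrow> 'a \<Rightarrow> real"
  assumes U: "open U" and "\<And>t. sym3 (T t)"
    and "\<And>i j k. i \<in> Basis \<Longrightarrow> j \<in> Basis \<Longrightarrow> k \<in> Basis \<Longrightarrow> Cinf_on U (\<lambda>t. T t i j k)"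
    and "Cinf_on U x" "Cinf_on U y" "Cinf_on U z"
  shows "Cinf_on U (\<lambda>t. T t (x t) (y t) (z t))"
proof -
  have "T t (x t) (y t) (z t) = (\<Sum>i\<in>Basis. \<Sum>j\<in>Basis. \<Sum>k\<in>Basis. (x t \<bullet> i) * (y t \<bullet> j) * (z t \<bullet> k) * T t i j k)" for t
    by (rule sym3_expand[OF assms(2)])
  moreover have "Cinf_on U (\<lambda>t. \<Sum>i\<in>Basis. \<Sum>j\<in>Basis. \<Sum>k\<in>Basis. (x t \<bullet> i) * (y t \<bullet> j) * (z t \<bullet> k) * T t i j k)"
    by (intro Cinf_sum Cinf_mult Cinf_inner Cinf_const U assms(3-6))
  ultimately show ?thesis by simp
qed

lemma sym3_uniform_limit:
  fixes T :: "'t \<Rightarrow> 'a::euclidean_space \<Rightarrow> 'a \<Rightarrow> 'a \<Rightarrow> real"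
  assumes "\<And>t. sym3 (T t)" "sym3 T'"
    and "\<And>i j k. i \<in> Basis \<Longrightarrow> j \<in> Basis \<Longrightarrow> k \<in> Basis \<Longrightarrow> ((\<lambda>t. T t i j k) \<longlongrightarrow> T' i j k) F"
  shows "uniform_limit (cball 0 1) (\<lambda>t x. T t x x x) (\<lambda>x. T' x x x) F"
proof (rule uniform_limitI)
  fix e :: real assume e: "0 < e"
  define S where "S t = (\<Sum>i\<in>Basis. \<Sum>j\<in>Basis. \<Sum>k\<in>Basis. \<bar>T t i j k - T' i j k\<bar>)" for t
  have "(S \<longlongrightarrow> (\<Sum>i\<in>(Basis::'a set). \<Sum>j\<in>(Basis::'a set). \<Sum>k\<in>(Basis::'a set). \<bar>T' i j k - T' i j k\<bar>)) F"
    unfolding S_def by (intro tendsto_sum tendsto_rabs tendsto_diff tendsto_const assms(3))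
  then have "(S \<longlongrightarrow> 0) F" by simp
  then have "\<forall>\<^sub>F t in F. S t < e" using e by (rule order_tendstoD(2))
  moreover have "dist (T t x x x) (T' x x x) \<le> S t" if "x \<in> cball 0 1" for t x
  proof -
    have c: "\<bar>x \<bullet> i\<bar> \<le> 1" if "i \<in> Basis" for i
      using \<open>x \<in> cball 0 1\<close> Basis_le_norm[OF that, of x] by simp
    have "T t x x x - T' x x x =
       (\<Sum>i\<in>Basis. \<Sum>j\<in>Basis. \<Sum>k\<in>Basis. (x \<bullet> i) * (x \<bullet> j) * (x \<bullet> k) * (T t i j k - T' i j k))"
      by (simp only: sym3_expand[OF assms(1), of t x x x] sym3_expand[OF assms(2), of x x x]
          right_diff_distrib sum_subtractf)
    also have "\<bar>\<dots>\<bar> \<le> (\<Sum>i\<in>Basis. \<Sum>j\<in>Basis. \<Sum>k\<in>Basis. \<bar>(x \<bullet> i) * (x \<bullet> j) * (x \<bullet> k) * (T t i j k - T' i j k)\<bar>)"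
      by (intro order_trans[OF sum_abs] sum_mono order_refl)
    also have "\<dots> \<le> S t"
      unfolding S_def
    proof (intro sum_mono)
      fix i j k :: 'a assume b: "i \<in> Basis" "j \<in> Basis" "k \<in> Basis"
      have "\<bar>x \<bullet> i\<bar> * \<bar>x \<bullet> j\<bar> * \<bar>x \<bullet> k\<bar> \<le> 1 * 1 * 1"
        by (intro mult_mono c b) auto
      then show "\<bar>(x \<bullet> i) * (x \<bullet> j) * (x \<bullet> k) * (T t i j k - T' i j k)\<bar> \<le> \<bar>T t i j k - T' i j k\<bar>"
        by (simp add: abs_mult mult_left_le_one_le)
    qed
    finally show ?thesis by (simp add: dist_real_def)
  qed
  ultimately show "\<forall>\<^sub>F t in F. \<forall>x\<in>cball 0 1. dist (T t x x x) (T' x x x) < e"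
    by (elim eventually_mono) (blast intro: order_le_less_trans)
qed

section \<open>Gram-Schmidt orthonormalization\<close>

text \<open>Gram-Schmidt depends smoothly on the scalar product and on the basis, and fixes a basis that is
  already orthonormal. Hence if b and G converge to an orthonormal situation, so does the orthonormalized
  basis.\<close>
lemma gram_schmidt_family:
  fixes G :: "real \<Rightarrow> 'a::euclidean_space \<Rightarrow> 'a \<Rightarrow> real" and b :: "nat \<Rightarrow> real \<Rightarrow> 'a"
  assumes U: "open U" and G: "\<And>t. sym_form (G t)"
    and Gsm: "\<And>x y. Cinf_on U x \<Longrightarrow> Cinf_on U y \<Longrightarrow> Cinf_on U (\<lambda>t. G t (x t) (y t))"
    and Glim: "\<And>x y x' y'. (x \<longlongrightarrow> x') F \<Longrightarrow> (y \<longlongrightarrow> y') F \<Longrightarrow> ((\<lambda>t. G t (x t) (y t)) \<longlongrightarrow> G' x' y') F"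
    and bsm: "\<And>i. Cinf_on U (b i)" and blim: "\<And>i. (b i \<longlongrightarrow> \<beta> i) F"
    and on: "\<And>i j. i < N \<Longrightarrow> j < N \<Longrightarrow> G' (\<beta> i) (\<beta> j) = (if i = j then 1 else 0)"
    and pos: "\<And>t x. t \<in> U \<Longrightarrow> x \<in> span ((\<lambda>j. b j t) ` {..<N}) \<Longrightarrow> x \<noteq> 0 \<Longrightarrow> 0 < G t x x"
    and ind: "\<And>t i. t \<in> U \<Longrightarrow> i < N \<Longrightarrow> b i t \<notin> span ((\<lambda>j. b j t) ` {..<i})"
  shows "n \<le> N \<Longrightarrow> \<exists>f. (\<forall>i<n. Cinf_on U (f i) \<and> (f i \<longlongrightarrow> \<beta> i) F) \<and>
     (\<forall>t\<in>U. (\<forall>i<n. f i t \<in> span ((\<lambda>j. b j t) ` {..<n})) \<and>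
        (\<forall>i<n. \<forall>j<n. G t (f i t) (f j t) = (if i = j then 1 else 0)))"
proof (induction n)
  case (Suc n)
  have "n \<le> N" using Suc.prems by simp
  then obtain f where "(\<forall>i<n. Cinf_on U (f i) \<and> (f i \<longlongrightarrow> \<beta> i) F) \<and>
     (\<forall>t\<in>U. (\<forall>i<n. f i t \<in> span ((\<lambda>j. b j t) ` {..<n})) \<and>
        (\<forall>i<n. \<forall>j<n. G t (f i t) (f j t) = (if i = j then 1 else 0)))"
    using exE[OF Suc.IH] by blast
  then have f: "\<And>i. i < n \<Longrightarrow> Cinf_on U (f i)" "\<And>i. i < n \<Longrightarrow> (f i \<longlongrightarrow> \<beta> i) F"
    "\<And>t i. t \<in> U \<Longrightarrow> i < n \<Longrightarrow> f i t \<in> span ((\<lambda>j. b j t) ` {..<n})"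
    "\<And>t i j. t \<in> U \<Longrightarrow> i < n \<Longrightarrow> j < n \<Longrightarrow> G t (f i t) (f j t) = (if i = j then 1 else 0)"
    by simp_all
  define w where "w t = b n t - (\<Sum>j<n. G t (b n t) (f j t) *\<^sub>R f j t)" for t
  define c where "c t = G t (w t) (w t)" for t
  have wsm: "Cinf_on U w"
    unfolding w_def by (intro Cinf_diff Cinf_sum Cinf_scaleR Gsm bsm f(1) U) auto
  have sp: "(\<Sum>j<n. G t (b n t) (f j t) *\<^sub>R f j t) \<in> span ((\<lambda>j. b j t) ` {..<n})" if "t \<in> U" for t
    using f(3)[OF that] by (intro span_sum span_scale) auto
  have mono: "span ((\<lambda>j. b j t) ` {..<n}) \<subseteq> span ((\<lambda>j. b j t) ` {..<Suc n})" for t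
    by (intro span_mono) auto
  have wsp: "w t \<in> span ((\<lambda>j. b j t) ` {..<Suc n})" if "t \<in> U" for t
    unfolding w_def by (rule span_diff[OF span_base subsetD[OF mono sp[OF that]]]) auto
  have w0: "w t \<noteq> 0" if "t \<in> U" for t
    using ind[OF that, of n] sp[OF that] Suc.prems by (auto simp: w_def)
  have cpos: "0 < c t" if "t \<in> U" for t
  proof -
    have "span ((\<lambda>j. b j t) ` {..<Suc n}) \<subseteq> span ((\<lambda>j. b j t) ` {..<N})"
      using Suc.prems by (intro span_mono) auto
    then show ?thesis unfolding c_def using pos[OF that] wsp[OF that] w0[OF that] by blast
  qed
  have wlim: "(w \<longlongrightarrow> \<beta> n) F"
  proof -
    have "(w \<longlongrightarrow> \<beta> n - (\<Sum>j<n. G' (\<beta> n) (\<beta> j) *\<^sub>R \<beta> j)) F"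
      unfolding w_def by (intro tendsto_diff tendsto_sum tendsto_scaleR Glim blim f(2)) auto
    moreover have "(\<Sum>j<n. G' (\<beta> n) (\<beta> j) *\<^sub>R \<beta> j) = 0"
      using on Suc.prems by (intro sum.neutral) auto
    ultimately show ?thesis by simp
  qed
  have clim: "(c \<longlongrightarrow> 1) F"
    using Glim[OF wlim wlim] on[of n n] Suc.prems unfolding c_def by simp
  define g where "g = f(n := (\<lambda>t. (c t powr (- 1 / 2)) *\<^sub>R w t))"
  have gn: "g n = (\<lambda>t. (c t powr (- 1 / 2)) *\<^sub>R w t)" by (simp add: g_def)
  have gi: "g i = f i" if "i < n" for i using that by (simp add: g_def)
  have orth: "G t (w t) (f i t) = 0" if "t \<in> U" "i < n" for t i
  proof -
    have "G t (\<Sum>j<n. G t (b n t) (f j t) *\<^sub>R f j t) (f i t) = (\<Sum>j<n. if j = i then G t (b n t) (f i t) else 0)"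
      unfolding sym_form_sum(1)[OF G] using f(4)[OF that(1)] that(2)
      by (intro sum.cong) (auto simp: sym_form_simps[OF G])
    then show ?thesis unfolding w_def using that(2) by (simp add: sym_form_simps[OF G])
  qed
  have cc: "c t powr (- 1 / 2) * (c t powr (- 1 / 2) * c t) = 1" if "t \<in> U" for t
  proof -
    have "c t powr (- 1 / 2) * c t powr (- 1 / 2) = c t powr (- 1)" by (simp flip: powr_add)
    then show ?thesis using cpos[OF that] by (simp add: powr_minus_divide mult.assoc[symmetric])
  qed
  show ?case
  proof (intro exI[of _ g] conjI allI ballI impI)
    fix i assume "i < Suc n"
    then consider "i < n" | "i = n" by linarith
    then show "Cinf_on U (g i)"
    proof cases
      case 2
      have "Cinf_on U c" unfolding c_def by (intro Gsm wsm)
      then show ?thesis unfolding 2 gn by (intro Cinf_scaleR Cinf_powr_comp wsm U cpos)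
    qed (simp add: gi f(1))
    from \<open>i < Suc n\<close> consider "i < n" | "i = n" by linarith
    then show "(g i \<longlongrightarrow> \<beta> i) F"
    proof cases
      case 2
      have "((\<lambda>t. (c t powr (- 1 / 2)) *\<^sub>R w t) \<longlongrightarrow> (1 powr (- 1 / 2)) *\<^sub>R \<beta> n) F"
        by (intro tendsto_scaleR tendsto_powr clim wlim tendsto_const) simp
      then show ?thesis unfolding 2 gn by simp
    qed (simp add: gi f(2))
  next
    fix t i assume t: "t \<in> U" and "i < Suc n"
    then consider "i < n" | "i = n" by linarith
    then show "g i t \<in> span ((\<lambda>j. b j t) ` {..<Suc n})"
    proof cases
      case 1
      then show ?thesis using f(3)[OF t 1] mono by (auto simp: gi)
    next
      case 2
      then show ?thesis using wsp[OF t] by (simp add: gn span_scale)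
    qed
    fix j assume "j < Suc n"
    have s: "G t (f k t) (w t) = 0" if "k < n" for k
      using orth[OF t that] sym_form_commute[OF G, of t "w t" "f k t"] by simp
    show "G t (g i t) (g j t) = (if i = j then 1 else 0)"
      using \<open>i < Suc n\<close> \<open>j < Suc n\<close> f(4)[OF t] orth[OF t] s cc[OF t]
      by (cases "i < n"; cases "j < n")
         (auto simp: gi gn less_Suc_eq sym_form_simps[OF G] c_def[symmetric])
  qed
qed simp

section \<open>Standard frames\<close>

text \<open>The form T (M a) (M b) (M (1, 0)) is the nondegenerate Lorentz product of std3_bilinear.\<close>
lemma std3_inj:
  fixes M :: "real \<times> 'b::euclidean_space \<Rightarrow> real \<times> 'b"
  assumes "linear M" "std3 (\<lambda>a b c. T (M a) (M b) (M c))" "sym3 T"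
  shows "inj M"
  unfolding linear_injective_0[OF assms(1)]
proof (intro allI impI)
  fix p assume p: "M p = 0"
  obtain x y where xy: "p = (x, y)" by (cases p)
  have "x * x' - (y \<bullet> y') / 3 = 0" for x' y'
    using std3_bilinear[OF assms(2), of x y x' y'] p xy by (simp add: sym3_simps[OF assms(3)])
  from this[of 1 0] this[of 0 y] have "x = 0" "y \<bullet> y = 0" by simp_all
  then show "p = 0" using xy by (simp add: zero_prod_def)
qed

definition rank_one :: "('a::real_normed_vector \<Rightarrow>\<^sub>L real) \<Rightarrow> 'b::real_normed_vector \<Rightarrow> ('a \<Rightarrow>\<^sub>L 'b)" where
  "rank_one \<phi> c = blinfun_scaleR_left c o\<^sub>L \<phi>"

lemma rank_one_apply: "blinfun_apply (rank_one \<phi> c) x = blinfun_apply \<phi> x *\<^sub>R c"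
  by (simp add: rank_one_def)

lemma bounded_linear_rank_one: "bounded_linear (rank_one \<phi>)"
  unfolding rank_one_def
  by (rule bounded_linear_compose[OF bounded_bilinear.bounded_linear_left[OF bounded_bilinear_blinfun_compose]
        bounded_linear_blinfun_scaleR_left])

text \<open>The linear map with (1, 0) \<mapsto> p and (0, i) \<mapsto> f i for basis vectors i.\<close>
definition frame_map :: "(real \<times> 'b::euclidean_space) \<Rightarrow> ('b \<Rightarrow> real \<times> 'b) \<Rightarrow> ((real \<times> 'b) \<Rightarrow>\<^sub>L (real \<times> 'b))" where
  "frame_map p f = rank_one (Blinfun fst) p + (\<Sum>i\<in>Basis. rank_one (Blinfun (\<lambda>q. snd q \<bullet> i)) (f i))"

lemma frame_map_apply: "blinfun_apply (frame_map p f) (x, y) = x *\<^sub>R p + (\<Sum>i\<in>Basis. (y \<bullet> i) *\<^sub>R f i)"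
proof -
  have "bounded_linear (\<lambda>q::real \<times> 'a. snd q \<bullet> i)" for i
    by (intro bounded_linear_inner_left_comp bounded_linear_snd)
  then show ?thesis
    unfolding frame_map_def
    by (simp add: blinfun.bilinear_simps rank_one_apply bounded_linear_Blinfun_apply bounded_linear_fst)
qed

lemma frame_map_Cinf:
  assumes "open U" "Cinf_on U p" "\<And>i. i \<in> Basis \<Longrightarrow> Cinf_on U (f i)"
  shows "Cinf_on U (\<lambda>t. frame_map (p t) (\<lambda>i. f i t))"
proof -
  note r = Cinf_linear_comp[OF assms(1) bounded_linear_rank_one]
  show ?thesis unfolding frame_map_def
    by (rule Cinf_add[OF assms(1) r[OF assms(2)] Cinf_sum[OF assms(1) r[OF assms(3)]]])
qed

lemma frame_map_std3:
  fixes T :: "real \<times> 'b::euclidean_space \<Rightarrow> real \<times> 'b \<Rightarrow> real \<times> 'b \<Rightarrow> real"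
  assumes T: "sym3 T" and p: "T p p p = 1" and f: "\<And>i. i \<in> Basis \<Longrightarrow> T p p (f i) = 0"
    and on: "\<And>i j. i \<in> Basis \<Longrightarrow> j \<in> Basis \<Longrightarrow> - 3 * T p (f i) (f j) = (if i = j then 1 else 0)"
  shows "std3 (\<lambda>a b c. T (blinfun_apply (frame_map p f) a) (blinfun_apply (frame_map p f) b) (blinfun_apply (frame_map p f) c))"
  unfolding std3_def
proof (intro conjI allI)
  show "sym3 (\<lambda>a b c. T (blinfun_apply (frame_map p f) a) (blinfun_apply (frame_map p f) b) (blinfun_apply (frame_map p f) c))"
    by (rule sym3_compose[OF T]) (simp add: bounded_linear.linear blinfun.bounded_linear_right)
  have e: "blinfun_apply (frame_map p f) (1, 0) = p" "blinfun_apply (frame_map p f) (0, y) = (\<Sum>i\<in>Basis. (y \<bullet> i) *\<^sub>R f i)" for y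
    by (simp_all add: frame_map_apply)
  show "T (blinfun_apply (frame_map p f) (1, 0)) (blinfun_apply (frame_map p f) (1, 0)) (blinfun_apply (frame_map p f) (1, 0)) = 1"
    by (simp add: e p)
  show "T (blinfun_apply (frame_map p f) (1, 0)) (blinfun_apply (frame_map p f) (1, 0)) (blinfun_apply (frame_map p f) (0, y)) = 0" for y
    unfolding e by (simp add: sym3_sum[OF T] sym3_simps[OF T] f)
  show "T (blinfun_apply (frame_map p f) (1, 0)) (blinfun_apply (frame_map p f) (0, y)) (blinfun_apply (frame_map p f) (0, z)) = - (y \<bullet> z) / 3" for y z
  proof -
    have "T p (\<Sum>i\<in>Basis. (y \<bullet> i) *\<^sub>R f i) (\<Sum>i\<in>Basis. (z \<bullet> i) *\<^sub>R f i) =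
        (\<Sum>i\<in>Basis. \<Sum>j\<in>Basis. (y \<bullet> i) * ((z \<bullet> j) * T p (f i) (f j)))"
      apply (subst sym3_sum(2)[OF T])
      apply (rule sum.cong[OF refl])
      apply (subst sym3_sum(3)[OF T])
      apply (rule sum.cong[OF refl])
      apply (simp add: sym3_simps[OF T])
      done
    also have "\<dots> = (\<Sum>i\<in>Basis. \<Sum>j\<in>Basis. if j = i then (y \<bullet> i) * (z \<bullet> i) * (- 1 / 3) else 0)"
    proof (intro sum.cong refl)
      fix i j :: 'b assume ij: "i \<in> Basis" "j \<in> Basis"
      have "T p (f i) (f j) = (if i = j then - 1 / 3 else 0)" using on[OF ij] by (auto split: if_splits)
      then show "(y \<bullet> i) * ((z \<bullet> j) * T p (f i) (f j)) = (if j = i then (y \<bullet> i) * (z \<bullet> i) * (- 1 / 3) else 0)"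
        by auto
    qed
    also have "\<dots> = (\<Sum>i\<in>Basis. (y \<bullet> i) * (z \<bullet> i) * (- 1 / 3))" by simp
    also have "\<dots> = - (y \<bullet> z) / 3"
      unfolding euclidean_inner[of y z] by (simp add: sum_negf sum_divide_distrib)
    finally show ?thesis unfolding e .
  qed
qed

text \<open>Points p t with h = 1 converging to (1, 0), for cubics converging to a standard one, have frames
  that bring the cubics into standard form and converge to the identity. Project the standard basis to the
  tangent hyperplane at p t and orthonormalize it for - 3 * T t (p t), which is positive definite there by
  hyperbolicity; in the limit the projected basis is orthonormal already.\<close>
theorem frame_family:
  fixes T :: "real \<Rightarrow> real \<times> 'b::euclidean_space \<Rightarrow> real \<times> 'b \<Rightarrow> real \<times> 'b \<Rightarrow> real"
    and p :: "real \<Rightarrow> real \<times> 'b"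
  assumes U: "open U" and T: "\<And>t. sym3 (T t)"
    and Tsm: "\<And>i j k. i \<in> Basis \<Longrightarrow> j \<in> Basis \<Longrightarrow> k \<in> Basis \<Longrightarrow> Cinf_on U (\<lambda>t. T t i j k)"
    and psm: "Cinf_on U p"
    and one: "\<And>t. t \<in> U \<Longrightarrow> T t (p t) (p t) (p t) = 1" and hyp: "\<And>t. t \<in> U \<Longrightarrow> hyp (T t) (p t)"
    and fst: "\<And>t. t \<in> U \<Longrightarrow> fst (p t) \<noteq> 0"
    and T': "std3 T'" and Tlim: "\<And>i j k. i \<in> Basis \<Longrightarrow> j \<in> Basis \<Longrightarrow> k \<in> Basis \<Longrightarrow> ((\<lambda>t. T t i j k) \<longlongrightarrow> T' i j k) F"
    and plim: "(p \<longlongrightarrow> (1, 0)) F"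
  obtains f where "\<And>i. i \<in> Basis \<Longrightarrow> Cinf_on U (f i)" "\<And>i. i \<in> Basis \<Longrightarrow> (f i \<longlongrightarrow> (0, i)) F"
    "\<And>t. t \<in> U \<Longrightarrow> std3 (\<lambda>a b c. T t (blinfun_apply (frame_map (p t) (\<lambda>i. f i t)) a)
        (blinfun_apply (frame_map (p t) (\<lambda>i. f i t)) b) (blinfun_apply (frame_map (p t) (\<lambda>i. f i t)) c))"
proof -
  note s' = std3_sym3[OF T']
  define N where "N = card (Basis :: 'b set)"
  obtain e :: "nat \<Rightarrow> 'b" where e: "bij_betw e {0..<N} Basis"
    using ex_bij_betw_nat_finite[of "Basis :: 'b set"] by (auto simp: N_def)
  have eB: "e i \<in> Basis" if "i < N" for i using e that by (auto simp: bij_betw_def)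
  have einj: "e i = e j \<longleftrightarrow> i = j" if "i < N" "j < N" for i j
    using e that by (auto simp: bij_betw_def inj_on_def)
  define \<beta> where "\<beta> i = (0::real, e i)" for i
  define b where "b i t = \<beta> i - T t (p t) (p t) (\<beta> i) *\<^sub>R p t" for i t
  define G where "G = (\<lambda>t x y. - 3 * T t (p t) x y)"
  define G' where "G' x y = - 3 * T' (1, 0) x y" for x y
  have G: "sym_form (G t)" for t unfolding G_def by (rule sym_form_sym3[OF T])
  have Gsm: "Cinf_on U (\<lambda>t. G t (x t) (y t))" if "Cinf_on U x" "Cinf_on U y" for x y
    unfolding G_def by (rule Cinf_mult[OF U Cinf_const[OF U] sym3_Cinf_family[where T = T, OF U T Tsm psm that]])
  have Glim: "((\<lambda>t. G t (x t) (y t)) \<longlongrightarrow> G' x' y') F" if "(x \<longlongrightarrow> x') F" "(y \<longlongrightarrow> y') F" for x y x' y'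
    unfolding G_def G'_def
    by (rule tendsto_mult[OF tendsto_const sym3_tendsto[where T = T, OF T s' Tlim plim that]])
  have bsm: "Cinf_on U (b i)" for i
    unfolding b_def
    by (rule Cinf_diff[OF U Cinf_const[OF U] Cinf_scaleR[OF U
          sym3_Cinf_family[where T = T, OF U T Tsm psm psm Cinf_const[OF U]] psm]])
  have blim: "(b i \<longlongrightarrow> \<beta> i) F" for i
  proof -
    have "(b i \<longlongrightarrow> \<beta> i - T' (1, 0) (1, 0) (\<beta> i) *\<^sub>R (1, 0)) F"
      unfolding b_def
      by (rule tendsto_diff[OF tendsto_const tendsto_scaleR[OF
            sym3_tendsto[where T = T, OF T s' Tlim plim plim tendsto_const] plim]])
    then show ?thesis using T' by (simp add: std3_def \<beta>_def)
  qed
  have on: "G' (\<beta> i) (\<beta> j) = (if i = j then 1 else 0)" if "i < N" "j < N" for i j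
    using T' eB[OF that(1)] eB[OF that(2)] einj[OF that]
    by (simp add: G'_def \<beta>_def std3_def inner_Basis)
  have kerb: "T t (p t) (p t) x = 0" if t: "t \<in> U" and x: "x \<in> span ((\<lambda>j. b j t) ` {..<N})" for t x
    using x
  proof (induction rule: span_induct_alt)
    case base
    then show ?case by (simp add: sym3_simps[OF T])
  next
    case (step c x y)
    then show ?case using one[OF t] by (auto simp: b_def sym3_simps[OF T])
  qed
  have pos: "0 < G t x x" if "t \<in> U" "x \<in> span ((\<lambda>j. b j t) ` {..<N})" "x \<noteq> 0" for t x
    using hyp[OF that(1)] kerb[OF that(1,2)] that(3) unfolding hyp_def G_def by (metis mult_neg_neg neg_less_0_iff_less zero_less_numeral)
  have ind: "b i t \<notin> span ((\<lambda>j. b j t) ` {..<i})" if t: "t \<in> U" and i: "i < N" for t i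
  proof
    assume asm: "b i t \<in> span ((\<lambda>j. b j t) ` {..<i})"
    define \<pi> where "\<pi> z = (z - (fst z / fst (p t)) *\<^sub>R p t) \<bullet> (0, e i)" for z
    have \<pi>: "linear \<pi>"
      by (simp add: \<pi>_def linear_iff inner_simps algebra_simps add_divide_distrib)
    have val: "\<pi> (b j t) = e j \<bullet> e i" for j
      using fst[OF t] by (simp add: \<pi>_def b_def \<beta>_def inner_simps diff_divide_distrib)
    have "\<pi> x = 0" if "x \<in> span ((\<lambda>j. b j t) ` {..<i})" for x
      using that
    proof (induction rule: span_induct_alt)
      case base
      then show ?case using linear_0[OF \<pi>] by simp
    next
      case (step c x y)
      then obtain j where j: "j < i" "x = b j t" by auto
      have "e j \<bullet> e i = 0" using eB[of j] eB[of i] einj[of j i] i j by (simp add: inner_Basis)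
      then show ?case using step by (simp add: linear_add[OF \<pi>] linear_scale[OF \<pi>] j val)
    qed
    from this[OF asm] show False using val[of i] eB[OF i] by simp
  qed
  obtain g where "(\<forall>i<N. Cinf_on U (g i) \<and> (g i \<longlongrightarrow> \<beta> i) F) \<and>
     (\<forall>t\<in>U. (\<forall>i<N. g i t \<in> span ((\<lambda>j. b j t) ` {..<N})) \<and>
        (\<forall>i<N. \<forall>j<N. G t (g i t) (g j t) = (if i = j then 1 else 0)))"
    using exE[OF gram_schmidt_family[where G = G and G' = G' and b = b and \<beta> = \<beta> and U = U and F = F and N = N and n = N,
       OF U G Gsm Glim bsm blim on pos ind order_refl]] by blast
  then have g: "\<And>i. i < N \<Longrightarrow> Cinf_on U (g i)" "\<And>i. i < N \<Longrightarrow> (g i \<longlongrightarrow> \<beta> i) F"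
    "\<And>t i. t \<in> U \<Longrightarrow> i < N \<Longrightarrow> g i t \<in> span ((\<lambda>j. b j t) ` {..<N})"
    "\<And>t i j. t \<in> U \<Longrightarrow> i < N \<Longrightarrow> j < N \<Longrightarrow> G t (g i t) (g j t) = (if i = j then 1 else 0)"
    by simp_all
  define d where "d = the_inv_into {0..<N} e"
  have d: "d i < N" "e (d i) = i" if "i \<in> Basis" for i
    using e that the_inv_into_into[of e "{0..<N}" i "{0..<N}"] f_the_inv_into_f[of e "{0..<N}" i]
    by (auto simp: d_def bij_betw_def)
  show thesis
  proof (rule that[of "\<lambda>i. g (d i)"])
    fix i :: 'b assume i: "i \<in> Basis"
    show "Cinf_on U (g (d i))" using g(1) d(1)[OF i] .
    show "(g (d i) \<longlongrightarrow> (0, i)) F" using g(2)[OF d(1)[OF i]] d(2)[OF i] by (simp add: \<beta>_def)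
  next
    fix t assume t: "t \<in> U"
    show "std3 (\<lambda>a b c. T t (blinfun_apply (frame_map (p t) (\<lambda>i. g (d i) t)) a)
        (blinfun_apply (frame_map (p t) (\<lambda>i. g (d i) t)) b) (blinfun_apply (frame_map (p t) (\<lambda>i. g (d i) t)) c))"
    proof (rule frame_map_std3[OF T one[OF t]])
      fix i :: 'b assume i: "i \<in> Basis"
      show "T t (p t) (p t) (g (d i) t) = 0" using kerb[OF t g(3)[OF t d(1)[OF i]]] .
      fix j :: 'b assume j: "j \<in> Basis"
      have "d i = d j \<longleftrightarrow> i = j" using d(2)[OF i] d(2)[OF j] by metis
      then show "- 3 * T t (p t) (g (d i) t) (g (d j) t) = (if i = j then 1 else 0)"
        using g(4)[OF t d(1)[OF i] d(1)[OF j]] unfolding G_def by simp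
    qed
  qed
qed

lemma frame_at_point:
  fixes T :: "real \<times> 'b::euclidean_space \<Rightarrow> real \<times> 'b \<Rightarrow> real \<times> 'b \<Rightarrow> real"
  assumes T: "std3 T" and p: "T p p p = 1" "hyp T p" "fst p \<noteq> 0"
  obtains A where "A \<in> GL" "blinfun_apply A (1, 0) = p"
    "std3 (\<lambda>a b c. T (blinfun_apply A a) (blinfun_apply A b) (blinfun_apply A c))"
proof -
  note s = std3_sym3[OF T]
  obtain f :: "'b \<Rightarrow> real \<Rightarrow> real \<times> 'b" where f: "\<And>t. t \<in> UNIV \<Longrightarrow> std3 (\<lambda>a b c. T (blinfun_apply (frame_map p (\<lambda>i. f i t)) a)
        (blinfun_apply (frame_map p (\<lambda>i. f i t)) b) (blinfun_apply (frame_map p (\<lambda>i. f i t)) c))"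
  \<comment> \<open>A constant family; for the trivial filter the convergence requirements are void.\<close>
  proof (rule frame_family[where T = "\<lambda>_. T" and p = "\<lambda>_. p" and U = UNIV and F = bot and T' = T])
    fix f :: "'b \<Rightarrow> real \<Rightarrow> real \<times> 'b"
    assume "\<And>t. t \<in> UNIV \<Longrightarrow> std3 (\<lambda>a b c. T (blinfun_apply (frame_map p (\<lambda>i. f i t)) a)
        (blinfun_apply (frame_map p (\<lambda>i. f i t)) b) (blinfun_apply (frame_map p (\<lambda>i. f i t)) c))"
    then show thesis by (rule that)
  qed (use s p T in \<open>simp_all add: Cinf_const\<close>)
  define A where "A = frame_map p (\<lambda>i. f i 0)"
  have A: "std3 (\<lambda>a b c. T (blinfun_apply A a) (blinfun_apply A b) (blinfun_apply A c))"
    unfolding A_def using f[of 0] by simp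
  have "linear (blinfun_apply A)" by (simp add: bounded_linear.linear blinfun.bounded_linear_right)
  then have "A \<in> GL" using linear_inj_imp_surj std3_inj[OF _ A s] by (auto simp: GL_def bij_def)
  moreover have "blinfun_apply A (1, 0) = p" by (simp add: A_def frame_map_apply)
  ultimately show thesis using that A by blast
qed

section \<open>Uniqueness of limit polynomials\<close>

text \<open>The scalar product on the tangent hyperplane at (1, 0) is - 3 * T (1, 0), which M preserves.\<close>
lemma std3_isometry:
  fixes M :: "real \<times> 'b::euclidean_space \<Rightarrow> real \<times> 'b"
  assumes M: "linear M" "M (1, 0) = (1, 0)" and T: "std3 T" "std3 (\<lambda>a b c. T (M a) (M b) (M c))"
  shows "norm (M z) = norm z"
proof -
  obtain x y where z: "z = (x, y)" by (cases z)
  have e: "T (M (0, y)) (M (0, y')) (1, 0) = - (y \<bullet> y') / 3" "T (M (0, y)) (1, 0) (1, 0) = 0" for y'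
    using std3_bilinear[OF T(2), of 0 y 0 y'] std3_bilinear[OF T(2), of 0 y 1 0] M(2) by simp_all
  obtain x1 y1 where m: "M (0, y) = (x1, y1)" by (cases "M (0, y)")
  have "x1 = 0" using e(2) std3_bilinear[OF T(1), of x1 y1 1 0] by (simp add: m)
  moreover have "y1 \<bullet> y1 = y \<bullet> y"
    using e(1)[of y] std3_bilinear[OF T(1), of x1 y1 x1 y1] \<open>x1 = 0\<close> by (simp add: m)
  moreover have "M z = x *\<^sub>R M (1, 0) + M (0, y)"
    unfolding z by (simp flip: linear_scale[OF M(1)] linear_add[OF M(1)])
  ultimately show ?thesis by (simp add: z m M(2) norm_Pair norm_eq_sqrt_inner)
qed

text \<open>Two standard frames along the same curve differ by linear isometries K t that fix (1, 0). By
  compactness these have a limit point k, and k carries one limit polynomial to the other.\<close>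
theorem limit_polynomial_unique:
  fixes h :: "real \<times> 'b::euclidean_space \<Rightarrow> real"
  assumes h: "cubic_form h" and l: "limit_polynomial h p v hb" "limit_polynomial h p v hb'"
  shows "std_equivalent hb' hb"
proof -
  obtain H where H: "sym3 H" "h = (\<lambda>x. H x x x)" using cubic_form_sym3[OF h] by blast
  obtain R A where R: "smallest_positive_zero h p v R" and A: "standard_frame h p v R A" "cubic_form hb"
    "uniform_limit (cball 0 1) (\<lambda>t. h \<circ> blinfun_apply (A t)) hb (at_left R)"
    using l(1) unfolding limit_polynomial_def by blast
  obtain R' A' where R': "smallest_positive_zero h p v R'" and A': "standard_frame h p v R' A'" "cubic_form hb'"
    "uniform_limit (cball 0 1) (\<lambda>t. h \<circ> blinfun_apply (A' t)) hb' (at_left R')"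
    using l(2) unfolding limit_polynomial_def by blast
  have R0: "0 < R" using R by (simp add: smallest_positive_zero_def)
  have RR: "R' = R"
    using R R' unfolding smallest_positive_zero_def by (metis linorder_neqE)
  have "\<exists>K. \<forall>t\<in>{0..<R}. (\<forall>z. blinfun_apply (A t) (blinfun_apply (K t) z) = blinfun_apply (A' t) z) \<and>
       blinfun_apply (K t) (1, 0) = (1, 0) \<and> (\<forall>z. norm (blinfun_apply (K t) z) = norm z)"
  proof (rule bchoice, rule ballI)
    fix t assume t: "t \<in> {0..<R}"
    have At: "A t \<in> GL" "blinfun_apply (A t) (1, 0) = limit_curve h p v t"
      and "\<exists>P. cubic_form P \<and> h \<circ> blinfun_apply (A t) = standard_cubic P"
      using A(1) t by (auto simp: standard_frame_def)
    then obtain T where T: "std3 T" "h \<circ> blinfun_apply (A t) = (\<lambda>x. T x x x)" by (metis standard_cubic_std3)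
    have At': "A' t \<in> GL" "blinfun_apply (A' t) (1, 0) = limit_curve h p v t"
      and "\<exists>P. cubic_form P \<and> h \<circ> blinfun_apply (A' t) = standard_cubic P"
      using A'(1) t RR by (auto simp: standard_frame_def)
    then obtain T' where T': "std3 T'" "h \<circ> blinfun_apply (A' t) = (\<lambda>x. T' x x x)" by (metis standard_cubic_std3)
    obtain K where K: "K \<in> GL" "\<And>x. blinfun_apply K (blinfun_apply (A t) x) = x" "\<And>x. blinfun_apply (A t) (blinfun_apply K x) = x"
      using blinfun_GL_inverse[OF At(1)] by blast
    define M where "M = K o\<^sub>L A' t"
    have lin: "linear (blinfun_apply M)" by (simp add: bounded_linear.linear blinfun.bounded_linear_right)
    have AM: "blinfun_apply (A t) (blinfun_apply M z) = blinfun_apply (A' t) z" for z by (simp add: M_def K(3))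
    have "blinfun_apply (A' t) (1, 0) = blinfun_apply (A t) (1, 0)" using At At' by simp
    then have M1: "blinfun_apply M (1, 0) = (1, 0)" by (simp add: M_def K(2))
    have "(\<lambda>a b c. T (blinfun_apply M a) (blinfun_apply M b) (blinfun_apply M c)) = T'"
    proof (rule sym3_eqI[OF sym3_compose[OF std3_sym3[OF T(1)] lin] std3_sym3[OF T'(1)]])
      fix x show "T (blinfun_apply M x) (blinfun_apply M x) (blinfun_apply M x) = T' x x x"
        using fun_cong[OF T(2), of "blinfun_apply M x"] fun_cong[OF T'(2), of x] AM[of x] by simp
    qed
    then have "norm (blinfun_apply M z) = norm z" for z
      using std3_isometry[OF lin M1 T(1)] T'(1) by simp
    then show "\<exists>K. (\<forall>z. blinfun_apply (A t) (blinfun_apply K z) = blinfun_apply (A' t) z) \<and>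
       blinfun_apply K (1, 0) = (1, 0) \<and> (\<forall>z. norm (blinfun_apply K z) = norm z)"
      using AM M1 by blast
  qed
  then obtain K where K: "\<And>t z. t \<in> {0..<R} \<Longrightarrow> blinfun_apply (A t) (blinfun_apply (K t) z) = blinfun_apply (A' t) z"
    "\<And>t. t \<in> {0..<R} \<Longrightarrow> blinfun_apply (K t) (1, 0) = (1, 0)"
    "\<And>t z. t \<in> {0..<R} \<Longrightarrow> norm (blinfun_apply (K t) z) = norm z" by blast
  \<comment> \<open>A sequence of parameters tending to R from below.\<close>
  define \<tau> where "\<tau> n = R - R / real (n + 2)" for n
  have \<tau>: "\<tau> n \<in> {0..<R}" for n using R0 by (simp add: \<tau>_def field_simps)
  have "\<tau> \<longlonglongrightarrow> R - 0"
    unfolding \<tau>_def by (intro tendsto_diff tendsto_const LIMSEQ_ignore_initial_segment lim_const_over_n)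
  then have \<tau>lim: "filterlim \<tau> (at_left R) sequentially"
    using \<tau> by (auto simp: filterlim_at eventually_sequentially)
  have "norm (K (\<tau> n)) \<le> 1" for n
    by (rule norm_blinfun_bound) (use K(3)[OF \<tau>] in auto)
  then have "bounded (range (\<lambda>n. K (\<tau> n)))" by (auto simp: bounded_iff)
  then obtain k :: "(real \<times> 'b) \<Rightarrow>\<^sub>L (real \<times> 'b)" and r :: "nat \<Rightarrow> nat"
    where r: "strict_mono r" "((\<lambda>n. K (\<tau> n)) \<circ> r) \<longlonglongrightarrow> k" using bounded_imp_convergent_subsequence by blast
  have klim: "(\<lambda>n. blinfun_apply (K (\<tau> (r n))) z) \<longlonglongrightarrow> blinfun_apply k z" for z
    using blinfun.tendsto[OF r(2) tendsto_const] by (simp add: o_def)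
  have k1: "blinfun_apply k (1, 0) = (1, 0)"
    using LIMSEQ_unique[OF klim[of "(1, 0)"]] K(2)[OF \<tau>] by simp
  have kn: "norm (blinfun_apply k z) = norm z" for z
    using LIMSEQ_unique[OF tendsto_norm[OF klim[of z]], of "norm z"] K(3)[OF \<tau>] by simp
  have klin: "linear (blinfun_apply k)" by (simp add: bounded_linear.linear blinfun.bounded_linear_right)
  have "inj (blinfun_apply k)" unfolding linear_injective_0[OF klin] using kn by (metis norm_eq_zero)
  then have kGL: "k \<in> GL" using linear_inj_imp_surj[OF klin] by (simp add: GL_def bij_def)
  have \<tau>r: "filterlim (\<lambda>n. \<tau> (r n)) (at_left R) sequentially"
    using filterlim_compose[OF \<tau>lim filterlim_subseq[OF r(1)]] .
  obtain B where B: "sym3 B" "hb = (\<lambda>x. B x x x)" using cubic_form_sym3[OF A(2)] by blast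
  have ball: "hb (blinfun_apply k z) = hb' z" if z: "norm z \<le> 1" for z
  proof -
    have "((\<lambda>t. h (blinfun_apply (A' t) z)) \<longlongrightarrow> hb' z) (at_left R)"
      using tendsto_uniform_limitI[OF A'(3), of z] z RR by (simp add: o_def)
    from filterlim_compose[OF this \<tau>r] have 1: "(\<lambda>n. h (blinfun_apply (A' (\<tau> (r n))) z)) \<longlonglongrightarrow> hb' z" .
    have ul: "uniform_limit (cball 0 1) (\<lambda>n. h \<circ> blinfun_apply (A (\<tau> (r n)))) hb sequentially"
      using filterlim_compose[OF A(3) \<tau>r] .
    have "(\<lambda>n. h (blinfun_apply (A (\<tau> (r n))) (blinfun_apply (K (\<tau> (r n))) z)) - hb (blinfun_apply (K (\<tau> (r n))) z)) \<longlonglongrightarrow> 0"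
    proof (rule tendstoI)
      fix e :: real assume "0 < e"
      have Kz: "blinfun_apply (K (\<tau> (r n))) z \<in> cball 0 1" for n using z K(3)[OF \<tau>] by simp
      from uniform_limitD[OF ul \<open>0 < e\<close>]
      show "\<forall>\<^sub>F n in sequentially. dist (h (blinfun_apply (A (\<tau> (r n))) (blinfun_apply (K (\<tau> (r n))) z))
          - hb (blinfun_apply (K (\<tau> (r n))) z)) 0 < e"
      proof (rule eventually_mono)
        fix n assume "\<forall>x\<in>cball 0 1. dist ((h \<circ> blinfun_apply (A (\<tau> (r n)))) x) (hb x) < e"
        from bspec[OF this Kz[of n]]
        show "dist (h (blinfun_apply (A (\<tau> (r n))) (blinfun_apply (K (\<tau> (r n))) z))
          - hb (blinfun_apply (K (\<tau> (r n))) z)) 0 < e" by (simp add: dist_real_def)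
      qed
    qed
    then have "(\<lambda>n. h (blinfun_apply (A' (\<tau> (r n))) z) - hb (blinfun_apply (K (\<tau> (r n))) z)) \<longlonglongrightarrow> 0"
      using K(1)[OF \<tau>] by simp
    moreover have "(\<lambda>n. hb (blinfun_apply (K (\<tau> (r n))) z)) \<longlonglongrightarrow> hb (blinfun_apply k z)"
      unfolding B(2) by (rule sym3_tendsto[where T = "\<lambda>_. B", OF B(1) B(1) tendsto_const klim klim klim])
    ultimately have "(\<lambda>n. h (blinfun_apply (A' (\<tau> (r n))) z)) \<longlonglongrightarrow> 0 + hb (blinfun_apply k z)"
      using tendsto_add by fastforce
    then show ?thesis using LIMSEQ_unique[OF 1] by simp
  qed
  have eq: "hb (blinfun_apply k z) = hb' z" for z
  proof (cases "z = 0")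
    case True
    then show ?thesis using ball[of z] by simp
  next
    case False
    define u where "u = (1 / norm z) *\<^sub>R z"
    have "norm u \<le> 1" "z = norm z *\<^sub>R u" using False by (simp_all add: u_def)
    moreover have "hb' (norm z *\<^sub>R u) = norm z ^ 3 * hb' u" "hb (norm z *\<^sub>R blinfun_apply k u) = norm z ^ 3 * hb (blinfun_apply k u)"
      using A(2) A'(2) unfolding cubic_form_def by blast+
    ultimately show ?thesis
      using ball[of u] by (metis blinfun.scaleR_right)
  qed
  have "hb (1, 0) = 1"
  proof -
    have "((\<lambda>t. h (blinfun_apply (A t) (1, 0))) \<longlongrightarrow> hb (1, 0)) (at_left R)"
      using tendsto_uniform_limitI[OF A(3), of "(1, 0)"] by (simp add: o_def norm_Pair)
    from filterlim_compose[OF this \<tau>lim] have "(\<lambda>n. h (blinfun_apply (A (\<tau> n)) (1, 0))) \<longlonglongrightarrow> hb (1, 0)" .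
    moreover have "h (blinfun_apply (A (\<tau> n)) (1, 0)) = 1" for n
    proof -
      obtain P where "cubic_form P" "h \<circ> blinfun_apply (A (\<tau> n)) = standard_cubic P"
        using A(1) \<tau>[of n] unfolding standard_frame_def by blast
      then have "h (blinfun_apply (A (\<tau> n)) (1, 0)) = standard_cubic P (1, 0)" by (metis comp_apply)
      moreover have "P 0 = 0" using \<open>cubic_form P\<close> unfolding cubic_form_def
        by (metis mult_zero_left power_zero_numeral scaleR_zero_left)
      ultimately show ?thesis by (simp add: standard_cubic_def)
    qed
    ultimately have "(\<lambda>n. 1) \<longlonglongrightarrow> hb (1, 0)" by simp
    from LIMSEQ_unique[OF this tendsto_const] show ?thesis .
  qed
  then have "blinfun_apply k (1, 0) \<in> std_component hb"
    by (simp add: k1 std_component_def connected_component_refl)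
  from std_equivalentI[OF kGL eq this] show ?thesis .
qed

section \<open>Degeneration along a grading\<close>

lemma hyp_scaleI:
  assumes "sym3 T" "0 < r" "hyp T q" shows "hyp T (r *\<^sub>R q)"
  using assms(2,3) unfolding hyp_def by (simp add: sym3_simps[OF assms(1)] zero_less_mult_iff mult_less_0_iff)

text \<open>The scaling of weights 2, - 4 and - 1 in l when m = 1 / l. Both parameters are kept, so that either
  end of the one-parameter group can be described by one of them tending to 0.\<close>
definition graded_sum where
  "graded_sum V2 V4 V1 l m z = l\<^sup>2 *\<^sub>R V2 z + m ^ 4 *\<^sub>R V4 z + m *\<^sub>R V1 z"

lemma graded_sum_linear:
  "linear V2 \<Longrightarrow> linear V4 \<Longrightarrow> linear V1 \<Longrightarrow> linear (graded_sum V2 V4 V1 l m)"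
  by (simp add: linear_iff graded_sum_def algebra_simps)

text \<open>In T composed with the scaling, every cubic monomial in V2, V4 and V1 is multiplied by a power of l
  given by its total weight. The weight-zero part is Tg; the alternative deg says that the monomials that would
  blow up vanish, so the composition converges to Tg. The scaling alone is not a standard frame, since it maps
  q t rather than (1, 0) to the curve. But q t converges to (1, 0), so frame_family supplies a correction that
  converges to the identity.\<close>
theorem degeneration_limit:
  fixes T Tg :: "real \<times> 'b::euclidean_space \<Rightarrow> real \<times> 'b \<Rightarrow> real \<times> 'b \<Rightarrow> real"
  assumes T: "sym3 T" and Tg: "std3 Tg" and V: "linear V2" "linear V4" "linear V1"
    and zero_part: "\<And>z. 3 * T (V2 z) (V2 z) (V4 z) + 3 * T (V2 z) (V1 z) (V1 z) = Tg z z z"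
    and deg: "((l \<longlongrightarrow> 0) (at_left R) \<and> (\<forall>z. T (V2 z) (V4 z) (V4 z) = 0 \<and> T (V2 z) (V4 z) (V1 z) = 0 \<and>
         T (V4 z) (V4 z) (V4 z) = 0 \<and> T (V4 z) (V4 z) (V1 z) = 0 \<and> T (V4 z) (V1 z) (V1 z) = 0 \<and> T (V1 z) (V1 z) (V1 z) = 0)) \<or>
       ((m \<longlongrightarrow> 0) (at_left R) \<and> (\<forall>z. T (V2 z) (V2 z) (V2 z) = 0 \<and> T (V2 z) (V2 z) (V1 z) = 0))"
    and U: "open U" "{0..<R} \<subseteq> U"
    and sm: "Cinf_on U l" "Cinf_on U m" "Cinf_on U q" and lm: "\<And>t. l t * m t = (1::real)"
    and inj: "\<And>t. t \<in> U \<Longrightarrow> inj (graded_sum V2 V4 V1 (l t) (m t))"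
    and hyp: "\<And>t. t \<in> U \<Longrightarrow> hyp T (p + t *\<^sub>R v)"
    and q: "\<And>t. t \<in> U \<Longrightarrow> fst (q t) \<noteq> 0" "(q \<longlongrightarrow> (1, 0)) (at_left R)"
      "\<And>t. t \<in> U \<Longrightarrow> graded_sum V2 V4 V1 (l t) (m t) (q t) = limit_curve (\<lambda>z. T z z z) p v t"
    and R: "smallest_positive_zero (\<lambda>z. T z z z) p v R"
  shows "limit_polynomial (\<lambda>z. T z z z) p v (\<lambda>z. Tg z z z)"
proof -
  define M where "M t = graded_sum V2 V4 V1 (l t) (m t)" for t
  have Ml: "linear (M t)" for t unfolding M_def by (rule graded_sum_linear[OF V])
  define K where "K t = (\<lambda>a b c. T (M t a) (M t b) (M t c))" for t
  have K: "sym3 (K t)" for t unfolding K_def by (rule sym3_compose[OF T Ml])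
  note g = std3_sym3[OF Tg]
  define w where "w t = T (p + t *\<^sub>R v) (p + t *\<^sub>R v) (p + t *\<^sub>R v) powr (- 1 / 3)" for t
  have pos: "0 < T (p + t *\<^sub>R v) (p + t *\<^sub>R v) (p + t *\<^sub>R v)" if "t \<in> U" for t
    using hyp[OF that] by (simp add: hyp_def)
  have Mq: "M t (q t) = w t *\<^sub>R (p + t *\<^sub>R v)" if "t \<in> U" for t
    using q(3)[OF that] unfolding M_def limit_curve_def w_def .
  have w0: "0 < w t" if "t \<in> U" for t using pos[OF that] by (simp add: w_def)
  have one: "K t (q t) (q t) (q t) = 1" if "t \<in> U" for t
  proof -
    have "T (c *\<^sub>R z) (c *\<^sub>R z) (c *\<^sub>R z) = c ^ 3 * T z z z" for c z
      by (simp add: sym3_simps[OF T] power3_eq_cube)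
    then show ?thesis
      using powr_cube_root[OF pos[OF that]] unfolding K_def Mq[OF that] by (simp only: w_def)
  qed
  have Khyp: "hyp (K t) (q t)" if "t \<in> U" for t
    unfolding hyp_def
  proof (intro conjI allI impI)
    show "0 < K t (q t) (q t) (q t)" using one[OF that] by simp
    fix a assume a: "a \<noteq> 0" "K t (q t) (q t) a = 0"
    have "M t a \<noteq> 0" using inj[OF that] a(1) linear_injective_0[OF Ml[of t]] unfolding M_def by blast
    then show "K t (q t) a a < 0"
      using hyp_scaleI[OF T w0[OF that] hyp[OF that]] a(2) unfolding K_def Mq[OF that] hyp_def by blast
  qed
  have expand: "K t z z z = l t ^ 6 * T (V2 z) (V2 z) (V2 z) + 3 * (l t * m t) ^ 4 * T (V2 z) (V2 z) (V4 z)
      + 3 * (l t ^ 4 * m t) * T (V2 z) (V2 z) (V1 z) + 3 * (l t ^ 2 * m t ^ 8) * T (V2 z) (V4 z) (V4 z)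
      + 6 * (l t ^ 2 * m t ^ 5) * T (V2 z) (V4 z) (V1 z) + 3 * (l t * m t) ^ 2 * T (V2 z) (V1 z) (V1 z)
      + m t ^ 12 * T (V4 z) (V4 z) (V4 z) + 3 * m t ^ 9 * T (V4 z) (V4 z) (V1 z)
      + 3 * m t ^ 6 * T (V4 z) (V1 z) (V1 z) + m t ^ 3 * T (V1 z) (V1 z) (V1 z)" for t z
  proof -
    show ?thesis
      unfolding K_def M_def graded_sum_def sym3_simps[OF T]
      by (simp add: power2_eq_square power_numeral_reduce algebra_simps sym3_commute[OF T])
  qed
  have Kcub: "((\<lambda>t. K t z z z) \<longlongrightarrow> Tg z z z) (at_left R)" for z
    using deg
  proof
    assume d: "(l \<longlongrightarrow> 0) (at_left R) \<and> (\<forall>z. T (V2 z) (V4 z) (V4 z) = 0 \<and> T (V2 z) (V4 z) (V1 z) = 0 \<and>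
         T (V4 z) (V4 z) (V4 z) = 0 \<and> T (V4 z) (V4 z) (V1 z) = 0 \<and> T (V4 z) (V1 z) (V1 z) = 0 \<and> T (V1 z) (V1 z) (V1 z) = 0)"
    then have d0: "T (V2 z) (V4 z) (V4 z) = 0" "T (V2 z) (V4 z) (V1 z) = 0" "T (V4 z) (V4 z) (V4 z) = 0"
      "T (V4 z) (V4 z) (V1 z) = 0" "T (V4 z) (V1 z) (V1 z) = 0" "T (V1 z) (V1 z) (V1 z) = 0" by blast+
    have "K t z z z = l t ^ 6 * T (V2 z) (V2 z) (V2 z) + 3 * (l t ^ 3 * (l t * m t)) * T (V2 z) (V2 z) (V1 z) + Tg z z z" for t
      unfolding expand zero_part[symmetric] lm d0
      by (simp add: lm) (simp add: power_numeral_reduce mult.assoc lm)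
    then have e: "K t z z z = l t ^ 6 * T (V2 z) (V2 z) (V2 z) + 3 * l t ^ 3 * T (V2 z) (V2 z) (V1 z) + Tg z z z" for t
      unfolding lm by simp
    have "((\<lambda>t. l t ^ 6 * T (V2 z) (V2 z) (V2 z) + 3 * l t ^ 3 * T (V2 z) (V2 z) (V1 z) + Tg z z z) \<longlongrightarrow>
        0 ^ 6 * T (V2 z) (V2 z) (V2 z) + 3 * 0 ^ 3 * T (V2 z) (V2 z) (V1 z) + Tg z z z) (at_left R)"
      using d by (intro tendsto_intros) auto
    then show ?thesis unfolding e by simp
  next
    assume d: "(m \<longlongrightarrow> 0) (at_left R) \<and> (\<forall>z. T (V2 z) (V2 z) (V2 z) = 0 \<and> T (V2 z) (V2 z) (V1 z) = 0)"
    then have d0: "T (V2 z) (V2 z) (V2 z) = 0" "T (V2 z) (V2 z) (V1 z) = 0" by blast+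
    have "l t ^ 2 * m t ^ 8 = (l t * m t) ^ 2 * m t ^ 6" "l t ^ 2 * m t ^ 5 = (l t * m t) ^ 2 * m t ^ 3" for t
      by (simp_all add: power_numeral_reduce)
    then have p: "l t ^ 2 * m t ^ 8 = m t ^ 6" "l t ^ 2 * m t ^ 5 = m t ^ 3" for t
      by (simp_all add: lm)
    have e: "K t z z z = 3 * m t ^ 6 * T (V2 z) (V4 z) (V4 z)
      + 6 * m t ^ 3 * T (V2 z) (V4 z) (V1 z)
      + m t ^ 12 * T (V4 z) (V4 z) (V4 z) + 3 * m t ^ 9 * T (V4 z) (V4 z) (V1 z)
      + 3 * m t ^ 6 * T (V4 z) (V1 z) (V1 z) + m t ^ 3 * T (V1 z) (V1 z) (V1 z) + Tg z z z" for t
      unfolding expand zero_part[symmetric] d0 p lm by simp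
    have "((\<lambda>t. 3 * m t ^ 6 * T (V2 z) (V4 z) (V4 z)
      + 6 * m t ^ 3 * T (V2 z) (V4 z) (V1 z)
      + m t ^ 12 * T (V4 z) (V4 z) (V4 z) + 3 * m t ^ 9 * T (V4 z) (V4 z) (V1 z)
      + 3 * m t ^ 6 * T (V4 z) (V1 z) (V1 z) + m t ^ 3 * T (V1 z) (V1 z) (V1 z) + Tg z z z) \<longlongrightarrow>
       3 * 0 ^ 6 * T (V2 z) (V4 z) (V4 z)
      + 6 * 0 ^ 3 * T (V2 z) (V4 z) (V1 z)
      + 0 ^ 12 * T (V4 z) (V4 z) (V4 z) + 3 * 0 ^ 9 * T (V4 z) (V4 z) (V1 z)
      + 3 * 0 ^ 6 * T (V4 z) (V1 z) (V1 z) + 0 ^ 3 * T (V1 z) (V1 z) (V1 z) + Tg z z z) (at_left R)"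
      using d by (intro tendsto_intros) auto
    then show ?thesis unfolding e by simp
  qed
  have Klim: "((\<lambda>t. K t a b c) \<longlongrightarrow> Tg a b c) (at_left R)" for a b c
    unfolding sym3_polar[OF K, of _ a b c] sym3_polar[OF g, of a b c]
    by (intro tendsto_divide tendsto_add tendsto_diff tendsto_const Kcub) simp
  have Msm: "Cinf_on U (\<lambda>t. M t (f t))" if f: "Cinf_on U f" for f
  proof -
    have c: "Cinf_on U (\<lambda>t. V (f t))" if "linear V" for V :: "real \<times> 'b \<Rightarrow> real \<times> 'b"
      using that by (intro Cinf_linear_comp[OF U(1) _ f]) (simp add: linear_linear)
    show ?thesis unfolding M_def graded_sum_def
      by (rule Cinf_add[OF U(1) Cinf_add[OF U(1) Cinf_scaleR[OF U(1) Cinf_power[OF U(1) sm(1)] c[OF V(1)]]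
            Cinf_scaleR[OF U(1) Cinf_power[OF U(1) sm(2)] c[OF V(2)]]] Cinf_scaleR[OF U(1) sm(2) c[OF V(3)]]])
  qed
  have Ksm: "Cinf_on U (\<lambda>t. K t a b c)" for a b c
    unfolding K_def
    by (rule sym3_Cinf_family[where T = "\<lambda>_. T", OF U(1) T Cinf_const[OF U(1)] Msm Msm Msm])
       (rule Cinf_const[OF U(1)])+
  obtain f where f: "\<And>i. i \<in> Basis \<Longrightarrow> Cinf_on U (f i)" "\<And>i. i \<in> Basis \<Longrightarrow> (f i \<longlongrightarrow> (0, i)) (at_left R)"
    "\<And>t. t \<in> U \<Longrightarrow> std3 (\<lambda>a b c. K t (blinfun_apply (frame_map (q t) (\<lambda>i. f i t)) a)
        (blinfun_apply (frame_map (q t) (\<lambda>i. f i t)) b) (blinfun_apply (frame_map (q t) (\<lambda>i. f i t)) c))"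
    by (rule frame_family[where T = K and p = q and U = U and F = "at_left R" and T' = Tg,
          OF U(1) K Ksm sm(3) one Khyp q(1) Tg Klim q(2)]) ((assumption | rule that)+)
  define A where "A t = frame_map (M t (q t)) (\<lambda>i. M t (f i t))" for t
  have Aeq: "blinfun_apply (A t) z = M t (blinfun_apply (frame_map (q t) (\<lambda>i. f i t)) z)" for t z
    by (cases z) (simp add: A_def frame_map_apply linear_add[OF Ml] linear_scale[OF Ml] linear_sum[OF Ml])
  define L where "L t = (\<lambda>a b c. T (blinfun_apply (A t) a) (blinfun_apply (A t) b) (blinfun_apply (A t) c))" for t
  have Al: "linear (blinfun_apply (A t))" for t by (simp add: bounded_linear.linear blinfun.bounded_linear_right)
  have L: "sym3 (L t)" for t unfolding L_def by (rule sym3_compose[OF T Al])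
  have Lstd: "std3 (L t)" if "t \<in> U" for t
    using f(3)[OF that] unfolding L_def K_def Aeq .
  have Asm: "Cinf_on U A"
    unfolding A_def by (rule frame_map_Cinf[OF U(1) Msm[OF sm(3)] Msm[OF f(1)]])
  have frame: "standard_frame (\<lambda>z. T z z z) p v R A"
    unfolding standard_frame_def
  proof (intro conjI ballI)
    show "smooth_on {0..<R} A" by (rule smooth_onI[OF U Asm])
    fix t assume "t \<in> {0..<R}"
    then have t: "t \<in> U" using U(2) by blast
    have "inj (blinfun_apply (A t))" using std3_inj[OF Al _ T] Lstd[OF t] unfolding L_def .
    then show "A t \<in> GL" using linear_inj_imp_surj[OF Al] by (simp add: GL_def bij_def)
    show "blinfun_apply (A t) (1, 0) = limit_curve (\<lambda>z. T z z z) p v t"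
      using q(3)[OF t] by (simp add: A_def frame_map_apply M_def)
    have "(\<lambda>z. T z z z) \<circ> blinfun_apply (A t) = (\<lambda>z. L t z z z)" by (auto simp: L_def)
    then show "\<exists>P. cubic_form P \<and> (\<lambda>z. T z z z) \<circ> blinfun_apply (A t) = standard_cubic P"
      using std3_standard_cubic[OF Lstd[OF t]] by auto
  qed
  have lim: "((\<lambda>t. blinfun_apply (frame_map (q t) (\<lambda>i. f i t)) z) \<longlongrightarrow> z) (at_left R)" for z
  proof -
    obtain x y where z: "z = (x, y)" by (cases z)
    have "((\<lambda>t. x *\<^sub>R q t + (\<Sum>i\<in>Basis. (y \<bullet> i) *\<^sub>R f i t)) \<longlongrightarrow>
        x *\<^sub>R (1, 0) + (\<Sum>i\<in>Basis. (y \<bullet> i) *\<^sub>R (0, i))) (at_left R)"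
      by (intro tendsto_add tendsto_scaleR tendsto_const q(2) tendsto_sum f(2))
    moreover have "x *\<^sub>R (1, 0) + (\<Sum>i\<in>Basis. (y \<bullet> i) *\<^sub>R (0::real, i)) = (x, y)"
      by (simp add: prod_eq_iff fst_sum snd_sum euclidean_representation)
    ultimately show ?thesis by (simp add: z frame_map_apply)
  qed
  have "((\<lambda>t. L t i j k) \<longlongrightarrow> Tg i j k) (at_left R)" for i j k
    using sym3_tendsto[where T = K, OF K g Klim lim[of i] lim[of j] lim[of k]] unfolding L_def K_def Aeq .
  then have "uniform_limit (cball 0 1) (\<lambda>t x. L t x x x) (\<lambda>x. Tg x x x) (at_left R)"
    by (intro sym3_uniform_limit L g)
  moreover have "(\<lambda>t. (\<lambda>z. T z z z) \<circ> blinfun_apply (A t)) = (\<lambda>t x. L t x x x)"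
    by (auto simp: L_def fun_eq_iff)
  ultimately show ?thesis
    unfolding limit_polynomial_def using R frame sym3_cubic_form[OF g]
    by (intro exI[of _ R] exI[of _ A]) simp
qed

section \<open>The normal form in light-cone coordinates\<close>

definition lw :: "(nat \<Rightarrow> 'n::finite) \<Rightarrow> real \<times> (real ^ 'n) \<Rightarrow> real" where
  "lw e p = snd p $ e (CARD('n) - 1)"

text \<open>The null coordinates X and Y in which the list of limit polynomials takes a simple form: the cubic
  x ^ 3 - x * w ^ 2 - 2 / (3 * sqrt 3) * w ^ 3 is X ^ 2 * Y.\<close>
definition lX :: "(nat \<Rightarrow> 'n::finite) \<Rightarrow> real \<times> (real ^ 'n) \<Rightarrow> real" where
  "lX e p = fst p + lw e p / sqrt 3"

definition lY :: "(nat \<Rightarrow> 'n::finite) \<Rightarrow> real \<times> (real ^ 'n) \<Rightarrow> real" where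
  "lY e p = fst p - 2 * lw e p / sqrt 3"

text \<open>The point with null coordinates X and Y whose other coordinates vanish.\<close>
definition light_point :: "(nat \<Rightarrow> 'n::finite) \<Rightarrow> real \<Rightarrow> real \<Rightarrow> real \<times> (real ^ 'n)" where
  "light_point e X Y = ((2 * X + Y) / 3, axis (e (CARD('n) - 1)) ((X - Y) / sqrt 3))"

lemma linear_light: "linear (lX e)" "linear (lY e)" "linear (lw e)"
  by (simp_all add: linear_iff lX_def lY_def lw_def algebra_simps add_divide_distrib)

lemma sum_lessThan_split: "(\<Sum>i<m + k. f i) = (\<Sum>i<m. f i) + (\<Sum>j<k. f (m + j))" for m k :: nat and f :: "nat \<Rightarrow> real"
  by (induction k) (simp_all add: add.assoc)

lemma inner_enumerated:
  fixes e :: "nat \<Rightarrow> 'n::finite" and y z :: "real ^ 'n"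
  assumes e: "bij_betw e {..<CARD('n)} UNIV" and m: "m \<le> CARD('n) - 1"
  shows "y \<bullet> z = (\<Sum>i<m. y $ e i * z $ e i) + (\<Sum>j<CARD('n) - 1 - m. y $ e (m + j) * z $ e (m + j))
     + y $ e (CARD('n) - 1) * z $ e (CARD('n) - 1)"
proof -
  have N: "CARD('n) = Suc (m + (CARD('n) - 1 - m))" using m zero_less_card_finite[where 'a='n] by linarith
  have "y \<bullet> z = (\<Sum>i\<in>UNIV. y $ i * z $ i)" by (simp add: inner_vec_def)
  also have "\<dots> = (\<Sum>i<CARD('n). y $ e i * z $ e i)"
    by (rule sum.reindex_bij_betw[OF e, symmetric])
  also have "\<dots> = (\<Sum>i<Suc (m + (CARD('n) - 1 - m)). y $ e i * z $ e i)" using N by simp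
  also have "\<dots> = (\<Sum>i<m. y $ e i * z $ e i) + (\<Sum>j<CARD('n) - 1 - m. y $ e (m + j) * z $ e (m + j))
     + y $ e (m + (CARD('n) - 1 - m)) * z $ e (m + (CARD('n) - 1 - m))"
    by (simp only: sum.lessThan_Suc sum_lessThan_split)
  finally show ?thesis unfolding le_add_diff_inverse[OF m] .
qed

lemma enumerated_eq_iff:
  fixes e :: "nat \<Rightarrow> 'n::finite"
  assumes "bij_betw e {..<CARD('n)} UNIV" "i < CARD('n)" "j < CARD('n)"
  shows "e i = e j \<longleftrightarrow> i = j"
  using assms by (auto simp: bij_betw_def inj_on_def)

text \<open>In this form the invariance under X, s of weight 2, Y of weight - 4 and u of weight - 1 is visible.\<close>
lemma poly_general_light:
  "poly_general e m F p = lY e p * ((lX e p)\<^sup>2 - (\<Sum>i<m. (snd p $ e i)\<^sup>2))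
     - lX e p * (\<Sum>j<CARD('n) - 1 - m. (snd p $ e (m + j))\<^sup>2)
     + (\<Sum>i<m. snd p $ e i * (\<Sum>j<CARD('n) - 1 - m. snd p $ e (m + j) *
          (\<Sum>l<CARD('n) - 1 - m. F i $$ (j, l) * snd p $ e (m + l))))"
  for e :: "nat \<Rightarrow> 'n::finite"
proof -
  obtain x y where p: "p = (x, y)" by (cases p)
  define w where "w = y $ e (CARD('n) - 1)"
  have k: "(x - 2 * w / sqrt 3) * (x + w / sqrt 3)\<^sup>2 = x ^ 3 - x * w\<^sup>2 - 2 / (3 * sqrt 3) * w ^ 3"
    by (simp add: power2_eq_square power3_eq_cube field_simps sqrt3_simps)
  show ?thesis
    unfolding poly_general_def p case_prod_conv Let_def lX_def lY_def lw_def fst_conv snd_conv w_def[symmetric]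
    using k by (simp add: algebra_simps)
qed

lemma poly_general_std3:
  fixes e :: "nat \<Rightarrow> 'n::finite"
  assumes e: "bij_betw e {..<CARD('n)} UNIV" and m: "m \<le> CARD('n) - 1"
  obtains T where "std3 T" "poly_general e m F = (\<lambda>z. T z z z)"
proof -
  define P where "P y = poly_general e m F (0, y)" for y
  have "cubic_form P"
    unfolding cubic_form_def
  proof (intro conjI allI)
    show "real_polynomial_function P"
      unfolding P_def poly_general_def case_prod_conv Let_def power2_eq_square power3_eq_cube
      by (intro real_polynomial_function_diff real_polynomial_function.intros(3,4) real_polynomial_function_sum
          real_polynomial_function.intros(1)[OF bounded_linear_vec_nth] real_polynomial_function.intros(2) finite_lessThan)
    show "P (c *\<^sub>R y) = c ^ 3 * P y" for c y
      unfolding P_def poly_general_def case_prod_conv Let_def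
      by (simp add: power_mult_distrib power2_eq_square power3_eq_cube sum_distrib_left algebra_simps)
  qed
  moreover have "poly_general e m F = standard_cubic P"
  proof
    fix p :: "real \<times> (real ^ 'n)"
    obtain x y where p: "p = (x, y)" by (cases p)
    show "poly_general e m F p = standard_cubic P p"
      unfolding p standard_cubic_def case_prod_conv P_def inner_enumerated[OF e m] poly_general_def Let_def
      by (simp add: power2_eq_square)
  qed
  ultimately show thesis using standard_cubic_std3[of P] that by metis
qed

section \<open>Admissible matrices\<close>

lemma eigenvalue_mat_iff:
  "eigenvalue (mat k k (\<lambda>(a, b). f a b)) \<mu> \<longleftrightarrow>
     (\<exists>x::nat \<Rightarrow> real. (\<exists>j<k. x j \<noteq> 0) \<and> (\<forall>j<k. (\<Sum>l<k. f j l * x l) = \<mu> * x j))"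
proof
  let ?A = "mat k k (\<lambda>(a, b). f a b)"
  have mv: "vec_index (?A *\<^sub>v v) j = (\<Sum>l<k. f j l * vec_index v l)" if "j < k" "v \<in> carrier_vec k" for j v
    using that by (simp add: scalar_prod_def lessThan_atLeast0)
  {
    assume "eigenvalue ?A \<mu>"
    then obtain v where v: "v \<in> carrier_vec k" "v \<noteq> 0\<^sub>v k" "?A *\<^sub>v v = \<mu> \<cdot>\<^sub>v v"
      by (auto simp: eigenvalue_def eigenvector_def)
    have "\<exists>j<k. vec_index v j \<noteq> 0"
    proof (rule ccontr)
      assume "\<not> ?thesis"
      then have "v = 0\<^sub>v k" using v(1) by (intro eq_vecI) auto
      then show False using v(2) by simp
    qed
    moreover have "(\<Sum>l<k. f j l * vec_index v l) = \<mu> * vec_index v j" if "j < k" for j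
      using mv[OF that v(1)] v(3) that v(1) by simp
    ultimately show "\<exists>x::nat \<Rightarrow> real. (\<exists>j<k. x j \<noteq> 0) \<and> (\<forall>j<k. (\<Sum>l<k. f j l * x l) = \<mu> * x j)"
      by (intro exI[of _ "vec_index v"]) blast
  next
    assume "\<exists>x::nat \<Rightarrow> real. (\<exists>j<k. x j \<noteq> 0) \<and> (\<forall>j<k. (\<Sum>l<k. f j l * x l) = \<mu> * x j)"
    then obtain x :: "nat \<Rightarrow> real" and j where x: "j < k" "x j \<noteq> 0" "\<And>j. j < k \<Longrightarrow> (\<Sum>l<k. f j l * x l) = \<mu> * x j" by blast
    have v: "vec k x \<in> carrier_vec k" by simp
    have "vec k x \<noteq> 0\<^sub>v k"
    proof
      assume "vec k x = 0\<^sub>v k"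
      then have "vec_index (vec k x) j = vec_index (0\<^sub>v k) j" by simp
      then show False using x(1,2) by simp
    qed
    moreover have "?A *\<^sub>v vec k x = \<mu> \<cdot>\<^sub>v vec k x"
    proof (rule eq_vecI)
      fix i assume "i < dim_vec (\<mu> \<cdot>\<^sub>v vec k x)"
      then have i: "i < k" by simp
      show "vec_index (?A *\<^sub>v vec k x) i = vec_index (\<mu> \<cdot>\<^sub>v vec k x) i"
        using mv[OF i v] x(3)[OF i] i by simp
    qed simp
    ultimately show "eigenvalue ?A \<mu>"
      using v unfolding eigenvalue_def eigenvector_def by (intro exI[of _ "vec k x"]) simp
  }
qed

text \<open>The maximum of the Rayleigh quotient is an eigenvalue. The form is transported to the coordinate
  subspace of real ^ 'n selected by d, where the maximum principle for symmetric forms applies.\<close>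
lemma rayleigh_bound:
  fixes d :: "nat \<Rightarrow> 'n::finite" and f :: "nat \<Rightarrow> nat \<Rightarrow> real"
  assumes d: "inj_on d {..<k}" and sym: "\<And>j l. j < k \<Longrightarrow> l < k \<Longrightarrow> f j l = f l j"
    and ev: "\<And>\<mu>. eigenvalue (mat k k (\<lambda>(a, b). f a b)) \<mu> \<Longrightarrow> \<mu> \<le> 1"
  shows "(\<Sum>j<k. u j * (\<Sum>l<k. f j l * u l)) \<le> (\<Sum>j<k. (u j)\<^sup>2)"
proof -
  define B :: "real ^ 'n \<Rightarrow> real ^ 'n \<Rightarrow> real" where
    "B y z = (\<Sum>j<k. y $ d j * (\<Sum>l<k. f j l * z $ d l))" for y z
  have B: "sym_form B"
    unfolding sym_form_def
  proof (intro conjI allI)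
    show "linear (\<lambda>x. B x y)" for y
      by (simp add: linear_iff B_def sum.distrib algebra_simps sum_distrib_left)
    show "B x y = B y x" for x y
    proof -
      have "B x y = (\<Sum>j<k. \<Sum>l<k. x $ d j * f j l * y $ d l)" by (simp add: B_def sum_distrib_left mult.assoc)
      also have "\<dots> = (\<Sum>l<k. \<Sum>j<k. x $ d j * f j l * y $ d l)" by (rule sum.swap)
      also have "\<dots> = (\<Sum>l<k. \<Sum>j<k. y $ d l * f l j * x $ d j)"
        using sym by (intro sum.cong) (auto simp: mult_ac)
      also have "\<dots> = B y x" by (simp add: B_def sum_distrib_left mult.assoc)
      finally show ?thesis .
    qed
  qed
  define S :: "(real ^ 'n) set" where "S = {y. \<forall>i. i \<notin> d ` {..<k} \<longrightarrow> y $ i = 0}"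
  have S: "subspace S" by (auto simp: subspace_def S_def)
  define y :: "real ^ 'n" where "y = (\<chi> i. \<Sum>j<k. if d j = i then u j else 0)"
  have yd: "y $ d j = u j" if "j < k" for j
  proof -
    have "(\<Sum>l<k. if d l = d j then u l else 0) = (\<Sum>l<k. if l = j then u l else 0)"
      using d that by (intro sum.cong) (auto simp: inj_on_def)
    then show ?thesis using that by (simp add: y_def)
  qed
  have yS: "y \<in> S" by (auto simp: S_def y_def intro!: sum.neutral)
  have nS: "z \<bullet> z = (\<Sum>j<k. (z $ d j)\<^sup>2)" if "z \<in> S" for z
  proof -
    have "z \<bullet> z = (\<Sum>i\<in>UNIV. (z $ i)\<^sup>2)" by (simp add: inner_vec_def power2_eq_square)
    also have "\<dots> = (\<Sum>i\<in>d ` {..<k}. (z $ i)\<^sup>2)"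
      using that by (intro sum.mono_neutral_right) (auto simp: S_def)
    also have "\<dots> = (\<Sum>j<k. (z $ d j)\<^sup>2)" by (simp add: sum.reindex[OF d])
    finally show ?thesis .
  qed
  have Byy: "B y y = (\<Sum>j<k. u j * (\<Sum>l<k. f j l * u l))"
    unfolding B_def by (intro sum.cong refl) (simp add: yd)
  have nyy: "y \<bullet> y = (\<Sum>j<k. (u j)\<^sup>2)" unfolding nS[OF yS] by (intro sum.cong refl) (simp add: yd)
  have "B y y \<le> y \<bullet> y"
  proof (cases "S = {0}")
    case True
    then show ?thesis using yS by (simp add: sym_form_simps[OF B])
  next
    case False
    obtain a \<mu> where a: "a \<in> S" "norm a = 1" "\<And>w. w \<in> S \<Longrightarrow> B a w = \<mu> * (a \<bullet> w)"
      and max: "\<And>w. w \<in> S \<Longrightarrow> B w w \<le> \<mu> * (w \<bullet> w)"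
      by (rule sym_form_max_eigenvector[OF B S False]) (rule that)
    have "\<exists>j<k. a $ d j \<noteq> 0"
    proof (rule ccontr)
      assume "\<not> ?thesis"
      then have "a \<bullet> a = 0" unfolding nS[OF a(1)] by simp
      then show False using a(2) by simp
    qed
    moreover have "(\<Sum>l<k. f j l * a $ d l) = \<mu> * a $ d j" if j: "j < k" for j
    proof -
      have "axis (d j) 1 \<in> S" using j by (auto simp: S_def axis_def)
      from a(3)[OF this] have "B (axis (d j) 1) a = \<mu> * a $ d j"
        using sym_form_commute[OF B, of a] by (simp add: inner_axis)
      moreover have "B (axis (d j) 1) a = (\<Sum>i<k. if i = j then \<Sum>l<k. f j l * a $ d l else 0)"
        unfolding B_def using d j by (intro sum.cong) (auto simp: axis_def inj_on_def)
      ultimately show ?thesis using j by simp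
    qed
    ultimately have "(\<exists>j<k. a $ d j \<noteq> 0) \<and> (\<forall>j<k. (\<Sum>l<k. f j l * a $ d l) = \<mu> * a $ d j)" by blast
    then have "eigenvalue (mat k k (\<lambda>(a, b). f a b)) \<mu>"
      unfolding eigenvalue_mat_iff by (rule exI[of _ "\<lambda>j. a $ d j"])
    then have "\<mu> \<le> 1" by (rule ev)
    then have "\<mu> * (y \<bullet> y) \<le> 1 * (y \<bullet> y)" by (intro mult_right_mono) auto
    then show ?thesis using max[OF yS] by simp
  qed
  then show ?thesis by (simp only: Byy nyy)
qed

text \<open>The part of admissibility that is independent of the eigenvalues.\<close>
definition normal_matrices where
  "normal_matrices m k F \<longleftrightarrow> (\<forall>i<m. F i \<in> carrier_mat k k \<and> transpose_mat (F i) = F i)"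

text \<open>By homogeneity the bound need only be checked on the sphere y \<bullet> y = 3, where it says h (1,
  y) \<le> 0. If the matrices are admissible, then with r = norm s and \<rho> = u \<bullet> u one has \<rho> =
  6 * X - 3 * X ^ 2 - r ^ 2 and h \<le> (3 - 2 * X) * (X ^ 2 - r ^ 2) - (X - r) * \<rho> = (X - r) ^ 2 * (X - r
  - 3) \<le> 0. Conversely, for an eigenvalue \<mu> of the combination with coefficients c and an eigenvector u
  with u \<bullet> u = 2, the points with x = 1, s = c or s = - c, and w = 0 lie on the light cone, where h
  takes the values 2 * \<mu> - 2 and - 2 * \<mu> - 2.\<close>
theorem admissible_iff_cubic_bound:
  fixes e :: "nat \<Rightarrow> 'n::finite"
  assumes e: "bij_betw e {..<CARD('n)} UNIV" and m: "m \<le> CARD('n) - 1"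
    and F: "normal_matrices m (CARD('n) - 1 - m) F"
    and T: "std3 T" "poly_general e m F = (\<lambda>z. T z z z)"
  shows "admissible_matrices m (CARD('n) - 1 - m) F \<longleftrightarrow> cubic_bound T"
proof
  define k where "k = CARD('n) - 1 - m"
  have N: "CARD('n) - 1 = m + k" "CARD('n) = Suc (m + k)"
    using m zero_less_card_finite[where 'a='n] unfolding k_def by linarith+
  define Q where "Q i u = (\<Sum>j<k. u j * (\<Sum>l<k. F i $$ (j, l) * u l))" for i and u :: "nat \<Rightarrow> real"
  have comb: "(\<Sum>i<m. c i * Q i u) = (\<Sum>j<k. u j * (\<Sum>l<k. (\<Sum>i<m. c i * F i $$ (j, l)) * u l))" for c u
  proof -
    have "(\<Sum>i<m. c i * Q i u) = (\<Sum>i<m. \<Sum>j<k. \<Sum>l<k. u j * (c i * F i $$ (j, l) * u l))"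
      by (simp add: Q_def sum_distrib_left mult_ac)
    also have "\<dots> = (\<Sum>j<k. \<Sum>i<m. \<Sum>l<k. u j * (c i * F i $$ (j, l) * u l))" by (rule sum.swap)
    also have "\<dots> = (\<Sum>j<k. \<Sum>l<k. \<Sum>i<m. u j * (c i * F i $$ (j, l) * u l))"
      by (intro sum.cong refl sum.swap)
    finally show ?thesis by (simp add: sum_distrib_left sum_distrib_right)
  qed
  have val: "T (x, y) (x, y) (x, y) = lY e (x, y) * ((lX e (x, y))\<^sup>2 - (\<Sum>i<m. (y $ e i)\<^sup>2))
     - lX e (x, y) * (\<Sum>j<k. (y $ e (m + j))\<^sup>2) + (\<Sum>i<m. y $ e i * Q i (\<lambda>j. y $ e (m + j)))" for x y
    using poly_general_light[of e m F "(x, y)"] unfolding T(2) by (simp add: Q_def k_def)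
  have nrm: "y \<bullet> y = (\<Sum>i<m. (y $ e i)\<^sup>2) + (\<Sum>j<k. (y $ e (m + j))\<^sup>2) + (lw e (x, y))\<^sup>2" for x y
    using inner_enumerated[OF e m, of y y] by (simp add: lw_def k_def power2_eq_square)
  {
    assume adm: "admissible_matrices m (CARD('n) - 1 - m) F"
    have bound: "(\<Sum>i<m. s i * Q i u) \<le> sqrt (\<Sum>i<m. (s i)\<^sup>2) * (\<Sum>j<k. (u j)\<^sup>2)" for s u
    proof (cases "(\<Sum>i<m. (s i)\<^sup>2) = 0")
      case True
      then have "\<forall>i<m. s i = 0" by (subst (asm) sum_nonneg_eq_0_iff) auto
      then show ?thesis by (simp add: True)
    next
      case False
      define r where "r = sqrt (\<Sum>i<m. (s i)\<^sup>2)"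
      have r: "0 < r" using False by (simp add: r_def sum_nonneg less_le)
      have r2: "r\<^sup>2 = (\<Sum>i<m. (s i)\<^sup>2)" by (simp add: r_def sum_nonneg)
      define c where "c i = s i / r" for i
      have "(\<Sum>i<m. (c i)\<^sup>2) = (\<Sum>i<m. (s i)\<^sup>2) / r\<^sup>2" by (simp add: c_def power_divide sum_divide_distrib)
      then have c1: "(\<Sum>i<m. (c i)\<^sup>2) = 1" unfolding r2[symmetric] using r by simp
      have "(\<Sum>j<k. u j * (\<Sum>l<k. (\<Sum>i<m. c i * F i $$ (j, l)) * u l)) \<le> (\<Sum>j<k. (u j)\<^sup>2)"
      proof (rule rayleigh_bound[of "\<lambda>j. e (m + j)"])
        show "inj_on (\<lambda>j. e (m + j)) {..<k}"
          using enumerated_eq_iff[OF e] N by (auto simp: inj_on_def)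
        show "(\<Sum>i<m. c i * F i $$ (j, l)) = (\<Sum>i<m. c i * F i $$ (l, j))" if "j < k" "l < k" for j l
        proof (rule sum.cong[OF refl])
          fix i assume "i \<in> {..<m}"
          then have "F i \<in> carrier_mat k k" "transpose_mat (F i) = F i" using F by (auto simp: normal_matrices_def k_def)
          then have "F i $$ (j, l) = F i $$ (l, j)" using that by (metis carrier_matD index_transpose_mat(1))
          then show "c i * F i $$ (j, l) = c i * F i $$ (l, j)" by simp
        qed
        show "\<mu> \<le> 1" if "eigenvalue (mat k k (\<lambda>(a, b). \<Sum>i<m. c i * F i $$ (a, b))) \<mu>" for \<mu>
          using adm c1 that unfolding admissible_matrices_def k_def[symmetric] by auto
      qed
      then have "r * (\<Sum>i<m. c i * Q i u) \<le> r * (\<Sum>j<k. (u j)\<^sup>2)" using r unfolding comb by simp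
      moreover have "r * (\<Sum>i<m. c i * Q i u) = (\<Sum>i<m. s i * Q i u)"
        using r by (simp add: sum_distrib_left c_def)
      ultimately show ?thesis by (simp add: r_def)
    qed
    have light: "T (1, y) (1, y) (1, y) \<le> 0" if y: "y \<bullet> y = 3" for y
    proof -
      define w where "w = lw e (1, y)"
      define X where "X = 1 + w / sqrt 3"
      define r where "r = sqrt (\<Sum>i<m. (y $ e i)\<^sup>2)"
      define \<rho> where "\<rho> = (\<Sum>j<k. (y $ e (m + j))\<^sup>2)"
      have r: "0 \<le> r" "r\<^sup>2 = (\<Sum>i<m. (y $ e i)\<^sup>2)" by (simp_all add: r_def sum_nonneg)
      have \<rho>0: "0 \<le> \<rho>" by (simp add: \<rho>_def sum_nonneg)
      have n: "r\<^sup>2 + \<rho> + w\<^sup>2 = 3" using y nrm[of y 1] r(2) by (simp add: \<rho>_def w_def)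
      have wX: "w = sqrt 3 * (X - 1)" by (simp add: X_def)
      have \<rho>: "\<rho> = 6 * X - 3 * X\<^sup>2 - r\<^sup>2"
        using n by (simp add: wX power_mult_distrib power2_eq_square algebra_simps)
      have "w\<^sup>2 \<le> 3" using n \<rho>0 r by (smt (verit) zero_le_power2)
      then have "\<bar>w\<bar> \<le> sqrt 3" using real_le_rsqrt[of "\<bar>w\<bar>" 3] by simp
      then have X2: "X \<le> 2" by (simp add: X_def divide_le_eq)
      have Y: "lY e (1, y) = 3 - 2 * X" "lX e (1, y) = X"
        by (simp_all add: lY_def lX_def X_def w_def field_simps)
      have "T (1, y) (1, y) (1, y) \<le> (3 - 2 * X) * (X\<^sup>2 - r\<^sup>2) - X * \<rho> + r * \<rho>"
        unfolding val Y r(2) \<rho>_def[symmetric] using bound[of "\<lambda>i. y $ e i" "\<lambda>j. y $ e (m + j)"]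
        by (simp add: r_def[symmetric] \<rho>_def[symmetric])
      also have "\<dots> = (X - r)\<^sup>2 * (X - r - 3)"
        unfolding \<rho> by (simp add: power2_eq_square algebra_simps)
      also have "\<dots> \<le> 0" using X2 r(1) by (intro mult_nonneg_nonpos) auto
      finally show ?thesis .
    qed
    show "cubic_bound T"
      unfolding cubic_bound_def
    proof
      fix y :: "real ^ 'n"
      show "T (0, y) (0, y) (0, y) \<le> 2 / (3 * sqrt 3) * norm y ^ 3"
      proof (cases "y = 0")
        case True
        then show ?thesis using sym3_simps(13)[OF std3_sym3[OF T(1)]] by (simp add: zero_prod_def[symmetric])
      next
        case False
        define z where "z = (sqrt 3 / norm y) *\<^sub>R y"
        have z3: "z \<bullet> z = 3" using False by (simp add: z_def dot_square_norm power2_eq_square)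
        from light[OF this] have z2: "T (0, z) (0, z) (0, z) \<le> 2"
          using std3_eval[OF T(1), of 1 z] z3 by simp
        have "(0::real, y) = (norm y / sqrt 3) *\<^sub>R (0, z)" using False by (simp add: z_def)
        then have "T (0, y) (0, y) (0, y) = (norm y / sqrt 3) ^ 3 * T (0, z) (0, z) (0, z)"
          by (simp only: sym3_simps[OF std3_sym3[OF T(1)]]) (simp add: power3_eq_cube)
        also have "\<dots> \<le> (norm y / sqrt 3) ^ 3 * 2" using z2 by (intro mult_left_mono) auto
        also have "\<dots> = 2 / (3 * sqrt 3) * norm y ^ 3" by (simp add: power_divide sqrt3_simps)
        finally show ?thesis .
      qed
    qed
  next
    assume B: "cubic_bound T"
    show "admissible_matrices m (CARD('n) - 1 - m) F"
      unfolding admissible_matrices_def k_def[symmetric]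
    proof (intro conjI allI impI)
      fix i assume "i < m"
      then show "F i \<in> carrier_mat k k" "transpose_mat (F i) = F i"
        using F by (auto simp: normal_matrices_def k_def)
    next
      fix c :: "nat \<Rightarrow> real" and \<mu>
      assume c: "(\<Sum>i<m. (c i)\<^sup>2) = 1" and "eigenvalue (mat k k (\<lambda>(a, b). \<Sum>i<m. c i * F i $$ (a, b))) \<mu>"
      then obtain x :: "nat \<Rightarrow> real" where x: "\<exists>j<k. x j \<noteq> 0"
        "\<And>j. j < k \<Longrightarrow> (\<Sum>l<k. (\<Sum>i<m. c i * F i $$ (j, l)) * x l) = \<mu> * x j"
        unfolding eigenvalue_mat_iff by blast
      define n2 where "n2 = (\<Sum>j<k. (x j)\<^sup>2)"
      have n2: "0 < n2" unfolding n2_def using x(1) by (auto intro: sum_pos2)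
      have Qx: "(\<Sum>i<m. c i * Q i x) = \<mu> * n2"
      proof -
        have "(\<Sum>i<m. c i * Q i x) = (\<Sum>j<k. \<mu> * (x j)\<^sup>2)"
          unfolding comb using x(2) by (intro sum.cong) (auto simp: power2_eq_square)
        then show ?thesis by (simp add: n2_def sum_distrib_left)
      qed
      have key: "\<sigma> * \<mu> \<le> 1" if \<sigma>: "\<sigma>\<^sup>2 = 1" for \<sigma> :: real
      proof -
        define u where "u j = sqrt (2 / n2) * x j" for j
        define d where "d = the_inv_into {..<CARD('n)} e"
        have d: "d (e i) = i" if "i < CARD('n)" for i
          using the_inv_into_f_f[of e "{..<CARD('n)}" i] e that by (simp add: d_def bij_betw_def)
        define y :: "real ^ 'n" where "y = (\<chi> i. if d i < m then \<sigma> * c (d i) else if d i < m + k then u (d i - m) else 0)"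
        have ys: "y $ e i = \<sigma> * c i" if "i < m" for i using that N d[of i] by (simp add: y_def)
        have yu: "y $ e (m + j) = u j" if "j < k" for j using that N d[of "m + j"] by (simp add: y_def)
        have yw: "lw e (x', y) = 0" for x' using N d[of "m + k"] by (simp add: y_def lw_def)
        have s1: "(\<Sum>i<m. (y $ e i)\<^sup>2) = 1"
          using c \<sigma> by (simp add: ys power_mult_distrib)
        have u2: "(\<Sum>j<k. (y $ e (m + j))\<^sup>2) = 2"
        proof -
          have "(\<Sum>j<k. (y $ e (m + j))\<^sup>2) = (\<Sum>j<k. 2 / n2 * (x j)\<^sup>2)"
            using n2 by (intro sum.cong) (auto simp: yu u_def power_mult_distrib)
          also have "\<dots> = 2 / n2 * n2" unfolding n2_def by (simp only: sum_distrib_left)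
          finally show ?thesis using n2 by simp
        qed
        have "Q i (\<lambda>j. y $ e (m + j)) = 2 / n2 * Q i x" for i
        proof -
          have "Q i (\<lambda>j. y $ e (m + j)) = (\<Sum>j<k. u j * (\<Sum>l<k. F i $$ (j, l) * u l))"
            unfolding Q_def by (intro sum.cong refl) (simp add: yu)
          also have "\<dots> = (\<Sum>j<k. (sqrt (2 / n2) * sqrt (2 / n2)) * (x j * (\<Sum>l<k. F i $$ (j, l) * x l)))"
            by (intro sum.cong refl) (simp add: u_def sum_distrib_left mult_ac)
          finally show ?thesis using n2 by (simp only: sum_distrib_left[symmetric] Q_def[symmetric]) simp
        qed
        then have "(\<Sum>i<m. y $ e i * Q i (\<lambda>j. y $ e (m + j))) = \<sigma> * (2 / n2) * (\<Sum>i<m. c i * Q i x)"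
          unfolding sum_distrib_left by (intro sum.cong refl) (simp add: ys)
        then have q: "(\<Sum>i<m. y $ e i * Q i (\<lambda>j. y $ e (m + j))) = 2 * (\<sigma> * \<mu>)" using n2 by (simp add: Qx)
        have "y \<bullet> y = 3" using nrm[of y 0] s1 u2 yw by simp
        then have "norm (snd (1::real, y)) = sqrt 3 * fst (1::real, y)" by (simp add: norm_eq_sqrt_inner)
        from nonpos_on_light_cone[OF T(1) B this]
        have "T (1, y) (1, y) (1, y) \<le> 0" .
        then show ?thesis unfolding val by (simp add: lX_def lY_def yw s1 u2 q)
      qed
      from key[of 1] key[of "-1"] show "\<mu> \<in> {- 1..1}" by simp
    qed
  }
qed

section \<open>Degeneration to the normal form\<close>

text \<open>A basis a, b, S, U of the ambient space in which T has the same products as the normal form has in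
  the directions of X, Y, s and u, as far as these are determined by weight zero.\<close>
definition adapted where
  "adapted T m k a b S U \<longleftrightarrow>
     T a a a = (0::real) \<and> T a a b = 1 / 3 \<and> T a b b = 0 \<and>
     (\<forall>i<m. T a a (S i) = 0 \<and> T a b (S i) = 0) \<and> (\<forall>j<k. T a a (U j) = 0 \<and> T a b (U j) = 0) \<and>
     (\<forall>i<m. \<forall>j<m. T b (S i) (S j) = (if i = j then - 1 / 3 else 0)) \<and>
     (\<forall>i<k. \<forall>j<k. T a (U i) (U j) = (if i = j then - 1 / 3 else 0))"

text \<open>The products of negative weight vanish, so that the scaling converges for l \<rightarrow> 0.\<close>
definition singular_end where
  "singular_end T k b U \<longleftrightarrow> (\<forall>z. T b b z = (0::real)) \<and> (\<forall>j<k. \<forall>z. T b (U j) z = 0) \<and>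
     (\<forall>i<k. \<forall>j<k. \<forall>l<k. T (U i) (U j) (U l) = 0)"

text \<open>The products of positive weight vanish, so that the scaling converges for 1 / l \<rightarrow> 0.\<close>
definition regular_end where
  "regular_end T m k a S U \<longleftrightarrow> (\<forall>i<m. \<forall>z. T a (S i) z = (0::real)) \<and>
     (\<forall>i<m. \<forall>j<m. \<forall>l<m. T (S i) (S j) (S l) = 0) \<and> (\<forall>i<m. \<forall>j<m. \<forall>l<k. T (S i) (S j) (U l) = 0)"

definition normal_form_matrices where
  "normal_form_matrices T k S U i = mat k k (\<lambda>(j, l). 3 * T (S i) (U j) (U l))" for k :: nat

lemma normal_form_matrices_symmetric:
  assumes "sym3 T" shows "normal_matrices m k (normal_form_matrices T k S U)"
  unfolding normal_matrices_def normal_form_matrices_def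
  by (auto intro!: eq_matI simp: sym3_commute(2)[OF assms])

lemma sym3_diagonal:
  fixes n :: nat
  assumes T: "sym3 T" and d: "\<And>i j. i < n \<Longrightarrow> j < n \<Longrightarrow> T c (f i) (f j) = (if i = j then r else 0)"
  shows "T c (\<Sum>i<n. x i *\<^sub>R f i) (\<Sum>i<n. y i *\<^sub>R f i) = r * (\<Sum>i<n. x i * y i)"
proof -
  have "T c (\<Sum>i<n. x i *\<^sub>R f i) (\<Sum>i<n. y i *\<^sub>R f i) = (\<Sum>i<n. x i * T c (f i) (\<Sum>i<n. y i *\<^sub>R f i))"
    by (simp add: sym3_sum(2)[OF T] sym3_simps[OF T])
  also have "\<dots> = (\<Sum>i<n. x i * (y i * r))"
  proof (rule sum.cong[OF refl])
    fix i assume i: "i \<in> {..<n}"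
    have "T c (f i) (\<Sum>i<n. y i *\<^sub>R f i) = (\<Sum>j<n. y j * T c (f i) (f j))"
      by (simp add: sym3_sum(3)[OF T] sym3_simps[OF T])
    also have "\<dots> = (\<Sum>j<n. if j = i then y i * r else 0)"
      using d i by (intro sum.cong) auto
    finally have "T c (f i) (\<Sum>i<n. y i *\<^sub>R f i) = (\<Sum>j<n. if j = i then y i * r else 0)" .
    then show "x i * T c (f i) (\<Sum>i<n. y i *\<^sub>R f i) = x i * (y i * r)" using i by simp
  qed
  finally show ?thesis by (simp add: sum_distrib_left mult_ac)
qed

text \<open>The curve has only X- and Y-components in the adapted basis, and after the rescaling these tend to
  1, the null coordinates of the base point (1, 0).\<close>
theorem adapted_limit:
  fixes T :: "real \<times> (real ^ 'n) \<Rightarrow> real \<times> (real ^ 'n) \<Rightarrow> real \<times> (real ^ 'n) \<Rightarrow> real"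
    and e :: "nat \<Rightarrow> 'n::finite"
  assumes e: "bij_betw e {..<CARD('n)} UNIV" and m: "m \<le> CARD('n) - 1" and k: "k = CARD('n) - 1 - m"
    and T: "sym3 T" and ad: "adapted T m k a b S U"
    and deg: "(l \<longlongrightarrow> 0) (at_left R) \<and> singular_end T k b U \<or> (\<mu> \<longlongrightarrow> 0) (at_left R) \<and> regular_end T m k a S U"
    and W: "open W" "{0..<R} \<subseteq> W"
    and sm: "Cinf_on W l" "Cinf_on W \<mu>" "Cinf_on W X" "Cinf_on W Y" and lm: "\<And>t. l t * \<mu> t = (1::real)"
    and hyp: "\<And>t. t \<in> W \<Longrightarrow> hyp T (p + t *\<^sub>R v)"
    and XY: "(X \<longlongrightarrow> 1) (at_left R)" "(Y \<longlongrightarrow> 1) (at_left R)" "\<And>t. t \<in> W \<Longrightarrow> 2 * X t + Y t \<noteq> 0"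
      "\<And>t. t \<in> W \<Longrightarrow> limit_curve (\<lambda>z. T z z z) p v t = ((l t)\<^sup>2 * X t) *\<^sub>R a + (\<mu> t ^ 4 * Y t) *\<^sub>R b"
    and R: "smallest_positive_zero (\<lambda>z. T z z z) p v R"
  shows "limit_polynomial (\<lambda>z. T z z z) p v (poly_general e m (normal_form_matrices T k S U))"
proof -
  let ?F = "normal_form_matrices T k S U"
  obtain Tg where Tg: "std3 Tg" "poly_general e m ?F = (\<lambda>z. Tg z z z)" using poly_general_std3[OF e m] by blast
  have N: "CARD('n) = Suc (m + k)" using m k zero_less_card_finite[where 'a='n] by linarith
  define A where "A p = (\<Sum>i<m. (snd p $ e i) *\<^sub>R S i)" for p :: "real \<times> (real ^ 'n)"
  define C where "C p = (\<Sum>j<k. (snd p $ e (m + j)) *\<^sub>R U j)" for p :: "real \<times> (real ^ 'n)"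
  define V2 where "V2 p = lX e p *\<^sub>R a + A p" for p
  define V4 where "V4 p = lY e p *\<^sub>R b" for p
  have Al: "linear A" and Cl: "linear C"
    by (simp_all add: linear_iff A_def C_def scaleR_add_left sum.distrib scaleR_sum_right)
  have V: "linear V2" "linear V4"
    using Al by (simp_all add: V2_def V4_def linear_iff linear_add[OF linear_light(1)] linear_scale[OF linear_light(1)]
      linear_add[OF linear_light(2)] linear_scale[OF linear_light(2)] algebra_simps)
  note ad' = ad[unfolded adapted_def]
  have ab: "T a a a = 0" "T a a b = 1 / 3" "T a b b = 0" using ad' by auto
  have SU: "T a a (S i) = 0" "T a b (S i) = 0" if "i < m" for i using ad' that by auto
  have SU': "T a a (U i) = 0" "T a b (U i) = 0" if "i < k" for i using ad' that by auto
  have SS: "T b (S i) (S j) = (if i = j then - 1 / 3 else 0)" if "i < m" "j < m" for i j using ad' that by auto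
  have UU: "T a (U i) (U j) = (if i = j then - 1 / 3 else 0)" if "i < k" "j < k" for i j using ad' that by auto
  have Az: "T a a (A z) = 0" "T a b (A z) = 0" for z
    unfolding A_def using SU by (simp_all add: sym3_sum[OF T] sym3_simps[OF T])
  have Cz: "T a a (C z) = 0" "T a b (C z) = 0" for z
    unfolding C_def using SU' by (simp_all add: sym3_sum[OF T] sym3_simps[OF T])
  have SSz: "T b (A z) (A z') = (- 1 / 3) * (\<Sum>i<m. snd z $ e i * snd z' $ e i)" for z z'
    unfolding A_def by (rule sym3_diagonal[OF T SS])
  have UUz: "T a (C z) (C z') = (- 1 / 3) * (\<Sum>i<k. snd z $ e (m + i) * snd z' $ e (m + i))" for z z'
    unfolding C_def by (rule sym3_diagonal[OF T UU])
  have SCC: "3 * T (S i) (C z) (C z) = (\<Sum>j<k. snd z $ e (m + j) * (\<Sum>l<k. ?F i $$ (j, l) * snd z $ e (m + l)))" for i z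
  proof -
    have "3 * T (S i) (C z) (C z) = (\<Sum>j<k. 3 * (snd z $ e (m + j) * T (S i) (U j) (C z)))"
      unfolding C_def[of z] by (subst sym3_sum(2)[OF T]) (simp add: sym3_simps[OF T] sum_distrib_left)
    also have "\<dots> = (\<Sum>j<k. snd z $ e (m + j) * (\<Sum>l<k. ?F i $$ (j, l) * snd z $ e (m + l)))"
    proof (rule sum.cong[OF refl])
      fix j assume j: "j \<in> {..<k}"
      have "3 * T (S i) (U j) (C z) = (\<Sum>l<k. 3 * (snd z $ e (m + l) * T (S i) (U j) (U l)))"
        unfolding C_def[of z] by (subst sym3_sum(3)[OF T]) (simp add: sym3_simps[OF T] sum_distrib_left)
      also have "\<dots> = (\<Sum>l<k. ?F i $$ (j, l) * snd z $ e (m + l))"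
        using j by (intro sum.cong) (auto simp: normal_form_matrices_def)
      finally show "3 * (snd z $ e (m + j) * T (S i) (U j) (C z)) =
          snd z $ e (m + j) * (\<Sum>l<k. ?F i $$ (j, l) * snd z $ e (m + l))" by (simp add: mult.left_commute)
    qed
    finally show ?thesis .
  qed
  have zero_part: "3 * T (V2 z) (V2 z) (V4 z) + 3 * T (V2 z) (C z) (C z) = Tg z z z" for z
  proof -
    have "T (V2 z) (V2 z) (V4 z) = lY e z * ((lX e z)\<^sup>2 * T a a b + 2 * lX e z * T a b (A z) + T b (A z) (A z))"
      unfolding V2_def V4_def
      by (simp add: sym3_simps[OF T] sym3_commute[OF T] power2_eq_square algebra_simps)
    moreover have "T (V2 z) (C z) (C z) = lX e z * T a (C z) (C z) + (\<Sum>i<m. (snd z $ e i) * T (S i) (C z) (C z))"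
      unfolding V2_def A_def by (simp add: sym3_simps[OF T] sym3_sum(1)[OF T])
    moreover have "3 * (\<Sum>i<m. (snd z $ e i) * T (S i) (C z) (C z)) = (\<Sum>i<m. (snd z $ e i) * (3 * T (S i) (C z) (C z)))"
      by (simp add: sum_distrib_left mult_ac)
    ultimately show ?thesis
      using fun_cong[OF Tg(2), of z] poly_general_light[of e m ?F z, folded k]
      by (simp add: Az ab SSz UUz SCC power2_eq_square algebra_simps)
  qed
  have deg': "((l \<longlongrightarrow> 0) (at_left R) \<and> (\<forall>z. T (V2 z) (V4 z) (V4 z) = 0 \<and> T (V2 z) (V4 z) (C z) = 0 \<and>
         T (V4 z) (V4 z) (V4 z) = 0 \<and> T (V4 z) (V4 z) (C z) = 0 \<and> T (V4 z) (C z) (C z) = 0 \<and> T (C z) (C z) (C z) = 0)) \<or>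
       ((\<mu> \<longlongrightarrow> 0) (at_left R) \<and> (\<forall>z. T (V2 z) (V2 z) (V2 z) = 0 \<and> T (V2 z) (V2 z) (C z) = 0))"
    using deg
  proof
    assume "(l \<longlongrightarrow> 0) (at_left R) \<and> singular_end T k b U"
    then have l: "(l \<longlongrightarrow> 0) (at_left R)" and bb: "T b b z = 0" and bU: "j < k \<Longrightarrow> T b (U j) z = 0"
      and UUU: "i < k \<Longrightarrow> j < k \<Longrightarrow> r < k \<Longrightarrow> T (U i) (U j) (U r) = 0" for z i j r
      unfolding singular_end_def by blast+
    have bC: "T b (C z) y = 0" for z y unfolding C_def using bU by (simp add: sym3_sum[OF T] sym3_simps[OF T])
    have CCC: "T (C z) (C z) (C z) = 0" for z
      unfolding C_def using UUU by (simp add: sym3_sum[OF T] sym3_simps[OF T])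
    have "T (V2 z) (V4 z) (V4 z) = 0" "T (V2 z) (V4 z) (C z) = 0" "T (V4 z) (V4 z) (V4 z) = 0"
      "T (V4 z) (V4 z) (C z) = 0" "T (V4 z) (C z) (C z) = 0" for z
      using bb[of "V2 z"] bb[of b] bb[of "C z"] bC[of z "V2 z"] bC[of z "C z"]
        sym3_rotate(1)[OF T, of "V2 z" b b] sym3_rotate(1)[OF T, of "V2 z" b "C z"]
      by (simp_all add: V4_def sym3_simps[OF T])
    then show ?thesis using l CCC by blast
  next
    assume "(\<mu> \<longlongrightarrow> 0) (at_left R) \<and> regular_end T m k a S U"
    then have l: "(\<mu> \<longlongrightarrow> 0) (at_left R)" and aS: "i < m \<Longrightarrow> T a (S i) z = 0"
      and SSS: "i < m \<Longrightarrow> j < m \<Longrightarrow> r < m \<Longrightarrow> T (S i) (S j) (S r) = 0"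
      and SSU: "i < m \<Longrightarrow> j < m \<Longrightarrow> r < k \<Longrightarrow> T (S i) (S j) (U r) = 0" for z i j r
      unfolding regular_end_def by blast+
    have aA: "T a (A z) y = 0" for z y unfolding A_def using aS by (simp add: sym3_sum[OF T] sym3_simps[OF T])
    have AAA: "T (A z) (A z) (A z) = 0" for z
      unfolding A_def using SSS by (simp add: sym3_sum[OF T] sym3_simps[OF T])
    have AAC: "T (A z) (A z) (C z) = 0" for z
      unfolding A_def C_def using SSU by (simp add: sym3_sum[OF T] sym3_simps[OF T])
    have Aa: "T (A z) a y = 0" "T (A z) y a = 0" for z y
      using aA sym3_commute(1)[OF T, of "A z" a y] sym3_rotate(2)[OF T, of "A z" y a] by simp_all
    have "T (V2 z) (V2 z) (V2 z) = 0" "T (V2 z) (V2 z) (C z) = 0" for z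
      by (simp_all add: V2_def sym3_simps[OF T] ab aA Aa AAA AAC Az Cz)
    then show ?thesis using l by blast
  qed
  have inj: "inj (graded_sum V2 V4 C (l t) (\<mu> t))" for t
    unfolding linear_injective_0[OF graded_sum_linear[OF V Cl]]
  proof (intro allI impI)
    have l0: "l t \<noteq> 0" "\<mu> t \<noteq> 0" using lm[of t] by auto
    fix z assume "graded_sum V2 V4 C (l t) (\<mu> t) z = 0"
    then have z: "(l t)\<^sup>2 *\<^sub>R (lX e z *\<^sub>R a + A z) + \<mu> t ^ 4 *\<^sub>R (lY e z *\<^sub>R b) + \<mu> t *\<^sub>R C z = 0"
      by (simp add: graded_sum_def V2_def V4_def)
    have "T a a ((l t)\<^sup>2 *\<^sub>R (lX e z *\<^sub>R a + A z) + \<mu> t ^ 4 *\<^sub>R (lY e z *\<^sub>R b) + \<mu> t *\<^sub>R C z) = \<mu> t ^ 4 * lY e z / 3"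
      by (simp add: sym3_simps[OF T] ab Az Cz)
    then have Y0: "lY e z = 0" using l0 unfolding z by (simp add: sym3_simps[OF T])
    have aba: "T a b a = 1 / 3" using ab(2) sym3_commute(2)[OF T, of a b a] by simp
    have "T a b ((l t)\<^sup>2 *\<^sub>R (lX e z *\<^sub>R a + A z) + \<mu> t ^ 4 *\<^sub>R (lY e z *\<^sub>R b) + \<mu> t *\<^sub>R C z) = (l t)\<^sup>2 * lX e z / 3"
      by (simp add: sym3_simps[OF T] ab aba Az Cz)
    then have X0: "lX e z = 0" using l0 unfolding z by (simp add: sym3_simps[OF T])
    have z0: "(l t)\<^sup>2 *\<^sub>R A z + \<mu> t *\<^sub>R C z = 0" using z X0 Y0 by simp
    have sq: "(\<Sum>i<r. x i * x i) = 0 \<Longrightarrow> i < r \<Longrightarrow> x i = 0" for r i :: nat and x :: "nat \<Rightarrow> real"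
      by (subst (asm) sum_nonneg_eq_0_iff) auto
    have su: "(\<forall>i<m. snd z $ e i = 0) \<and> (\<forall>j<k. snd z $ e (m + j) = 0)"
      using deg
    proof
      assume "(l \<longlongrightarrow> 0) (at_left R) \<and> singular_end T k b U"
      then have "T b (U j) y = 0" if "j < k" for j y using that unfolding singular_end_def by blast
      then have bC: "T b y (C z) = 0" for y
        unfolding C_def sym3_sum(3)[OF T] sym3_simps[OF T] sym3_commute(2)[OF T, of b y]
        by (intro sum.neutral) simp
      have "T b (A z) ((l t)\<^sup>2 *\<^sub>R A z + \<mu> t *\<^sub>R C z) = (l t)\<^sup>2 * T b (A z) (A z)"
        by (simp add: sym3_simps[OF T] bC)
      then have "(\<Sum>i<m. snd z $ e i * snd z $ e i) = 0" using l0 unfolding z0 SSz by (simp add: sym3_simps[OF T])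
      from sq[OF this] have s0: "snd z $ e i = 0" if "i < m" for i using that .
      then have "A z = 0" by (simp add: A_def)
      then have "C z = 0" using z0 l0 by simp
      then have "(\<Sum>i<k. snd z $ e (m + i) * snd z $ e (m + i)) = 0" using UUz[of z z] by (simp add: sym3_simps[OF T])
      from sq[OF this] s0 show ?thesis by blast
    next
      assume "(\<mu> \<longlongrightarrow> 0) (at_left R) \<and> regular_end T m k a S U"
      then have "T a (S j) y = 0" if "j < m" for j y using that unfolding regular_end_def by blast
      then have aA: "T a y (A z) = 0" for y
        unfolding A_def sym3_sum(3)[OF T] sym3_simps[OF T] sym3_commute(2)[OF T, of a y]
        by (intro sum.neutral) simp
      have "T a (C z) ((l t)\<^sup>2 *\<^sub>R A z + \<mu> t *\<^sub>R C z) = \<mu> t * T a (C z) (C z)"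
        by (simp add: sym3_simps[OF T] aA)
      then have "(\<Sum>i<k. snd z $ e (m + i) * snd z $ e (m + i)) = 0" using l0 unfolding z0 UUz by (simp add: sym3_simps[OF T])
      from sq[OF this] have u0: "snd z $ e (m + i) = 0" if "i < k" for i using that .
      then have "C z = 0" by (simp add: C_def)
      then have "A z = 0" using z0 l0 by simp
      then have "(\<Sum>i<m. snd z $ e i * snd z $ e i) = 0" using SSz[of z z] by (simp add: sym3_simps[OF T])
      from sq[OF this] u0 show ?thesis by blast
    qed
    have "lX e z - lY e z = sqrt 3 * lw e z" by (simp add: lX_def lY_def field_simps)
    then have w0: "lw e z = 0" using X0 Y0 by simp
    then have "fst z = 0" using X0 by (simp add: lX_def)
    moreover have "snd z \<bullet> snd z = 0"
      using su w0 unfolding inner_enumerated[OF e m] k[symmetric] lw_def by simp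
    ultimately show "z = 0" by (simp add: prod_eq_iff)
  qed
  have lp: "lX e (light_point e x y) = x" "lY e (light_point e x y) = y" "A (light_point e x y) = 0" "C (light_point e x y) = 0" for x y
  proof -
    have w: "lw e (light_point e x y) = (x - y) / sqrt 3" by (simp add: lw_def light_point_def)
    show "lX e (light_point e x y) = x" "lY e (light_point e x y) = y"
      unfolding lX_def lY_def w by (simp_all add: light_point_def field_simps)
    have ne: "e i \<noteq> e (CARD('n) - 1)" if "i < m + k" for i
      using enumerated_eq_iff[OF e, of i "CARD('n) - 1"] that N by auto
    show "A (light_point e x y) = 0" "C (light_point e x y) = 0"
      unfolding A_def C_def light_point_def using ne by (auto simp: axis_def intro!: sum.neutral)
  qed
  define q where "q t = light_point e (X t) (Y t)" for t
  have axl: "bounded_linear (\<lambda>x. axis (e (CARD('n) - 1)) x :: real ^ 'n)"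
    unfolding linear_conv_bounded_linear[symmetric]
    by (auto simp: linear_iff axis_def Finite_Cartesian_Product.vec_eq_iff)
  have qsm: "Cinf_on W q"
  proof -
    have "Cinf_on W (\<lambda>t. ((2 * X t + Y t) * (1 / 3)) *\<^sub>R (1, 0) + ((X t - Y t) * (1 / sqrt 3)) *\<^sub>R (0, axis (e (CARD('n) - 1)) 1) :: real \<times> (real ^ 'n))"
      by (intro Cinf_add Cinf_scaleR Cinf_mult Cinf_diff Cinf_const W(1) sm)
    moreover have "(\<lambda>t. ((2 * X t + Y t) * (1 / 3)) *\<^sub>R (1, 0) + ((X t - Y t) * (1 / sqrt 3)) *\<^sub>R (0, axis (e (CARD('n) - 1)) 1)) = q"
      by (auto simp: q_def light_point_def axis_def Finite_Cartesian_Product.vec_eq_iff fun_eq_iff)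
    ultimately show ?thesis by simp
  qed
  have "limit_polynomial (\<lambda>z. T z z z) p v (\<lambda>z. Tg z z z)"
  proof (rule degeneration_limit[where ?V2.0 = V2 and ?V4.0 = V4 and ?V1.0 = C and l = l and m = \<mu> and U = W and q = q,
        OF T Tg(1) V Cl zero_part deg' W sm(1,2) qsm lm inj hyp _ _ _ R])
    show "fst (q t) \<noteq> 0" if "t \<in> W" for t using XY(3)[OF that] by (simp add: q_def light_point_def)
    have "(q \<longlongrightarrow> ((2 * 1 + 1) / 3, axis (e (CARD('n) - 1)) ((1 - 1) / sqrt 3))) (at_left R)"
      unfolding q_def light_point_def
      by (intro tendsto_Pair tendsto_divide tendsto_add tendsto_mult tendsto_diff tendsto_const XY(1,2)
          bounded_linear.tendsto[OF axl]) auto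
    then show "(q \<longlongrightarrow> (1, 0)) (at_left R)" by (simp add: axis_eq_0_iff[THEN iffD2])
    show "graded_sum V2 V4 C (l t) (\<mu> t) (q t) = limit_curve (\<lambda>z. T z z z) p v t" if "t \<in> W" for t
      unfolding XY(4)[OF that] graded_sum_def V2_def V4_def q_def lp by simp
  qed
  then show ?thesis unfolding Tg(2) .
qed

section \<open>Boundary points of the cone\<close>

text \<open>Orthonormalize an ordinary basis of S for B.\<close>
lemma posdef_orthonormal_family:
  fixes B :: "'a::euclidean_space \<Rightarrow> 'a \<Rightarrow> real"
  assumes B: "sym_form B" and S: "subspace S" and pos: "\<And>x. x \<in> S \<Longrightarrow> x \<noteq> 0 \<Longrightarrow> 0 < B x x"
  obtains f :: "nat \<Rightarrow> 'a" where "\<And>i. i < dim S \<Longrightarrow> f i \<in> S"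
    "\<And>i j. i < dim S \<Longrightarrow> j < dim S \<Longrightarrow> B (f i) (f j) = (if i = j then 1 else 0)"
proof -
  obtain Bs :: "'a set" and l where Bs: "Bs \<subseteq> S" "finite Bs" "pairwise Linear_Algebra.orthogonal Bs"
    "\<forall>b\<in>Bs. norm b = 1" "span Bs = S" "\<forall>b\<in>Bs. \<forall>w\<in>S. B b w = l b * (b \<bullet> w)"
    using sym_form_orthonormal_eigenbasis[OF B S] by (elim exE conjE) (rule that)
  have "0 \<notin> Bs" using Bs(4) by auto
  then have ind: "independent Bs" using Bs(3) by (simp add: pairwise_orthogonal_independent)
  have card: "card Bs = dim S" using dim_span_eq_card_independent[OF ind] Bs(5) by simp
  obtain g where g: "bij_betw g {0..<dim S} Bs"
    using ex_bij_betw_nat_finite[OF Bs(2)] unfolding card by blast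
  have gB: "g i \<in> Bs" if "i < dim S" for i using g that by (auto simp: bij_betw_def)
  have ginj: "g i = g j \<longleftrightarrow> i = j" if "i < dim S" "j < dim S" for i j
    using g that by (auto simp: bij_betw_def inj_on_def)
  have lpos: "0 < l b" if "b \<in> Bs" for b
  proof -
    have "b \<in> S" "b \<noteq> 0" using that Bs(1) \<open>0 \<notin> Bs\<close> by auto
    then have "0 < l b * (b \<bullet> b)" using pos[of b] Bs(6) that by simp
    then show ?thesis using Bs(4) that by (simp add: dot_square_norm)
  qed
  define f where "f i = (1 / sqrt (l (g i))) *\<^sub>R g i" for i
  show thesis
  proof (rule that[of f])
    show "f i \<in> S" if "i < dim S" for i
      using gB[OF that] Bs(1) S by (auto simp: f_def intro: subspace_scale)
    show "B (f i) (f j) = (if i = j then 1 else 0)" if ij: "i < dim S" "j < dim S" for i j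
    proof -
      have "B (g i) (g j) = l (g i) * (g i \<bullet> g j)" using Bs(1,6) gB ij by blast
      moreover have "g i \<bullet> g j = (if i = j then 1 else 0)"
        using Bs(3,4) gB[OF ij(1)] gB[OF ij(2)] ginj[OF ij]
        by (auto simp: pairwise_def Linear_Algebra.orthogonal_def dot_square_norm)
      ultimately show ?thesis using lpos[OF gB[OF ij(1)]]
        by (auto simp: f_def sym_form_simps[OF B])
    qed
  qed
qed

text \<open>The radical of P on Z is orthonormalized by C, and a complement of it by P.\<close>
lemma semidefinite_split:
  fixes P C :: "'a::euclidean_space \<Rightarrow> 'a \<Rightarrow> real"
  assumes P: "sym_form P" and C: "sym_form C" and Z: "subspace Z"
    and psd: "\<And>z. z \<in> Z \<Longrightarrow> 0 \<le> P z z" and ker: "\<And>z. z \<in> Z \<Longrightarrow> P z z = 0 \<Longrightarrow> z \<noteq> 0 \<Longrightarrow> 0 < C z z"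
  obtains r s :: nat and f g :: "nat \<Rightarrow> 'a" where "r + s = dim Z"
    "\<And>i. i < r \<Longrightarrow> f i \<in> Z" "\<And>i z. i < r \<Longrightarrow> z \<in> Z \<Longrightarrow> P (f i) z = 0"
    "\<And>i j. i < r \<Longrightarrow> j < r \<Longrightarrow> C (f i) (f j) = (if i = j then 1 else 0)"
    "\<And>i. i < s \<Longrightarrow> g i \<in> Z" "\<And>i j. i < s \<Longrightarrow> j < s \<Longrightarrow> P (g i) (g j) = (if i = j then 1 else 0)"
proof -
  define K where "K = {z \<in> Z. P z z = 0}"
  have Kz: "P x z = 0" if "x \<in> K" "z \<in> Z" for x z
    using psd_kernel[OF P Z psd _ _ that(2)] that(1) by (simp add: K_def)
  have K: "subspace K"
    unfolding subspace_def
  proof (intro conjI ballI allI)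
    show "0 \<in> K" using subspace_0[OF Z] by (simp add: K_def sym_form_simps[OF P])
    show "x + y \<in> K" if "x \<in> K" "y \<in> K" for x y
      using that Kz[OF that(1), of y] Kz[OF that(2), of x] Kz[OF that(1), of x] Kz[OF that(2), of y]
        subspace_add[OF Z, of x y] by (simp add: K_def sym_form_simps[OF P])
    show "c *\<^sub>R x \<in> K" if "x \<in> K" for c x
      using that subspace_scale[OF Z, of x c] by (simp add: K_def sym_form_simps[OF P])
  qed
  have KZ: "K \<subseteq> Z" by (auto simp: K_def)
  define W where "W = {y \<in> Z. \<forall>x\<in>K. Linear_Algebra.orthogonal x y}"
  have W: "subspace W"
    using Z unfolding W_def subspace_def by (auto simp: Linear_Algebra.orthogonal_def inner_simps)
  have dims: "dim W + dim K = dim Z"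
    unfolding W_def by (rule dim_subspace_orthogonal_to_vectors[OF K Z KZ])
  have Cpos: "0 < C x x" if "x \<in> K" "x \<noteq> 0" for x using that ker by (simp add: K_def)
  have Ppos: "0 < P x x" if x: "x \<in> W" "x \<noteq> 0" for x
  proof -
    have "x \<in> Z" using x by (simp add: W_def)
    moreover have "P x x \<noteq> 0"
    proof
      assume "P x x = 0"
      then have "x \<in> K" using x by (simp add: K_def W_def)
      then have "x \<bullet> x = 0" using x(1) unfolding W_def Linear_Algebra.orthogonal_def by blast
      then show False using x(2) by simp
    qed
    ultimately show ?thesis using psd[of x] by simp
  qed
  obtain f :: "nat \<Rightarrow> 'a" where f: "\<And>i. i < dim K \<Longrightarrow> f i \<in> K"
    "\<And>i j. i < dim K \<Longrightarrow> j < dim K \<Longrightarrow> C (f i) (f j) = (if i = j then 1 else 0)"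
    by (rule posdef_orthonormal_family[OF C K Cpos]) (assumption | rule that)+
  obtain g :: "nat \<Rightarrow> 'a" where g: "\<And>i. i < dim W \<Longrightarrow> g i \<in> W"
    "\<And>i j. i < dim W \<Longrightarrow> j < dim W \<Longrightarrow> P (g i) (g j) = (if i = j then 1 else 0)"
    by (rule posdef_orthonormal_family[OF P W Ppos]) (assumption | rule that)+
  show thesis
    by (rule that[of "dim K" "dim W" f g])
       (use dims f g Kz KZ in \<open>auto simp: W_def\<close>)
qed

text \<open>The two functionals are independent, as their values on a and b show.\<close>
lemma dim_two_functionals:
  fixes T :: "'a::euclidean_space \<Rightarrow> 'a \<Rightarrow> 'a \<Rightarrow> real"
  assumes T: "sym3 T" and ab: "T a a a = 0" "T a a b = 1 / 3" "T a b b = 0"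
  shows "subspace {z. T a a z = 0 \<and> T a b z = 0}" "dim {z. T a a z = 0 \<and> T a b z = 0} = DIM('a) - 2"
proof -
  define \<alpha> where "\<alpha> = (\<Sum>i\<in>Basis. T a a i *\<^sub>R i)"
  define \<beta> where "\<beta> = (\<Sum>i\<in>Basis. T a b i *\<^sub>R i)"
  have al: "\<alpha> \<bullet> z = T a a z" "\<beta> \<bullet> z = T a b z" for z
    using sym3_expand1(3)[OF T, of a a z] sym3_expand1(3)[OF T, of a b z]
    unfolding \<alpha>_def \<beta>_def inner_sum_left inner_scaleR_left
    by (simp_all add: inner_commute[of _ z] mult.commute)
  have aba: "T a b a = 1 / 3" using ab(2) sym3_commute(2)[OF T, of a b a] by simp
  have b0: "\<beta> \<noteq> 0" using al(2)[of a] aba by auto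
  have a_notin: "\<alpha> \<notin> span {\<beta>}"
  proof
    assume "\<alpha> \<in> span {\<beta>}"
    then obtain c where "\<alpha> = c *\<^sub>R \<beta>" by (auto simp: span_singleton)
    then have "T a a b = c * T a b b" using al(1)[of b] al(2)[of b] by simp
    then show False using ab by simp
  qed
  then have ne: "\<alpha> \<noteq> \<beta>" using span_base[of \<beta> "{\<beta>}"] by auto
  have ind: "independent {\<alpha>, \<beta>}" using a_notin b0 ne by (simp add: independent_insert)
  have eq: "{z. T a a z = 0 \<and> T a b z = 0} = {y \<in> UNIV. \<forall>x\<in>span {\<alpha>, \<beta>}. Linear_Algebra.orthogonal x y}"
  proof -
    have "(\<forall>x\<in>span {\<alpha>, \<beta>}. Linear_Algebra.orthogonal x y) \<longleftrightarrow> \<alpha> \<bullet> y = 0 \<and> \<beta> \<bullet> y = 0" for y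
    proof
      show "\<alpha> \<bullet> y = 0 \<and> \<beta> \<bullet> y = 0" if "\<forall>x\<in>span {\<alpha>, \<beta>}. Linear_Algebra.orthogonal x y"
        using that by (auto simp: Linear_Algebra.orthogonal_def intro: span_base)
      show "\<forall>x\<in>span {\<alpha>, \<beta>}. Linear_Algebra.orthogonal x y" if "\<alpha> \<bullet> y = 0 \<and> \<beta> \<bullet> y = 0"
      proof
        fix x assume "x \<in> span {\<alpha>, \<beta>}"
        then obtain c d where "x = c *\<^sub>R \<alpha> + d *\<^sub>R \<beta>" by (auto simp: span_insert span_singleton algebra_simps)
        then show "Linear_Algebra.orthogonal x y" using that by (simp add: Linear_Algebra.orthogonal_def inner_simps)
      qed
    qed
    then show ?thesis by (simp add: al)
  qed
  show "subspace {z. T a a z = 0 \<and> T a b z = 0}"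
    by (auto simp: subspace_def sym3_simps[OF T])
  have "dim {z. T a a z = 0 \<and> T a b z = 0} + dim (span {\<alpha>, \<beta>}) = dim (UNIV :: 'a set)"
    unfolding eq by (rule dim_subspace_orthogonal_to_vectors) auto
  moreover have "dim (span {\<alpha>, \<beta>}) = 2"
    using dim_span_eq_card_independent[OF ind] ne by simp
  ultimately show "dim {z. T a a z = 0 \<and> T a b z = 0} = DIM('a) - 2" by simp
qed

lemma sign_of_perturbation:
  fixes x y e0 :: real
  assumes "0 < e0" "\<And>e. 0 < e \<Longrightarrow> e < e0 \<Longrightarrow> x + e * y < 0"
  shows "x \<le> 0" "x = 0 \<Longrightarrow> y < 0"
proof -
  have lim: "((\<lambda>e. x + e * y) \<longlongrightarrow> x + 0 * y) (at_right 0)" by (intro tendsto_intros)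
  have ev: "\<forall>\<^sub>F e in at_right 0. x + e * y \<le> 0"
    using assms by (auto simp: eventually_at_right_field intro!: exI[of _ e0] less_imp_le)
  show "x \<le> 0" using tendsto_upperbound[OF lim ev trivial_limit_at_right_real] by simp
  show "y < 0" if "x = 0"
    using assms(2)[of "e0 / 2"] assms(1) that by (simp add: mult_less_0_iff)
qed

lemma zero_on_subspace_polar:
  assumes T: "sym3 T" and K: "subspace K" "\<And>x. x \<in> K \<Longrightarrow> T x x x = 0" and "a \<in> K" "b \<in> K" "c \<in> K"
  shows "T a b c = 0"
  by (subst sym3_polar[OF T]) (simp add: K assms(4-6) subspace_add[OF K(1)])

text \<open>The point a + e b lies in the cone, and z is tangent to the level set of h through it.\<close>
lemma regular_semidefinite:
  assumes T: "std3 T" "cubic_bound T" and ab: "T a a a = 0" "T a a b = 1 / 3" "T a b b = 0"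
    and z: "T a a z = 0" "T a b z = 0" "z \<noteq> 0" and e: "0 < e" "a + e *\<^sub>R b \<in> hyp_cone T"
  shows "T a z z + e * T b z z < 0"
proof -
  note s = std3_sym3[OF T(1)]
  define c where "c = - (3 * e / 2) * T b b z"
  define z' where "z' = z + c *\<^sub>R a"
  have "z' \<noteq> 0"
  proof
    assume "z' = 0"
    then have "T a b z' = 0" by (simp add: sym3_simps[OF s])
    then have "c = 0" using ab z by (simp add: z'_def sym3_simps[OF s] sym3_commute[OF s])
    then show False using \<open>z' = 0\<close> z(3) by (simp add: z'_def)
  qed
  moreover have "T (a + e *\<^sub>R b) (a + e *\<^sub>R b) z' = 0"
    using ab z by (simp add: z'_def c_def sym3_simps[OF s] sym3_commute[OF s] power2_eq_square algebra_simps)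
  ultimately have "T (a + e *\<^sub>R b) z' z' < 0"
    using hyp_cone_hyp[OF T e(2)] unfolding hyp_def by blast
  moreover have "T (a + e *\<^sub>R b) z' z' = T a z z + e * T b z z + c\<^sup>2 * (e / 3)"
    using ab z by (simp add: z'_def sym3_simps[OF s] sym3_commute[OF s] power2_eq_square algebra_simps)
  moreover have "0 \<le> c\<^sup>2 * (e / 3)" using e by simp
  ultimately show ?thesis by linarith
qed

lemma open_timelike: "open {p :: real \<times> 'b::real_normed_vector. norm (snd p) < sqrt 3 * fst p}"
  by (intro open_Collect_less continuous_intros)

lemma timelike_nearby:
  fixes a x :: "real \<times> 'b::real_normed_vector"
  assumes "norm (snd a) < sqrt 3 * fst a"
  shows "\<forall>\<^sub>F t in at_right 0. norm (snd (a + t *\<^sub>R x)) < sqrt 3 * fst (a + t *\<^sub>R x)"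
    "\<forall>\<^sub>F t in at_left 0. norm (snd (a + t *\<^sub>R x)) < sqrt 3 * fst (a + t *\<^sub>R x)"
proof -
  have lim: "((\<lambda>t. a + t *\<^sub>R x) \<longlongrightarrow> a + 0 *\<^sub>R x) (at 0)" by (intro tendsto_intros)
  have mem: "a + 0 *\<^sub>R x \<in> {p. norm (snd p) < sqrt 3 * fst p}" using assms by simp
  note ev = topological_tendstoD[OF lim open_timelike mem, unfolded eventually_at_split mem_Collect_eq]
  show "\<forall>\<^sub>F t in at_right 0. norm (snd (a + t *\<^sub>R x)) < sqrt 3 * fst (a + t *\<^sub>R x)"
    by (rule conjunct2[OF ev])
  show "\<forall>\<^sub>F t in at_left 0. norm (snd (a + t *\<^sub>R x)) < sqrt 3 * fst (a + t *\<^sub>R x)"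
    by (rule conjunct1[OF ev])
qed

lemma signed_small:
  assumes "\<forall>\<^sub>F t in at_right (0::real). P t" "\<forall>\<^sub>F t in at_left (0::real). P t" "d \<noteq> (0::real)"
  obtains t where "0 < t * d" "P t"
proof (cases "0 < d")
  case True
  from eventually_happens[OF eventually_conj[OF assms(1) eventually_at_right_less[of 0]]] obtain t where "P t" "0 < t"
    by (auto simp: trivial_limit_at_right_real)
  then show thesis by (intro that[of t]) (use True in simp_all)
next
  case False
  have "\<forall>\<^sub>F t in at_left (0::real). t < 0" by (auto simp: eventually_at_left_field intro: exI[of _ "-1"])
  from eventually_happens[OF eventually_conj[OF assms(2) this]] obtain t where "P t" "t < 0"
    by (auto simp: trivial_limit_at_left_real)
  then show thesis by (intro that[of t]) (use False assms(3) in \<open>simp_all add: mult_neg_neg\<close>)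
qed

text \<open>If T x x x were not zero, moving from a by a small multiple of x with the right sign would lead
  into the cone. There a would be tangent, but it is a null vector, contrary to hyperbolicity.\<close>
lemma regular_cube_zero:
  assumes T: "std3 T" "cubic_bound T" and a: "T a a a = 0" "a \<noteq> 0" "norm (snd a) < sqrt 3 * fst a"
    and x: "T a a x = 0" "T a x x = 0"
  shows "T x x x = 0"
proof (rule ccontr)
  note s = std3_sym3[OF T(1)]
  assume ne: "T x x x \<noteq> 0"
  obtain t where t: "0 < t * T x x x" "norm (snd (a + t *\<^sub>R x)) < sqrt 3 * fst (a + t *\<^sub>R x)"
    using signed_small[OF timelike_nearby[OF a(3), of x] ne] by blast
  have "T (a + t *\<^sub>R x) (a + t *\<^sub>R x) (a + t *\<^sub>R x) = t\<^sup>2 * (t * T x x x)"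
    using a x by (simp add: sym3_simps[OF s] sym3_commute[OF s] power2_eq_square)
  moreover have "t \<noteq> 0" using t by auto
  ultimately have "a + t *\<^sub>R x \<in> hyp_cone T" using t by (simp add: hyp_cone_def)
  from hyp_cone_hyp[OF T this] have "T (a + t *\<^sub>R x) (a + t *\<^sub>R x) a = 0 \<longrightarrow> T (a + t *\<^sub>R x) a a < 0"
    using a(2) unfolding hyp_def by blast
  then show False using a x by (simp add: sym3_simps[OF s] sym3_commute[OF s])
qed

text \<open>Start at a + l x, a zero of h inside the light cone, and move by t z with t * T x x z positive and
  small. This leads into the cone, to a point q with T q x x = t * T x x z > 0. A multiple of the null vector a
  corrects x to a tangent vector at q without changing this value, contrary to hyperbolicity.\<close>
lemma regular_mixed_zero:
  assumes T: "std3 T" "cubic_bound T" and a: "T a a a = 0" "norm (snd a) < sqrt 3 * fst a"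
    and x: "T a a x = 0" "T a x x = 0" "T x x x = 0" and z: "T a a z = 0" "T a x z = 0" "T a z z \<noteq> 0"
    and ind: "\<And>c. x + c *\<^sub>R a \<noteq> 0"
  shows "T x x z = 0"
proof (rule ccontr)
  note s = std3_sym3[OF T(1)]
  assume ne: "T x x z \<noteq> 0"
  obtain l where l: "0 < l * 1" "norm (snd (a + l *\<^sub>R x)) < sqrt 3 * fst (a + l *\<^sub>R x)"
    using signed_small[OF timelike_nearby[OF a(2), of x], of 1] by auto
  define D where "D = T x x z"
  define g where "g t = 3 * l\<^sup>2 * (t * D) + t\<^sup>2 * (3 * T a z z + 3 * l * T x z z + t * T z z z)" for t
  have hg: "T (a + l *\<^sub>R x + t *\<^sub>R z) (a + l *\<^sub>R x + t *\<^sub>R z) (a + l *\<^sub>R x + t *\<^sub>R z) = g t" for t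
    using a x z by (simp add: g_def D_def sym3_simps[OF s] sym3_commute[OF s] power2_eq_square algebra_simps)
  have lim: "((\<lambda>t. 3 * l\<^sup>2 * (D * D) + t * D * (3 * T a z z + 3 * l * T x z z + t * T z z z)) \<longlongrightarrow>
      3 * l\<^sup>2 * (D * D) + 0 * D * (3 * T a z z + 3 * l * T x z z + 0 * T z z z)) (at 0)"
    by (intro tendsto_intros)
  have "0 < D * D" using ne by (simp add: D_def flip: power2_eq_square)
  then have "0 < 3 * l\<^sup>2 * (D * D)" using l by simp
  then have ev: "\<forall>\<^sub>F t in at 0. 0 < 3 * l\<^sup>2 * (D * D) + t * D * (3 * T a z z + 3 * l * T x z z + t * T z z z)"
    using order_tendstoD(1)[OF lim, of 0] by simp
  have gD: "g t * (D * D) = t * D * (3 * l\<^sup>2 * (D * D) + t * D * (3 * T a z z + 3 * l * T x z z + t * T z z z))" for t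
    by (simp add: g_def power2_eq_square algebra_simps)
  have 1: "\<forall>\<^sub>F t in at_right 0. norm (snd (a + l *\<^sub>R x + t *\<^sub>R z)) < sqrt 3 * fst (a + l *\<^sub>R x + t *\<^sub>R z) \<and>
      0 < 3 * l\<^sup>2 * (D * D) + t * D * (3 * T a z z + 3 * l * T x z z + t * T z z z)"
    using timelike_nearby(1)[OF l(2), of z] ev by (auto simp: eventually_at_split intro: eventually_conj)
  have 2: "\<forall>\<^sub>F t in at_left 0. norm (snd (a + l *\<^sub>R x + t *\<^sub>R z)) < sqrt 3 * fst (a + l *\<^sub>R x + t *\<^sub>R z) \<and>
      0 < 3 * l\<^sup>2 * (D * D) + t * D * (3 * T a z z + 3 * l * T x z z + t * T z z z)"
    using timelike_nearby(2)[OF l(2), of z] ev by (auto simp: eventually_at_split intro: eventually_conj)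
  have D0: "D \<noteq> 0" using ne by (simp add: D_def)
  obtain t where t: "0 < t * D" "norm (snd (a + l *\<^sub>R x + t *\<^sub>R z)) < sqrt 3 * fst (a + l *\<^sub>R x + t *\<^sub>R z)"
      "0 < 3 * l\<^sup>2 * (D * D) + t * D * (3 * T a z z + 3 * l * T x z z + t * T z z z)"
    using signed_small[OF 1 2 D0] by blast
  define q where "q = a + l *\<^sub>R x + t *\<^sub>R z"
  have "0 < g t * (D * D)" unfolding gD using t by simp
  then have "0 < g t" using D0 by (simp add: zero_less_mult_iff)
  then have q: "q \<in> hyp_cone T" using t(2) hg[of t] by (simp add: hyp_cone_def q_def)
  have t0: "t \<noteq> 0" using t(1) by auto
  have qqa: "T q q a = t\<^sup>2 * T a z z"
    using a x z by (simp add: q_def sym3_simps[OF s] sym3_commute[OF s] power2_eq_square algebra_simps)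
  define c where "c = - T q q x / T q q a"
  have "T q q (x + c *\<^sub>R a) = 0"
    using qqa t0 z(3) by (simp add: sym3_simps[OF s] c_def)
  then have "T q (x + c *\<^sub>R a) (x + c *\<^sub>R a) < 0" using hyp_cone_hyp[OF T q] ind unfolding hyp_def by blast
  moreover have "T q (x + c *\<^sub>R a) (x + c *\<^sub>R a) = t * D"
    using a x z by (simp add: q_def D_def sym3_simps[OF s] sym3_commute[OF s])
  ultimately show False using t(1) by simp
qed

lemma singular_semidefinite:
  assumes T: "std3 T" "cubic_bound T" and bb: "\<And>z. T b b z = 0"
    and z: "T a a z = 0" "T a b z = 0" "z \<noteq> 0" and e: "b + e *\<^sub>R a \<in> hyp_cone T"
  shows "T b z z + e * T a z z < 0"
proof -
  note s = std3_sym3[OF T(1)]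
  have "T (b + e *\<^sub>R a) (b + e *\<^sub>R a) z = 0"
    using bb[of z] z by (simp add: sym3_simps[OF s] sym3_commute[OF s])
  then have "T (b + e *\<^sub>R a) z z < 0"
    using hyp_cone_hyp[OF T e] z(3) unfolding hyp_def by blast
  then show ?thesis by (simp add: sym3_simps[OF s])
qed

text \<open>Test the point q = b + l u + \<nu> a, where l is small, has the sign of T u u u, and \<nu> is a
  multiple of l ^ 2. The term in a makes q timelike, while \<nu> is too small to compete with the cube of u, so
  q lies in the cone. The vector u, made tangent by a multiple of b, then has T q u u of the wrong sign.\<close>
lemma singular_cube_zero:
  fixes T :: "real \<times> 'b::euclidean_space \<Rightarrow> real \<times> 'b \<Rightarrow> real \<times> 'b \<Rightarrow> real"
  assumes T: "std3 T" "cubic_bound T" and ab: "T a a a = 0" "T a a b = 1 / 3" and bb: "\<And>z. T b b z = 0"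
    and e: "(1, 0) = \<xi> *\<^sub>R a + \<eta> *\<^sub>R b" "0 < \<xi>" "0 < \<eta>"
    and u: "T a a u = 0" "T a b u = 0" "T b u u = 0"
  shows "T u u u = 0"
proof (rule ccontr)
  note s = std3_sym3[OF T(1)]
  assume ne: "T u u u \<noteq> 0"
  define D where "D = T u u u"
  define A where "A = T a u u"
  \<comment> \<open>Large enough for the term in a to outweigh T a u u, whatever its sign.\<close>
  define K where "K = 2 * \<bar>A\<bar> + 1"
  have K: "1 \<le> K" by (simp add: K_def)
  define \<epsilon> where "\<epsilon> = \<bar>D\<bar> / (2 * (3 * K * \<bar>A\<bar> + 1))"
  have \<epsilon>: "0 < \<epsilon>" using ne K by (simp add: \<epsilon>_def D_def add_nonneg_pos)
  have "\<epsilon> * (3 * K * \<bar>A\<bar> + 1) = \<bar>D\<bar> / 2"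
    using K by (simp add: \<epsilon>_def field_simps add_nonneg_eq_0_iff)
  then have small: "\<epsilon> * (3 * K * \<bar>A\<bar>) < \<bar>D\<bar>" using \<epsilon> ne by (simp add: D_def algebra_simps)
  define l where "l = sgn D * \<epsilon>"
  have lD: "l * D = \<epsilon> * \<bar>D\<bar>" by (simp add: l_def sgn_mult_abs[symmetric] abs_sgn mult_ac)
  have l2: "l\<^sup>2 = \<epsilon>\<^sup>2" using ne by (simp add: l_def power_mult_distrib D_def sgn_if)
  have l0: "l \<noteq> 0" using \<epsilon> ne by (auto simp: l_def D_def sgn_if)
  define \<nu> where "\<nu> = K * l\<^sup>2"
  have \<nu>: "0 < \<nu>" using K l0 by (simp add: \<nu>_def)
  define q where "q = b + l *\<^sub>R u + \<nu> *\<^sub>R a"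
  have aba: "T a b a = 1 / 3" using ab(2) sym3_commute(2)[OF s, of a b a] by simp
  have tim: "T q q (1, 0) = \<xi> * (l\<^sup>2 * A + 2 * \<nu> / 3) + \<eta> * \<nu>\<^sup>2 / 3"
    unfolding e(1) q_def using ab u bb[of a] bb[of u] bb[of b]
    by (simp add: sym3_simps[OF s] sym3_commute[OF s] A_def power2_eq_square algebra_simps ab(2))
  have "0 < A + 2 * K / 3" by (cases "0 \<le> A") (simp_all add: K_def field_simps)
  then have "0 < l\<^sup>2 * (A + 2 * K / 3)" using l0 by (intro mult_pos_pos) auto
  then have "0 < l\<^sup>2 * A + 2 * \<nu> / 3" by (simp add: \<nu>_def algebra_simps)
  then have "0 < T q q (1, 0)" unfolding tim using e(2,3) \<nu> by (intro add_pos_nonneg) auto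
  moreover have "T q q (1, 0) = (fst q)\<^sup>2 - (snd q \<bullet> snd q) / 3"
    using std3_bilinear[OF T(1), of "fst q" "snd q" "fst q" "snd q"] by (simp add: power2_eq_square)
  ultimately have n: "(norm (snd q))\<^sup>2 < 3 * (fst q)\<^sup>2" by (simp add: dot_square_norm)
  have fstT: "fst z = T (1, 0) (1, 0) z" for z
    using std3_bilinear[OF T(1), of 1 0 "fst z" "snd z"] sym3_commute(2)[OF s, of "(1, 0)" z "(1, 0)"] by simp
  have "fst q = (\<xi>\<^sup>2 + 2 * \<xi> * \<eta> * \<nu>) / 3"
    unfolding fstT e(1) q_def using ab u bb[of a] bb[of u] bb[of b]
    by (simp add: sym3_simps[OF s] sym3_commute[OF s] power2_eq_square algebra_simps add_divide_distrib ab(2))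
  moreover have "0 < \<xi>\<^sup>2 + 2 * \<xi> * \<eta> * \<nu>" using e(2,3) \<nu> by (intro add_pos_pos mult_pos_pos zero_less_power) auto
  ultimately have fq: "0 < fst q" by simp
  have "(norm (snd q))\<^sup>2 < (sqrt 3 * fst q)\<^sup>2" using n by (simp add: power_mult_distrib)
  then have tl: "norm (snd q) < sqrt 3 * fst q" 
    by (rule power2_less_imp_less) (use fq in simp)
  have absA: "- (K * \<bar>A\<bar>) \<le> K * A" "- (3 * K * \<bar>A\<bar>) \<le> 3 * K * A"
  proof -
    have "K * - \<bar>A\<bar> \<le> K * A" by (rule mult_left_mono) (use K in auto)
    then show "- (K * \<bar>A\<bar>) \<le> K * A" "- (3 * K * \<bar>A\<bar>) \<le> 3 * K * A"
      by (simp_all only: mult_minus_right mult.assoc)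
  qed
  have "T q q q = l\<^sup>2 * (l * D + 3 * K * A * l\<^sup>2 + K\<^sup>2 * l\<^sup>2)"
    unfolding q_def \<nu>_def A_def D_def using ab u bb[of a] bb[of u] bb[of b]
    by (simp add: sym3_simps[OF s] sym3_commute[OF s] power2_eq_square algebra_simps)
  also have "\<dots> = l\<^sup>2 * (\<epsilon> * (\<bar>D\<bar> + \<epsilon> * (3 * K * A) + K\<^sup>2 * \<epsilon>))"
    unfolding lD l2 by (simp add: power2_eq_square algebra_simps)
  finally have h: "T q q q = l\<^sup>2 * (\<epsilon> * (\<bar>D\<bar> + \<epsilon> * (3 * K * A) + K\<^sup>2 * \<epsilon>))" .
  have "\<epsilon> * - (3 * K * \<bar>A\<bar>) \<le> \<epsilon> * (3 * K * A)" using absA(2) \<epsilon> by (intro mult_left_mono) auto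
  moreover have "\<epsilon> * - (3 * K * \<bar>A\<bar>) = - (\<epsilon> * (3 * K * \<bar>A\<bar>))" by (rule mult_minus_right)
  ultimately have "0 < \<bar>D\<bar> + \<epsilon> * (3 * K * A)" using small by linarith
  moreover have "0 \<le> K\<^sup>2 * \<epsilon>" using \<epsilon> by simp
  ultimately have "0 < \<bar>D\<bar> + \<epsilon> * (3 * K * A) + K\<^sup>2 * \<epsilon>" by linarith
  then have "0 < T q q q" unfolding h using \<epsilon> l0 by simp
  then have q: "q \<in> hyp_cone T" using tl by (simp add: hyp_cone_def)
  have qqb: "T q q b = \<nu>\<^sup>2 / 3"
    unfolding q_def using ab u bb[of a] bb[of u] bb[of b]
    by (simp add: sym3_simps[OF s] sym3_commute[OF s] power2_eq_square algebra_simps)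
  define c where "c = - T q q u / T q q b"
  have "u + c *\<^sub>R b \<noteq> 0"
  proof
    assume z: "u + c *\<^sub>R b = 0"
    have "T a a (u + c *\<^sub>R b) = c / 3" using ab u by (simp add: sym3_simps[OF s])
    then have "c = 0" using z by (simp add: sym3_simps[OF s])
    then show False using z ne by (simp add: sym3_simps[OF s])
  qed
  moreover have "0 < T q q b" unfolding qqb using \<nu> by simp
  then have "T q q (u + c *\<^sub>R b) = 0" by (simp add: sym3_simps[OF s] c_def)
  ultimately have neg: "T q (u + c *\<^sub>R b) (u + c *\<^sub>R b) < 0" using hyp_cone_hyp[OF T q] unfolding hyp_def by blast
  have val: "T q (u + c *\<^sub>R b) (u + c *\<^sub>R b) = l * D + \<nu> * A"
    unfolding q_def D_def A_def using ab u bb[of a] bb[of u] bb[of b]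
    by (simp add: sym3_simps[OF s] sym3_commute[OF s])
  have val2: "l * D + \<nu> * A = \<epsilon> * (\<bar>D\<bar> + \<epsilon> * (K * A))"
    unfolding lD \<nu>_def l2 by (simp add: power2_eq_square algebra_simps)
  have "\<epsilon> * - (K * \<bar>A\<bar>) \<le> \<epsilon> * (K * A)" using absA(1) \<epsilon> by (intro mult_left_mono) auto
  moreover have "\<epsilon> * (K * \<bar>A\<bar>) \<le> \<epsilon> * (3 * K * \<bar>A\<bar>)" using \<epsilon> K by (intro mult_left_mono mult_right_mono) auto
  ultimately have "0 < \<bar>D\<bar> + \<epsilon> * (K * A)" using small by linarith
  then have "0 < \<epsilon> * (\<bar>D\<bar> + \<epsilon> * (K * A))" using \<epsilon> by (rule mult_pos_pos[rotated])
  then show False using neg val val2 by linarith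
qed

section \<open>Existence of limit polynomials along lines through the base point\<close>

text \<open>At the light cone h is not positive, so the first zero occurs there at the latest.\<close>
lemma first_zero:
  assumes T: "std3 T" "cubic_bound T" and w: "w \<noteq> 0"
  obtains R where "smallest_positive_zero (\<lambda>z. T z z z) (1, 0) (0, w) R" "R * norm w \<le> sqrt 3"
    "\<And>t. 0 \<le> t \<Longrightarrow> t < R \<Longrightarrow> (1, t *\<^sub>R w) \<in> hyp_cone T"
proof -
  note s = std3_sym3[OF T(1)]
  define f where "f t = T (1, t *\<^sub>R w) (1, t *\<^sub>R w) (1, t *\<^sub>R w)" for t
  define b where "b = sqrt 3 / norm w"
  have b: "0 < b" "b * norm w = sqrt 3" using w by (simp_all add: b_def)
  have f0: "f 0 = 1" using T(1) by (simp add: f_def std3_def)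
  have fb: "f b \<le> 0"
    unfolding f_def by (rule nonpos_on_light_cone[OF T]) (use b in simp)
  have cont: "continuous_on A f" for A
    unfolding f_def by (subst sym3_expand[OF s]) (intro continuous_intros)
  define Z where "Z = {t \<in> {0..b}. f t = 0}"
  have "Z \<noteq> {}" using IVT2'[of f b 0 0] fb f0 b cont by (auto simp: Z_def)
  moreover have "compact Z"
  proof -
    have "Z = {0..b} \<inter> f -` {0}" by (auto simp: Z_def)
    then have "closed Z" using continuous_closed_preimage[OF cont[of "{0..b}"], of "{0}"] by simp
    moreover have "Z \<subseteq> {0..b}" by (auto simp: Z_def)
    ultimately show ?thesis using compact_Icc[of 0 b] by (metis compact_Int_closed inf.absorb2)
  qed
  ultimately obtain R where R: "R \<in> Z" "\<And>t. t \<in> Z \<Longrightarrow> R \<le> t" using compact_attains_inf[of Z] by blast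
  have RZ: "0 \<le> R" "R \<le> b" "f R = 0" using R(1) by (auto simp: Z_def)
  have R0: "0 < R" using RZ f0 by (cases "R = 0") auto
  have nz: "f t \<noteq> 0" if "0 \<le> t" "t < R" for t using R(2)[of t] that RZ by (auto simp: Z_def)
  have pos: "0 < f t" if t: "0 \<le> t" "t < R" for t
  proof (rule ccontr)
    assume "\<not> 0 < f t"
    then obtain x where "0 \<le> x" "x \<le> t" "f x = 0" using IVT2'[of f t 0 0] f0 t cont by auto
    then show False using nz[of x] t by simp
  qed
  show thesis
  proof (rule that[of R])
    have e: "(1, 0) + t *\<^sub>R (0, w) = (1, t *\<^sub>R w)" for t by simp
    show "smallest_positive_zero (\<lambda>z. T z z z) (1, 0) (0, w) R"
      unfolding smallest_positive_zero_def e using R0 RZ nz by (auto simp: f_def)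
    show "R * norm w \<le> sqrt 3" using RZ b w by (metis mult_right_mono norm_ge_zero)
    show "(1, t *\<^sub>R w) \<in> hyp_cone T" if t: "0 \<le> t" "t < R" for t
    proof -
      have "t * norm w < b * norm w" using t RZ w by (intro mult_strict_right_mono) auto
      then show ?thesis using pos[OF t] t b by (simp add: hyp_cone_def f_def)
    qed
  qed
qed

text \<open>The form T a is negative semidefinite on the common kernel of T a a and T a b, and T b is negative
  definite on its radical: both follow from hyperbolicity at a + e b for small e. Orthonormal bases of the
  radical and of a complement give S and U. That the products of positive weight vanish is regular_cube_zero
  and regular_mixed_zero.\<close>
lemma adapted_regular:
  fixes T :: "real \<times> 'b::euclidean_space \<Rightarrow> real \<times> 'b \<Rightarrow> real \<times> 'b \<Rightarrow> real"
  assumes T: "std3 T" "cubic_bound T" and ab: "T a a a = 0" "T a a b = 1 / 3" "T a b b = 0"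
    and tl: "norm (snd a) < sqrt 3 * fst a" and e0: "0 < e0" "\<And>e. 0 < e \<Longrightarrow> e < e0 \<Longrightarrow> a + e *\<^sub>R b \<in> hyp_cone T"
  obtains m k S U where "m + k = DIM('b) - 1" "adapted T m k a b S U" "regular_end T m k a S U"
proof -
  note s = std3_sym3[OF T(1)]
  define Z where "Z = {z. T a a z = 0 \<and> T a b z = 0}"
  have Z: "subspace Z" "dim Z = DIM('b) - 1"
    using dim_two_functionals[OF s ab] by (simp_all add: Z_def)
  have a0: "a \<noteq> 0" using ab(2) by (auto simp: sym3_simps[OF s])
  have P: "sym_form (\<lambda>x y. - 3 * T a x y)" and C: "sym_form (\<lambda>x y. - 3 * T b x y)"
    by (rule sym_form_sym3[OF s])+
  have semi: "T a z z \<le> 0" "T a z z = 0 \<Longrightarrow> T b z z < 0" if "z \<in> Z" "z \<noteq> 0" for z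
    using sign_of_perturbation[OF e0(1), of "T a z z" "T b z z"] regular_semidefinite[OF T ab _ _ that(2) _ e0(2)] that(1)
    by (auto simp: Z_def)
  have psd: "0 \<le> - 3 * T a z z" if "z \<in> Z" for z
    using semi(1)[OF that] by (cases "z = 0") (auto simp: sym3_simps[OF s])
  have ker: "0 < - 3 * T b z z" if "z \<in> Z" "- 3 * T a z z = 0" "z \<noteq> 0" for z
    using semi(2)[OF that(1,3)] that(2) by simp
  obtain m k f g where fg: "m + k = dim Z" "\<And>i. i < m \<Longrightarrow> f i \<in> Z" "\<And>i z. i < m \<Longrightarrow> z \<in> Z \<Longrightarrow> - 3 * T a (f i) z = 0"
    "\<And>i j. i < m \<Longrightarrow> j < m \<Longrightarrow> - 3 * T b (f i) (f j) = (if i = j then 1 else 0)"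
    "\<And>i. i < k \<Longrightarrow> g i \<in> Z" "\<And>i j. i < k \<Longrightarrow> j < k \<Longrightarrow> - 3 * T a (g i) (g j) = (if i = j then 1 else 0)"
    by (rule semidefinite_split[OF P C Z(1) psd ker]) (assumption | rule that)+
  define K where "K = {z \<in> Z. \<forall>y\<in>Z. T a z y = 0}"
  have K: "subspace K"
    using Z(1) by (auto simp: K_def subspace_def sym3_simps[OF s])
  have fK: "f i \<in> K" if "i < m" for i using fg(2,3)[OF that] by (auto simp: K_def)
  have KZ: "T a a x = 0" "T a b x = 0" "T a x x = 0" if "x \<in> K" for x
    using that unfolding K_def Z_def by blast+
  have cube: "T x x x = 0" if "x \<in> K" for x
    by (rule regular_cube_zero[OF T ab(1) a0 tl KZ(1,3)[OF that]])
  have mixed: "T x x z = 0" if x: "x \<in> K" and z: "z \<in> Z" for x z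
  proof (cases "x = 0 \<or> T a z z = 0")
    case True
    then show ?thesis
    proof
      assume "T a z z = 0"
      then have "- 3 * T a z z = 0" by simp
      then have "- 3 * T a z y = 0" if "y \<in> Z" for y
        using psd_kernel[OF P Z(1) psd z _ that] by blast
      then have "z \<in> K" using z by (simp add: K_def)
      then show ?thesis using zero_on_subspace_polar[OF s K cube x x] by blast
    qed (simp add: sym3_simps[OF s])
  next
    case False
    have "x + c *\<^sub>R a \<noteq> 0" for c
    proof
      assume z: "x + c *\<^sub>R a = 0"
      have "T a b (x + c *\<^sub>R a) = c / 3"
        using KZ(2)[OF x] ab(2) sym3_commute(2)[OF s, of a b a] by (simp add: sym3_simps[OF s])
      then have "c = 0" using z by (simp add: sym3_simps[OF s])
      then show False using z False by simp
    qed
    then show ?thesis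
      using regular_mixed_zero[OF T ab(1) tl KZ(1,3)[OF x] cube[OF x], of z] x z False
      unfolding K_def Z_def by blast
  qed
  have mixed2: "T x y z = 0" if "x \<in> K" "y \<in> K" "z \<in> Z" for x y z
    using mixed[of "x + y" z] mixed[of x z] mixed[of y z] that subspace_add[OF K that(1,2)]
      sym3_commute(1)[OF s, of y x z] by (simp add: sym3_simps[OF s])
  have KsubZ: "K \<subseteq> Z" by (auto simp: K_def)
  have aK: "T a x z = 0" if x: "x \<in> K" for x z
  proof -
    define \<beta> where "\<beta> = 3 * T a a z"
    define \<alpha> where "\<alpha> = 3 * T a b z"
    have aba: "T a b a = 1 / 3" using ab(2) sym3_commute(2)[OF s, of a b a] by simp
    have "z - \<alpha> *\<^sub>R a - \<beta> *\<^sub>R b \<in> Z"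
      using ab aba by (simp add: Z_def sym3_simps[OF s] \<alpha>_def \<beta>_def)
    then have "T a x (z - \<alpha> *\<^sub>R a - \<beta> *\<^sub>R b) = 0" using x by (simp add: K_def)
    moreover have "T a x a = 0" "T a x b = 0"
      using KZ(1,2)[OF x] sym3_commute(2)[OF s, of a x a] sym3_commute(2)[OF s, of a x b] by simp_all
    ultimately show ?thesis by (simp add: sym3_simps[OF s])
  qed
  have fZ: "T a a (f i) = 0 \<and> T a b (f i) = 0" if "i < m" for i using fg(2)[OF that] by (simp add: Z_def)
  have gZ: "T a a (g i) = 0 \<and> T a b (g i) = 0" if "i < k" for i using fg(5)[OF that] by (simp add: Z_def)
  have "T b (f i) (f j) = (if i = j then - 1 / 3 else 0)" if "i < m" "j < m" for i j
    using fg(4)[OF that] by (auto split: if_splits)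
  moreover have "T a (g i) (g j) = (if i = j then - 1 / 3 else 0)" if "i < k" "j < k" for i j
    using fg(6)[OF that] by (auto split: if_splits)
  ultimately have "adapted T m k a b f g" unfolding adapted_def using ab fZ gZ by blast
  moreover have "regular_end T m k a f g"
    unfolding regular_end_def using aK[OF fK] mixed2[OF fK fK] fg(2,5) by blast
  ultimately show thesis using that fg(1) Z(2) by metis
qed

text \<open>As in adapted_regular with the roles of a and b exchanged: here the radical of T b gives U, and a
  complement gives S.\<close>
lemma adapted_singular:
  fixes T :: "real \<times> 'b::euclidean_space \<Rightarrow> real \<times> 'b \<Rightarrow> real \<times> 'b \<Rightarrow> real"
  assumes T: "std3 T" "cubic_bound T" and ab: "T a a a = 0" "T a a b = 1 / 3" and bb: "\<And>z. T b b z = 0"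
    and e: "(1, 0) = \<xi> *\<^sub>R a + \<eta> *\<^sub>R b" "0 < \<xi>" "0 < \<eta>"
    and e0: "0 < e0" "\<And>e. 0 < e \<Longrightarrow> e < e0 \<Longrightarrow> b + e *\<^sub>R a \<in> hyp_cone T"
  obtains m k S U where "m + k = DIM('b) - 1" "adapted T m k a b S U" "singular_end T k b U"
proof -
  note s = std3_sym3[OF T(1)]
  have abb: "T a b b = 0" using bb[of a] sym3_rotate(1)[OF s, of a b b] by simp
  define Z where "Z = {z. T a a z = 0 \<and> T a b z = 0}"
  have Z: "subspace Z" "dim Z = DIM('b) - 1"
    using dim_two_functionals[OF s ab abb] by (simp_all add: Z_def)
  have P: "sym_form (\<lambda>x y. - 3 * T b x y)" and C: "sym_form (\<lambda>x y. - 3 * T a x y)"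
    by (rule sym_form_sym3[OF s])+
  have semi: "T b z z \<le> 0" "T b z z = 0 \<Longrightarrow> T a z z < 0" if "z \<in> Z" "z \<noteq> 0" for z
    using sign_of_perturbation[OF e0(1), of "T b z z" "T a z z"] singular_semidefinite[OF T bb _ _ that(2) e0(2)] that(1)
    by (auto simp: Z_def)
  have psd: "0 \<le> - 3 * T b z z" if "z \<in> Z" for z
    using semi(1)[OF that] by (cases "z = 0") (auto simp: sym3_simps[OF s])
  have ker: "0 < - 3 * T a z z" if "z \<in> Z" "- 3 * T b z z = 0" "z \<noteq> 0" for z
    using semi(2)[OF that(1,3)] that(2) by simp
  obtain k m f g where fg: "k + m = dim Z" "\<And>i. i < k \<Longrightarrow> f i \<in> Z" "\<And>i z. i < k \<Longrightarrow> z \<in> Z \<Longrightarrow> - 3 * T b (f i) z = 0"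
    "\<And>i j. i < k \<Longrightarrow> j < k \<Longrightarrow> - 3 * T a (f i) (f j) = (if i = j then 1 else 0)"
    "\<And>i. i < m \<Longrightarrow> g i \<in> Z" "\<And>i j. i < m \<Longrightarrow> j < m \<Longrightarrow> - 3 * T b (g i) (g j) = (if i = j then 1 else 0)"
    by (rule semidefinite_split[OF P C Z(1) psd ker]) (assumption | rule that)+
  define K where "K = {z \<in> Z. \<forall>y\<in>Z. T b z y = 0}"
  have K: "subspace K"
    using Z(1) by (auto simp: K_def subspace_def sym3_simps[OF s])
  have fK: "f i \<in> K" if "i < k" for i using fg(2,3)[OF that] by (auto simp: K_def)
  have cube: "T x x x = 0" if "x \<in> K" for x
  proof (rule singular_cube_zero[OF T ab bb e])
    show "T a a x = 0" "T a b x = 0" "T b x x = 0" using that unfolding K_def Z_def by blast+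
  qed
  have bK: "T b x z = 0" if x: "x \<in> K" for x z
  proof -
    define \<beta> where "\<beta> = 3 * T a a z"
    define \<alpha> where "\<alpha> = 3 * T a b z"
    have aba: "T a b a = 1 / 3" using ab(2) sym3_commute(2)[OF s, of a b a] by simp
    have "z - \<alpha> *\<^sub>R a - \<beta> *\<^sub>R b \<in> Z"
      using ab abb aba by (simp add: Z_def sym3_simps[OF s] \<alpha>_def \<beta>_def)
    then have "T b x (z - \<alpha> *\<^sub>R a - \<beta> *\<^sub>R b) = 0" using x by (simp add: K_def)
    moreover have "T b x a = 0" "T b x b = 0"
      using x bb[of x] sym3_rotate(2)[OF s, of b x a] sym3_commute(2)[OF s, of b x b] by (simp_all add: K_def Z_def)
    ultimately show ?thesis by (simp add: sym3_simps[OF s])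
  qed
  have fZ: "T a a (f i) = 0 \<and> T a b (f i) = 0" if "i < k" for i using fg(2)[OF that] by (simp add: Z_def)
  have gZ: "T a a (g i) = 0 \<and> T a b (g i) = 0" if "i < m" for i using fg(5)[OF that] by (simp add: Z_def)
  have "T a (f i) (f j) = (if i = j then - 1 / 3 else 0)" if "i < k" "j < k" for i j
    using fg(4)[OF that] by (auto split: if_splits)
  moreover have "T b (g i) (g j) = (if i = j then - 1 / 3 else 0)" if "i < m" "j < m" for i j
    using fg(6)[OF that] by (auto split: if_splits)
  ultimately have ad: "adapted T m k a b g f" unfolding adapted_def using ab abb fZ gZ by blast
  have si: "singular_end T k b f"
    unfolding singular_end_def using bb bK[OF fK] zero_on_subspace_polar[OF s K cube fK fK fK] by blast
  have "m + k = DIM('b) - 1" using fg(1) Z(2) by simp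
  from that[OF this ad si] show thesis .
qed

lemma powr_pow: "0 < (g::real) \<Longrightarrow> (g powr a) ^ n = g powr (real n * a)"
  by (induction n) (simp_all add: powr_add algebra_simps)

lemma hyp_cone_scale:
  assumes "sym3 T" "0 < r" "p \<in> hyp_cone T" shows "r *\<^sub>R p \<in> hyp_cone T"
  using assms(2,3) by (simp add: hyp_cone_def sym3_simps[OF assms(1)] mult.left_commute)

text \<open>The distance to the end of the interval, normalized to 1 at the start. The constant value beyond R
  keeps it positive, so that its powers satisfy the exponent rules everywhere.\<close>
definition left_gap :: "real \<Rightarrow> real \<Rightarrow> real" where
  "left_gap R t = (if t < R then 1 - t / R else 1)"

lemma left_gap_pos: "0 < R \<Longrightarrow> 0 < left_gap R t"
  by (simp add: left_gap_def field_simps)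

lemma left_gap_Cinf:
  assumes "open W" "W \<subseteq> {..<R}" "0 < R" shows "Cinf_on W (\<lambda>t. left_gap R t powr a)"
proof (rule Cinf_powr_comp[OF assms(1) _ left_gap_pos[OF assms(3)]])
  have c: "Cinf_on W (\<lambda>t. 1 - t * (1 / R))"
    by (intro Cinf_diff Cinf_mult Cinf_const Cinf_ident assms(1))
  show "Cinf_on W (left_gap R)"
    by (rule Cinf_cong[OF assms(1) _ c]) (use assms(2) in \<open>auto simp: left_gap_def\<close>)
qed

lemma left_gap_tendsto:
  assumes "0 < a" "0 < R" shows "((\<lambda>t. left_gap R t powr a) \<longlongrightarrow> 0) (at_left R)"
proof -
  have "((\<lambda>t. 1 - t / R) \<longlongrightarrow> 1 - R / R) (at_left R)" by (intro tendsto_intros) (use assms in auto)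
  then have g: "((\<lambda>t. 1 - t / R) \<longlongrightarrow> 0) (at_left R)" using assms by simp
  have ev: "\<forall>\<^sub>F t in at_left R. t < R" by (auto simp: eventually_at_left_field intro: exI[of _ "R - 1"])
  have "((\<lambda>t. (1 - t / R) powr a) \<longlongrightarrow> 0 powr a) (at_left R)"
    by (rule tendsto_powr'[OF g tendsto_const])
       (use assms ev in \<open>auto elim!: eventually_mono simp: field_simps\<close>)
  then have "((\<lambda>t. (1 - t / R) powr a) \<longlongrightarrow> 0) (at_left R)" by simp
  moreover have "\<forall>\<^sub>F t in at_left R. left_gap R t powr a = (1 - t / R) powr a"
    using ev by (auto elim!: eventually_mono simp: left_gap_def)
  ultimately show ?thesis by (simp add: tendsto_cong)
qed

lemma left_gap_inverse: "0 < R \<Longrightarrow> left_gap R t powr a * left_gap R t powr (- a) = 1"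
  using left_gap_pos[of R t] by (simp flip: powr_add)

lemma cubic_bound_sq:
  assumes T: "std3 T" "cubic_bound T"
  shows "(T (0, y) (0, y) (0, y))\<^sup>2 \<le> 4 / 27 * (y \<bullet> y) ^ 3"
proof -
  note s = std3_sym3[OF T(1)]
  let ?P = "T (0, y) (0, y) (0, y)"
  let ?k = "2 / (3 * sqrt 3) * norm y ^ 3"
  have 1: "?P \<le> ?k" using T(2) by (simp add: cubic_bound_def)
  have "T (0, - y) (0, - y) (0, - y) \<le> 2 / (3 * sqrt 3) * norm (- y) ^ 3" using T(2) unfolding cubic_bound_def by blast
  moreover have "(0::real, - y) = - (0, y)" by simp
  ultimately have 2: "- ?P \<le> ?k" by (simp only: sym3_simps[OF s]) simp
  have "\<bar>?P\<bar> \<le> \<bar>?k\<bar>" using 1 2 by simp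
  then have "?P\<^sup>2 \<le> ?k\<^sup>2" by (rule abs_le_square_iff[THEN iffD1])
  also have "?k\<^sup>2 = 4 / 27 * (norm y ^ 3)\<^sup>2" by (simp add: power_mult_distrib power_divide)
  also have "(norm y ^ 3)\<^sup>2 = (y \<bullet> y) ^ 3" by (simp add: dot_square_norm power_mult[symmetric] mult.commute)
  finally show ?thesis .
qed

text \<open>On the light cone the bound on P is attained at w, so the difference of both sides of
  cubic_bound_sq has a minimum at w. The vanishing derivative of this difference is the vanishing of T q q on
  vectors (0, u) at q = (1, R w).\<close>
lemma singular_critical:
  assumes T: "std3 T" "cubic_bound T" and R: "0 < R" "R * norm w = sqrt 3"
    and h: "T (1, R *\<^sub>R w) (1, R *\<^sub>R w) (1, R *\<^sub>R w) = 0"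
  shows "T (1, R *\<^sub>R w) (1, R *\<^sub>R w) z = 0"
proof -
  note s = std3_sym3[OF T(1)]
  have ww: "R\<^sup>2 * (w \<bullet> w) = 3"
  proof -
    have "R\<^sup>2 * (w \<bullet> w) = (R * norm w)\<^sup>2" by (simp add: power_mult_distrib dot_square_norm)
    then show ?thesis using R by simp
  qed
  obtain z1 u where z: "z = (z1, u)" by (cases z)
  define p0 where "p0 = T (0, w) (0, w) (0, w)"
  define p1 where "p1 = T (0, w) (0, w) (0, u)"
  define p2 where "p2 = T (0, w) (0, u) (0, u)"
  define p3 where "p3 = T (0, u) (0, u) (0, u)"
  define f where "f t = 4 / 27 * (w \<bullet> w + 2 * t * (w \<bullet> u) + t\<^sup>2 * (u \<bullet> u)) ^ 3
     - (p0 + 3 * t * p1 + 3 * t\<^sup>2 * p2 + t ^ 3 * p3)\<^sup>2" for t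
  have fpos: "0 \<le> f t" for t
  proof -
    have "(0::real, w + t *\<^sub>R u) = (0, w) + t *\<^sub>R (0, u)" by simp
    then have "T (0, w + t *\<^sub>R u) (0, w + t *\<^sub>R u) (0, w + t *\<^sub>R u) = p0 + 3 * t * p1 + 3 * t\<^sup>2 * p2 + t ^ 3 * p3"
      unfolding p0_def p1_def p2_def p3_def
      by (simp only: sym3_simps[OF s]) (simp add: sym3_commute[OF s] power2_eq_square power3_eq_cube algebra_simps)
    moreover have "(w + t *\<^sub>R u) \<bullet> (w + t *\<^sub>R u) = w \<bullet> w + 2 * t * (w \<bullet> u) + t\<^sup>2 * (u \<bullet> u)"
      by (simp add: inner_simps inner_commute power2_eq_square algebra_simps)
    ultimately show ?thesis using cubic_bound_sq[OF T, of "w + t *\<^sub>R u"] by (simp add: f_def)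
  qed
  have c: "R ^ 3 * p0 = 2"
  proof -
    have "(0::real, R *\<^sub>R w) = R *\<^sub>R (0, w)" by simp
    then have "T (0, R *\<^sub>R w) (0, R *\<^sub>R w) (0, R *\<^sub>R w) = R ^ 3 * p0"
      unfolding p0_def by (simp only: sym3_simps[OF s]) (simp add: power3_eq_cube)
    then show ?thesis using h std3_eval[OF T(1), of 1 "R *\<^sub>R w"] ww by (simp add: power2_eq_square)
  qed
  have ww': "w \<bullet> w = 3 / R\<^sup>2" and p0': "p0 = 2 / R ^ 3" using ww c R by (simp_all add: field_simps)
  have f0: "f 0 = 0" using R by (simp add: f_def ww' p0' power_divide)
  have "DERIV f 0 :> 4 / 27 * (3 * (w \<bullet> w)\<^sup>2 * (2 * (w \<bullet> u))) - 2 * p0 * (3 * p1)"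
    unfolding f_def by (auto intro!: derivative_eq_intros simp: power2_eq_square)
  then have "4 / 27 * (3 * (w \<bullet> w)\<^sup>2 * (2 * (w \<bullet> u))) - 2 * p0 * (3 * p1) = 0"
    by (rule DERIV_local_min[where d = 1]) (use fpos f0 in simp_all)
  then have "8 * (w \<bullet> u) / R ^ 4 = 12 * p1 / R ^ 3"
    unfolding ww' p0' by (simp add: power_divide power_mult[symmetric])
  then have "8 * (w \<bullet> u) / R ^ 4 * R ^ 4 = 12 * p1 / R ^ 3 * R ^ 4" by simp
  then have p1: "2 * (w \<bullet> u) = 3 * (R * p1)" using R by (simp add: power_numeral_reduce)
  have e: "(1, R *\<^sub>R w) = (1, 0) + R *\<^sub>R (0, w)" by simp
  have v: "T (1, 0) (1, 0) (1, 0) = 1" "T (1, 0) (1, 0) (0, u) = 0" "T (1, 0) (0, w) (0, u) = - (w \<bullet> u) / 3"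
    "T (1, 0) (0, w) (0, w) = - (w \<bullet> w) / 3" "T (1, 0) (1, 0) (0, w) = 0"
    using T(1) by (simp_all add: std3_def)
  have "T (1, R *\<^sub>R w) (1, R *\<^sub>R w) (1, 0) = 1 - R\<^sup>2 * (w \<bullet> w) / 3"
    using std3_bilinear[OF T(1), of 1 "R *\<^sub>R w" 1 "R *\<^sub>R w"] by (simp add: power2_eq_square)
  then have 1: "T (1, R *\<^sub>R w) (1, R *\<^sub>R w) (1, 0) = 0" using ww by simp
  have "T (1, R *\<^sub>R w) (1, R *\<^sub>R w) (0, u) = - 2 * R * (w \<bullet> u) / 3 + R\<^sup>2 * p1"
    unfolding e sym3_simps[OF s] using v sym3_commute(1)[OF s, of "(0, w)" "(1, 0)" "(0, u)"]
    by (simp add: p1_def power2_eq_square algebra_simps)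
  then have 2: "T (1, R *\<^sub>R w) (1, R *\<^sub>R w) (0, u) = 0" using p1 by (simp add: power2_eq_square algebra_simps)
  have "z = z1 *\<^sub>R (1, 0) + (0, u)" by (simp add: z)
  then have "T (1, R *\<^sub>R w) (1, R *\<^sub>R w) z = z1 * T (1, R *\<^sub>R w) (1, R *\<^sub>R w) (1, 0) + T (1, R *\<^sub>R w) (1, R *\<^sub>R w) (0, u)"
    by (simp only: sym3_simps[OF s])
  then show ?thesis using 1 2 by simp
qed

text \<open>Let q = (1, R w) be the first zero of h on the line. If it lies inside the light cone, then a is a
  multiple of q and b a multiple of (1, 0) - \<mu> q, with \<mu> chosen so that T a b b = 0; the point of the
  line has a coefficient 1 - t / R in the direction of b and a convergent one in the direction of a, so
  normalizing to h = 1 scales the curve with weight 2 in a and - 4 in b for l = (1 - t / R) powr (- 1 / 6). If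
  q lies on the light cone, it is a critical point of h; then b is a multiple of q, a is a multiple of (1, 0) -
  q / 3, and the curve scales in the same way with l = (1 - t / R) powr (1 / 6).\<close>
theorem limit_exists_at_base:
  fixes T :: "real \<times> (real ^ 'n) \<Rightarrow> real \<times> (real ^ 'n) \<Rightarrow> real \<times> (real ^ 'n) \<Rightarrow> real"
    and e :: "nat \<Rightarrow> 'n::finite"
  assumes e: "bij_betw e {..<CARD('n)} UNIV" and T: "std3 T" "cubic_bound T" and w: "w \<noteq> 0"
  shows "\<exists>m F. m \<le> CARD('n) - 1 \<and> normal_matrices m (CARD('n) - 1 - m) F \<and>
     limit_polynomial (\<lambda>z. T z z z) (1, 0) (0, w) (poly_general e m F)"
proof -
  note s = std3_sym3[OF T(1)]
  obtain R where R: "smallest_positive_zero (\<lambda>z. T z z z) (1, 0) (0, w) R" "R * norm w \<le> sqrt 3"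
    "\<And>t. 0 \<le> t \<Longrightarrow> t < R \<Longrightarrow> (1, t *\<^sub>R w) \<in> hyp_cone T"
    by (rule first_zero[OF T w]) (rule that)
  have R0: "0 < R" using R(1) by (simp add: smallest_positive_zero_def)
  define v where "v = (0::real, w)"
  define q where "q = (1::real, R *\<^sub>R w)"
  have q3: "T q q q = 0" using R(1) by (simp add: smallest_positive_zero_def q_def)
  have line: "(1, 0) + t *\<^sub>R (0, w) = (1 - t / R) *\<^sub>R (1, 0) + (t / R) *\<^sub>R q" for t
    using R0 by (simp add: q_def)
  define \<tau> where "\<tau> = T q q (1, 0)"
  have \<tau>: "\<tau> = 1 - (R * norm w)\<^sup>2 / 3"
    using std3_bilinear[OF T(1), of 1 "R *\<^sub>R w" 1 "R *\<^sub>R w"]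
    by (simp add: \<tau>_def q_def power_mult_distrib dot_square_norm power2_eq_square)
  have qe: "T q (1, 0) (1, 0) = 1"
    using std3_bilinear[OF T(1), of 1 "R *\<^sub>R w" 1 0] by (simp add: q_def)
  have eee: "T (1, 0) (1, 0) (1, 0) = 1" using T(1) by (simp add: std3_def)
  have DIMn: "DIM(real ^ 'n) = CARD('n)" by simp
  have cont: "continuous_on UNIV (\<lambda>t. T (x t) (x t) (x t))" if "continuous_on UNIV x" for x
    by (subst sym3_expand[OF s]) (intro continuous_intros that)
  define g where "g = left_gap R"
  have gpos: "0 < g t" for t unfolding g_def by (rule left_gap_pos[OF R0])
  show ?thesis
  proof (cases "R * norm w < sqrt 3")
    case True
    have "(R * norm w)\<^sup>2 < (sqrt 3)\<^sup>2" using True R0 by (intro power_strict_mono) auto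
    then have \<tau>0: "0 < \<tau>" unfolding \<tau> by simp
    \<comment> \<open>This makes T q y y vanish.\<close>
    define \<mu> where "\<mu> = 1 / (2 * \<tau>)"
    define y where "y = (1, 0) - \<mu> *\<^sub>R q"
    define \<rho> where "\<rho> = (3 * \<tau>) powr (- 1 / 3)"
    have \<rho>0: "0 < \<rho>" using \<tau>0 by (simp add: \<rho>_def)
    have \<rho>3: "\<rho> ^ 3 * (3 * \<tau>) = 1" unfolding \<rho>_def using \<tau>0 by (intro powr_cube_root) simp
    define a where "a = \<rho> *\<^sub>R q"
    define b where "b = \<rho> *\<^sub>R y"
    have qqy: "T q q y = \<tau>" by (simp add: y_def sym3_simps[OF s] q3 \<tau>_def)
    have qyy: "T q y y = 0"
      using \<tau>0 qe q3 sym3_commute(2)[OF s, of q "(1, 0)" q]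
      by (simp add: y_def sym3_simps[OF s] \<tau>_def[symmetric] \<mu>_def)
    have ab: "T a a a = 0" "T a a b = 1 / 3" "T a b b = 0"
      using q3 qqy qyy \<rho>3 by (simp_all add: a_def b_def sym3_simps[OF s] power3_eq_cube)
    have tl: "norm (snd a) < sqrt 3 * fst a"
      using True \<rho>0 R0 by (simp add: a_def q_def)
    have "\<forall>\<^sub>F x in at_right 0. a + x *\<^sub>R b \<in> hyp_cone T"
    proof -
      have "((\<lambda>x. 1 + x\<^sup>2 * T b b b) \<longlongrightarrow> 1 + 0\<^sup>2 * T b b b) (at_right 0)" by (intro tendsto_intros)
      then have "\<forall>\<^sub>F x in at_right 0. 0 < 1 + x\<^sup>2 * T b b b" by (rule order_tendstoD(1)) simp
      from eventually_conj[OF this eventually_conj[OF timelike_nearby(1)[OF tl, of b] eventually_at_right_less]]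
      show ?thesis
      proof (rule eventually_mono)
        fix x assume x: "0 < 1 + x\<^sup>2 * T b b b \<and> norm (snd (a + x *\<^sub>R b)) < sqrt 3 * fst (a + x *\<^sub>R b) \<and> 0 < x"
        have "T (a + x *\<^sub>R b) (a + x *\<^sub>R b) (a + x *\<^sub>R b) = T a a a + 3 * x * T a a b + 3 * x\<^sup>2 * T a b b + x ^ 3 * T b b b"
          by (simp add: sym3_simps[OF s] sym3_commute[OF s] power2_eq_square power3_eq_cube algebra_simps)
        also have "\<dots> = x * (1 + x\<^sup>2 * T b b b)" by (simp add: ab power2_eq_square power3_eq_cube algebra_simps)
        finally show "a + x *\<^sub>R b \<in> hyp_cone T" using x by (simp add: hyp_cone_def)
      qed
    qed
    then obtain e0 where e0: "0 < e0" "\<And>x. 0 < x \<Longrightarrow> x < e0 \<Longrightarrow> a + x *\<^sub>R b \<in> hyp_cone T"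
      by (auto simp: eventually_at_right_field)
    obtain m k S U where ad: "m + k = DIM(real ^ 'n) - 1" "adapted T m k a b S U" "regular_end T m k a S U"
      by (rule adapted_regular[OF T ab tl e0]) (assumption | rule that)+
    have m: "m \<le> CARD('n) - 1" and k: "k = CARD('n) - 1 - m" using ad(1) DIMn by linarith+
    define \<xi> where "\<xi> t = t / R + \<mu> * (1 - t / R)" for t
    have L: "(1, 0) + t *\<^sub>R (0, w) = (1 - t / R) *\<^sub>R y + \<xi> t *\<^sub>R q" for t
      unfolding line by (simp add: y_def \<xi>_def algebra_simps)
    define f1 where "f1 t = (1 - t / R)\<^sup>2 * T y y y + 3 * \<tau> * (\<xi> t)\<^sup>2" for t
    have f: "T ((1, 0) + t *\<^sub>R (0, w)) ((1, 0) + t *\<^sub>R (0, w)) ((1, 0) + t *\<^sub>R (0, w)) = (1 - t / R) * f1 t" for t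
    proof -
      have "T (c *\<^sub>R y + d *\<^sub>R q) (c *\<^sub>R y + d *\<^sub>R q) (c *\<^sub>R y + d *\<^sub>R q)
          = c ^ 3 * T y y y + 3 * c\<^sup>2 * d * T q y y + 3 * c * d\<^sup>2 * T q q y + d ^ 3 * T q q q" for c d
        by (simp add: sym3_simps[OF s] sym3_commute[OF s] power2_eq_square power3_eq_cube algebra_simps)
      then show ?thesis unfolding L by (simp only: q3 qqy qyy f1_def) (simp add: power2_eq_square power3_eq_cube algebra_simps)
    qed
    define W where "W = {t. t < R \<and> norm (snd ((1, 0) + t *\<^sub>R (0, w))) < sqrt 3 * fst ((1, 0) + t *\<^sub>R (0, w))
       \<and> 0 < T ((1, 0) + t *\<^sub>R (0, w)) ((1, 0) + t *\<^sub>R (0, w)) ((1, 0) + t *\<^sub>R (0, w)) \<and> 0 < \<xi> t}"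
    have W: "open W"
      unfolding W_def \<xi>_def
      by (intro open_Collect_conj open_Collect_less cont continuous_intros) (use R0 in \<open>auto intro!: continuous_intros\<close>)
    have WR: "W \<subseteq> {..<R}" by (auto simp: W_def)
    have cone: "(1, 0) + t *\<^sub>R (0, w) \<in> hyp_cone T" if "t \<in> W" for t
      using that by (simp add: W_def hyp_cone_def)
    have sub: "{0..<R} \<subseteq> W"
    proof
      fix t assume t: "t \<in> {0..<R}"
      have "(1, t *\<^sub>R w) \<in> hyp_cone T" using R(3) t by simp
      moreover have "0 < \<xi> t"
        using t R0 \<tau>0 unfolding \<xi>_def \<mu>_def by (intro add_nonneg_pos mult_pos_pos) (auto simp: field_simps)
      ultimately show "t \<in> W" using t by (simp add: W_def hyp_cone_def)
    qed
    have g1: "g t = 1 - t / R" if "t \<in> W" for t using that WR by (auto simp: g_def left_gap_def)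
    have f1pos: "0 < f1 t" if "t \<in> W" for t
    proof -
      have "0 < g t * f1 t" using that f[of t] g1[OF that] by (simp add: W_def)
      then show ?thesis using gpos[of t] by (simp add: zero_less_mult_iff)
    qed
    have \<xi>sm: "Cinf_on W \<xi>"
    proof -
      have "Cinf_on W (\<lambda>t. t * (1 / R) + \<mu> * (1 - t * (1 / R)))"
        by (intro Cinf_add Cinf_diff Cinf_mult Cinf_const Cinf_ident W)
      then show ?thesis by (simp add: \<xi>_def[abs_def])
    qed
    have f1sm: "Cinf_on W f1"
    proof -
      have "Cinf_on W (\<lambda>t. (1 - t * (1 / R))\<^sup>2 * T y y y + 3 * \<tau> * (\<xi> t)\<^sup>2)"
        by (intro Cinf_add Cinf_diff Cinf_mult Cinf_power Cinf_const Cinf_ident W \<xi>sm)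
      then show ?thesis by (simp add: f1_def[abs_def])
    qed
    define X where "X t = f1 t powr (- 1 / 3) * (1 / \<rho>) * \<xi> t" for t
    define Y where "Y t = f1 t powr (- 1 / 3) * (1 / \<rho>)" for t
    have sm: "Cinf_on W X" "Cinf_on W Y"
      unfolding X_def Y_def by ((rule Cinf_mult Cinf_powr_comp Cinf_const W \<xi>sm f1sm f1pos | assumption)+)
    have \<xi>lim: "(\<xi> \<longlongrightarrow> R / R + \<mu> * (1 - R / R)) (at_left R)"
      unfolding \<xi>_def by (intro tendsto_intros) (use R0 in auto)
    then have \<xi>lim: "(\<xi> \<longlongrightarrow> 1) (at_left R)" using R0 by simp
    have "(f1 \<longlongrightarrow> (1 - R / R)\<^sup>2 * T y y y + 3 * \<tau> * 1\<^sup>2) (at_left R)"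
      unfolding f1_def by (intro tendsto_intros \<xi>lim) (use R0 in auto)
    then have f1lim: "(f1 \<longlongrightarrow> 3 * \<tau>) (at_left R)" using R0 by simp
    have Ylim: "(Y \<longlongrightarrow> (3 * \<tau>) powr (- 1 / 3) * (1 / \<rho>)) (at_left R)"
      unfolding Y_def by (intro tendsto_intros f1lim) (use \<tau>0 in auto)
    then have Ylim: "(Y \<longlongrightarrow> 1) (at_left R)" using \<rho>0 unfolding \<rho>_def[symmetric] by simp
    have Xlim: "(X \<longlongrightarrow> 1) (at_left R)"
    proof -
      have "((\<lambda>t. Y t * \<xi> t) \<longlongrightarrow> 1 * 1) (at_left R)" by (intro tendsto_mult Ylim \<xi>lim)
      then show ?thesis by (simp add: X_def[abs_def] Y_def)
    qed
    have XY: "2 * X t + Y t \<noteq> 0" if "t \<in> W" for t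
    proof -
      have "0 < \<xi> t" using that by (simp add: W_def)
      then have "0 < X t" "0 < Y t" using f1pos[OF that] \<rho>0 by (simp_all add: X_def Y_def)
      then show ?thesis by simp
    qed
    have curve: "limit_curve (\<lambda>z. T z z z) (1, 0) (0, w) t =
        ((g t powr - (1 / 6))\<^sup>2 * X t) *\<^sub>R a + ((g t powr (1 / 6)) ^ 4 * Y t) *\<^sub>R b" if t: "t \<in> W" for t
    proof -
      have p: "(g t powr - (1 / 6))\<^sup>2 = g t powr (- 1 / 3)" "(g t powr (1 / 6)) ^ 4 = g t powr (- 1 / 3) * g t"
      proof -
        show "(g t powr - (1 / 6))\<^sup>2 = g t powr (- 1 / 3)" by (subst powr_pow[OF gpos]) simp
        have "(g t powr (1 / 6)) ^ 4 = g t powr (- 1 / 3 + 1)" by (subst powr_pow[OF gpos]) simp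
        also have "\<dots> = g t powr (- 1 / 3) * g t" unfolding powr_add using gpos[of t] by simp
        finally show "(g t powr (1 / 6)) ^ 4 = g t powr (- 1 / 3) * g t" .
      qed
      have "limit_curve (\<lambda>z. T z z z) (1, 0) (0, w) t = (g t * f1 t) powr (- 1 / 3) *\<^sub>R (g t *\<^sub>R y + \<xi> t *\<^sub>R q)"
        unfolding limit_curve_def f by (simp only: L g1[OF t])
      also have "(g t * f1 t) powr (- 1 / 3) = g t powr (- 1 / 3) * f1 t powr (- 1 / 3)"
        using gpos[of t] f1pos[OF t] by (simp add: powr_mult)
      finally show ?thesis
        unfolding p X_def Y_def a_def b_def using \<rho>0 by (simp add: algebra_simps)
    qed
    have lm: "g t powr - (1 / 6) * g t powr (1 / 6) = 1" for t
      using left_gap_inverse[OF R0, of t "- (1 / 6)"] by (simp add: g_def)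
    have lim: "((\<lambda>t. g t powr (1 / 6)) \<longlongrightarrow> 0) (at_left R)"
      unfolding g_def by (rule left_gap_tendsto[OF _ R0]) simp
    have gsm: "Cinf_on W (\<lambda>t. g t powr x)" for x
      unfolding g_def by (rule left_gap_Cinf[OF W WR R0])
    have "limit_polynomial (\<lambda>z. T z z z) (1, 0) (0, w) (poly_general e m (normal_form_matrices T k S U))"
      by (rule adapted_limit[OF e m k s ad(2) disjI2[OF conjI[OF lim ad(3)]] W sub gsm gsm sm lm
            hyp_cone_hyp[OF T cone] Xlim Ylim XY curve R(1)])
    then show ?thesis using m k normal_form_matrices_symmetric[OF s, of m k S U] by blast
  next
    case False
    then have eq: "R * norm w = sqrt 3" using R(2) by simp
    have crit: "T q q z = 0" for z
      unfolding q_def by (rule singular_critical[OF T R0 eq]) (use q3 in \<open>simp add: q_def\<close>)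
    define x where "x = (1, 0) - (1 / 3) *\<^sub>R q"
    define \<alpha> where "\<alpha> = (3::real) powr (- 1 / 3)"
    define \<beta> where "\<beta> = (3::real) powr (2 / 3)"
    have \<alpha>\<beta>: "0 < \<alpha>" "0 < \<beta>" "\<alpha> * \<alpha> * \<beta> = 1"
      by (simp_all add: \<alpha>_def \<beta>_def flip: powr_add)
    define a where "a = \<alpha> *\<^sub>R x"
    define b where "b = (\<beta> / 3) *\<^sub>R q"
    have eq1: "T (1, 0) (1, 0) q = 1" using qe sym3_rotate(1)[OF s, of q "(1, 0)" "(1, 0)"] by simp
    have eqq: "T (1, 0) q q = 0" "T q (1, 0) q = 0" "T q z q = 0" "T z q q = 0" for z
      using crit sym3_rotate(1)[OF s, of _ q q] sym3_commute(2)[OF s, of q _ q] by simp_all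
    have xxx: "T x x x = 0" and xxq: "T x x q = 1"
      using eee qe eq1 crit eqq sym3_commute(2)[OF s, of "(1, 0)" q "(1, 0)"]
      by (simp_all add: x_def sym3_simps[OF s])
    have ab: "T a a a = 0" "T a a b = 1 / 3"
      using xxx xxq \<alpha>\<beta>(3) by (simp_all add: a_def b_def sym3_simps[OF s] mult_ac)
    have bb: "T b b z = 0" for z by (simp add: b_def sym3_simps[OF s] crit)
    have e1: "(1, 0) = (1 / \<alpha>) *\<^sub>R a + (1 / \<beta>) *\<^sub>R b" using \<alpha>\<beta>(1,2) by (simp add: a_def b_def x_def)
    have L: "(1, 0) + t *\<^sub>R (0, w) = (1 - t / R) *\<^sub>R x + ((1 + 2 * t / R) / 3) *\<^sub>R q" for t
      unfolding line by (simp add: x_def algebra_simps add_divide_distrib diff_divide_distrib) (simp flip: scaleR_add_left)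
    have e0: "b + c *\<^sub>R a \<in> hyp_cone T" if c: "0 < c" "c < \<beta> / \<alpha>" for c
    proof -
      define d where "d = c * \<alpha> / \<beta>"
      have d: "0 < d" "d < 1" using c \<alpha>\<beta> by (simp_all add: d_def field_simps)
      define t where "t = R * ((1 - d) / (1 + 2 * d))"
      have tR: "t / R = (1 - d) / (1 + 2 * d)" using R0 by (simp add: t_def)
      have t: "0 \<le> t" "t < R" using d R0 by (simp_all add: t_def field_simps)
      have "(\<beta> * (1 + 2 * d) / 3) *\<^sub>R ((1, 0) + t *\<^sub>R (0, w)) =
          (\<beta> * (1 + 2 * d) / 3 * (1 - t / R)) *\<^sub>R x + (\<beta> * (1 + 2 * d) / 3 * ((1 + 2 * (t / R)) / 3)) *\<^sub>R q"
        unfolding L by (simp add: scaleR_add_right)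
      also have "\<beta> * (1 + 2 * d) / 3 * (1 - t / R) = c * \<alpha>"
        unfolding tR using d \<alpha>\<beta> by (simp add: field_simps) (simp add: d_def)
      also have "\<beta> * (1 + 2 * d) / 3 * ((1 + 2 * (t / R)) / 3) = \<beta> / 3"
        unfolding tR using d by (simp add: field_simps)
      finally have "b + c *\<^sub>R a = (\<beta> * (1 + 2 * d) / 3) *\<^sub>R ((1, 0) + t *\<^sub>R (0, w))" by (simp add: a_def b_def)
      moreover have "(1, 0) + t *\<^sub>R (0, w) \<in> hyp_cone T" using R(3)[OF t] by simp
      ultimately show ?thesis using d \<alpha>\<beta> by (simp only:) (rule hyp_cone_scale[OF s], auto)
    qed
    have pos: "0 < 1 / \<alpha>" "0 < 1 / \<beta>" "0 < \<beta> / \<alpha>" using \<alpha>\<beta> by simp_all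
    obtain m k S U where ad: "m + k = DIM(real ^ 'n) - 1" "adapted T m k a b S U" "singular_end T k b U"
      by (rule adapted_singular[OF T ab bb e1 pos e0]) (assumption | rule that)+
    have m: "m \<le> CARD('n) - 1" and k: "k = CARD('n) - 1 - m" using ad(1) DIMn by linarith+
    define \<xi> where "\<xi> t = 1 + 2 * t / R" for t
    have f: "T ((1, 0) + t *\<^sub>R (0, w)) ((1, 0) + t *\<^sub>R (0, w)) ((1, 0) + t *\<^sub>R (0, w)) = (1 - t / R)\<^sup>2 * \<xi> t" for t
    proof -
      have "T (c *\<^sub>R x + d *\<^sub>R q) (c *\<^sub>R x + d *\<^sub>R q) (c *\<^sub>R x + d *\<^sub>R q)
          = c ^ 3 * T x x x + 3 * c\<^sup>2 * d * T x x q + 3 * c * d\<^sup>2 * T q q x + d ^ 3 * T q q q" for c d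
        by (simp add: sym3_simps[OF s] sym3_commute[OF s] power2_eq_square power3_eq_cube algebra_simps)
      then show ?thesis unfolding L by (simp only: xxx xxq crit \<xi>_def) simp
    qed
    define W where "W = {t. t < R \<and> norm (snd ((1, 0) + t *\<^sub>R (0, w))) < sqrt 3 * fst ((1, 0) + t *\<^sub>R (0, w))
       \<and> 0 < T ((1, 0) + t *\<^sub>R (0, w)) ((1, 0) + t *\<^sub>R (0, w)) ((1, 0) + t *\<^sub>R (0, w))}"
    have W: "open W"
      unfolding W_def
      by (intro open_Collect_conj open_Collect_less cont continuous_intros) (auto intro!: continuous_intros)
    have WR: "W \<subseteq> {..<R}" by (auto simp: W_def)
    have cone: "(1, 0) + t *\<^sub>R (0, w) \<in> hyp_cone T" if "t \<in> W" for t
      using that by (simp add: W_def hyp_cone_def)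
    have sub: "{0..<R} \<subseteq> W"
    proof
      fix t assume t: "t \<in> {0..<R}"
      then have "(1, t *\<^sub>R w) \<in> hyp_cone T" using R(3) by simp
      then show "t \<in> W" using t by (simp add: W_def hyp_cone_def)
    qed
    have g1: "g t = 1 - t / R" if "t \<in> W" for t using that WR by (auto simp: g_def left_gap_def)
    have \<xi>pos: "0 < \<xi> t" if "t \<in> W" for t
    proof -
      have "0 < (g t)\<^sup>2 * \<xi> t" using that f[of t] g1[OF that] by (simp add: W_def)
      then show ?thesis by (simp add: zero_less_mult_iff)
    qed
    have \<xi>sm: "Cinf_on W \<xi>"
    proof -
      have "Cinf_on W (\<lambda>t. 1 + 2 * t * (1 / R))"
        by (intro Cinf_add Cinf_mult Cinf_const Cinf_ident W)
      then show ?thesis by (simp add: \<xi>_def[abs_def])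
    qed
    define X where "X t = \<xi> t powr (- 1 / 3) * (1 / \<alpha>)" for t
    define Y where "Y t = \<xi> t powr (2 / 3) * (1 / \<beta>)" for t
    have sm: "Cinf_on W X" "Cinf_on W Y"
      unfolding X_def Y_def by ((rule Cinf_mult Cinf_powr_comp Cinf_const W \<xi>sm \<xi>pos | assumption)+)
    have "(\<xi> \<longlongrightarrow> 1 + 2 * R / R) (at_left R)"
      unfolding \<xi>_def by (intro tendsto_intros) (use R0 in auto)
    then have \<xi>lim: "(\<xi> \<longlongrightarrow> 3) (at_left R)" using R0 by simp
    have "(X \<longlongrightarrow> 3 powr (- 1 / 3) * (1 / \<alpha>)) (at_left R)" "(Y \<longlongrightarrow> 3 powr (2 / 3) * (1 / \<beta>)) (at_left R)"
      unfolding X_def Y_def by (intro tendsto_intros \<xi>lim; simp)+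
    then have XYlim: "(X \<longlongrightarrow> 1) (at_left R)" "(Y \<longlongrightarrow> 1) (at_left R)" by (simp_all add: \<alpha>_def \<beta>_def)
    have XY: "2 * X t + Y t \<noteq> 0" if "t \<in> W" for t
    proof -
      have "0 < X t" "0 < Y t" using \<xi>pos[OF that] \<alpha>\<beta> by (simp_all add: X_def Y_def)
      then show ?thesis by simp
    qed
    have curve: "limit_curve (\<lambda>z. T z z z) (1, 0) (0, w) t =
        ((g t powr (1 / 6))\<^sup>2 * X t) *\<^sub>R a + ((g t powr - (1 / 6)) ^ 4 * Y t) *\<^sub>R b" if t: "t \<in> W" for t
    proof -
      have p: "(g t powr (1 / 6))\<^sup>2 = g t powr (- 2 / 3) * g t" "(g t powr - (1 / 6)) ^ 4 = g t powr (- 2 / 3)"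
      proof -
        show "(g t powr - (1 / 6)) ^ 4 = g t powr (- 2 / 3)" by (subst powr_pow[OF gpos]) simp
        have "(g t powr (1 / 6))\<^sup>2 = g t powr (- 2 / 3 + 1)" by (subst powr_pow[OF gpos]) simp
        also have "\<dots> = g t powr (- 2 / 3) * g t" unfolding powr_add using gpos[of t] by simp
        finally show "(g t powr (1 / 6))\<^sup>2 = g t powr (- 2 / 3) * g t" .
      qed
      have x23: "\<xi> t powr (2 / 3) = \<xi> t powr (- 1 / 3) * \<xi> t"
      proof -
        have "\<xi> t powr (2 / 3) = \<xi> t powr (- 1 / 3 + 1)" by simp
        also have "\<dots> = \<xi> t powr (- 1 / 3) * \<xi> t" unfolding powr_add using \<xi>pos[OF t] by simp
        finally show ?thesis .
      qed
      have "limit_curve (\<lambda>z. T z z z) (1, 0) (0, w) t = ((g t)\<^sup>2 * \<xi> t) powr (- 1 / 3) *\<^sub>R (g t *\<^sub>R x + (\<xi> t / 3) *\<^sub>R q)"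
        unfolding limit_curve_def f by (simp only: L g1[OF t] \<xi>_def)
      also have "((g t)\<^sup>2 * \<xi> t) powr (- 1 / 3) = g t powr (- 2 / 3) * \<xi> t powr (- 1 / 3)"
      proof -
        have "((g t)\<^sup>2) powr (- 1 / 3) = g t powr (- 2 / 3)"
        proof -
          have "(g t)\<^sup>2 = g t powr 2" using gpos[of t] by (simp add: powr_numeral)
          then show ?thesis by (simp add: powr_powr)
        qed
        then show ?thesis using \<xi>pos[OF t] by (simp add: powr_mult)
      qed
      finally show ?thesis
        unfolding p X_def Y_def a_def b_def x23 using \<alpha>\<beta>(1,2) by (simp add: algebra_simps)
    qed
    have lm: "g t powr (1 / 6) * g t powr - (1 / 6) = 1" for t
      using left_gap_inverse[OF R0, of t "1 / 6"] by (simp add: g_def)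
    have lim: "((\<lambda>t. g t powr (1 / 6)) \<longlongrightarrow> 0) (at_left R)"
      unfolding g_def by (rule left_gap_tendsto[OF _ R0]) simp
    have gsm: "Cinf_on W (\<lambda>t. g t powr x)" for x
      unfolding g_def by (rule left_gap_Cinf[OF W WR R0])
    have "limit_polynomial (\<lambda>z. T z z z) (1, 0) (0, w) (poly_general e m (normal_form_matrices T k S U))"
      by (rule adapted_limit[OF e m k s ad(2) disjI1[OF conjI[OF lim ad(3)]] W sub gsm gsm sm lm
            hyp_cone_hyp[OF T cone] XYlim XY curve R(1)])
    then show ?thesis using m k normal_form_matrices_symmetric[OF s, of m k S U] by blast
  qed
qed

section \<open>Scaling symmetries of the normal form\<close>

lemma lX_simps: "lX e (x + y) = lX e x + lX e y" "lX e (c *\<^sub>R x) = c * lX e x"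
  and lY_simps: "lY e (x + y) = lY e x + lY e y" "lY e (c *\<^sub>R x) = c * lY e x"
  by (simp_all add: linear_add[OF linear_light(1)] linear_scale[OF linear_light(1)]
    linear_add[OF linear_light(2)] linear_scale[OF linear_light(2)])

lemma light_point_decompose: "light_point e X Y = X *\<^sub>R light_point e 1 0 + Y *\<^sub>R light_point e 0 1"
  by (simp add: light_point_def axis_def Finite_Cartesian_Product.vec_eq_iff field_simps)

lemma light_point_one: "light_point e 1 1 = (1, 0)"
  by (simp add: light_point_def)

lemma light_point_coordinates:
  "lX e (light_point e X Y) = X" "lY e (light_point e X Y) = Y"
  "i \<noteq> e (CARD('n) - 1) \<Longrightarrow> snd (light_point e X Y) $ i = 0" for e :: "nat \<Rightarrow> 'n::finite"
  by (simp_all add: light_point_def lX_def lY_def lw_def axis_def field_simps sqrt3_simps)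

lemma transverse_coordinates:
  fixes e :: "nat \<Rightarrow> 'n::finite"
  assumes "y $ e (CARD('n) - 1) = 0"
  shows "lX e (0, y) = 0" "lY e (0, y) = 0"
  using assms by (simp_all add: lX_def lY_def lw_def)

lemma light_eqI:
  fixes e :: "nat \<Rightarrow> 'n::finite"
  assumes "lX e z = lX e z'" "lY e z = lY e z'" "\<And>i. i \<noteq> e (CARD('n) - 1) \<Longrightarrow> snd z $ i = snd z' $ i"
  shows "z = z'"
proof -
  have "lX e z - lY e z = 3 * (lw e z / sqrt 3)" "2 * lX e z + lY e z = 3 * fst z" for z
    by (simp_all add: lX_def lY_def)
  then have w: "lw e z = lw e z'" and f: "fst z = fst z'"
    using assms(1,2) by (metis mult_left_cancel zero_neq_numeral divide_cancel_right real_sqrt_eq_zero_cancel_iff)+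
  have "snd z = snd z'"
    unfolding Finite_Cartesian_Product.vec_eq_iff using assms(3) w[unfolded lw_def] by metis
  then show ?thesis using f by (simp add: prod_eq_iff)
qed

definition coordinate_part :: "(nat \<Rightarrow> 'n::finite) \<Rightarrow> nat set \<Rightarrow> real ^ 'n \<Rightarrow> real ^ 'n" where
  "coordinate_part e A y = (\<chi> i. if i \<in> e ` A then y $ i else 0)"

definition grade2 :: "(nat \<Rightarrow> 'n::finite) \<Rightarrow> nat \<Rightarrow> real \<times> (real ^ 'n) \<Rightarrow> real \<times> (real ^ 'n)" where
  "grade2 e m z = lX e z *\<^sub>R light_point e 1 0 + (0, coordinate_part e {..<m} (snd z))"

definition grade4 :: "(nat \<Rightarrow> 'n::finite) \<Rightarrow> real \<times> (real ^ 'n) \<Rightarrow> real \<times> (real ^ 'n)" where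
  "grade4 e z = lY e z *\<^sub>R light_point e 0 1"

definition grade1 :: "(nat \<Rightarrow> 'n::finite) \<Rightarrow> nat \<Rightarrow> real \<times> (real ^ 'n) \<Rightarrow> real \<times> (real ^ 'n)" where
  "grade1 e m z = (0, coordinate_part e {m..<CARD('n) - 1} (snd z))"

text \<open>The scaling on the coordinates of the normal form itself: a for X and s, b for Y, and c for u.\<close>
definition grading_map :: "(nat \<Rightarrow> 'n::finite) \<Rightarrow> nat \<Rightarrow> real \<Rightarrow> real \<Rightarrow> real \<Rightarrow> (real \<times> (real ^ 'n)) \<Rightarrow>\<^sub>L (real \<times> (real ^ 'n))" where
  "grading_map e m a b c = a *\<^sub>R Blinfun (grade2 e m) + b *\<^sub>R Blinfun (grade4 e) + c *\<^sub>R Blinfun (grade1 e m)"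

lemma linear_coordinate_part: "linear (coordinate_part e A)"
  by (auto simp: linear_iff coordinate_part_def Finite_Cartesian_Product.vec_eq_iff)

lemma linear_grades: "linear (grade2 e m)" "linear (grade4 e)" "linear (grade1 e m)"
  by (simp_all add: linear_iff grade2_def grade4_def grade1_def lX_simps lY_simps algebra_simps
      linear_add[OF linear_coordinate_part] linear_scale[OF linear_coordinate_part])

lemma grading_map_apply:
  "blinfun_apply (grading_map e m a b c) z = a *\<^sub>R grade2 e m z + b *\<^sub>R grade4 e z + c *\<^sub>R grade1 e m z"
  by (simp add: grading_map_def blinfun.add_left blinfun.scaleR_left
      bounded_linear_Blinfun_apply[OF linear_grades(1)[THEN linear_linear[THEN iffD2]]]
      bounded_linear_Blinfun_apply[OF linear_grades(2)[THEN linear_linear[THEN iffD2]]]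
      bounded_linear_Blinfun_apply[OF linear_grades(3)[THEN linear_linear[THEN iffD2]]])

lemma coordinate_part_last:
  fixes e :: "nat \<Rightarrow> 'n::finite"
  assumes "bij_betw e {..<CARD('n)} UNIV" "A \<subseteq> {..<CARD('n) - 1}"
  shows "coordinate_part e A y $ e (CARD('n) - 1) = 0"
proof -
  have "e (CARD('n) - 1) \<notin> e ` A"
  proof
    assume "e (CARD('n) - 1) \<in> e ` A"
    then obtain i where i: "i \<in> A" "e (CARD('n) - 1) = e i" by auto
    have "CARD('n) - 1 < CARD('n)" "i < CARD('n)" "i < CARD('n) - 1" using i assms(2) by auto
    then show False using enumerated_eq_iff[OF assms(1), of "CARD('n) - 1" i] i(2) by simp
  qed
  then show ?thesis by (simp add: coordinate_part_def)
qed

lemma coordinate_part_nth: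
  fixes e :: "nat \<Rightarrow> 'n::finite"
  assumes "bij_betw e {..<CARD('n)} UNIV" "A \<subseteq> {..<CARD('n)}" "i < CARD('n)"
  shows "coordinate_part e A y $ e i = (if i \<in> A then y $ e i else 0)"
proof -
  have "e i \<in> e ` A \<longleftrightarrow> i \<in> A"
    using assms by (intro inj_on_image_mem_iff[of e "{..<CARD('n)}"]) (auto simp: bij_betw_def)
  then show ?thesis by (simp add: coordinate_part_def)
qed

lemma grading_map_coordinates:
  fixes e :: "nat \<Rightarrow> 'n::finite"
  assumes e: "bij_betw e {..<CARD('n)} UNIV" and m: "m \<le> CARD('n) - 1"
  shows "lX e (blinfun_apply (grading_map e m a b c) z) = a * lX e z"
    "lY e (blinfun_apply (grading_map e m a b c) z) = b * lY e z"
    "i < m \<Longrightarrow> snd (blinfun_apply (grading_map e m a b c) z) $ e i = a * snd z $ e i"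
    "j < CARD('n) - 1 - m \<Longrightarrow> snd (blinfun_apply (grading_map e m a b c) z) $ e (m + j) = c * snd z $ e (m + j)"
proof -
  have A: "{..<m} \<subseteq> {..<CARD('n) - 1}" "{m..<CARD('n) - 1} \<subseteq> {..<CARD('n) - 1}"
    "{..<m} \<subseteq> {..<CARD('n)}" "{m..<CARD('n) - 1} \<subseteq> {..<CARD('n)}" using m by auto
  have t: "lX e (0, coordinate_part e {..<m} y) = 0" "lX e (0, coordinate_part e {m..<CARD('n) - 1} y) = 0"
    "lY e (0, coordinate_part e {..<m} y) = 0" "lY e (0, coordinate_part e {m..<CARD('n) - 1} y) = 0" for y
    by (rule transverse_coordinates coordinate_part_last[OF e] A)+
  show "lX e (blinfun_apply (grading_map e m a b c) z) = a * lX e z"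
    "lY e (blinfun_apply (grading_map e m a b c) z) = b * lY e z"
    unfolding grading_map_apply grade2_def grade4_def grade1_def
    by (simp_all only: lX_simps lY_simps light_point_coordinates t) simp_all
  have ne: "e i \<noteq> e (CARD('n) - 1)" if "i < CARD('n) - 1" for i
    using enumerated_eq_iff[OF e, of i "CARD('n) - 1"] that by auto
  have c: "snd (blinfun_apply (grading_map e m a b c) z) $ e i =
      (if i < m then a * snd z $ e i else c * snd z $ e i)" if i: "i < CARD('n) - 1" for i
  proof -
    have i': "i < CARD('n)" using i by simp
    have "coordinate_part e {..<m} y $ e i = (if i < m then y $ e i else 0)"
      "coordinate_part e {m..<CARD('n) - 1} y $ e i = (if i < m then 0 else y $ e i)" for y
      using i coordinate_part_nth[OF e A(3) i', of y] coordinate_part_nth[OF e A(4) i', of y] by auto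
    note cp = this[unfolded One_nat_def]
    show ?thesis
      unfolding grading_map_apply grade2_def grade4_def grade1_def
      using i by (simp add: light_point_coordinates(3)[where e = e, OF ne[OF i]] cp)
  qed
  show "i < m \<Longrightarrow> snd (blinfun_apply (grading_map e m a b c) z) $ e i = a * snd z $ e i"
    using c[of i] m by simp
  show "j < CARD('n) - 1 - m \<Longrightarrow> snd (blinfun_apply (grading_map e m a b c) z) $ e (m + j) = c * snd z $ e (m + j)"
    using c[of "m + j"] by simp
qed

text \<open>Every monomial of the normal form has factor a ^ 2 * b or a * c ^ 2.\<close>
lemma grading_map_invariance:
  fixes e :: "nat \<Rightarrow> 'n::finite"
  assumes e: "bij_betw e {..<CARD('n)} UNIV" and m: "m \<le> CARD('n) - 1"
    and s: "a\<^sup>2 * b = 1" "a * c\<^sup>2 = 1"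
  shows "poly_general e m F (blinfun_apply (grading_map e m a b c) z) = poly_general e m F z"
proof -
  let ?k = "CARD('n) - 1 - m"
  let ?z = "blinfun_apply (grading_map e m a b c) z"
  note co = grading_map_coordinates[OF e m]
  have 1: "(\<Sum>i<m. (snd ?z $ e i)\<^sup>2) = a\<^sup>2 * (\<Sum>i<m. (snd z $ e i)\<^sup>2)"
    by (simp add: co(3) power_mult_distrib sum_distrib_left)
  have 2: "(\<Sum>j<?k. (snd ?z $ e (m + j))\<^sup>2) = c\<^sup>2 * (\<Sum>j<?k. (snd z $ e (m + j))\<^sup>2)"
    by (simp add: co(4) power_mult_distrib sum_distrib_left)
  have 3: "(\<Sum>i<m. snd ?z $ e i * (\<Sum>j<?k. snd ?z $ e (m + j) * (\<Sum>l<?k. F i $$ (j, l) * snd ?z $ e (m + l))))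
     = (a * c\<^sup>2) * (\<Sum>i<m. snd z $ e i * (\<Sum>j<?k. snd z $ e (m + j) * (\<Sum>l<?k. F i $$ (j, l) * snd z $ e (m + l))))"
    by (simp add: co(3,4) sum_distrib_left power2_eq_square mult_ac)
  have "poly_general e m F ?z = (a\<^sup>2 * b) * (lY e z * ((lX e z)\<^sup>2 - (\<Sum>i<m. (snd z $ e i)\<^sup>2)))
      - (a * c\<^sup>2) * (lX e z * (\<Sum>j<?k. (snd z $ e (m + j))\<^sup>2))
      + (a * c\<^sup>2) * (\<Sum>i<m. snd z $ e i * (\<Sum>j<?k. snd z $ e (m + j) * (\<Sum>l<?k. F i $$ (j, l) * snd z $ e (m + l))))"
    unfolding poly_general_light 1 2 3 co(1,2) by (simp add: power_mult_distrib algebra_simps)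
  then show ?thesis unfolding s by (simp add: poly_general_light)
qed

lemma grading_map_GL:
  fixes e :: "nat \<Rightarrow> 'n::finite"
  assumes e: "bij_betw e {..<CARD('n)} UNIV" and m: "m \<le> CARD('n) - 1" and n: "a \<noteq> 0" "b \<noteq> 0" "c \<noteq> 0"
  shows "grading_map e m a b c \<in> GL"
proof -
  let ?G = "blinfun_apply (grading_map e m a b c)"
  note co = grading_map_coordinates[OF e m]
  have "z = 0" if z: "?G z = 0" for z
  proof (rule light_eqI[of e])
    show "lX e z = lX e 0" "lY e z = lY e 0"
      using co(1,2)[of a b c z] n unfolding z by (simp_all add: lX_def lY_def lw_def)
    fix i assume i: "i \<noteq> e (CARD('n) - 1)"
    obtain d where d: "d < CARD('n)" "i = e d" using e by (auto simp: bij_betw_def image_iff)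
    have d1: "d < CARD('n) - 1" using d i by (cases "d = CARD('n) - 1") auto
    show "snd z $ i = snd 0 $ i"
    proof (cases "d < m")
      case True
      then show ?thesis using co(3)[OF True, of a b c z] n unfolding z d(2) by simp
    next
      case False
      then have "d - m < CARD('n) - 1 - m" "m + (d - m) = d" using d1 by auto
      then show ?thesis using co(4)[of "d - m" a b c z] n unfolding z d(2) by simp
    qed
  qed
  moreover have l: "linear ?G" by (rule bounded_linear.linear[OF blinfun.bounded_linear_right])
  ultimately have "inj ?G" using linear_injective_0[OF l] by blast
  then show ?thesis using linear_inj_imp_surj[OF l] by (simp add: GL_def bij_def)
qed

lemma grading_map_base:
  fixes e :: "nat \<Rightarrow> 'n::finite"
  assumes "bij_betw e {..<CARD('n)} UNIV" and m: "m \<le> CARD('n) - 1"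
  shows "blinfun_apply (grading_map e m a b c) (1, 0) = light_point e a b"
proof -
  have z: "lX e (1, 0) = 1" "lY e (1, 0) = 1" by (simp_all add: lX_def lY_def lw_def)
  have "coordinate_part e A 0 = 0" for A by (simp add: linear_0[OF linear_coordinate_part])
  then show ?thesis
    unfolding grading_map_apply grade2_def grade4_def grade1_def z light_point_decompose[of e a b]
    by (simp add: zero_prod_def[symmetric])
qed

text \<open>The exponents solve a ^ 2 * b = 1 and a * c ^ 2 = 1, normalized so that r is the quotient of the
  null coordinates of the image of (1, 0).\<close>
definition scaling :: "(nat \<Rightarrow> 'n::finite) \<Rightarrow> nat \<Rightarrow> real \<Rightarrow> (real \<times> (real ^ 'n)) \<Rightarrow>\<^sub>L (real \<times> (real ^ 'n))" where
  "scaling e m r = grading_map e m (r powr (- 1 / 3)) (r powr (2 / 3)) (r powr (1 / 6))"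

lemma norm_axis: "norm (axis i c :: real ^ 'n::finite) = \<bar>c\<bar>"
  by (simp add: norm_eq_sqrt_inner inner_axis_axis)

lemma light_point_timelike:
  assumes "0 < X" "0 < Y" shows "norm (snd (light_point e X Y)) < sqrt 3 * fst (light_point e X Y)"
proof -
  have "\<bar>X - Y\<bar> < 2 * X + Y" using assms by linarith
  then have "\<bar>X - Y\<bar> / sqrt 3 < (2 * X + Y) / sqrt 3" by (intro divide_strict_right_mono) auto
  moreover have "(2 * X + Y) / sqrt 3 = sqrt 3 * ((2 * X + Y) / 3)" by (simp add: field_simps sqrt3_simps)
  ultimately show ?thesis by (simp add: light_point_def norm_axis)
qed

lemma scaling_symmetry:
  fixes e :: "nat \<Rightarrow> 'n::finite"
  assumes e: "bij_betw e {..<CARD('n)} UNIV" and m: "m \<le> CARD('n) - 1"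
    and T: "std3 T" "cubic_bound T" "poly_general e m F = (\<lambda>z. T z z z)" and r: "0 < r"
  shows "scaling e m r \<in> GL" "poly_general e m F (blinfun_apply (scaling e m r) z) = poly_general e m F z"
    "blinfun_apply (scaling e m r) (1, 0) = light_point e (r powr (- 1 / 3)) (r powr (2 / 3))"
    "light_point e (r powr (- 1 / 3)) (r powr (2 / 3)) \<in> std_component (poly_general e m F)"
    "scaling e m r \<in> symmetry_group (std_component (poly_general e m F))"
proof -
  have s: "(r powr (- 1 / 3))\<^sup>2 * r powr (2 / 3) = 1" "r powr (- 1 / 3) * (r powr (1 / 6))\<^sup>2 = 1"
    using r by (simp_all add: power2_eq_square flip: powr_add)
  show 1: "scaling e m r \<in> GL" unfolding scaling_def by (rule grading_map_GL[OF e m]) (use r in auto)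
  show 2: "poly_general e m F (blinfun_apply (scaling e m r) z) = poly_general e m F z" for z
    unfolding scaling_def by (rule grading_map_invariance[OF e m s])
  show 3: "blinfun_apply (scaling e m r) (1, 0) = light_point e (r powr (- 1 / 3)) (r powr (2 / 3))"
    unfolding scaling_def by (rule grading_map_base[OF e m])
  have "poly_general e m F (light_point e (r powr (- 1 / 3)) (r powr (2 / 3))) = poly_general e m F (1, 0)"
    using 2[of "(1, 0)"] by (simp add: 3)
  also have "\<dots> = 1" using T(1) by (simp add: T(3) std3_def)
  finally show 4: "light_point e (r powr (- 1 / 3)) (r powr (2 / 3)) \<in> std_component (poly_general e m F)"
    unfolding T(3) std_component_eq[OF T(1,2)] using light_point_timelike[of "r powr (- 1 / 3)" "r powr (2 / 3)" e] r by simp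
  show "scaling e m r \<in> symmetry_group (std_component (poly_general e m F))"
    unfolding symmetry_group_def using 1 component_image[OF 1, of "poly_general e m F" "poly_general e m F"] 2 4 3 by simp
qed

section \<open>Dimension of the symmetry group\<close>

text \<open>The matrix units span the endomorphisms.\<close>
lemma blinfun_finite_span:
  fixes L :: "'a::euclidean_space \<Rightarrow>\<^sub>L 'a"
  shows "L \<in> span {rank_one (Blinfun (\<lambda>q. q \<bullet> i)) j | i j :: 'a. i \<in> Basis \<and> j \<in> Basis}" (is "_ \<in> span ?B")
proof -
  have "L = (\<Sum>i\<in>Basis. \<Sum>j\<in>Basis. (blinfun_apply L i \<bullet> j) *\<^sub>R rank_one (Blinfun (\<lambda>q. q \<bullet> i)) j)"
  proof (rule blinfun_eqI)
    fix x
    have "blinfun_apply L x = blinfun_apply L (\<Sum>i\<in>Basis. (x \<bullet> i) *\<^sub>R i)" by (simp add: euclidean_representation)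
    also have "\<dots> = (\<Sum>i\<in>Basis. (x \<bullet> i) *\<^sub>R blinfun_apply L i)" by (simp add: blinfun.sum_right blinfun.scaleR_right)
    also have "\<dots> = (\<Sum>i\<in>Basis. (x \<bullet> i) *\<^sub>R (\<Sum>j\<in>Basis. (blinfun_apply L i \<bullet> j) *\<^sub>R j))" by (simp add: euclidean_representation)
    also have "\<dots> = blinfun_apply (\<Sum>i\<in>Basis. \<Sum>j\<in>Basis. (blinfun_apply L i \<bullet> j) *\<^sub>R rank_one (Blinfun (\<lambda>q. q \<bullet> i)) j) x"
      by (simp add: blinfun.sum_left blinfun.scaleR_left rank_one_apply bounded_linear_Blinfun_apply
          bounded_linear_inner_left scaleR_sum_right mult.commute)
    finally show "blinfun_apply L x = \<dots>" .
  qed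
  also have "\<dots> \<in> span ?B"
    by (intro span_sum span_scale span_base) blast
  finally show ?thesis .
qed

text \<open>A dimension counts a basis only when that basis is finite; finiteness comes from the finite
  spanning set of matrix units.\<close>
lemma lie_group_dim_ge_1:
  fixes G :: "('a::euclidean_space \<Rightarrow>\<^sub>L 'a) set"
  assumes "E \<in> tangent_space G id_blinfun" "E \<noteq> 0"
  shows "1 \<le> lie_group_dim G"
proof (rule ccontr)
  let ?V = "tangent_space G id_blinfun"
  let ?S = "{rank_one (Blinfun (\<lambda>q. q \<bullet> i)) j | i j :: 'a. i \<in> Basis \<and> j \<in> Basis}"
  assume "\<not> 1 \<le> lie_group_dim G"
  then have d: "dim ?V = 0" by (simp add: lie_group_dim_def)
  obtain B where B: "B \<subseteq> ?V" "independent B" "?V \<subseteq> span B" "card B = dim ?V" using basis_exists by blast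
  have "finite ((\<lambda>(i, j). rank_one (Blinfun (\<lambda>q. q \<bullet> i)) j) ` (Basis \<times> (Basis :: 'a set)))" by simp
  moreover have "?S \<subseteq> (\<lambda>(i, j). rank_one (Blinfun (\<lambda>q. q \<bullet> i)) j) ` (Basis \<times> Basis)" by auto
  ultimately have "finite ?S" by (rule rev_finite_subset)
  then have "finite B" using independent_span_bound[OF _ B(2), of ?S] blinfun_finite_span by blast
  then have "B = {}" using B(4) d by simp
  then show False using B(3) assms by auto
qed

lemma scaling_tangent:
  "((\<lambda>t. scaling e m (exp t)) has_vector_derivative grading_map e m (- 1 / 3) (2 / 3) (1 / 6)) (at 0)"
proof -
  have "scaling e m (exp t) = exp (- 1 / 3 * t) *\<^sub>R Blinfun (grade2 e m) + exp (2 / 3 * t) *\<^sub>R Blinfun (grade4 e)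
     + exp (1 / 6 * t) *\<^sub>R Blinfun (grade1 e m)" for t
    by (simp add: scaling_def grading_map_def powr_def)
  moreover have "((\<lambda>t. exp (- 1 / 3 * t) *\<^sub>R Blinfun (grade2 e m) + exp (2 / 3 * t) *\<^sub>R Blinfun (grade4 e)
     + exp (1 / 6 * t) *\<^sub>R Blinfun (grade1 e m)) has_vector_derivative grading_map e m (- 1 / 3) (2 / 3) (1 / 6)) (at 0)"
    unfolding grading_map_def
    by (auto intro!: derivative_eq_intros)
  ultimately show ?thesis by simp
qed

text \<open>The tangent vector at the identity of the one-parameter group of scalings.\<close>
theorem symmetry_group_dim:
  fixes e :: "nat \<Rightarrow> 'n::finite"
  assumes e: "bij_betw e {..<CARD('n)} UNIV" and m: "m \<le> CARD('n) - 1"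
    and T: "std3 T" "cubic_bound T" "poly_general e m F = (\<lambda>z. T z z z)"
  shows "grading_map e m (- 1 / 3) (2 / 3) (1 / 6) \<in> tangent_space (symmetry_group (std_component (poly_general e m F))) id_blinfun"
    "grading_map e m (- 1 / 3) (2 / 3) (1 / 6) \<noteq> 0"
proof -
  let ?E = "grading_map e m (- 1 / 3) (2 / 3) (1 / 6)"
  have "scaling e m 1 = id_blinfun"
  proof (rule blinfun_eqI, rule light_eqI[of e])
    fix z
    note co = grading_map_coordinates[OF e m, where a = 1 and b = 1 and c = 1 and z = z]
    have sc: "scaling e m 1 = grading_map e m 1 1 1" by (simp add: scaling_def)
    show "lX e (blinfun_apply (scaling e m 1) z) = lX e (blinfun_apply id_blinfun z)"
      "lY e (blinfun_apply (scaling e m 1) z) = lY e (blinfun_apply id_blinfun z)" using co by (simp_all add: sc)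
    fix i assume i: "i \<noteq> e (CARD('n) - 1)"
    obtain d where d: "d < CARD('n)" "i = e d" using e by (auto simp: bij_betw_def image_iff)
    have d1: "d < CARD('n) - 1" using d i by (cases "d = CARD('n) - 1") auto
    show "snd (blinfun_apply (scaling e m 1) z) $ i = snd (blinfun_apply id_blinfun z) $ i"
    proof (cases "d < m")
      case True
      then show ?thesis using co(3)[OF True] by (simp add: sc d(2))
    next
      case False
      then have "d - m < CARD('n) - 1 - m" "m + (d - m) = d" using d1 by auto
      then show ?thesis using co(4)[where j = "d - m"] by (simp add: sc d(2))
    qed
  qed
  then show "?E \<in> tangent_space (symmetry_group (std_component (poly_general e m F))) id_blinfun"
    unfolding tangent_space_def
    using scaling_tangent[of e m] scaling_symmetry(5)[OF e m T exp_gt_zero]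
    by (intro CollectI exI[of _ "\<lambda>t. scaling e m (exp t)"] exI[of _ 1]) simp
  have "lX e (blinfun_apply ?E (1, 0)) \<noteq> lX e 0"
    unfolding grading_map_base[OF e m] light_point_coordinates by (simp add: lX_def lw_def)
  then show "?E \<noteq> 0" by auto
qed

section \<open>The normal forms are singular at infinity and limits of themselves\<close>

text \<open>The singular point is (1, - sqrt 3) in the direction of w, that is X = 0 and Y = 3. It lies on the
  light cone, so singular_critical applies, and it is the limit of multiples of the points of the orbit of (1,
  0) under the scalings.\<close>
theorem normal_form_singular:
  fixes e :: "nat \<Rightarrow> 'n::finite"
  assumes e: "bij_betw e {..<CARD('n)} UNIV" and m: "m \<le> CARD('n) - 1"
    and T: "std3 T" "cubic_bound T" "poly_general e m F = (\<lambda>z. T z z z)"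
  shows "singular_at_infinity (poly_general e m F) (std_component (poly_general e m F))"
proof -
  note s = std3_sym3[OF T(1)]
  let ?g = "poly_general e m F"
  let ?C = "{r *\<^sub>R q | r q. 0 < r \<and> q \<in> std_component ?g}"
  define q where "q = light_point e 0 3"
  define w where "w = (axis (e (CARD('n) - 1)) (- (3 / sqrt 3)) :: real ^ 'n)"
  have qw: "q = (1, 1 *\<^sub>R w)" by (simp add: q_def light_point_def w_def)
  have nw: "norm w = sqrt 3" by (simp add: w_def norm_axis real_div_sqrt)
  have ne: "snd q $ e i = 0" if "i < CARD('n) - 1" for i
    unfolding q_def using enumerated_eq_iff[OF e, of i "CARD('n) - 1"] that by (intro light_point_coordinates(3)) auto
  have g0: "?g q = 0"
    using ne m unfolding poly_general_light by (simp add: q_def light_point_coordinates)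
  have crit: "T q q z = 0" for z
    unfolding qw by (rule singular_critical[OF T(1,2)]) (use nw g0 in \<open>simp_all add: T(3) qw\<close>)
  have "frechet_derivative ?g (at q) = (\<lambda>_. 0)"
    unfolding T(3) sym3_frechet[OF s] crit by simp
  moreover have "q \<noteq> 0" by (simp add: qw zero_prod_def)
  moreover have "q \<in> frontier ?C"
  proof -
    have "q \<notin> ?C"
    proof
      assume "q \<in> ?C"
      then obtain r x where r: "q = r *\<^sub>R x" "0 < r" "x \<in> std_component ?g" by blast
      have "?g x = 1" using r(3) connected_component_subset[of "{q. ?g q = 1}"] unfolding std_component_def by blast
      then have "?g q = r ^ 3" unfolding r(1) T(3) by (simp add: sym3_simps[OF s] power3_eq_cube)
      then show False using g0 r(2) by simp
    qed
    moreover have "q \<in> closure ?C"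
      unfolding closure_sequential
    proof (intro exI[of _ "\<lambda>n. light_point e (3 * inverse (real (Suc n))) 3"] conjI allI)
      fix n :: nat
      let ?r = "real (Suc n)"
      have "light_point e (?r powr (- 1 / 3)) (?r powr (2 / 3)) \<in> std_component ?g"
        by (rule scaling_symmetry(4)[OF e m T]) simp
      moreover have "light_point e (3 * inverse ?r) 3 = (3 * ?r powr (- 2 / 3)) *\<^sub>R light_point e (?r powr (- 1 / 3)) (?r powr (2 / 3))"
      proof -
        have "?r powr (- 2 / 3) * ?r powr (- 1 / 3) = inverse ?r" "?r powr (- 2 / 3) * ?r powr (2 / 3) = 1"
          unfolding powr_add[symmetric] by (simp_all add: powr_minus)
        then show ?thesis
          unfolding light_point_decompose[of e "3 * inverse ?r"] light_point_decompose[of e "?r powr (- 1 / 3)"]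
          by (simp add: algebra_simps)
      qed
      moreover have "0 < 3 * ?r powr (- 2 / 3)" by simp
      ultimately show "light_point e (3 * inverse ?r) 3 \<in> ?C" by blast
    next
      have "(\<lambda>n. (3 * inverse (real (Suc n))) *\<^sub>R light_point e 1 0 + 3 *\<^sub>R light_point e 0 1)
          \<longlonglongrightarrow> (3 * 0) *\<^sub>R light_point e 1 0 + 3 *\<^sub>R light_point e 0 1"
        by (intro tendsto_intros LIMSEQ_inverse_real_of_nat)
      then show "(\<lambda>n. light_point e (3 * inverse (real (Suc n))) 3) \<longlonglongrightarrow> q"
        unfolding q_def light_point_decompose[of e _ 3] by simp
    qed
    ultimately show ?thesis unfolding frontier_def using interior_subset by blast
  qed
  ultimately show ?thesis unfolding singular_at_infinity_def by blast
qed

text \<open>Along the line (1, 0) + t v, where v is tangent to the orbit of (1, 0) under the scalings, the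
  limit curve is that orbit. Hence the scalings themselves are standard frames, and the pulled-back polynomial
  is constant in t.\<close>
theorem normal_form_self_limit:
  fixes e :: "nat \<Rightarrow> 'n::finite"
  assumes e: "bij_betw e {..<CARD('n)} UNIV" and m: "m \<le> CARD('n) - 1"
    and T: "std3 T" "cubic_bound T" "poly_general e m F = (\<lambda>z. T z z z)"
  shows "\<exists>p\<in>std_component (poly_general e m F). \<exists>v\<in>tangent_space (std_component (poly_general e m F)) p - {0}.
    limit_polynomial (poly_general e m F) p v (poly_general e m F)"
proof (intro bexI)
  let ?g = "poly_general e m F"
  define v where "v = light_point e (- 1 / 3) (2 / 3)"
  note sy = scaling_symmetry[OF e m T]
  have one: "(1, 0) = light_point e (1 powr (- 1 / 3)) (1 powr (2 / 3))" by (simp add: light_point_one)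
  show p: "(1, 0) \<in> std_component ?g" unfolding one by (rule sy(4)) simp
  have "((\<lambda>t. blinfun_apply (scaling e m (exp t)) (1, 0)) has_vector_derivative
      blinfun_apply (grading_map e m (- 1 / 3) (2 / 3) (1 / 6)) (1, 0)) (at 0)"
    by (rule bounded_linear.has_vector_derivative[OF blinfun.bounded_linear_left scaling_tangent])
  then have "((\<lambda>t. light_point e (exp t powr (- 1 / 3)) (exp t powr (2 / 3))) has_vector_derivative v) (at 0)"
    unfolding sy(3)[OF exp_gt_zero] grading_map_base[OF e m] v_def .
  then have "v \<in> tangent_space (std_component ?g) (1, 0)"
    unfolding tangent_space_def using sy(4)[OF exp_gt_zero]
    by (intro CollectI exI[of _ "\<lambda>t. light_point e (exp t powr (- 1 / 3)) (exp t powr (2 / 3))"] exI[of _ 1])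
       (simp add: light_point_one)
  moreover have "v \<noteq> 0" using light_point_coordinates(1)[of e "- 1 / 3" "2 / 3"] by (auto simp: v_def lX_def lw_def)
  ultimately show "v \<in> tangent_space (std_component ?g) (1, 0) - {0}" by simp
  define X where "X t = 1 - t / 3" for t :: real
  define Y where "Y t = 1 + 2 * t / 3" for t :: real
  define r where "r t = Y t / X t" for t
  have line: "(1, 0) + t *\<^sub>R v = light_point e (X t) (Y t)" for t
  proof -
    have "light_point e (X t) (Y t) = (1 - t / 3) *\<^sub>R light_point e 1 0 + (1 + 2 * t / 3) *\<^sub>R light_point e 0 1"
      by (subst light_point_decompose) (simp add: X_def Y_def)
    moreover have "(1, 0) = light_point e 1 0 + light_point e 0 1"
      using light_point_decompose[of e 1 1] by (simp add: light_point_one)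
    moreover have "v = (- 1 / 3) *\<^sub>R light_point e 1 0 + (2 / 3) *\<^sub>R light_point e 0 1"
      unfolding v_def by (rule light_point_decompose)
    ultimately show ?thesis by (simp only: scaleR_add_right scaleR_add_left scaleR_diff_left) simp
  qed
  have ne: "snd (light_point e a b) $ e i = 0" if "i < CARD('n) - 1" for i a b
    using enumerated_eq_iff[OF e, of i "CARD('n) - 1"] that by (intro light_point_coordinates(3)) auto
  have g: "?g (light_point e a b) = a\<^sup>2 * b" for a b
    using ne m unfolding poly_general_light by (simp add: light_point_coordinates)
  have z: "smallest_positive_zero ?g (1, 0) v 3"
    unfolding smallest_positive_zero_def line g by (simp add: X_def Y_def)
  define A where "A t = scaling e m (r t)" for t
  have pos: "0 < X t" "0 < Y t" "0 < r t" if "t \<in> {-1<..<3}" for t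
    using that by (simp_all add: r_def X_def Y_def)
  have sm: "Cinf_on {-1<..<3} X" "Cinf_on {-1<..<3} Y"
  proof -
    have "Cinf_on {-1<..<3::real} (\<lambda>t::real. 1 - t * (1 / 3))" "Cinf_on {-1<..<3::real} (\<lambda>t::real. 1 + t * (2 / 3))"
      by (rule Cinf_diff Cinf_add Cinf_mult Cinf_ident open_greaterThanLessThan Cinf_const)+
    moreover have "X = (\<lambda>t. 1 - t * (1 / 3))" "Y = (\<lambda>t. 1 + t * (2 / 3))" by (auto simp: X_def Y_def)
    ultimately show "Cinf_on {-1<..<3} X" "Cinf_on {-1<..<3} Y" by (simp_all only:)
  qed
  have rsm: "Cinf_on {-1<..<3} r"
    unfolding r_def by (rule Cinf_divide[OF _ sm(2,1) pos(1)]) auto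
  have Asm: "Cinf_on {-1<..<3} A"
    unfolding A_def scaling_def grading_map_def
    by (rule Cinf_add Cinf_scaleR Cinf_const Cinf_powr_comp[OF _ rsm pos(3)] open_greaterThanLessThan | assumption)+
  have curve: "limit_curve ?g (1, 0) v t = blinfun_apply (A t) (1, 0)" if t: "t \<in> {-1<..<3}" for t
  proof -
    note p = pos[OF t]
    have "((X t)\<^sup>2 * Y t) = X t powr 3 * r t" using p by (simp add: r_def powr_numeral power2_eq_square power3_eq_cube)
    then have 1: "((X t)\<^sup>2 * Y t) powr (- 1 / 3) = r t powr (- 1 / 3) / X t"
      using p by (simp only: powr_mult powr_powr) (simp add: powr_mult powr_powr powr_minus_divide)
    have 2: "r t powr (- 1 / 3) * r t = r t powr (2 / 3)"
    proof -
      have "r t powr (- 1 / 3) * r t powr 1 = r t powr (2 / 3)" by (simp only: powr_add[symmetric]) simp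
      then show ?thesis using p by simp
    qed
    have "light_point e (r t powr (- 1 / 3)) (r t powr (2 / 3)) = (r t powr (- 1 / 3) / X t) *\<^sub>R light_point e (X t) (Y t)"
      unfolding 2[symmetric] light_point_decompose[of e "X t"] light_point_decompose[of e "r t powr (- 1 / 3)"]
      using p by (simp add: r_def algebra_simps)
    then show ?thesis unfolding limit_curve_def line g 1 A_def sy(3)[OF p(3)] by simp
  qed
  have inv: "?g \<circ> blinfun_apply (A t) = ?g" if "t \<in> {-1<..<3}" for t
    unfolding A_def using sy(2)[OF pos(3)[OF that]] by auto
  obtain P where P: "cubic_form P" "?g = standard_cubic P" using std3_standard_cubic[OF T(1)] unfolding T(3) by blast
  have "standard_frame ?g (1, 0) v 3 A"
    unfolding standard_frame_def
  proof (intro conjI ballI)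
    show "smooth_on {0..<3} A" by (rule smooth_onI[OF _ _ Asm]) auto
    fix t :: real assume "t \<in> {0..<3}"
    then have t: "t \<in> {-1<..<3}" by simp
    show "A t \<in> GL" unfolding A_def by (rule sy(1)[OF pos(3)[OF t]])
    show "blinfun_apply (A t) (1, 0) = limit_curve ?g (1, 0) v t" using curve[OF t] by simp
    show "\<exists>P. cubic_form P \<and> ?g \<circ> blinfun_apply (A t) = standard_cubic P" unfolding inv[OF t] using P by blast
  qed
  moreover have "uniform_limit (cball 0 1) (\<lambda>t. ?g \<circ> blinfun_apply (A t)) ?g (at_left 3)"
  proof -
    have "\<forall>\<^sub>F t in at_left (3::real). t \<in> {-1<..<3}" by (auto simp: eventually_at_left_field intro: exI[of _ 0])
    then show ?thesis unfolding uniform_limit_iff by (intro allI impI, elim eventually_mono) (simp only: inv, simp)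
  qed
  moreover have "cubic_form ?g" unfolding T(3) by (rule sym3_cubic_form[OF std3_sym3[OF T(1)]])
  ultimately show "limit_polynomial ?g (1, 0) v ?g" unfolding limit_polynomial_def using z by blast
qed

section \<open>Homogeneity of the low-dimensional normal forms\<close>

text \<open>Composing one such map with the inverse of another moves any point to any other.\<close>
lemma homogeneousI:
  assumes "\<And>p. p \<in> std_component g \<Longrightarrow> \<exists>L\<in>GL. (\<forall>z. g (blinfun_apply L z) = g z) \<and> blinfun_apply L (1, 0) = p"
  shows "homogeneous_space (std_component g)"
  unfolding homogeneous_space_def
proof (intro ballI)
  fix p q assume pq: "p \<in> std_component g" "q \<in> std_component g"
  obtain L where L: "L \<in> GL" "\<And>z. g (blinfun_apply L z) = g z" "blinfun_apply L (1, 0) = p" using assms[OF pq(1)] by blast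
  obtain M where M: "M \<in> GL" "\<And>z. g (blinfun_apply M z) = g z" "blinfun_apply M (1, 0) = q" using assms[OF pq(2)] by blast
  obtain K where K: "K \<in> GL" "\<And>x. blinfun_apply K (blinfun_apply L x) = x" "\<And>x. blinfun_apply L (blinfun_apply K x) = x"
    using blinfun_GL_inverse[OF L(1)] by blast
  have iL: "blinfun_apply L ` std_component g = std_component g"
    by (rule component_image[OF L(1)]) (use L pq in simp_all)
  have iM: "blinfun_apply M ` std_component g = std_component g"
    by (rule component_image[OF M(1)]) (use M pq in simp_all)
  have "blinfun_apply K ` std_component g = blinfun_apply K ` blinfun_apply L ` std_component g" by (simp only: iL)
  then have iK: "blinfun_apply K ` std_component g = std_component g" by (simp add: image_image K(2))
  have "blinfun_apply (M o\<^sub>L K) ` std_component g = blinfun_apply M ` blinfun_apply K ` std_component g"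
    by (simp add: image_image)
  then have "M o\<^sub>L K \<in> symmetry_group (std_component g)"
    using GL_compose[OF M(1) K(1)] by (simp add: symmetry_group_def iK iM)
  moreover have "blinfun_apply (M o\<^sub>L K) p = q" using K(2)[of "(1, 0)"] L(3) M(3) by simp
  ultimately show "\<exists>L\<in>symmetry_group (std_component g). blinfun_apply L p = q" by blast
qed

text \<open>The image is connected, so it stays in the component.\<close>
lemma component_parametrization:
  assumes "connected U" "continuous_on U \<phi>" "\<And>u. u \<in> U \<Longrightarrow> g (\<phi> u) = 1" "base \<in> U" "\<phi> base = (1, 0)"
    and "\<And>z. z \<in> std_component g \<Longrightarrow> \<psi> z \<in> U \<and> \<phi> (\<psi> z) = z"
  shows "\<phi> ` U = std_component g"
proof
  show "\<phi> ` U \<subseteq> std_component g"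
    unfolding std_component_def
  proof (rule connected_component_maximal)
    show "(1, 0) \<in> \<phi> ` U" using assms(4,5) by (metis imageI)
    show "connected (\<phi> ` U)" by (rule connected_continuous_image[OF assms(2,1)])
    show "\<phi> ` U \<subseteq> {q. g q = 1}" using assms(3) by auto
  qed
  show "std_component g \<subseteq> \<phi> ` U" using assms(6) by (metis imageI subsetI)
qed

section \<open>The limit curve\<close>

text \<open>For n = 1 the polynomial is X ^ 2 * Y, and the curve is a single orbit of the scalings.\<close>
theorem curve_geometry_normal_form:
  fixes e :: "nat \<Rightarrow> 'n::finite"
  assumes N: "CARD('n) = 1" and e: "bij_betw e {..<CARD('n)} UNIV"
    and T: "std3 T" "cubic_bound T" "poly_general e 0 F = (\<lambda>z. T z z z)"
  shows "curve_geometry e (poly_general e 0 F) (std_component (poly_general e 0 F))"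
proof -
  let ?g = "poly_general e 0 F"
  have m: "(0::nat) \<le> CARD('n) - 1" by simp
  have all: "i = e 0" for i using e N by (auto simp: bij_betw_def image_iff)
  have eq: "z = z'" if "lX e z = lX e z'" "lY e z = lY e z'" for z z'
    by (rule light_eqI[OF that]) (use all N in \<open>metis diff_self_eq_0\<close>)
  have g: "?g z = lY e z * (lX e z)\<^sup>2" for z by (simp add: poly_general_light N)
  have comp: "0 < lX e z" "lY e z * (lX e z)\<^sup>2 = 1" if "z \<in> std_component ?g" for z
  proof -
    have t: "norm (snd z) < sqrt 3 * fst z" "?g z = 1"
      using that unfolding T(3) std_component_eq[OF T(1,2)] by simp_all
    have "\<bar>lw e z\<bar> < sqrt 3 * fst z" using component_le_norm_cart[of "snd z" "e (CARD('n) - 1)"] t(1) by (simp add: lw_def)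
    then have "- (lw e z) < fst z * sqrt 3" by (simp add: mult.commute)
    then have "- (lw e z) / sqrt 3 < fst z" using pos_divide_less_eq[of "sqrt 3" "- lw e z" "fst z"] by simp
    then show "0 < lX e z" by (simp add: lX_def)
    show "lY e z * (lX e z)\<^sup>2 = 1" using t(2) by (simp add: g)
  qed
  have pt: "z = light_point e (r powr (- 1 / 3)) (r powr (2 / 3))" "0 < r"
    if "0 < lX e z" "lY e z * (lX e z)\<^sup>2 = 1" "r = lX e z powr (- 3)" for z r
  proof -
    have "r powr (2 / 3) = lX e z powr (- 2)" using that by (simp add: powr_powr)
    also have "\<dots> = lY e z" using that(1,2) by (simp add: powr_minus powr_numeral field_simps)
    finally show "z = light_point e (r powr (- 1 / 3)) (r powr (2 / 3))"
      using that by (intro eq) (simp_all add: light_point_coordinates powr_powr)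
    show "0 < r" using that by simp
  qed
  have comp': "z \<in> std_component ?g" if "0 < lX e z" "lY e z * (lX e z)\<^sup>2 = 1" for z
    using pt[OF that refl] scaling_symmetry(4)[OF e m T] by metis
  have hom: "homogeneous_space (std_component ?g)"
  proof (rule homogeneousI)
    fix p assume p: "p \<in> std_component ?g"
    define r where "r = lX e p powr (- 3)"
    note q = pt[OF comp[OF p] r_def]
    note s = scaling_symmetry[OF e m T q(2)]
    show "\<exists>L\<in>GL. (\<forall>z. ?g (blinfun_apply L z) = ?g z) \<and> blinfun_apply L (1, 0) = p"
      using s(1,2,3) q(1) by (intro bexI[of _ "scaling e 0 r"]) auto
  qed
  define M where "M z = (lX e z, axis (e 0) (lY e z) :: real ^ 'n)" for z
  have lin: "linear M"
    by (auto simp: M_def linear_iff lX_simps lY_simps axis_def Finite_Cartesian_Product.vec_eq_iff)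
  have "inj M" unfolding linear_injective_0[OF lin]
  proof (intro allI impI)
    fix z assume "M z = 0"
    then have "lX e z = 0" "axis (e 0) (lY e z) = (0 :: real ^ 'n)" by (simp_all add: M_def zero_prod_def)
    then have "lX e z = lX e 0" "lY e z = lY e 0" by (simp_all add: axis_eq_0_iff lX_def lY_def lw_def)
    then show "z = 0" by (rule eq)
  qed
  note L = GL_linear_injI[OF lin this]
  have "psr_equivalent ?g (std_component ?g) (\<lambda>(x, v). x\<^sup>2 * v $ e 0) {(x, v). x\<^sup>2 * v $ e 0 = 1 \<and> 0 < x}"
    unfolding psr_equivalent_def
  proof (rule bexI[OF _ L(1)], unfold L(2), intro conjI allI)
    show "(case M z of (x, v) \<Rightarrow> x\<^sup>2 * v $ e 0) = ?g z" for z by (simp add: M_def g)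
    show "M ` std_component ?g = {(x, v). x\<^sup>2 * v $ e 0 = 1 \<and> 0 < x}"
    proof
      show "M ` std_component ?g \<subseteq> {(x, v). x\<^sup>2 * v $ e 0 = 1 \<and> 0 < x}"
        using comp by (auto simp: M_def mult.commute)
      show "{(x, v). x\<^sup>2 * v $ e 0 = 1 \<and> 0 < x} \<subseteq> M ` std_component ?g"
      proof clarify
        fix x and v :: "real ^ 'n" assume v: "x\<^sup>2 * v $ e 0 = 1" "0 < x"
        let ?z = "light_point e x (v $ e 0)"
        have "axis (e 0) (v $ e 0) = v" by (simp add: axis_def Finite_Cartesian_Product.vec_eq_iff) (metis all)
        then have "M ?z = (x, v)" by (simp add: M_def light_point_coordinates)
        moreover have "?z \<in> std_component ?g" using v by (intro comp') (simp_all add: light_point_coordinates mult.commute)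
        ultimately show "(x, v) \<in> M ` std_component ?g" by (metis imageI)
      qed
    qed
  qed
  with hom show ?thesis unfolding curve_geometry_def by blast
qed

section \<open>The limit surfaces\<close>

text \<open>The metric is - 2 T on tangent vectors.\<close>
lemma isometric_by_parametrization:
  fixes U :: "(real \<times> real) set" and g :: "real \<times> 'b::euclidean_space \<Rightarrow> real"
  assumes U: "open U" "connected U" "base \<in> U" "\<phi> base = (1, 0)" and sm: "Cinf_on U \<phi>"
    and T: "sym3 T" "g = (\<lambda>z. T z z z)" "\<And>u. u \<in> U \<Longrightarrow> g (\<phi> u) = 1"
    and psi: "smooth_on (std_component g) \<psi>" "\<And>z. z \<in> std_component g \<Longrightarrow> \<psi> z \<in> U \<and> \<phi> (\<psi> z) = z"
      "\<And>u. u \<in> U \<Longrightarrow> \<psi> (\<phi> u) = u"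
    and D: "\<And>u. u \<in> U \<Longrightarrow> (\<phi> has_derivative \<phi>' u) (at u)" and c: "0 < c"
    and metric: "\<And>u a b. u \<in> U \<Longrightarrow> - 2 * T (\<phi> u) (\<phi>' u a) (\<phi>' u b) = c * gU u a b"
  shows "isometric_up_to_scale U gU (std_component g) (psr_metric g)"
proof -
  have co: "continuous_on U \<phi>"
    using D by (intro continuous_at_imp_continuous_on ballI has_derivative_continuous) blast
  have im: "\<phi> ` U = std_component g"
    by (rule component_parametrization[where \<psi> = \<psi> and g = g and \<phi> = \<phi>, OF U(2) co T(3) U(3,4) psi(2)])
  have "psr_metric g (\<phi> u) (frechet_derivative \<phi> (at u) a) (frechet_derivative \<phi> (at u) b) = c * gU u a b" if "u \<in> U" for u a b
  proof -
    have "frechet_derivative \<phi> (at u) = \<phi>' u" using frechet_derivative_at[OF D[OF that]] by simp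
    then show ?thesis using metric[OF that, of a b] by (simp add: psr_metric_def T(2) sym3_hessian[OF T(1)])
  qed
  then show ?thesis
    unfolding isometric_up_to_scale_def
    using smooth_onI[OF U(1) subset_refl sm] psi(1,3) im c by blast
qed

definition lt :: "(nat \<Rightarrow> 'n::finite) \<Rightarrow> real \<times> (real ^ 'n) \<Rightarrow> real" where
  "lt e z = snd z $ e 0"

text \<open>The inverse of the coordinates X, Y and t when n = 2.\<close>
definition chart :: "(nat \<Rightarrow> 'n::finite) \<Rightarrow> real \<Rightarrow> real \<Rightarrow> real \<Rightarrow> real \<times> (real ^ 'n)" where
  "chart e X Y t = light_point e X Y + (0, axis (e 0) t)"

lemma lt_simps: "lt e (x + y) = lt e x + lt e y" "lt e (c *\<^sub>R x) = c * lt e x"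
  by (simp_all add: lt_def)

lemma chart_decompose: "chart e X Y t = X *\<^sub>R chart e 1 0 0 + Y *\<^sub>R chart e 0 1 0 + t *\<^sub>R chart e 0 0 1"
proof -
  have a: "axis (e 0) t = t *\<^sub>R (axis (e 0) 1 :: real ^ 'a)" "axis (e 0) 0 = (0 :: real ^ 'a)"
    by (simp_all add: axis_def Finite_Cartesian_Product.vec_eq_iff)
  have "light_point e 0 0 = 0" using light_point_decompose[of e 0 0] by simp
  then show ?thesis
    unfolding chart_def light_point_decompose[of e X Y] a by (simp add: zero_prod_def[symmetric])
qed

lemma chart_linear:
  assumes "linear f" "linear g" "linear h" shows "linear (\<lambda>z. chart e (f z) (g z) (h z))"
proof -
  have "linear (\<lambda>z. f z *\<^sub>R chart e 1 0 0 + g z *\<^sub>R chart e 0 1 0 + h z *\<^sub>R chart e 0 0 1)"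
    using assms by (simp add: linear_iff algebra_simps)
  then show ?thesis by (simp flip: chart_decompose)
qed

lemma chart_has_derivative:
  assumes "(X has_derivative X') (at u)" "(Y has_derivative Y') (at u)" "(t has_derivative t') (at u)"
  shows "((\<lambda>u. chart e (X u) (Y u) (t u)) has_derivative (\<lambda>a. chart e (X' a) (Y' a) (t' a))) (at u)"
proof -
  have "((\<lambda>u. X u *\<^sub>R chart e 1 0 0 + Y u *\<^sub>R chart e 0 1 0 + t u *\<^sub>R chart e 0 0 1) has_derivative
     (\<lambda>a. X' a *\<^sub>R chart e 1 0 0 + Y' a *\<^sub>R chart e 0 1 0 + t' a *\<^sub>R chart e 0 0 1)) (at u)"
    by (intro has_derivative_add has_derivative_scaleR_left assms)
  then show ?thesis by (simp flip: chart_decompose)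
qed

lemma chart_Cinf:
  assumes "open U" "Cinf_on U X" "Cinf_on U Y" "Cinf_on U t"
  shows "Cinf_on U (\<lambda>u. chart e (X u) (Y u) (t u))"
proof -
  have "Cinf_on U (\<lambda>u. X u *\<^sub>R chart e 1 0 0 + Y u *\<^sub>R chart e 0 1 0 + t u *\<^sub>R chart e 0 0 1)"
    by (intro Cinf_add Cinf_scaleR Cinf_const assms)
  then show ?thesis by (simp flip: chart_decompose)
qed

context
  fixes e :: "nat \<Rightarrow> 'n::finite"
  assumes N: "CARD('n) = 2" and e: "bij_betw e {..<CARD('n)} UNIV"
begin

lemma e_ne: "e 0 \<noteq> e 1" "e 0 \<noteq> e (Suc 0)"
  using enumerated_eq_iff[OF e, of 0 1] N by auto

lemma chart_coordinates: "lX e (chart e X Y t) = X" "lY e (chart e X Y t) = Y" "lt e (chart e X Y t) = t"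
proof -
  have z: "axis (e 0) t $ e (CARD('n) - 1) = 0" using e_ne by (simp add: N axis_def)
  show "lX e (chart e X Y t) = X" "lY e (chart e X Y t) = Y"
    by (simp_all add: chart_def lX_simps lY_simps light_point_coordinates transverse_coordinates[of _ e, OF z])
  show "lt e (chart e X Y t) = t" using light_point_coordinates(3)[of "e 0" e X Y] e_ne by (simp add: chart_def lt_def N)
qed

lemma chart_eqI: "lX e z = lX e z' \<Longrightarrow> lY e z = lY e z' \<Longrightarrow> lt e z = lt e z' \<Longrightarrow> z = z'"
proof (rule light_eqI)
  fix i assume "lt e z = lt e z'" "i \<noteq> e (CARD('n) - 1)"
  moreover obtain d where "d < 2" "i = e d" using e N by (auto simp: bij_betw_def image_iff)
  ultimately have "d = 0" using N by (cases "d = 1") auto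
  then show "snd z $ i = snd z' $ i" using \<open>lt e z = lt e z'\<close> \<open>i = e d\<close> by (simp add: lt_def)
qed

lemma chart_base: "chart e 1 1 0 = (1, 0)"
  by (rule chart_eqI) (simp_all only: chart_coordinates, simp_all add: lX_def lY_def lw_def lt_def)

lemma chart_GL:
  assumes "linear f" "linear g" "linear h" "\<And>z. f z = 0 \<Longrightarrow> g z = 0 \<Longrightarrow> h z = 0 \<Longrightarrow> lX e z = 0 \<and> lY e z = 0 \<and> lt e z = 0"
  shows "Blinfun (\<lambda>z. chart e (f z) (g z) (h z)) \<in> GL"
    "blinfun_apply (Blinfun (\<lambda>z. chart e (f z) (g z) (h z))) z = chart e (f z) (g z) (h z)"
proof -
  note l = chart_linear[OF assms(1-3), of e]
  have z0: "lX e 0 = 0" "lY e 0 = 0" "lt e 0 = 0" by (simp_all add: lX_def lY_def lw_def lt_def)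
  have "inj (\<lambda>z. chart e (f z) (g z) (h z))"
    unfolding linear_injective_0[OF l]
  proof (intro allI impI)
    fix z assume c: "chart e (f z) (g z) (h z) = 0"
    then have "lX e (chart e (f z) (g z) (h z)) = 0" "lY e (chart e (f z) (g z) (h z)) = 0" "lt e (chart e (f z) (g z) (h z)) = 0"
      by (simp_all add: z0)
    then have "lX e z = 0 \<and> lY e z = 0 \<and> lt e z = 0" unfolding chart_coordinates by (rule assms(4))
    then show "z = 0" by (intro chart_eqI) (simp_all add: z0)
  qed
  from GL_linear_injI[OF l this]
  show "Blinfun (\<lambda>z. chart e (f z) (g z) (h z)) \<in> GL"
    "blinfun_apply (Blinfun (\<lambda>z. chart e (f z) (g z) (h z))) z = chart e (f z) (g z) (h z)" by simp_all
qed

text \<open>The last inequality is the timelike condition in the coordinates X, Y, t.\<close>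
lemma surface_component:
  assumes T: "std3 T" "cubic_bound T" "g = (\<lambda>z. T z z z)" and z: "z \<in> std_component g"
  shows "g z = 1" "0 < lX e z" "(lt e z)\<^sup>2 < lX e z * (lX e z + 2 * lY e z)"
proof -
  have t: "norm (snd z) < sqrt 3 * fst z" "g z = 1"
    using z unfolding T(3) std_component_eq[OF T(1,2)] by simp_all
  show "g z = 1" by (rule t(2))
  have "\<bar>lw e z\<bar> < sqrt 3 * fst z" using component_le_norm_cart[of "snd z" "e (CARD('n) - 1)"] t(1) by (simp add: lw_def)
  then have "- (lw e z) < fst z * sqrt 3" by (simp add: mult.commute)
  then have "- (lw e z) / sqrt 3 < fst z" using pos_divide_less_eq[of "sqrt 3" "- lw e z" "fst z"] by simp
  then show "0 < lX e z" by (simp add: lX_def)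
  have "(norm (snd z))\<^sup>2 < (sqrt 3 * fst z)\<^sup>2" using t(1) by (intro power_strict_mono) auto
  then have "snd z \<bullet> snd z < 3 * (fst z)\<^sup>2" by (simp add: power_mult_distrib dot_square_norm)
  moreover have "snd z \<bullet> snd z = (lt e z)\<^sup>2 + (lw e z)\<^sup>2"
    using inner_enumerated[OF e, of 1 "snd z" "snd z"] N by (simp add: lt_def lw_def power2_eq_square)
  moreover have "lX e z * (lX e z + 2 * lY e z) = 3 * (fst z)\<^sup>2 - (lw e z)\<^sup>2"
    by (simp add: lX_def lY_def power2_eq_square field_simps sqrt3_simps)
  ultimately show "(lt e z)\<^sup>2 < lX e z * (lX e z + 2 * lY e z)" by simp
qed

lemma linear_coordinates: "linear (lX e)" "linear (lY e)" "linear (lt e)"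
  using linear_light by (simp_all add: linear_iff lt_simps)

lemma coordinates_Cinf: "open U \<Longrightarrow> Cinf_on U (lX e)" "open U \<Longrightarrow> Cinf_on U (lY e)" "open U \<Longrightarrow> Cinf_on U (lt e)"
  using linear_coordinates[THEN linear_linear[THEN iffD2]] by (auto intro: Cinf_linear)

lemma coordinates_continuous: "continuous_on A (lX e)" "continuous_on A (lY e)" "continuous_on A (lt e)"
  using linear_coordinates by (auto intro: linear_continuous_on linear_linear[THEN iffD2])

text \<open>Here h = X ^ 2 * Y - X * t ^ 2, and the level set with X > 0 is a graph over the (X, t)-plane. The
  group generated by the scalings and by the shears t \<mapsto> t + c X is simply transitive on it. Setting X =
  \<beta> powr (- 2 / 3) and t = (2 / sqrt 3) * \<alpha> * X identifies the level set with the upper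
  half-plane.\<close>
theorem surface_a_geometry:
  assumes T: "std3 T" "cubic_bound T" "poly_general e 0 F = (\<lambda>z. T z z z)"
  shows "homogeneous_space (std_component (poly_general e 0 F))"
    "isomorphic_hyperbolic_plane (poly_general e 0 F) (std_component (poly_general e 0 F))"
proof -
  let ?g = "poly_general e 0 F"
  have g: "?g z = lY e z * (lX e z)\<^sup>2 - lX e z * (lt e z)\<^sup>2" for z
    by (simp add: poly_general_light N lt_def)
  note comp = surface_component[OF T]
  have Yeq: "lY e z = (1 + lX e z * (lt e z)\<^sup>2) / (lX e z)\<^sup>2" if "z \<in> std_component ?g" for z
    using comp(1,2)[OF that] unfolding g by (simp add: field_simps)
  show "homogeneous_space (std_component ?g)"
  proof (rule homogeneousI)
    fix p assume p: "p \<in> std_component ?g"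
    \<comment> \<open>The map to be built is the scaling to X = lX e p followed by the shear to t = lt e p.\<close>
    define \<sigma> where "\<sigma> = sqrt (lX e p)"
    define t0 where "t0 = lt e p"
    have \<sigma>: "0 < \<sigma>" "lX e p = \<sigma>\<^sup>2" using comp(2)[OF p] by (simp_all add: \<sigma>_def)
    define f where "f z = \<sigma>\<^sup>2 * lX e z" for z
    define k where "k z = (lY e z + 2 * \<sigma> * t0 * lt e z + \<sigma>\<^sup>2 * t0\<^sup>2 * lX e z) / \<sigma> ^ 4" for z
    define h where "h z = lt e z / \<sigma> + t0 * lX e z" for z
    have lin: "linear f" "linear k" "linear h"
      by (simp_all add: f_def k_def h_def linear_iff lX_simps lY_simps lt_simps algebra_simps add_divide_distrib)
    have 0: "lX e z = 0 \<and> lY e z = 0 \<and> lt e z = 0" if "f z = 0" "k z = 0" "h z = 0" for z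
      using that \<sigma> by (auto simp: f_def k_def h_def)
    have L: "Blinfun (\<lambda>z. chart e (f z) (k z) (h z)) \<in> GL"
      "\<And>z. blinfun_apply (Blinfun (\<lambda>z. chart e (f z) (k z) (h z))) z = chart e (f z) (k z) (h z)"
      by (rule chart_GL[OF lin]; (rule 0; assumption))+
    show "\<exists>L\<in>GL. (\<forall>z. ?g (blinfun_apply L z) = ?g z) \<and> blinfun_apply L (1, 0) = p"
    proof (rule bexI[OF _ L(1)], intro conjI allI)
      fix z
      have "k z * (f z)\<^sup>2 - f z * (h z)\<^sup>2 = lY e z * (lX e z)\<^sup>2 - lX e z * (lt e z)\<^sup>2"
        using \<sigma>(1) unfolding f_def k_def h_def by (simp add: field_simps power2_eq_square power4_eq_xxxx)
      then show "?g (blinfun_apply (Blinfun (\<lambda>z. chart e (f z) (k z) (h z))) z) = ?g z"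
        unfolding L(2) g chart_coordinates .
    next
      have b: "lX e (1, 0) = 1" "lY e (1, 0) = 1" "lt e (1, 0) = 0" by (simp_all add: lX_def lY_def lw_def lt_def)
      show "blinfun_apply (Blinfun (\<lambda>z. chart e (f z) (k z) (h z))) (1, 0) = p"
        unfolding L(2)
      proof (rule chart_eqI; unfold chart_coordinates)
        show "f (1, 0) = lX e p" "h (1, 0) = lt e p" by (simp_all add: f_def h_def b \<sigma>(2) t0_def)
        show "k (1, 0) = lY e p"
          unfolding Yeq[OF p] \<sigma>(2) using \<sigma>(1) by (simp add: k_def b t0_def power2_eq_square power4_eq_xxxx field_simps)
      qed
    qed
  qed
  define S where "S p q r = (lX e p * lX e q * lY e r + lX e p * lY e q * lX e r + lY e p * lX e q * lX e r
     - lX e p * lt e q * lt e r - lt e p * lX e q * lt e r - lt e p * lt e q * lX e r) / 3" for p q r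
  have S: "sym3 S"
    unfolding sym3_def S_def by (auto simp: linear_iff lX_simps lY_simps lt_simps algebra_simps add_divide_distrib diff_divide_distrib)
  have gS: "?g = (\<lambda>z. S z z z)" by (auto simp: g S_def power2_eq_square)
  define k where "k = 2 / sqrt 3"
  have k: "k * k = 4 / 3" "k * (k * x) = 4 / 3 * x" "0 < k" for x by (simp_all add: k_def field_simps sqrt3_simps)
  define U where "U = {u :: real \<times> real. 0 < snd u}"
  define \<rho> where "\<rho> u = snd u powr (- 2 / 3)" for u :: "real \<times> real"
  define Y where "Y u = \<rho> u * ((snd u)\<^sup>2 + 4 / 3 * (fst u)\<^sup>2)" for u
  define t where "t u = k * (fst u * \<rho> u)" for u
  define \<phi> where "\<phi> u = chart e (\<rho> u) (Y u) (t u)" for u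
  define \<psi> where "\<psi> z = (lt e z / lX e z * (1 / k), lX e z powr (- 3 / 2))" for z
  define d where "d u a = snd a * (- (2 / 3) * \<rho> u / snd u)" for u a :: "real \<times> real"
  define Y' where "Y' u a = d u a * ((snd u)\<^sup>2 + 4 / 3 * (fst u)\<^sup>2) + \<rho> u * (2 * snd u * snd a + 8 / 3 * fst u * fst a)" for u a
  define t' where "t' u a = k * (fst a * \<rho> u + fst u * d u a)" for u a
  define \<phi>' where "\<phi>' u a = chart e (d u a) (Y' u a) (t' u a)" for u a
  have U: "open U" "connected U"
  proof -
    show "open U" unfolding U_def by (intro open_Collect_less continuous_intros)
    have "U = UNIV \<times> {0<..}" by (auto simp: U_def)
    moreover have "connected (UNIV \<times> {0<..} :: (real \<times> real) set)"
      by (intro connected_Times connected_UNIV) (simp add: is_interval_connected)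
    ultimately show "connected U" by simp
  qed
  have \<rho>: "0 < \<rho> u" "\<rho> u ^ 3 * (snd u)\<^sup>2 = 1" if "u \<in> U" for u
  proof -
    have u: "0 < snd u" using that by (simp add: U_def)
    then show "0 < \<rho> u" by (simp add: \<rho>_def)
    have "\<rho> u ^ 3 = snd u powr (- 2)" unfolding \<rho>_def by (subst powr_pow[OF u]) simp
    then show "\<rho> u ^ 3 * (snd u)\<^sup>2 = 1" using u by (simp add: powr_minus powr_numeral)
  qed
  have fst_snd: "Cinf_on U fst" "Cinf_on U snd"
    by (intro Cinf_linear U bounded_linear_fst bounded_linear_snd)+
  have \<rho>sm: "Cinf_on U \<rho>" unfolding \<rho>_def[abs_def] by (intro Cinf_powr_comp U fst_snd) (simp add: U_def)
  have \<phi>sm: "Cinf_on U \<phi>"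
    unfolding \<phi>_def[abs_def] Y_def t_def
    by (intro chart_Cinf Cinf_mult Cinf_add Cinf_power Cinf_const U fst_snd \<rho>sm)
  have D: "(\<phi> has_derivative \<phi>' u) (at u)" if u: "u \<in> U" for u
  proof -
    have s: "0 < snd u" using u by (simp add: U_def)
    have e1: "- (2 / 3) * \<rho> u / snd u = - 2 / 3 * snd u powr (- 2 / 3 - 1)"
      unfolding \<rho>_def powr_diff using s by simp
    have "((\<lambda>x. x powr (- 2 / 3)) has_real_derivative (- (2 / 3) * \<rho> u / snd u)) (at (snd u))"
      unfolding e1 by (rule has_real_derivative_powr[OF s])
    from DERIV_compose_FDERIV[OF this has_derivative_snd[OF has_derivative_ident]]
    have \<rho>': "(\<rho> has_derivative d u) (at u)" by (simp add: \<rho>_def[abs_def] d_def[abs_def])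
    have "(Y has_derivative Y' u) (at u)"
      unfolding Y_def[abs_def]
      by (auto intro!: derivative_eq_intros \<rho>' simp: Y'_def algebra_simps)
    moreover have "(t has_derivative t' u) (at u)"
      unfolding t_def[abs_def]
      by (auto intro!: derivative_eq_intros \<rho>' simp: t'_def algebra_simps)
    ultimately show ?thesis unfolding \<phi>_def[abs_def] \<phi>'_def[abs_def] by (intro chart_has_derivative \<rho>')
  qed
  have g1: "?g (\<phi> u) = 1" if u: "u \<in> U" for u
  proof -
    have "?g (\<phi> u) = \<rho> u ^ 3 * (snd u)\<^sup>2"
      unfolding g \<phi>_def chart_coordinates Y_def t_def
      by (simp add: power2_eq_square power3_eq_cube algebra_simps k)
    then show ?thesis using \<rho>(2)[OF u] by simp
  qed
  have XX: "(X powr (- 3 / 2)) powr (- 2 / 3) = X" "(X powr (- 3 / 2))\<^sup>2 = 1 / X ^ 3" if "0 < X" for X :: real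
  proof -
    show "(X powr (- 3 / 2)) powr (- 2 / 3) = X" using that by (simp add: powr_powr)
    have "(X powr (- 3 / 2))\<^sup>2 = X powr (- 3)" by (subst powr_pow[OF that]) simp
    then show "(X powr (- 3 / 2))\<^sup>2 = 1 / X ^ 3" using that by (simp add: powr_minus powr_numeral field_simps)
  qed
  have "isometric_up_to_scale U (\<lambda>u a b. (a \<bullet> b) / (snd u)\<^sup>2) (std_component ?g) (psr_metric ?g)"
  proof (rule isometric_by_parametrization[where \<phi> = \<phi> and \<psi> = \<psi> and \<phi>' = \<phi>' and T = S and base = "(0, 1)" and c = "8 / 9"])
    show "open U" "connected U" "Cinf_on U \<phi>" "sym3 S" "?g = (\<lambda>z. S z z z)" by (fact U \<phi>sm S gS)+
    show "(0, 1) \<in> U" by (simp add: U_def)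
    show "\<phi> (0, 1) = (1, 0)" using chart_base by (simp add: \<phi>_def Y_def t_def \<rho>_def)
    show "?g (\<phi> u) = 1" if "u \<in> U" for u by (rule g1[OF that])
    show "(\<phi> has_derivative \<phi>' u) (at u)" if "u \<in> U" for u by (rule D[OF that])
    show "(0::real) < 8 / 9" by simp
    show "smooth_on (std_component ?g) \<psi>"
    proof (rule smooth_onI[of "{z. 0 < lX e z}"])
      show o: "open {z. 0 < lX e z}" by (intro open_Collect_less continuous_on_const coordinates_continuous)
      show "std_component ?g \<subseteq> {z. 0 < lX e z}" using comp(2) by auto
      have "Cinf_on {z. 0 < lX e z} (\<lambda>z. (lt e z / lX e z * (1 / k)) *\<^sub>R (1::real, 0::real) + (lX e z powr (- 3 / 2)) *\<^sub>R (0::real, 1::real))"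
        by (intro Cinf_add Cinf_scaleR Cinf_mult Cinf_const Cinf_divide Cinf_powr_comp o coordinates_Cinf) auto
      then show "Cinf_on {z. 0 < lX e z} \<psi>" by (simp add: \<psi>_def[abs_def])
    qed
    show "\<psi> z \<in> U \<and> \<phi> (\<psi> z) = z" if z: "z \<in> std_component ?g" for z
    proof
      note X = comp(2)[OF z]
      show "\<psi> z \<in> U" using X by (simp add: \<psi>_def U_def)
      have 1: "\<rho> (\<psi> z) = lX e z" unfolding \<rho>_def \<psi>_def snd_conv by (rule XX(1)[OF X])
      show "\<phi> (\<psi> z) = z"
      proof (rule chart_eqI; unfold \<phi>_def chart_coordinates)
        show "\<rho> (\<psi> z) = lX e z" by (rule 1)
        show "t (\<psi> z) = lt e z" unfolding t_def 1 using X k(3) by (simp add: \<psi>_def)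
        have "4 / 3 * (fst (\<psi> z))\<^sup>2 = (lt e z / lX e z)\<^sup>2"
          unfolding k(1)[symmetric] using k(3) by (simp add: \<psi>_def power2_eq_square)
        moreover have "(snd (\<psi> z))\<^sup>2 = 1 / lX e z ^ 3" unfolding \<psi>_def snd_conv by (rule XX(2)[OF X])
        ultimately have "Y (\<psi> z) = lX e z * (1 / lX e z ^ 3 + (lt e z / lX e z)\<^sup>2)" unfolding Y_def 1 by simp
        also have "\<dots> = lY e z" unfolding Yeq[OF z] using X by (simp add: field_simps power2_eq_square power3_eq_cube)
        finally show "Y (\<psi> z) = lY e z" .
      qed
    qed
    show "\<psi> (\<phi> u) = u" if u: "u \<in> U" for u
    proof -
      have s: "0 < snd u" using u by (simp add: U_def)
      have "\<rho> u powr (- 3 / 2) = snd u" using s by (simp add: \<rho>_def powr_powr)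
      then show ?thesis
        unfolding \<psi>_def \<phi>_def chart_coordinates t_def using \<rho>(1)[OF u] k(3) by (simp add: prod_eq_iff)
    qed
    fix u a b :: "real \<times> real" assume u: "u \<in> U"
    have s: "0 < snd u" using u by (simp add: U_def)
    obtain \<alpha> \<beta> where ab: "u = (\<alpha>, \<beta>)" by (cases u)
    define x where "x a = - (2 / 3) * snd a / \<beta>" for a :: "real \<times> real"
    define y where "y a = x a * (\<beta>\<^sup>2 + 4 / 3 * \<alpha>\<^sup>2) + 2 * \<beta> * snd a + 8 / 3 * \<alpha> * fst a" for a :: "real \<times> real"
    define w where "w a = fst a + \<alpha> * x a" for a :: "real \<times> real"
    have dd: "d u a = \<rho> u * x a" "Y' u a = \<rho> u * y a" "t' u a = k * (\<rho> u * w a)" for a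
      by (simp_all add: d_def Y'_def t'_def x_def y_def w_def ab algebra_simps)
    have "- 2 * S (\<phi> u) (\<phi>' u a) (\<phi>' u b) = - (2 / 3) * \<rho> u ^ 3 *
       (x a * y b + y a * x b + (\<beta>\<^sup>2 + 4 / 3 * \<alpha>\<^sup>2) * x a * x b - 4 / 3 * (w a * w b + \<alpha> * x a * w b + \<alpha> * w a * x b))"
      unfolding S_def \<phi>_def \<phi>'_def chart_coordinates dd Y_def t_def
      by (simp add: ab k field_simps power3_eq_cube)
    also have "\<dots> = \<rho> u ^ 3 * (8 / 9 * (a \<bullet> b))"
      using s unfolding y_def w_def x_def by (simp add: ab inner_prod_def field_simps power2_eq_square)
    also have "\<rho> u ^ 3 = 1 / (snd u)\<^sup>2" using \<rho>(2)[OF u] s by (simp add: field_simps)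
    finally show "- 2 * S (\<phi> u) (\<phi>' u a) (\<phi>' u b) = 8 / 9 * ((a \<bullet> b) / (snd u)\<^sup>2)" by simp
  qed
  then show "isomorphic_hyperbolic_plane ?g (std_component ?g)"
    unfolding isomorphic_hyperbolic_plane_def U_def .
qed

text \<open>Here h = (X - t) * (X + t) * Y, so the component is {P Q Y = 1; P, Q, Y > 0} with P = X - t and Q =
  X + t. It is an orbit of the diagonal group, and logarithms of the coordinates are flat.\<close>
theorem surface_b_geometry:
  assumes T: "std3 T" "cubic_bound T" "poly_general e 1 F = (\<lambda>z. T z z z)"
  shows "homogeneous_space (std_component (poly_general e 1 F))"
    "isomorphic_flat_plane (poly_general e 1 F) (std_component (poly_general e 1 F))"
proof -
  let ?g = "poly_general e 1 F"
  define P where "P z = lX e z - lt e z" for z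
  define Q where "Q z = lX e z + lt e z" for z
  have g: "?g z = P z * Q z * lY e z" for z
    by (simp add: poly_general_light N lt_def P_def Q_def power2_eq_square algebra_simps)
  have comp: "0 < P z" "0 < Q z" "P z * Q z * lY e z = 1" if z: "z \<in> std_component ?g" for z
  proof -
    note c = surface_component[OF T z]
    show 1: "P z * Q z * lY e z = 1" unfolding g[symmetric] by (rule c(1))
    have 2: "0 < P z * Q z"
    proof (rule ccontr)
      assume neg: "\<not> 0 < P z * Q z"
      then have "lY e z < 0" using 1 mult_nonpos_nonneg[of "P z * Q z" "lY e z"] by linarith
      then have "lX e z * lY e z < 0" using c(2) by (simp add: mult_pos_neg)
      moreover have "P z * Q z = lX e z * (lX e z + 2 * lY e z) - (lt e z)\<^sup>2 - 2 * (lX e z * lY e z)"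
        by (simp add: P_def Q_def power2_eq_square algebra_simps)
      ultimately show False using neg c(3) by linarith
    qed
    show "0 < P z" "0 < Q z" using 2 c(2) by (auto simp: zero_less_mult_iff P_def Q_def)
  qed
  have lin: "linear P" "linear Q"
    by (simp_all add: P_def[abs_def] Q_def[abs_def] linear_iff lX_simps lt_simps algebra_simps)
  show "homogeneous_space (std_component ?g)"
  proof (rule homogeneousI)
    fix p assume p: "p \<in> std_component ?g"
    define f where "f z = (P p * P z + Q p * Q z) / 2" for z
    define k where "k z = lY e p * lY e z" for z
    define h where "h z = (Q p * Q z - P p * P z) / 2" for z
    have lin: "linear f" "linear k" "linear h"
      by (simp_all add: f_def k_def h_def linear_iff lY_simps linear_add[OF lin(1)] linear_add[OF lin(2)]
          linear_scale[OF lin(1)] linear_scale[OF lin(2)] algebra_simps add_divide_distrib diff_divide_distrib)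
    have 0: "lX e z = 0 \<and> lY e z = 0 \<and> lt e z = 0" if "f z = 0" "k z = 0" "h z = 0" for z
    proof -
      have "f z + h z = Q p * Q z" "f z - h z = P p * P z" by (simp_all add: f_def h_def field_simps)
      then have "Q p * Q z = 0" "P p * P z = 0" using that by simp_all
      moreover have "lY e p \<noteq> 0" using comp(3)[OF p] by auto
      ultimately have "Q z = 0" "P z = 0" "lY e z = 0" using comp(1,2)[OF p] that(2) by (auto simp: k_def)
      then show ?thesis by (simp add: P_def Q_def)
    qed
    have L: "Blinfun (\<lambda>z. chart e (f z) (k z) (h z)) \<in> GL"
      "\<And>z. blinfun_apply (Blinfun (\<lambda>z. chart e (f z) (k z) (h z))) z = chart e (f z) (k z) (h z)"
      by (rule chart_GL[OF lin]; (rule 0; assumption))+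
    show "\<exists>L\<in>GL. (\<forall>z. ?g (blinfun_apply L z) = ?g z) \<and> blinfun_apply L (1, 0) = p"
    proof (rule bexI[OF _ L(1)], intro conjI allI)
      fix z
      have "f z - h z = P p * P z" "f z + h z = Q p * Q z" by (simp_all add: f_def h_def field_simps)
      then have "?g (chart e (f z) (k z) (h z)) = (P p * P z) * (Q p * Q z) * (lY e p * lY e z)"
        unfolding g P_def[of "chart e a b c" for a b c] Q_def[of "chart e a b c" for a b c] chart_coordinates k_def by simp
      also have "\<dots> = (P p * Q p * lY e p) * ?g z" unfolding g[of z] by simp
      finally show "?g (blinfun_apply (Blinfun (\<lambda>z. chart e (f z) (k z) (h z))) z) = ?g z"
        unfolding L(2) comp(3)[OF p] by simp
    next
      have b: "P (1, 0) = 1" "Q (1, 0) = 1" "lY e (1, 0) = 1" by (simp_all add: P_def Q_def lX_def lY_def lw_def lt_def)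
      show "blinfun_apply (Blinfun (\<lambda>z. chart e (f z) (k z) (h z))) (1, 0) = p"
        unfolding L(2)
        by (rule chart_eqI; unfold chart_coordinates) (simp_all add: f_def k_def h_def b, simp_all add: P_def Q_def)
    qed
  qed
  define S where "S p q r = (P p * Q q * lY e r + P p * lY e q * Q r + Q p * P q * lY e r + Q p * lY e q * P r
     + lY e p * P q * Q r + lY e p * Q q * P r) / 6" for p q r
  have S: "sym3 S"
    unfolding sym3_def S_def by (auto simp: linear_iff lY_simps linear_add[OF lin(1)] linear_add[OF lin(2)]
          linear_scale[OF lin(1)] linear_scale[OF lin(2)] algebra_simps add_divide_distrib)
  have gS: "?g = (\<lambda>z. S z z z)" unfolding fun_eq_iff g by (simp add: S_def)
  define lp where "lp u = fst u + snd u / sqrt 3" for u :: "real \<times> real"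
  define lq where "lq u = - fst u + snd u / sqrt 3" for u :: "real \<times> real"
  define ly where "ly u = - 2 * snd u / sqrt 3" for u :: "real \<times> real"
  have ll: "linear lp" "linear lq" "linear ly"
    by (simp_all add: lp_def lq_def ly_def linear_iff algebra_simps add_divide_distrib diff_divide_distrib)
  define \<phi> where "\<phi> u = chart e ((exp (lp u) + exp (lq u)) * (1 / 2)) (exp (ly u)) ((exp (lq u) - exp (lp u)) * (1 / 2))" for u
  define \<psi> where "\<psi> z = ((ln (P z) - ln (Q z)) * (1 / 2), (ln (P z) + ln (Q z)) * (sqrt 3 / 2))" for z
  define \<phi>' where "\<phi>' u a = chart e ((exp (lp u) * lp a + exp (lq u) * lq a) * (1 / 2)) (exp (ly u) * ly a) ((exp (lq u) * lq a - exp (lp u) * lp a) * (1 / 2))" for u a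
  have co: "P (\<phi> u) = exp (lp u)" "Q (\<phi> u) = exp (lq u)" "lY e (\<phi> u) = exp (ly u)"
    "P (\<phi>' u a) = exp (lp u) * lp a" "Q (\<phi>' u a) = exp (lq u) * lq a" "lY e (\<phi>' u a) = exp (ly u) * ly a" for u a
    unfolding P_def Q_def \<phi>_def \<phi>'_def chart_coordinates by (simp_all add: field_simps)
  have prod: "exp (lp u) * exp (lq u) * exp (ly u) = 1" for u
    by (simp add: lp_def lq_def ly_def flip: exp_add)
  have ex: "Cinf_on UNIV (\<lambda>u. exp (l u))" "((\<lambda>u. exp (l u)) has_derivative (\<lambda>a. exp (l u) * l a)) (at u)"
    if "linear l" for l :: "real \<times> real \<Rightarrow> real" and u
  proof -
    have b: "bounded_linear l" using that by (simp add: linear_linear)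
    show "Cinf_on UNIV (\<lambda>u. exp (l u))"
      by (rule Cinf_real_comp[OF open_UNIV Cinf_exp Cinf_linear[OF open_UNIV b]]) simp
    show "((\<lambda>u. exp (l u)) has_derivative (\<lambda>a. exp (l u) * l a)) (at u)"
      using DERIV_compose_FDERIV[OF DERIV_exp bounded_linear_imp_has_derivative[OF b]] by (simp add: mult.commute)
  qed
  have PQ: "open {z. 0 < P z \<and> 0 < Q z}"
    using lin by (intro open_Collect_conj open_Collect_less continuous_on_const linear_continuous_on) (simp_all add: linear_linear)
  have "isometric_up_to_scale (UNIV :: (real \<times> real) set) (\<lambda>u a b. a \<bullet> b) (std_component ?g) (psr_metric ?g)"
  proof (rule isometric_by_parametrization[where \<phi> = \<phi> and \<psi> = \<psi> and \<phi>' = \<phi>' and T = S and base = 0 and c = "2 / 3"])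
    show "open (UNIV :: (real \<times> real) set)" "connected (UNIV :: (real \<times> real) set)" "(0 :: real \<times> real) \<in> UNIV" by auto
    show "sym3 S" "?g = (\<lambda>z. S z z z)" by (fact S gS)+
    show "\<phi> 0 = (1, 0)" using chart_base by (simp add: \<phi>_def lp_def lq_def ly_def)
    have "Cinf_on UNIV (\<lambda>u. chart e ((exp (lp u) + exp (lq u)) * (1 / 2)) (exp (ly u)) ((exp (lq u) - exp (lp u)) * (1 / 2)))"
      by (intro chart_Cinf Cinf_mult Cinf_add Cinf_diff Cinf_const ex(1) ll open_UNIV)
    then show "Cinf_on UNIV \<phi>" by (simp add: \<phi>_def[abs_def])
    show "?g (\<phi> u) = 1" for u unfolding g co by (rule prod)
    show "(\<phi> has_derivative \<phi>' u) (at u)" for u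
      unfolding \<phi>_def[abs_def] \<phi>'_def[abs_def]
      by (intro chart_has_derivative has_derivative_mult_left has_derivative_add has_derivative_diff ex(2) ll)
    show "(0::real) < 2 / 3" by simp
    show "smooth_on (std_component ?g) \<psi>"
    proof (rule smooth_onI[OF PQ])
      show "std_component ?g \<subseteq> {z. 0 < P z \<and> 0 < Q z}" using comp by auto
      have l: "Cinf_on {z. 0 < P z \<and> 0 < Q z} (\<lambda>z. ln (P z))" "Cinf_on {z. 0 < P z \<and> 0 < Q z} (\<lambda>z. ln (Q z))"
        by (rule Cinf_real_comp[OF PQ Cinf_ln Cinf_linear[OF PQ lin(1)[THEN linear_linear[THEN iffD2]]]], simp)
           (rule Cinf_real_comp[OF PQ Cinf_ln Cinf_linear[OF PQ lin(2)[THEN linear_linear[THEN iffD2]]]], simp)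
      have "Cinf_on {z. 0 < P z \<and> 0 < Q z} (\<lambda>z. ((ln (P z) - ln (Q z)) * (1 / 2)) *\<^sub>R (1::real, 0::real)
          + ((ln (P z) + ln (Q z)) * (sqrt 3 / 2)) *\<^sub>R (0::real, 1::real))"
        by (intro Cinf_add Cinf_scaleR Cinf_mult Cinf_diff Cinf_const PQ l)
      then show "Cinf_on {z. 0 < P z \<and> 0 < Q z} \<psi>" by (simp add: \<psi>_def[abs_def])
    qed
    show "\<psi> z \<in> UNIV \<and> \<phi> (\<psi> z) = z" if z: "z \<in> std_component ?g" for z
    proof
      note c = comp[OF z]
      have l: "lp (\<psi> z) = ln (P z)" "lq (\<psi> z) = ln (Q z)" "ly (\<psi> z) = - (ln (P z) + ln (Q z))"
        by (simp_all add: lp_def lq_def ly_def \<psi>_def field_simps)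
      have Y: "exp (ly (\<psi> z)) = lY e z"
        unfolding l exp_minus exp_add using c by (simp add: field_simps)
      show "\<phi> (\<psi> z) = z"
        by (rule chart_eqI; unfold \<phi>_def chart_coordinates Y) (simp_all add: l c, simp_all add: P_def Q_def)
    qed simp
    show "\<psi> (\<phi> u) = u" for u
      unfolding \<psi>_def co by (simp add: prod_eq_iff lp_def lq_def field_simps)
    fix u a b :: "real \<times> real"
    have "- 2 * S (\<phi> u) (\<phi>' u a) (\<phi>' u b) = - (1 / 3) * (exp (lp u) * exp (lq u) * exp (ly u)) *
        (lq a * ly b + ly a * lq b + lp a * ly b + ly a * lp b + lp a * lq b + lq a * lp b)"
      unfolding S_def co by (simp add: field_simps)
    also have "\<dots> = 2 / 3 * (a \<bullet> b)"
      unfolding prod unfolding lp_def lq_def ly_def inner_prod_def by (simp add: field_simps sqrt3_simps)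
    finally show "- 2 * S (\<phi> u) (\<phi>' u a) (\<phi>' u b) = 2 / 3 * (a \<bullet> b)" .
  qed
  then show "isomorphic_flat_plane ?g (std_component ?g)" unfolding isomorphic_flat_plane_def .
qed

end

section \<open>Invariance under linear equivalence\<close>

lemma psr_equivalent_homogeneous:
  assumes "psr_equivalent h1 H1 h2 H2" "homogeneous_space H1" shows "homogeneous_space H2"
proof -
  obtain L where L: "L \<in> GL" "blinfun_apply L ` H1 = H2"
    using assms(1) unfolding psr_equivalent_def by blast
  obtain K where K: "K \<in> GL" "\<And>x. blinfun_apply K (blinfun_apply L x) = x" "\<And>x. blinfun_apply L (blinfun_apply K x) = x"
    using blinfun_GL_inverse[OF L(1)] by blast
  have KH: "blinfun_apply K ` H2 = H1" unfolding L(2)[symmetric] by (simp add: image_image K(2))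
  show ?thesis unfolding homogeneous_space_def
  proof (intro ballI)
    fix p q assume pq: "p \<in> H2" "q \<in> H2"
    then have "blinfun_apply K p \<in> H1" "blinfun_apply K q \<in> H1" using KH by blast+
    then obtain M where M: "M \<in> symmetry_group H1" "blinfun_apply M (blinfun_apply K p) = blinfun_apply K q"
      using assms(2) unfolding homogeneous_space_def by blast
    have MG: "M \<in> GL" "blinfun_apply M ` H1 = H1" using M(1) by (simp_all add: symmetry_group_def)
    have "blinfun_apply (L o\<^sub>L (M o\<^sub>L K)) ` H2 = blinfun_apply L ` blinfun_apply M ` blinfun_apply K ` H2"
      by (simp add: image_image)
    then have "L o\<^sub>L (M o\<^sub>L K) \<in> symmetry_group H2"
      using GL_compose[OF L(1) GL_compose[OF MG(1) K(1)]] by (simp add: symmetry_group_def KH MG(2) L(2))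
    moreover have "blinfun_apply (L o\<^sub>L (M o\<^sub>L K)) p = q" by (simp add: M(2) K(3))
    ultimately show "\<exists>L\<in>symmetry_group H2. blinfun_apply L p = q" by blast
  qed
qed

text \<open>Conjugation by L is linear and injective, so it carries a nonzero tangent vector of one symmetry
  group to one of the other.\<close>
lemma psr_equivalent_symmetry_dim:
  assumes "psr_equivalent h1 H1 h2 H2" "E \<in> tangent_space (symmetry_group H1) id_blinfun" "E \<noteq> 0"
  shows "1 \<le> lie_group_dim (symmetry_group H2)"
proof -
  obtain L where L: "L \<in> GL" "blinfun_apply L ` H1 = H2"
    using assms(1) unfolding psr_equivalent_def by blast
  obtain K where K: "K \<in> GL" "\<And>x. blinfun_apply K (blinfun_apply L x) = x" "\<And>x. blinfun_apply L (blinfun_apply K x) = x"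
    using blinfun_GL_inverse[OF L(1)] by blast
  have KH: "blinfun_apply K ` H2 = H1" unfolding L(2)[symmetric] by (simp add: image_image K(2))
  define C where "C M = L o\<^sub>L (M o\<^sub>L K)" for M
  have bl: "bounded_linear C"
    unfolding C_def[abs_def]
    by (intro bounded_linear_compose[OF bounded_bilinear.bounded_linear_right[OF bounded_bilinear_blinfun_compose]
          bounded_bilinear.bounded_linear_left[OF bounded_bilinear_blinfun_compose]])
  obtain c \<epsilon> where c: "0 < \<epsilon>" "c 0 = id_blinfun" "\<And>t. \<bar>t\<bar> < \<epsilon> \<Longrightarrow> c t \<in> symmetry_group H1"
    "(c has_vector_derivative E) (at 0)"
    using assms(2) unfolding tangent_space_def by blast
  have "C M \<in> symmetry_group H2" if M: "M \<in> symmetry_group H1" for M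
  proof -
    have MG: "M \<in> GL" "blinfun_apply M ` H1 = H1" using M by (simp_all add: symmetry_group_def)
    have "blinfun_apply (C M) ` H2 = blinfun_apply L ` blinfun_apply M ` blinfun_apply K ` H2"
      by (simp add: image_image C_def)
    then show ?thesis
      using GL_compose[OF L(1) GL_compose[OF MG(1) K(1)]] by (simp add: symmetry_group_def KH MG(2) L(2) C_def)
  qed
  moreover have "C id_blinfun = id_blinfun" by (rule blinfun_eqI) (simp add: C_def K(3))
  ultimately have "C E \<in> tangent_space (symmetry_group H2) id_blinfun"
    unfolding tangent_space_def using c bounded_linear.has_vector_derivative[OF bl c(4)]
    by (intro CollectI exI[of _ "\<lambda>t. C (c t)"] exI[of _ \<epsilon>]) simp
  moreover have "C E \<noteq> 0"
  proof
    assume C0: "C E = 0"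
    have "blinfun_apply E x = 0" for x
    proof -
      have "blinfun_apply L (blinfun_apply E x) = blinfun_apply (C E) (blinfun_apply L x)" by (simp add: C_def K(2))
      then have "blinfun_apply L (blinfun_apply E x) = 0" by (simp add: C0)
      then have "blinfun_apply K (blinfun_apply L (blinfun_apply E x)) = 0" by (simp add: blinfun.zero_right)
      then show ?thesis by (simp add: K(2))
    qed
    then have "E = 0" by (intro blinfun_eqI) simp
    then show False using assms(3) by simp
  qed
  ultimately show ?thesis by (rule lie_group_dim_ge_1)
qed

text \<open>The Hessian is natural under linear maps, so L composed with a parametrization is again one.\<close>
lemma psr_equivalent_isometric:
  fixes U :: "'c::euclidean_space set" and h1 h2 :: "'a::euclidean_space \<Rightarrow> real"
  assumes eq: "psr_equivalent h1 H1 h2 H2" and h: "cubic_form h2" and U: "open U"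
    and iso: "isometric_up_to_scale U gU H1 (psr_metric h1)"
  shows "isometric_up_to_scale U gU H2 (psr_metric h2)"
proof -
  obtain L where L: "L \<in> GL" "\<And>x. h2 (blinfun_apply L x) = h1 x" "blinfun_apply L ` H1 = H2"
    using eq unfolding psr_equivalent_def by blast
  obtain K where K: "K \<in> GL" "\<And>x. blinfun_apply K (blinfun_apply L x) = x" "\<And>x. blinfun_apply L (blinfun_apply K x) = x"
    using blinfun_GL_inverse[OF L(1)] by blast
  note bl = blinfun.bounded_linear_right
  obtain T where T: "sym3 T" "h2 = (\<lambda>x. T x x x)" using cubic_form_sym3[OF h] by blast
  have T1: "sym3 (\<lambda>a b c. T (blinfun_apply L a) (blinfun_apply L b) (blinfun_apply L c))"
    by (rule sym3_compose[OF T(1) bounded_linear.linear[OF bl]])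
  have h1: "h1 = (\<lambda>x. T (blinfun_apply L x) (blinfun_apply L x) (blinfun_apply L x))"
    using L(2) by (auto simp: T(2))
  have metric: "psr_metric h2 (blinfun_apply L p) (blinfun_apply L v) (blinfun_apply L w) = psr_metric h1 p v w" for p v w
    unfolding psr_metric_def h1 T(2) sym3_hessian[OF T1] sym3_hessian[OF T(1)] by simp
  obtain \<phi> \<psi> c where i: "smooth_on U \<phi>" "smooth_on H1 \<psi>" "\<phi> ` U = H1" "\<forall>u\<in>U. \<psi> (\<phi> u) = u" "0 < c"
    "\<forall>u\<in>U. \<forall>a b. psr_metric h1 (\<phi> u) (frechet_derivative \<phi> (at u) a) (frechet_derivative \<phi> (at u) b) = c * gU u a b"
    using iso unfolding isometric_up_to_scale_def by blast
  have diff: "(\<phi> has_derivative frechet_derivative \<phi> (at u)) (at u)" if u: "u \<in> U" for u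
  proof -
    obtain V f where V: "open V" "U \<subseteq> V" "Cinf_on V f" "\<forall>x\<in>U. f x = \<phi> x"
      using i(1) unfolding smooth_on_def Cinf_on_def by blast
    have "Ck_on (Suc 0) V f" using V(3) unfolding Cinf_on_def by blast
    then have "f differentiable (at u)" using V(2) u by auto
    then obtain D where D: "(f has_derivative D) (at u)" unfolding differentiable_def by blast
    have "(\<phi> has_derivative D) (at u)"
      by (rule has_derivative_transform_within_open[OF D U u]) (use V(4) in auto)
    then show ?thesis using frechet_derivative_at by metis
  qed
  have D2: "frechet_derivative (\<lambda>u. blinfun_apply L (\<phi> u)) (at u) a = blinfun_apply L (frechet_derivative \<phi> (at u) a)"
    if u: "u \<in> U" for u a
    using frechet_derivative_at[OF bounded_linear.has_derivative[OF bl diff[OF u]], of L] by metis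
  show ?thesis unfolding isometric_up_to_scale_def
  proof (intro exI conjI)
    show "smooth_on U (\<lambda>u. blinfun_apply L (\<phi> u))" by (rule smooth_on_linear_comp[OF bl i(1)])
    obtain V f where V: "open V" "H1 \<subseteq> V" "Cinf_on V f" "\<forall>x\<in>H1. f x = \<psi> x"
      using i(2) unfolding smooth_on_def Cinf_on_def by blast
    show "smooth_on H2 (\<lambda>z. \<psi> (blinfun_apply K z))"
      unfolding smooth_on_def Cinf_on_def[symmetric]
    proof (intro exI[of _ "blinfun_apply K -` V"] exI[of _ "\<lambda>z. f (blinfun_apply K z)"] conjI)
      show o: "open (blinfun_apply K -` V)"
        by (rule open_vimage[OF V(1)]) (rule linear_continuous_on[OF bl])
      show "H2 \<subseteq> blinfun_apply K -` V" using V(2) L(3) K(2) by auto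
      show "Cinf_on (blinfun_apply K -` V) (\<lambda>z. f (blinfun_apply K z))"
        by (rule Cinf_precomp_linear[OF V(1) bl _ o V(3)]) simp
      show "\<forall>z\<in>H2. f (blinfun_apply K z) = \<psi> (blinfun_apply K z)" using V(4) L(3) K(2) by auto
    qed
    have "(\<lambda>u. blinfun_apply L (\<phi> u)) ` U = blinfun_apply L ` \<phi> ` U" by (simp add: image_image)
    then show "(\<lambda>u. blinfun_apply L (\<phi> u)) ` U = H2" by (simp add: i(3) L(3))
    show "\<forall>u\<in>U. \<psi> (blinfun_apply K (blinfun_apply L (\<phi> u))) = u" using i(4) by (simp add: K(2))
    show "0 < c" by (rule i(5))
    show "\<forall>u\<in>U. \<forall>a b. psr_metric h2 (blinfun_apply L (\<phi> u)) (frechet_derivative (\<lambda>u. blinfun_apply L (\<phi> u)) (at u) a)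
        (frechet_derivative (\<lambda>u. blinfun_apply L (\<phi> u)) (at u) b) = c * gU u a b"
      using i(6) by (simp add: D2 metric)
  qed
qed

text \<open>Frames for h composed with L become frames for h after composing with L.\<close>
lemma limit_polynomial_pullback:
  fixes h :: "real \<times> 'b::euclidean_space \<Rightarrow> real"
  assumes L: "L \<in> GL" and l: "limit_polynomial (h \<circ> blinfun_apply L) q u hb"
  shows "limit_polynomial h (blinfun_apply L q) (blinfun_apply L u) hb"
proof -
  note bl = blinfun.bounded_linear_right
  obtain R A where A: "smallest_positive_zero (h \<circ> blinfun_apply L) q u R" "standard_frame (h \<circ> blinfun_apply L) q u R A"
    "cubic_form hb" "uniform_limit (cball 0 1) (\<lambda>t. (h \<circ> blinfun_apply L) \<circ> blinfun_apply (A t)) hb (at_left R)"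
    using l unfolding limit_polynomial_def by blast
  have line: "blinfun_apply L q + t *\<^sub>R blinfun_apply L u = blinfun_apply L (q + t *\<^sub>R u)" for t
    by (simp add: blinfun.add_right blinfun.scaleR_right)
  have comp: "h \<circ> blinfun_apply (L o\<^sub>L M) = (h \<circ> blinfun_apply L) \<circ> blinfun_apply M" for M by auto
  show ?thesis unfolding limit_polynomial_def
  proof (intro exI[of _ R] exI[of _ "\<lambda>t. L o\<^sub>L A t"] conjI)
    show "smallest_positive_zero h (blinfun_apply L q) (blinfun_apply L u) R"
      using A(1) unfolding smallest_positive_zero_def line by simp
    show "standard_frame h (blinfun_apply L q) (blinfun_apply L u) R (\<lambda>t. L o\<^sub>L A t)"
      unfolding standard_frame_def comp
    proof (intro conjI ballI)
      show "smooth_on {0..<R} (\<lambda>t. L o\<^sub>L A t)"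
        using A(2) unfolding standard_frame_def
        by (intro smooth_on_linear_comp[OF bounded_bilinear.bounded_linear_right[OF bounded_bilinear_blinfun_compose]]) blast
      fix t assume "t \<in> {0..<R}"
      then have t: "A t \<in> GL" "blinfun_apply (A t) (1, 0) = limit_curve (h \<circ> blinfun_apply L) q u t"
        "\<exists>P. cubic_form P \<and> (h \<circ> blinfun_apply L) \<circ> blinfun_apply (A t) = standard_cubic P"
        using A(2) unfolding standard_frame_def by blast+
      show "L o\<^sub>L A t \<in> GL" by (rule GL_compose[OF L t(1)])
      show "blinfun_apply (L o\<^sub>L A t) (1, 0) = limit_curve h (blinfun_apply L q) (blinfun_apply L u) t"
        by (simp add: t(2) limit_curve_def line blinfun.scaleR_right)
      show "\<exists>P. cubic_form P \<and> (h \<circ> blinfun_apply L) \<circ> blinfun_apply (A t) = standard_cubic P" by (rule t(3))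
    qed
    show "uniform_limit (cball 0 1) (\<lambda>t. h \<circ> blinfun_apply (L o\<^sub>L A t)) hb (at_left R)"
      unfolding comp by (rule A(4))
  qed (rule A(3))
qed

section \<open>Limits of standard cubics\<close>

text \<open>A standard form of h at another point of the component satisfies the bound, because hyperbolicity
  of the component is invariant under linear maps.\<close>
lemma frame_cubic_bound:
  fixes T :: "real \<times> 'b::euclidean_space \<Rightarrow> real \<times> 'b \<Rightarrow> real \<times> 'b \<Rightarrow> real"
  assumes T: "std3 T" "cubic_bound T" and A: "A \<in> GL" "blinfun_apply A (1, 0) \<in> std_component (\<lambda>z. T z z z)"
    and S: "std3 S" "\<And>z. S z z z = T (blinfun_apply A z) (blinfun_apply A z) (blinfun_apply A z)"
  shows "cubic_bound S"
proof (rule cubic_bound_if_hyp[OF S(1)])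
  note bl = bounded_linear.linear[OF blinfun.bounded_linear_right]
  have ST: "S = (\<lambda>a b c. T (blinfun_apply A a) (blinfun_apply A b) (blinfun_apply A c))"
    by (rule sym3_eqI[OF std3_sym3[OF S(1)] sym3_compose[OF std3_sym3[OF T(1)] bl]]) (rule S(2))
  fix p assume "p \<in> std_component (\<lambda>z. S z z z)"
  then have "blinfun_apply A p \<in> std_component (\<lambda>z. T z z z)"
    using component_image[OF A(1), of "\<lambda>z. T z z z" "\<lambda>z. S z z z"] A(2) S(2) by auto
  then have "hyp T (blinfun_apply A p)"
    using hyp_cone_hyp[OF T] std_component_hyp_cone[OF T] by blast
  moreover have "blinfun_apply A a \<noteq> 0" if "a \<noteq> 0" for a
  proof
    assume "blinfun_apply A a = 0"
    then have "blinfun_apply A a = blinfun_apply A 0" by (simp add: blinfun.zero_right)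
    moreover have "inj (blinfun_apply A)" using A(1) by (simp add: GL_def bij_def)
    ultimately have "a = 0" by (rule injD[rotated])
    then show False using that by simp
  qed
  ultimately show "hyp S p" unfolding hyp_def ST by blast
qed

text \<open>Uniform convergence on the unit ball gives pointwise convergence by homogeneity and convergence of
  the trilinear forms by polarization; the defining equations and the inequality then pass to the limit.\<close>
lemma limit_of_standard_cubics:
  fixes hb :: "real \<times> 'b::euclidean_space \<Rightarrow> real"
  assumes hb: "cubic_form hb" and F: "F \<noteq> bot"
    and ev: "\<forall>\<^sub>F t in F. \<exists>S. std3 S \<and> cubic_bound S \<and> f t = (\<lambda>z. S z z z)"
    and lim: "uniform_limit (cball 0 1) f hb F"
  obtains T where "std3 T" "cubic_bound T" "hb = (\<lambda>z. T z z z)"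
proof -
  obtain T where T: "sym3 T" "hb = (\<lambda>z. T z z z)" using cubic_form_sym3[OF hb] by blast
  define S where "S t = (SOME S. std3 S \<and> cubic_bound S \<and> f t = (\<lambda>z. S z z z))" for t
  have S: "\<forall>\<^sub>F t in F. std3 (S t) \<and> cubic_bound (S t) \<and> f t = (\<lambda>z. S t z z z)"
    using ev
  proof (rule eventually_mono)
    fix t assume "\<exists>S. std3 S \<and> cubic_bound S \<and> f t = (\<lambda>z. S z z z)"
    then show "std3 (S t) \<and> cubic_bound (S t) \<and> f t = (\<lambda>z. S t z z z)"
      unfolding S_def by (rule someI_ex[where P = "\<lambda>S. std3 S \<and> cubic_bound S \<and> f t = (\<lambda>z. S z z z)"])
  qed
  have pt: "((\<lambda>t. S t z z z) \<longlongrightarrow> T z z z) F" for z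
  proof -
    define r where "r = inverse (norm z + 1)"
    have "0 < norm z + 1" by (simp add: add_nonneg_pos)
    then have r: "0 < r" "r *\<^sub>R z \<in> cball 0 1" by (simp_all add: r_def field_simps)
    have "((\<lambda>t. f t (r *\<^sub>R z)) \<longlongrightarrow> hb (r *\<^sub>R z)) F" by (rule tendsto_uniform_limitI[OF lim r(2)])
    moreover have "hb (r *\<^sub>R z) = r ^ 3 * T z z z" by (simp add: T(2) sym3_simps[OF T(1)] power3_eq_cube)
    ultimately have "((\<lambda>t. f t (r *\<^sub>R z) / r ^ 3) \<longlongrightarrow> r ^ 3 * T z z z / r ^ 3) F"
      using r by (intro tendsto_divide tendsto_const) auto
    then have "((\<lambda>t. f t (r *\<^sub>R z) / r ^ 3) \<longlongrightarrow> T z z z) F" using r by simp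
    moreover have "\<forall>\<^sub>F t in F. f t (r *\<^sub>R z) / r ^ 3 = S t z z z"
      using S
    proof (rule eventually_mono)
      fix t assume S: "std3 (S t) \<and> cubic_bound (S t) \<and> f t = (\<lambda>z. S t z z z)"
      then have s: "sym3 (S t)" by (simp add: std3_sym3)
      have "f t (r *\<^sub>R z) = r ^ 3 * S t z z z" using S by (simp add: sym3_simps[OF s] power3_eq_cube)
      then show "f t (r *\<^sub>R z) / r ^ 3 = S t z z z" using r by simp
    qed
    ultimately show ?thesis by (rule Lim_transform_eventually)
  qed
  have tri: "((\<lambda>t. S t a b c) \<longlongrightarrow> T a b c) F" for a b c
  proof -
    have "((\<lambda>t. (S t (a+b+c) (a+b+c) (a+b+c) - S t (a+b) (a+b) (a+b) - S t (b+c) (b+c) (b+c)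
       - S t (a+c) (a+c) (a+c) + S t a a a + S t b b b + S t c c c) / 6) \<longlongrightarrow> T a b c) F"
      unfolding sym3_polar[OF T(1), of a b c] by (intro tendsto_intros pt) simp
    moreover have "\<forall>\<^sub>F t in F. (S t (a+b+c) (a+b+c) (a+b+c) - S t (a+b) (a+b) (a+b) - S t (b+c) (b+c) (b+c)
       - S t (a+c) (a+c) (a+c) + S t a a a + S t b b b + S t c c c) / 6 = S t a b c"
      using S
    proof (rule eventually_mono)
      fix t assume S: "std3 (S t) \<and> cubic_bound (S t) \<and> f t = (\<lambda>z. S t z z z)"
      then have s: "sym3 (S t)" by (simp add: std3_sym3)
      show "(S t (a+b+c) (a+b+c) (a+b+c) - S t (a+b) (a+b) (a+b) - S t (b+c) (b+c) (b+c)
       - S t (a+c) (a+c) (a+c) + S t a a a + S t b b b + S t c c c) / 6 = S t a b c"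
        by (rule sym3_polar[OF s, symmetric])
    qed
    ultimately show ?thesis by (rule Lim_transform_eventually)
  qed
  have const: "T a b c = x" if "\<forall>\<^sub>F t in F. S t a b c = x" for a b c x
    using tendsto_unique[OF F tri[of a b c]] tendsto_eventually[OF that] by blast
  have "std3 T" unfolding std3_def
  proof (intro conjI allI T(1) const)
    show "\<forall>\<^sub>F t in F. S t (1, 0) (1, 0) (1, 0) = 1" "\<forall>\<^sub>F t in F. S t (1, 0) (1, 0) (0, y) = 0"
      "\<forall>\<^sub>F t in F. S t (1, 0) (0, y) (0, z) = - (y \<bullet> z) / 3" for y z
      by (rule eventually_mono[OF S], simp add: std3_def)+
  qed
  moreover have "cubic_bound T" unfolding cubic_bound_def
  proof
    fix y
    show "T (0, y) (0, y) (0, y) \<le> 2 / (3 * sqrt 3) * norm y ^ 3"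
      by (rule tendsto_upperbound[OF tri _ F], rule eventually_mono[OF S]) (simp add: cubic_bound_def)
  qed
  ultimately show thesis using that T(2) by blast
qed

lemma limit_at_base_standard:
  fixes T :: "real \<times> 'b::euclidean_space \<Rightarrow> real \<times> 'b \<Rightarrow> real \<times> 'b \<Rightarrow> real"
  assumes T: "std3 T" "cubic_bound T" and w: "w \<noteq> 0"
    and l: "limit_polynomial (\<lambda>z. T z z z) (1, 0) (0, w) hb"
  obtains S where "std3 S" "cubic_bound S" "hb = (\<lambda>z. S z z z)"
proof -
  let ?h = "\<lambda>z. T z z z"
  note s = std3_sym3[OF T(1)]
  obtain R A where A: "smallest_positive_zero ?h (1, 0) (0, w) R" "standard_frame ?h (1, 0) (0, w) R A"
    "cubic_form hb" "uniform_limit (cball 0 1) (\<lambda>t. ?h \<circ> blinfun_apply (A t)) hb (at_left R)"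
    using l unfolding limit_polynomial_def by blast
  obtain R' where R': "smallest_positive_zero ?h (1, 0) (0, w) R'"
    "\<And>t. 0 \<le> t \<Longrightarrow> t < R' \<Longrightarrow> (1, t *\<^sub>R w) \<in> hyp_cone T"
    by (rule first_zero[OF T w]) (rule that)
  have "R = R'"
    using A(1) R'(1) unfolding smallest_positive_zero_def by (metis linorder_neqE_linordered_idom)
  have R0: "0 < R" using A(1) by (simp add: smallest_positive_zero_def)
  have fr: "\<exists>S. std3 S \<and> cubic_bound S \<and> ?h \<circ> blinfun_apply (A t) = (\<lambda>z. S z z z)" if tR: "t \<in> {0..<R}" for t
  proof -
    obtain P where t: "A t \<in> GL" "blinfun_apply (A t) (1, 0) = limit_curve ?h (1, 0) (0, w) t"
      "cubic_form P" "?h \<circ> blinfun_apply (A t) = standard_cubic P"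
      using bspec[OF conjunct2[OF A(2)[unfolded standard_frame_def]] tR] by blast
    obtain S where S: "std3 S" "standard_cubic P = (\<lambda>z. S z z z)"
      by (rule standard_cubic_std3[OF t(3)]) (rule that)
    have c: "(1, t *\<^sub>R w) \<in> hyp_cone T" using R'(2) tR \<open>R = R'\<close> by simp
    then have pos: "0 < ?h (1, t *\<^sub>R w)" by (simp add: hyp_cone_def)
    define r where "r = ?h (1, t *\<^sub>R w) powr (- 1 / 3)"
    have r: "0 < r" using pos by (simp add: r_def)
    have p: "blinfun_apply (A t) (1, 0) = r *\<^sub>R (1, t *\<^sub>R w)" unfolding t(2) limit_curve_def r_def by simp
    have "?h (r *\<^sub>R (1, t *\<^sub>R w)) = r ^ 3 * ?h (1, t *\<^sub>R w)"
      by (simp only: sym3_simps[OF s]) (simp add: power3_eq_cube)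
    also have "\<dots> = 1" unfolding r_def by (rule powr_cube_root[OF pos])
    finally have "blinfun_apply (A t) (1, 0) \<in> std_component ?h"
      unfolding p std_component_hyp_cone[OF T] using hyp_cone_scale[OF s r c] by blast
    moreover have "S z z z = T (blinfun_apply (A t) z) (blinfun_apply (A t) z) (blinfun_apply (A t) z)" for z
      using fun_cong[OF t(4), of z] by (simp add: S(2))
    ultimately have "cubic_bound S" by (intro frame_cubic_bound[OF T t(1) _ S(1)])
    then show ?thesis using S t(4) by auto
  qed
  have ev: "\<forall>\<^sub>F t in at_left R. t \<in> {0..<R}" using R0 by (auto simp: eventually_at_left_field intro: exI[of _ 0])
  have "\<forall>\<^sub>F t in at_left R. \<exists>S. std3 S \<and> cubic_bound S \<and> ?h \<circ> blinfun_apply (A t) = (\<lambda>z. S z z z)"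
    by (rule eventually_mono[OF ev fr])
  then show thesis
    by (rule limit_of_standard_cubics[OF A(3) trivial_limit_at_left_real _ A(4)]) (rule that)
qed

text \<open>Differentiate h = 1 along a curve.\<close>
lemma tangent_space_polar:
  fixes T :: "'a::euclidean_space \<Rightarrow> 'a \<Rightarrow> 'a \<Rightarrow> real"
  assumes T: "sym3 T" and H: "\<And>q. q \<in> H \<Longrightarrow> T q q q = 1" and v: "v \<in> tangent_space H p"
  shows "T p p v = 0"
proof -
  obtain c \<epsilon> where c: "0 < \<epsilon>" "c 0 = p" "\<And>t. \<bar>t\<bar> < \<epsilon> \<Longrightarrow> c t \<in> H" "(c has_vector_derivative v) (at 0)"
    using v unfolding tangent_space_def by blast
  have "((\<lambda>q. T q q q) has_derivative (\<lambda>v. 3 * T p p v)) (at (c 0))" unfolding c(2) by (rule sym3_cubic_derivative[OF T])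
  from has_derivative_compose[OF c(4)[unfolded has_vector_derivative_def] this]
  have 1: "((\<lambda>t. T (c t) (c t) (c t)) has_derivative (\<lambda>x. 3 * T p p (x *\<^sub>R v))) (at 0)" .
  have "((\<lambda>t. 1) has_derivative (\<lambda>x. 3 * T p p (x *\<^sub>R v))) (at (0::real))"
    by (rule has_derivative_transform_within_open[OF 1, of "{-\<epsilon><..<\<epsilon>}"]) (use c(1) in \<open>auto intro!: H c(3)\<close>)
  moreover have "((\<lambda>t. 1::real) has_derivative (\<lambda>x. 0)) (at (0::real))" by (rule has_derivative_const)
  ultimately have "(\<lambda>x. 3 * T p p (x *\<^sub>R v)) = (\<lambda>x. 0)" by (rule has_derivative_unique)
  from fun_cong[OF this, of 1] show ?thesis by simp
qed

section \<open>Classification of the limits\<close>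

text \<open>The inverse of a standard frame A at p moves p to (1, 0) and v to a vector (0, w). The limits of h
  along the curve of p and v are the limits of h composed with A along the curve of (1, 0) and (0, w), where
  existence is known. The bound on P passes to the limit, and for the normal form it amounts to admissibility.\<close>
theorem limit_classification:
  fixes e :: "nat \<Rightarrow> 'n::finite"
  assumes e: "bij_betw e {..<CARD('n)} UNIV" and H: "ccpsr_manifold h H" "standard_form h H"
    and p: "p \<in> H" and v: "v \<in> tangent_space H p - {0}"
  obtains m F T where "m \<le> CARD('n) - 1" "admissible_matrices m (CARD('n) - 1 - m) F" "std3 T" "cubic_bound T"
    "poly_general e m F = (\<lambda>z. T z z z)" "limit_polynomial h p v (poly_general e m F)"
    "cubic_form h" "\<And>hb. limit_polynomial h p v hb \<Longrightarrow> cubic_form hb \<and> ccpsr_manifold hb (std_component hb)"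
proof -
  obtain P where P: "cubic_form P" "h = standard_cubic P" and Hc: "H = std_component h"
    using H(2) unfolding standard_form_def by blast
  obtain T where T: "std3 T" "standard_cubic P = (\<lambda>z. T z z z)"
    by (rule standard_cubic_std3[OF P(1)]) (rule that)
  note s = std3_sym3[OF T(1)]
  have h: "h = (\<lambda>z. T z z z)" using P(2) T(2) by simp
  have B: "cubic_bound T" using H(1) unfolding Hc h ccpsr_iff_cubic_bound[OF T(1)] .
  have pc: "p \<in> hyp_cone T" "T p p p = 1" using p unfolding Hc h std_component_hyp_cone[OF T(1) B] by auto
  have "0 \<le> norm (snd p)" "norm (snd p) < sqrt 3 * fst p" using pc(1) by (auto simp: hyp_cone_def)
  then have "fst p \<noteq> 0" by auto
  then obtain A where A: "A \<in> GL" "blinfun_apply A (1, 0) = p"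
    "std3 (\<lambda>a b c. T (blinfun_apply A a) (blinfun_apply A b) (blinfun_apply A c))"
    by (rule frame_at_point[OF T(1) pc(2) hyp_cone_hyp[OF T(1) B pc(1)]]) (rule that)
  obtain K where K: "K \<in> GL" "\<And>x. blinfun_apply K (blinfun_apply A x) = x" "\<And>x. blinfun_apply A (blinfun_apply K x) = x"
    using blinfun_GL_inverse[OF A(1)] by blast
  define S where "S a b c = T (blinfun_apply A a) (blinfun_apply A b) (blinfun_apply A c)" for a b c
  have S: "std3 S" unfolding S_def[abs_def] by (rule A(3))
  have SB: "cubic_bound S"
    by (rule frame_cubic_bound[OF T(1) B A(1) _ S]) (use p in \<open>simp_all add: A(2) Hc h S_def\<close>)
  have hA: "h \<circ> blinfun_apply A = (\<lambda>z. S z z z)" by (auto simp: h S_def)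
  have hK: "(\<lambda>z. S z z z) \<circ> blinfun_apply K = h" by (auto simp: h S_def K(3))
  define a where "a = fst (blinfun_apply K v)"
  define w where "w = snd (blinfun_apply K v)"
  have Kv: "blinfun_apply K v = (a, w)" by (simp add: a_def w_def)
  have "T p p v = 0"
    by (rule tangent_space_polar[OF s, of H]) (use v std_component_hyp_cone[OF T(1) B] in \<open>auto simp: Hc h\<close>)
  then have "S (1, 0) (1, 0) (a, w) = 0" unfolding S_def A(2) Kv[symmetric] K(3) .
  then have a0: "a = 0"
    using std3_bilinear[OF S, of 1 0 a w] sym3_commute(2)[OF std3_sym3[OF S], of "(1, 0)" "(1, 0)" "(a, w)"] by simp
  have "blinfun_apply K v \<noteq> 0" using v K(3)[of v] by (auto simp: blinfun.zero_right)
  then have w: "w \<noteq> 0" by (auto simp: Kv a0 zero_prod_def)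
  have v': "v = blinfun_apply A (0, w)" using K(3)[of v] by (simp add: Kv a0)
  have there: "limit_polynomial h p v hb" if "limit_polynomial (\<lambda>z. S z z z) (1, 0) (0, w) hb" for hb
    using limit_polynomial_pullback[OF A(1), of h "(1, 0)" "(0, w)" hb] that by (simp only: hA A(2) v')
  have backward: "limit_polynomial (\<lambda>z. S z z z) (1, 0) (0, w) hb" if "limit_polynomial h p v hb" for hb
  proof -
    have "blinfun_apply K p = (1, 0)" using K(2)[of "(1, 0)"] by (simp add: A(2))
    then show ?thesis
      using limit_polynomial_pullback[OF K(1), of "\<lambda>z. S z z z" p v hb] that by (simp only: hK Kv a0)
  qed
  obtain m F where mF: "m \<le> CARD('n) - 1" "normal_matrices m (CARD('n) - 1 - m) F"
    "limit_polynomial (\<lambda>z. S z z z) (1, 0) (0, w) (poly_general e m F)"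
    using limit_exists_at_base[OF e S SB w] by blast
  obtain G where G: "std3 G" "cubic_bound G" "poly_general e m F = (\<lambda>z. G z z z)"
    by (rule limit_at_base_standard[OF S SB w mF(3)]) (rule that)
  have ad: "admissible_matrices m (CARD('n) - 1 - m) F"
    using admissible_iff_cubic_bound[OF e mF(1,2) G(1,3)] G(2) by blast
  have "cubic_form hb \<and> ccpsr_manifold hb (std_component hb)" if l: "limit_polynomial h p v hb" for hb
  proof -
    obtain Q where Q: "std3 Q" "cubic_bound Q" "hb = (\<lambda>z. Q z z z)"
      by (rule limit_at_base_standard[OF S SB w backward[OF l]]) (rule that)
    show ?thesis unfolding Q(3) using ccpsr_iff_cubic_bound[OF Q(1)] Q(2) sym3_cubic_form[OF std3_sym3[OF Q(1)]] by blast
  qed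
  moreover have "cubic_form h" unfolding h by (rule sym3_cubic_form[OF s])
  ultimately show thesis using that[OF mF(1) ad G there[OF mF(3)]] by blast
qed

lemma normal_form_std3:
  fixes e :: "nat \<Rightarrow> 'n::finite"
  assumes e: "bij_betw e {..<CARD('n)} UNIV" and m: "m \<le> CARD('n) - 1"
    and F: "admissible_matrices m (CARD('n) - 1 - m) F"
  obtains T where "std3 T" "cubic_bound T" "poly_general e m F = (\<lambda>z. T z z z)"
proof -
  obtain T where T: "std3 T" "poly_general e m F = (\<lambda>z. T z z z)" by (rule poly_general_std3[OF e m]) (rule that)
  moreover have "normal_matrices m (CARD('n) - 1 - m) F" using F by (simp add: admissible_matrices_def normal_matrices_def)
  ultimately show thesis using admissible_iff_cubic_bound[OF e m _ T] F that by blast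
qed

lemma admissible_trivial: "admissible_matrices 0 k F" "admissible_matrices m 0 (\<lambda>_. 0\<^sub>m 0 0)"
  by (simp_all add: admissible_matrices_def eigenvalue_mat_iff)

lemma poly_curve_normal_form:
  fixes e :: "nat \<Rightarrow> 'n::finite"
  assumes "CARD('n) = 1" shows "poly_curve e = poly_general e 0 F"
  using assms by (auto simp: poly_curve_def poly_general_def Let_def)

text \<open>For n = 2 the two listed surfaces have w as their first coordinate, whereas the normal form has it
  last.\<close>
definition swapped :: "(nat \<Rightarrow> 'n) \<Rightarrow> nat \<Rightarrow> 'n" where
  "swapped e i = e (1 - i)"

lemma swapped_bij:
  fixes e :: "nat \<Rightarrow> 'n::finite"
  assumes "CARD('n) = 2" "bij_betw e {..<CARD('n)} UNIV" shows "bij_betw (swapped e) {..<CARD('n)} UNIV"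
proof -
  have "bij_betw (\<lambda>i. 1 - i :: nat) {..<2} {..<2}"
    by (rule bij_betw_byWitness[where f' = "\<lambda>i. 1 - i"]) auto
  from bij_betw_trans[OF this assms(2)[unfolded assms(1)]] show ?thesis
    by (simp add: assms(1) o_def swapped_def[abs_def])
qed

lemma poly_surface_normal_form:
  fixes e :: "nat \<Rightarrow> 'n::finite"
  assumes "CARD('n) = 2"
  shows "poly_surface_a e = poly_general (swapped e) 0 F" "poly_surface_b e = poly_general (swapped e) 1 F"
  using assms by (auto simp: poly_surface_a_def poly_surface_b_def poly_general_def Let_def swapped_def algebra_simps)

lemma limit_list_normal_form:
  fixes e :: "nat \<Rightarrow> 'n::finite"
  assumes e: "bij_betw e {..<CARD('n)} UNIV" and g: "g \<in> limit_list e"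
  obtains e' :: "nat \<Rightarrow> 'n" and m F T where "bij_betw e' {..<CARD('n)} UNIV" "m \<le> CARD('n) - 1" "std3 T" "cubic_bound T"
    "g = poly_general e' m F" "poly_general e' m F = (\<lambda>z. T z z z)"
proof -
  have "\<exists>(e' :: nat \<Rightarrow> 'n) m F. bij_betw e' {..<CARD('n)} UNIV \<and> m \<le> CARD('n) - 1 \<and>
      admissible_matrices m (CARD('n) - 1 - m) F \<and> g = poly_general e' m F"
  proof -
    consider "CARD('n) = 1" | "CARD('n) = 2" | "CARD('n) \<noteq> 1" "CARD('n) \<noteq> 2" by blast
    then show ?thesis
    proof cases
      case 1
      then have "g = poly_general e 0 (\<lambda>_. 0\<^sub>m 0 0)" using g poly_curve_normal_form[OF 1] by (auto simp: limit_list_def)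
      then show ?thesis using e admissible_trivial(1) by blast
    next
      case 2
      have "g = poly_general (swapped e) 0 (\<lambda>_. 0\<^sub>m 0 0) \<or> g = poly_general (swapped e) 1 (\<lambda>_. 0\<^sub>m 0 0)"
        using g 2 poly_surface_normal_form[OF 2] by (auto simp: limit_list_def)
      moreover have "admissible_matrices 1 (CARD('n) - 1 - 1) (\<lambda>_. 0\<^sub>m 0 0)" "1 \<le> CARD('n) - 1"
        using admissible_trivial(2)[of 1] 2 by simp_all
      ultimately show ?thesis using swapped_bij[OF 2 e] admissible_trivial(1) by blast
    next
      case 3
      then show ?thesis using g e unfolding limit_list_def by auto
    qed
  qed
  then obtain e' :: "nat \<Rightarrow> 'n" and m F where x: "bij_betw e' {..<CARD('n)} UNIV" "m \<le> CARD('n) - 1"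
      "admissible_matrices m (CARD('n) - 1 - m) F" "g = poly_general e' m F" by blast
  show thesis by (rule normal_form_std3[OF x(1-3)]) (rule that[OF x(1,2) _ _ x(4)])
qed

lemma surfaces_geometry:
  fixes e :: "nat \<Rightarrow> 'n::finite"
  assumes 2: "CARD('n) = 2" and e: "bij_betw e {..<CARD('n)} UNIV"
  shows "homogeneous_space (std_component (poly_surface_a e))"
    "isomorphic_hyperbolic_plane (poly_surface_a e) (std_component (poly_surface_a e))"
    "homogeneous_space (std_component (poly_surface_b e))"
    "isomorphic_flat_plane (poly_surface_b e) (std_component (poly_surface_b e))"
proof -
  let ?F = "\<lambda>_::nat. 0\<^sub>m 0 0 :: real mat"
  note e' = swapped_bij[OF 2 e]
  obtain T where T: "std3 T" "cubic_bound T" "poly_general (swapped e) 0 ?F = (\<lambda>z. T z z z)"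
    by (rule normal_form_std3[OF e' _ admissible_trivial(1)]) (simp, rule that)
  show "homogeneous_space (std_component (poly_surface_a e))"
    "isomorphic_hyperbolic_plane (poly_surface_a e) (std_component (poly_surface_a e))"
    unfolding poly_surface_normal_form(1)[OF 2, of e ?F] by (rule surface_a_geometry[OF 2 e' T])+
  have k: "CARD('n) - 1 - 1 = 0" "1 \<le> CARD('n) - 1" using 2 by simp_all
  have ad: "admissible_matrices 1 (CARD('n) - 1 - 1) ?F" unfolding k(1) by (rule admissible_trivial(2))
  obtain T where T: "std3 T" "cubic_bound T" "poly_general (swapped e) 1 ?F = (\<lambda>z. T z z z)"
    by (rule normal_form_std3[OF e' k(2) ad]) (rule that)
  show "homogeneous_space (std_component (poly_surface_b e))"
    "isomorphic_flat_plane (poly_surface_b e) (std_component (poly_surface_b e))"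
    unfolding poly_surface_normal_form(2)[OF 2, of e ?F] by (rule surface_b_geometry[OF 2 e' T])+
qed

lemma curve_geometry_transfer:
  assumes "std_equivalent hb g" "curve_geometry e g (std_component g)"
  shows "curve_geometry e hb (std_component hb)"
  using assms psr_equivalent_homogeneous[OF psr_equivalent_sym] psr_equivalent_trans
  unfolding curve_geometry_def std_equivalent_def by blast

lemma poly_curve_geometry:
  fixes e :: "nat \<Rightarrow> 'n::finite"
  assumes 1: "CARD('n) = 1" and e: "bij_betw e {..<CARD('n)} UNIV"
  shows "curve_geometry e (poly_curve e) (std_component (poly_curve e))"
proof -
  let ?F = "\<lambda>_::nat. 0\<^sub>m 0 0 :: real mat"
  obtain T where T: "std3 T" "cubic_bound T" "poly_general e 0 ?F = (\<lambda>z. T z z z)"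
    by (rule normal_form_std3[OF e _ admissible_trivial(1)]) (simp, rule that)
  show ?thesis unfolding poly_curve_normal_form[OF 1, of e ?F] by (rule curve_geometry_normal_form[OF 1 e T])
qed

text \<open>By uniqueness up to equivalence it suffices that one limit along the curve is the normal form; its
  geometric properties are then carried over by the equivalence.\<close>
theorem limit_geometry:
  fixes e :: "nat \<Rightarrow> 'n::finite"
  assumes e: "bij_betw e {..<CARD('n)} UNIV" and H: "ccpsr_manifold h H" "standard_form h H"
    and p: "p \<in> H" and v: "v \<in> tangent_space H p - {0}" and hb: "limit_polynomial h p v hb"
  shows "ccpsr_manifold hb (std_component hb)"
    and "CARD('n) = 1 \<Longrightarrow> std_equivalent hb (poly_curve e) \<and> curve_geometry e hb (std_component hb)"
    and "CARD('n) = 2 \<Longrightarrow>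
        (std_equivalent hb (poly_surface_a e) \<and> homogeneous_space (std_component hb) \<and>
           isomorphic_hyperbolic_plane hb (std_component hb)) \<or>
        (std_equivalent hb (poly_surface_b e) \<and> homogeneous_space (std_component hb) \<and>
           isomorphic_flat_plane hb (std_component hb))"
    and "\<exists>m F. m \<le> CARD('n) - 1 \<and> admissible_matrices m (CARD('n) - 1 - m) F \<and> std_equivalent hb (poly_general e m F)"
    and "1 \<le> lie_group_dim (symmetry_group (std_component hb))"
proof -
  obtain m F T where c: "m \<le> CARD('n) - 1" "admissible_matrices m (CARD('n) - 1 - m) F" "std3 T" "cubic_bound T"
    "poly_general e m F = (\<lambda>z. T z z z)" "limit_polynomial h p v (poly_general e m F)"
    "cubic_form h" "\<And>hb. limit_polynomial h p v hb \<Longrightarrow> cubic_form hb \<and> ccpsr_manifold hb (std_component hb)"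
    by (rule limit_classification[OF e H p v]) (rule that)
  have eq: "std_equivalent hb (poly_general e m F)" by (rule limit_polynomial_unique[OF c(7,6) hb])
  show "ccpsr_manifold hb (std_component hb)" using c(8)[OF hb] by blast
  show "\<exists>m F. m \<le> CARD('n) - 1 \<and> admissible_matrices m (CARD('n) - 1 - m) F \<and> std_equivalent hb (poly_general e m F)"
    using c(1,2) eq by blast
  show "1 \<le> lie_group_dim (symmetry_group (std_component hb))"
    by (rule psr_equivalent_symmetry_dim[OF psr_equivalent_sym[OF eq[unfolded std_equivalent_def]] symmetry_group_dim[OF e c(1,3,4,5)]])
  show "std_equivalent hb (poly_curve e) \<and> curve_geometry e hb (std_component hb)" if 1: "CARD('n) = 1"
  proof -
    have "m = 0" using c(1) 1 by simp
    then have "std_equivalent hb (poly_curve e)" using eq poly_curve_normal_form[OF 1] by metis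
    then show ?thesis using curve_geometry_transfer[OF _ poly_curve_geometry[OF 1 e]] by blast
  qed
  show "(std_equivalent hb (poly_surface_a e) \<and> homogeneous_space (std_component hb) \<and>
           isomorphic_hyperbolic_plane hb (std_component hb)) \<or>
        (std_equivalent hb (poly_surface_b e) \<and> homogeneous_space (std_component hb) \<and>
           isomorphic_flat_plane hb (std_component hb))" if 2: "CARD('n) = 2"
  proof -
    \<comment> \<open>For k = 0 or m = 0 the matrices do not enter the polynomial.\<close>
    obtain m F where c': "m \<le> CARD('n) - 1" "limit_polynomial h p v (poly_general (swapped e) m F)"
      by (rule limit_classification[OF swapped_bij[OF 2 e] H p v]) (rule that)
    have eq: "std_equivalent hb (poly_general (swapped e) m F)" by (rule limit_polynomial_unique[OF c(7) c'(2) hb])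
    have cf: "cubic_form hb" using c(8)[OF hb] by blast
    have "m = 0 \<or> m = 1" using c'(1) 2 by auto
    then show ?thesis
    proof
      assume "m = 0"
      then have a: "std_equivalent hb (poly_surface_a e)" using eq poly_surface_normal_form(1)[OF 2] by metis
      note b = psr_equivalent_sym[OF a[unfolded std_equivalent_def]]
      have "open {u :: real \<times> real. 0 < snd u}" by (intro open_Collect_less continuous_intros)
      then have "isomorphic_hyperbolic_plane hb (std_component hb)"
        using surfaces_geometry(2)[OF 2 e] unfolding isomorphic_hyperbolic_plane_def
        by (rule psr_equivalent_isometric[OF b cf])
      then show ?thesis using a psr_equivalent_homogeneous[OF b surfaces_geometry(1)[OF 2 e]] by blast
    next
      assume "m = 1"
      then have a: "std_equivalent hb (poly_surface_b e)" using eq poly_surface_normal_form(2)[OF 2] by metis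
      note b = psr_equivalent_sym[OF a[unfolded std_equivalent_def]]
      have "isomorphic_flat_plane hb (std_component hb)"
        using surfaces_geometry(4)[OF 2 e] unfolding isomorphic_flat_plane_def
        by (rule psr_equivalent_isometric[OF b cf open_UNIV])
      then show ?thesis using a psr_equivalent_homogeneous[OF b surfaces_geometry(3)[OF 2 e]] by blast
    qed
  qed
qed

theorem theorem1p11:
  fixes e :: "nat \<Rightarrow> 'n::finite"
  assumes "bij_betw e {..<CARD('n)} UNIV"
  shows
    "(\<forall>(h :: real \<times> (real ^ 'n) \<Rightarrow> real) H.
        ccpsr_manifold h H \<and> standard_form h H \<longrightarrow>
        (\<forall>p\<in>H. \<forall>v\<in>tangent_space H p - {0}.
           (\<exists>hb. limit_polynomial h p v hb) \<and>
           (\<forall>hb hb'. limit_polynomial h p v hb \<and> limit_polynomial h p v hb' \<longrightarrow> std_equivalent hb hb') \<and>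
           (\<forall>hb. limit_polynomial h p v hb \<longrightarrow>
              ccpsr_manifold hb (std_component hb) \<and>
              (CARD('n) = 1 \<longrightarrow>
                 std_equivalent hb (poly_curve e) \<and> curve_geometry e hb (std_component hb)) \<and>
              (CARD('n) = 2 \<longrightarrow>
                 (std_equivalent hb (poly_surface_a e) \<and> homogeneous_space (std_component hb) \<and>
                    isomorphic_hyperbolic_plane hb (std_component hb)) \<or>
                 (std_equivalent hb (poly_surface_b e) \<and> homogeneous_space (std_component hb) \<and>
                    isomorphic_flat_plane hb (std_component hb))) \<and>
              (CARD('n) \<ge> 3 \<longrightarrow>
                 (\<exists>m F. m \<le> CARD('n) - 1 \<and> admissible_matrices m (CARD('n) - 1 - m) F \<and>
                    std_equivalent hb (poly_general e m F)) \<and>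
                 lie_group_dim (symmetry_group (std_component hb)) \<ge> 1)))) \<and>
     (CARD('n) = 1 \<longrightarrow> curve_geometry e (poly_curve e) (std_component (poly_curve e))) \<and>
     (CARD('n) = 2 \<longrightarrow>
        homogeneous_space (std_component (poly_surface_a e)) \<and>
        isomorphic_hyperbolic_plane (poly_surface_a e) (std_component (poly_surface_a e)) \<and>
        homogeneous_space (std_component (poly_surface_b e)) \<and>
        isomorphic_flat_plane (poly_surface_b e) (std_component (poly_surface_b e))) \<and>
     (CARD('n) \<ge> 3 \<longrightarrow>
        (\<forall>g\<in>limit_list e. lie_group_dim (symmetry_group (std_component g)) \<ge> 1)) \<and>
     (\<forall>g\<in>limit_list e.
        ccpsr_manifold g (std_component g) \<and> standard_form g (std_component g) \<and>
        singular_at_infinity g (std_component g) \<and>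
        (\<exists>p\<in>std_component g. \<exists>v\<in>tangent_space (std_component g) p - {0}. limit_polynomial g p v g))"
proof -
  have list: "ccpsr_manifold g (std_component g) \<and> standard_form g (std_component g) \<and>
      singular_at_infinity g (std_component g) \<and>
      (\<exists>p\<in>std_component g. \<exists>v\<in>tangent_space (std_component g) p - {0}. limit_polynomial g p v g)"
    and dim: "1 \<le> lie_group_dim (symmetry_group (std_component g))" if g: "g \<in> limit_list e" for g
  proof -
    obtain e' :: "nat \<Rightarrow> 'n" and m F T where x: "bij_betw e' {..<CARD('n)} UNIV" "m \<le> CARD('n) - 1" "std3 T" "cubic_bound T"
      "g = poly_general e' m F" "poly_general e' m F = (\<lambda>z. T z z z)"
      by (rule limit_list_normal_form[OF assms g]) (rule that)
    have "ccpsr_manifold g (std_component g)" unfolding x(5,6) using ccpsr_iff_cubic_bound[OF x(3)] x(4) by blast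
    moreover have "standard_form g (std_component g)"
      unfolding standard_form_def x(5,6) using std3_standard_cubic[OF x(3)] by blast
    ultimately show "ccpsr_manifold g (std_component g) \<and> standard_form g (std_component g) \<and>
      singular_at_infinity g (std_component g) \<and>
      (\<exists>p\<in>std_component g. \<exists>v\<in>tangent_space (std_component g) p - {0}. limit_polynomial g p v g)"
      using normal_form_singular[OF x(1-4,6)] normal_form_self_limit[OF x(1-4,6)] unfolding x(5) by blast
    show "1 \<le> lie_group_dim (symmetry_group (std_component g))"
      unfolding x(5) by (rule lie_group_dim_ge_1[OF symmetry_group_dim[OF x(1-4,6)]])
  qed
  show ?thesis
  proof (intro conjI, goal_cases)
    case 1
    show ?case
    proof (intro allI impI ballI, goal_cases)
      case (1 h H p v)
      then have H: "ccpsr_manifold h H" "standard_form h H" by blast+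
      note l = limit_geometry[OF assms H 1(2,3)]
      obtain m F where c: "limit_polynomial h p v (poly_general e m F)" "cubic_form h"
        by (rule limit_classification[OF assms H 1(2,3)]) (rule that)
      have ex: "\<exists>hb. limit_polynomial h p v hb" using c(1) by blast
      have uniq: "\<forall>hb hb'. limit_polynomial h p v hb \<and> limit_polynomial h p v hb' \<longrightarrow> std_equivalent hb hb'"
        using limit_polynomial_unique[OF c(2)] by blast
      show ?case
        by (rule conjI[OF ex conjI[OF uniq]]) (use l in blast)
    qed
  next
    case 2 show ?case using poly_curve_geometry[OF _ assms] by blast
  next
    case 3 show ?case using surfaces_geometry[OF _ assms] by blast
  next
    case 4 show ?case using dim by blast
  next
    case 5 show ?case using list by blast
  qed
qed

end
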